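(* Let $\mathcal{L}$ be a discrete lamination of $\mathcal{C}_\pi^\psi$. Then there are $k\ge2$ points $x_1<x_2<\cdots<x_k<x_1+\pi$ in $S^1_\pi$ (represented by real numbers) such that: (1) $R(\mathcal{L})=S^1_\pi\setminus\{x_1,x_2,\dots,x_k\}$ is a disjoint union of $k$ intervals. (2) $\mathcal{L}$ has exactly $k$ singular objects, and these objects are either (a) singular objects of the same sign, supported at the points $x_1,\dots,x_k$, or (b) a singular pair supported at either $x_1$ or $x_2$ (when $k=2$). Conversely, for any set $S$ of $k\ge2$ points in $S^1_\pi$, the union of any set of singular objects satisfying (2a) or (2b) and any choice of discrete sublaminations for the $k$ intervals making up $S^1_\pi\setminus S$ gives a discrete lamination for $\mathcal{C}_\pi^\psi$.
   Context: **The categories.** $R$ is a discrete valuation ring with uniformizer $u$ and residue field $K=R/(u)$ of characteristic $\neq2$. For $0<b\le\pi$ let $\tilde{\mathcal{X}}_b=\{(x,y,\epsilon)\in\mathbb{R}\times\mathbb{R}\times\{+,-\}: |x-y|\le b\}$, with $(x,y,\epsilon)\le(x',y',\epsilon')$ iff $x\le x'$ and $y\le y'$, and automorphism $\sigma(x,y,\epsilon)=(y+\pi,x+\pi,-\epsilon)$. Let $\mathcal{X}_b$ be the set of $\sigma$-orbits, $M(x,y)$ the orbit of $(x,y,+)$ and $M(x,y)'$ the orbit of $(x,y,-)$; thus $M(x,y)'=M(y+\pi,x+\pi)$ and $M(x+2\pi,y+2\pi)=M(x,y)$. For $X,Y,Z\in\mathcal{X}_b$ with representatives $\tilde X,\tilde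 Y,\tilde Z$ put $c(X,Y,Z)=i+j-k$ where $i,j,k$ are the minimal integers with $\tilde X\le\sigma^i\tilde Y$, $\tilde Y\le\sigma^j\tilde Z$, $\tilde X\le\sigma^k\tilde Z$. Let $\mathcal{F}_b$ be the additive $R$-category of finite direct sums of elements of $\mathcal{X}_b$, where $\mathrm{Hom}(X,Y)=Rf_{XY}$ is free of rank one for $X,Y\in\mathcal{X}_b$ ($f_{XY}$ is the basic morphism), $f_{XX}=\mathrm{id}$ and $f_{YZ}f_{XY}=u^{c(X,Y,Z)}f_{XZ}$. It is known that $\mathcal{F}_b$ has a unique exact structure making it a Frobenius category whose indecomposable projective-injectives are the $M(x,y)$ with $|x-y|=b$. Let $\psi$ be the $R$-linear involution of $\mathcal{F}_b$ with $\psi M(x,y)=M(x+\pi,y+\pi)$ and $\psi f_{XY}=f_{\psi X,\psi Y}$. Let $\mathcal{F}_b^\psi$ have objects $(X,\xi)$, $\xi:\psi X\to X$ an isomorphism with $\xi\circ\psi\xi=\mathrm{id}$, morphisms $(X,\xi^X)\to(Y,\xi^Y)$ the $f:X\to Y$ with $f\xi^X=\xi^Y\psi f$, and exact sequences those exact in $\mathcal{F}_b$. It is a Frobenius category; its stable category, a triangulated category with shift $[1]$, is $\mathcal{C}_b^\psi$, and $\mathrm{Ext}^1(A,B)=\mathcal{C}_b^\psi(A,B[1])$. **Objects.** $SX=(X\oplus\psi X,\xi)$ with $\xi$ the swap of summands; $E(x,y)=M(x,y-\pi)$; $Z_\epsilon(x)=(M(x,x),\epsilon\zeta)$ for $\epsilon=\pm$,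 with $\zeta:\psi M(x,x)\to M(x,x)$ the basic isomorphism. The nonzero indecomposable objects of $\mathcal{C}_b^\psi$ are, up to isomorphism, the regular objects $SM(x,y)$ with $0<|x-y|<b$ and the singular objects $Z_\epsilon(x)$ (with sign $\epsilon$). A singular pair at $x$ is $\{Z_+(x),Z_-(x)\}$. **Compatibility.** For $0<b<\pi$, objects $X,Y$ of $\mathcal{C}_b^\psi$ are compatible if $\mathrm{Ext}^1(X,Y)=0=\mathrm{Ext}^1(Y,X)$. Two indecomposable objects of $\mathcal{C}_\pi^\psi$ are compatible if the objects of $\mathcal{C}_b^\psi$ with the same names ($SM(x,y)$ or $Z_\epsilon(x)$) are compatible for all $b<\pi$ sufficiently close to $\pi$. **Supports.** $S^1_\pi=\mathbb{R}/\pi\mathbb{Z}$. For a regular object, $J(SE(x,y))\subset S^1_\pi$ is the open interval which is the image of $(x,y)$ if $x<y<x+\pi$, and of $(y,x+2\pi)$ if $x+\pi<y<x+2\pi$. For a singular object, $J(Z_\epsilon(x))$ is the point $x+\pi\mathbb{Z}$, the point at which $Z_\epsilon(x)$ is supported. **Laminations.** A lamination in $\mathcal{C}_\pi^\psi$ is a maximal set $\mathcal{L}$ of pairwise compatible nonisomorphic indecomposable objects. $R(\mathcal{L})$ is the union of all $J(X)$ with $X\in\mathcal{L}$ regular. An interval in $S^1_\pi$ is a nonempty connected open proper subset. A sublamination of an interval $I$ is a maximal collection of pairwise compatible nonisomorphic indecomposable regular objects $X$ with $J(X)\subseteq I$. **Discreteness.** $\mathcal{H}=\tilde{\mathcal{H}}/\sim$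 with the quotient topology, where $\tilde{\mathcal{H}}=\{(x,y,\epsilon)\in\mathbb{R}^2\times\{+,-\}: x<y\le x+\pi\}$ and $\sim$ is generated by $(x,y,+)\sim(x,y,-)$ if $y<x+\pi$, and $(x,y,\epsilon)\sim(x+\pi,y+\pi,\epsilon)$. Write $[x,y]_\epsilon$ for classes ($[x,y]$ if $y<x+\pi$). Put $h(SE(x,y))=[x,y]$ if $x<y<x+\pi$, $h(SE(x,y))=[y,x+2\pi]$ if $x+\pi<y<x+2\pi$, and $h(Z_\epsilon(x))=[x,x+\pi]_\epsilon$. A lamination or sublamination $\mathcal{L}$ is discrete if $h(\mathcal{L})=\{h(X):X\in\mathcal{L}\}$ is a discrete subset of $\mathcal{H}$ (discrete in the subspace topology). *)

theory Defs
  imports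
    "HOL-Analysis.Product_Topology"
    "HOL-Analysis.Abstract_Topology_2"
    "Jordan_Normal_Form.Matrix"
begin

section \<open>Discrete valuation rings\<close>

definition ring_ideal :: "'r::comm_ring_1 set \<Rightarrow> bool" where
  "ring_ideal I \<longleftrightarrow> 0 \<in> I \<and> (\<forall>a\<in>I. \<forall>b\<in>I. a + b \<in> I) \<and> (\<forall>r. \<forall>a\<in>I. r * a \<in> I)"

text \<open>The type \<open>'r\<close> is a discrete valuation ring with uniformizer \<open>u\<close>: a principal ideal domain
  which is local (the non-units form the ideal generated by \<open>u\<close>) and not a field.\<close>

definition dvr_uniformizer :: "'r::idom \<Rightarrow> bool" where
  "dvr_uniformizer u \<longleftrightarrow>
     (\<forall>I :: 'r set. ring_ideal I \<longrightarrow> (\<exists>a. I = {r * a | r. True})) \<and>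
     u \<noteq> 0 \<and> {x. \<not> x dvd 1} = {r * u | r. True}"


section \<open>Preadditive categories, exact structures, stable categories\<close>

text \<open>Hom-sets need not be disjoint, but the composite and the sum of two
  morphisms are determined by the morphisms alone.\<close>

record ('o, 'm) acat =
  Ob :: "'o set"
  Mor :: "'o \<Rightarrow> 'o \<Rightarrow> 'm set"
  Idt :: "'o \<Rightarrow> 'm"
  Cmp :: "'m \<Rightarrow> 'm \<Rightarrow> 'm"   \<comment> \<open>\<open>Cmp C g f\<close> is \<open>g\<close> after \<open>f\<close>\<close>
  Add :: "'m \<Rightarrow> 'm \<Rightarrow> 'm"
  Zer :: "'o \<Rightarrow> 'o \<Rightarrow> 'm"

definition iso_mor :: "('o, 'm) acat \<Rightarrow> 'o \<Rightarrow> 'o \<Rightarrow> 'm \<Rightarrow> bool" where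
  "iso_mor C A B f \<longleftrightarrow> f \<in> Mor C A B \<and>
     (\<exists>g\<in>Mor C B A. Cmp C g f = Idt C A \<and> Cmp C f g = Idt C B)"

definition iso_obj :: "('o, 'm) acat \<Rightarrow> 'o \<Rightarrow> 'o \<Rightarrow> bool" where
  "iso_obj C A B \<longleftrightarrow> (\<exists>f. iso_mor C A B f)"

definition zero_obj :: "('o, 'm) acat \<Rightarrow> 'o \<Rightarrow> bool" where
  "zero_obj C A \<longleftrightarrow> A \<in> Ob C \<and> Idt C A = Zer C A A"

definition biproduct :: "('o, 'm) acat \<Rightarrow> 'o \<Rightarrow> 'o \<Rightarrow> 'o \<Rightarrow> bool" where
  "biproduct C P A B \<longleftrightarrow>
     (\<exists>i\<in>Mor C A P. \<exists>j\<in>Mor C B P. \<exists>p\<in>Mor C P A. \<exists>q\<in>Mor C P B.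
        Cmp C p i = Idt C A \<and> Cmp C q j = Idt C B \<and>
        Cmp C p j = Zer C B A \<and> Cmp C q i = Zer C A B \<and>
        Add C (Cmp C i p) (Cmp C j q) = Idt C P)"

definition indecomposable_obj :: "('o, 'm) acat \<Rightarrow> 'o \<Rightarrow> bool" where
  "indecomposable_obj C P \<longleftrightarrow> P \<in> Ob C \<and> \<not> zero_obj C P \<and>
     (\<forall>A\<in>Ob C. \<forall>B\<in>Ob C. biproduct C P A B \<longrightarrow> zero_obj C A \<or> zero_obj C B)"

definition kernel_cokernel ::
  "('o, 'm) acat \<Rightarrow> 'o \<Rightarrow> 'm \<Rightarrow> 'o \<Rightarrow> 'm \<Rightarrow> 'o \<Rightarrow> bool" where
  "kernel_cokernel C A i B p T \<longleftrightarrow>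
     A \<in> Ob C \<and> B \<in> Ob C \<and> T \<in> Ob C \<and> i \<in> Mor C A B \<and> p \<in> Mor C B T \<and>
     Cmp C p i = Zer C A T \<and>
     (\<forall>W\<in>Ob C. \<forall>w\<in>Mor C W B. Cmp C p w = Zer C W T \<longrightarrow>
        (\<exists>!v. v \<in> Mor C W A \<and> Cmp C i v = w)) \<and>
     (\<forall>W\<in>Ob C. \<forall>w\<in>Mor C B W. Cmp C w i = Zer C A W \<longrightarrow>
        (\<exists>!v. v \<in> Mor C T W \<and> Cmp C v p = w))"

text \<open>\<open>E A i B p T\<close> means that the sequence of \<open>i : A \<rightarrow> B\<close> and \<open>p : B \<rightarrow> T\<close> is
  (admissibly) exact.\<close>

type_synonym ('o, 'm) conflations = "'o \<Rightarrow> 'm \<Rightarrow> 'o \<Rightarrow> 'm \<Rightarrow> 'o \<Rightarrow> bool"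

definition inflation :: "('o, 'm) conflations \<Rightarrow> 'o \<Rightarrow> 'o \<Rightarrow> 'm \<Rightarrow> bool" where
  "inflation E A B i \<longleftrightarrow> (\<exists>p T. E A i B p T)"

definition deflation :: "('o, 'm) conflations \<Rightarrow> 'o \<Rightarrow> 'o \<Rightarrow> 'm \<Rightarrow> bool" where
  "deflation E B T p \<longleftrightarrow> (\<exists>A i. E A i B p T)"

definition pushout_square ::
  "('o, 'm) acat \<Rightarrow> 'o \<Rightarrow> 'o \<Rightarrow> 'o \<Rightarrow> 'o \<Rightarrow> 'm \<Rightarrow> 'm \<Rightarrow> 'm \<Rightarrow> 'm \<Rightarrow> bool" where
  \<comment> \<open>\<open>i : A \<rightarrow> B\<close>, \<open>f : A \<rightarrow> A'\<close>, \<open>i' : A' \<rightarrow> B'\<close>, \<open>f' : B \<rightarrow> B'\<close>\<close>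
  "pushout_square C A B A' B' i f i' f' \<longleftrightarrow>
     i \<in> Mor C A B \<and> f \<in> Mor C A A' \<and> i' \<in> Mor C A' B' \<and> f' \<in> Mor C B B' \<and>
     Cmp C f' i = Cmp C i' f \<and>
     (\<forall>W\<in>Ob C. \<forall>s\<in>Mor C B W. \<forall>t\<in>Mor C A' W. Cmp C s i = Cmp C t f \<longrightarrow>
        (\<exists>!v. v \<in> Mor C B' W \<and> Cmp C v f' = s \<and> Cmp C v i' = t))"

definition pullback_square ::
  "('o, 'm) acat \<Rightarrow> 'o \<Rightarrow> 'o \<Rightarrow> 'o \<Rightarrow> 'o \<Rightarrow> 'm \<Rightarrow> 'm \<Rightarrow> 'm \<Rightarrow> 'm \<Rightarrow> bool" where
  \<comment> \<open>\<open>p : B \<rightarrow> T\<close>, \<open>f : T' \<rightarrow> T\<close>, \<open>p' : B' \<rightarrow> T'\<close>, \<open>f' : B' \<rightarrow> B\<close>\<close>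
  "pullback_square C B T B' T' p f p' f' \<longleftrightarrow>
     p \<in> Mor C B T \<and> f \<in> Mor C T' T \<and> p' \<in> Mor C B' T' \<and> f' \<in> Mor C B' B \<and>
     Cmp C p f' = Cmp C f p' \<and>
     (\<forall>W\<in>Ob C. \<forall>s\<in>Mor C W B. \<forall>t\<in>Mor C W T'. Cmp C p s = Cmp C f t \<longrightarrow>
        (\<exists>!v. v \<in> Mor C W B' \<and> Cmp C f' v = s \<and> Cmp C p' v = t))"

text \<open>Quillen's axioms, in the form given by Buehler.\<close>

definition exact_structure :: "('o, 'm) acat \<Rightarrow> ('o, 'm) conflations \<Rightarrow> bool" where
  "exact_structure C E \<longleftrightarrow>
     (\<forall>A i B p T. E A i B p T \<longrightarrow> kernel_cokernel C A i B p T) \<and>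
     (\<forall>A i B p T A' i' B' p' T' a b t.
        E A i B p T \<and> A' \<in> Ob C \<and> B' \<in> Ob C \<and> T' \<in> Ob C \<and>
        i' \<in> Mor C A' B' \<and> p' \<in> Mor C B' T' \<and>
        iso_mor C A A' a \<and> iso_mor C B B' b \<and> iso_mor C T T' t \<and>
        Cmp C b i = Cmp C i' a \<and> Cmp C t p = Cmp C p' b \<longrightarrow> E A' i' B' p' T') \<and>
     (\<forall>A\<in>Ob C. inflation E A A (Idt C A) \<and> deflation E A A (Idt C A)) \<and>
     (\<forall>A B D i j. inflation E A B i \<and> inflation E B D j \<longrightarrow> inflation E A D (Cmp C j i)) \<and>
     (\<forall>A B D p q. deflation E A B p \<and> deflation E B D q \<longrightarrow> deflation E A D (Cmp C q p)) \<and>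
     (\<forall>A B A' i f. inflation E A B i \<and> A' \<in> Ob C \<and> f \<in> Mor C A A' \<longrightarrow>
        (\<exists>B'\<in>Ob C. \<exists>i' f'. pushout_square C A B A' B' i f i' f' \<and> inflation E A' B' i')) \<and>
     (\<forall>B T T' p f. deflation E B T p \<and> T' \<in> Ob C \<and> f \<in> Mor C T' T \<longrightarrow>
        (\<exists>B'\<in>Ob C. \<exists>p' f'. pullback_square C B T B' T' p f p' f' \<and> deflation E B' T' p'))"

definition projective_obj :: "('o, 'm) acat \<Rightarrow> ('o, 'm) conflations \<Rightarrow> 'o \<Rightarrow> bool" where
  "projective_obj C E P \<longleftrightarrow> P \<in> Ob C \<and>
     (\<forall>A i B p T. E A i B p T \<longrightarrow> (\<forall>f\<in>Mor C P T. \<exists>g\<in>Mor C P B. Cmp C p g = f))"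

definition injective_obj :: "('o, 'm) acat \<Rightarrow> ('o, 'm) conflations \<Rightarrow> 'o \<Rightarrow> bool" where
  "injective_obj C E I \<longleftrightarrow> I \<in> Ob C \<and>
     (\<forall>A i B p T. E A i B p T \<longrightarrow> (\<forall>f\<in>Mor C A I. \<exists>g\<in>Mor C B I. Cmp C g i = f))"

definition frobenius_category :: "('o, 'm) acat \<Rightarrow> ('o, 'm) conflations \<Rightarrow> bool" where
  "frobenius_category C E \<longleftrightarrow> exact_structure C E \<and>
     (\<forall>T\<in>Ob C. \<exists>A i P p. projective_obj C E P \<and> E A i P p T) \<and>
     (\<forall>A\<in>Ob C. \<exists>i I p T. injective_obj C E I \<and> E A i I p T) \<and>
     (\<forall>P. projective_obj C E P \<longleftrightarrow> injective_obj C E P)"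

definition stably_null :: "('o, 'm) acat \<Rightarrow> ('o, 'm) conflations \<Rightarrow> 'o \<Rightarrow> 'o \<Rightarrow> 'm set" where
  "stably_null C E A B =
     {Cmp C h g | h g P. projective_obj C E P \<and> injective_obj C E P \<and>
                         g \<in> Mor C A P \<and> h \<in> Mor C P B}"

definition stable_class ::
  "('o, 'm) acat \<Rightarrow> ('o, 'm) conflations \<Rightarrow> 'o \<Rightarrow> 'o \<Rightarrow> 'm \<Rightarrow> 'm set" where
  "stable_class C E A B f = {Add C f n | n. n \<in> stably_null C E A B}"

definition stable_hom :: "('o, 'm) acat \<Rightarrow> ('o, 'm) conflations \<Rightarrow> 'o \<Rightarrow> 'o \<Rightarrow> 'm set set" where
  "stable_hom C E A B = stable_class C E A B ` Mor C A B"

definition stably_isomorphic :: "('o, 'm) acat \<Rightarrow> ('o, 'm) conflations \<Rightarrow> 'o \<Rightarrow> 'o \<Rightarrow> bool" where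
  "stably_isomorphic C E A B \<longleftrightarrow>
     (\<exists>f\<in>Mor C A B. \<exists>g\<in>Mor C B A.
        stable_class C E A A (Cmp C g f) = stable_class C E A A (Idt C A) \<and>
        stable_class C E B B (Cmp C f g) = stable_class C E B B (Idt C B))"

text \<open>The shift of \<open>B\<close> is the end term of a chosen exact sequence starting in \<open>B\<close> with
  injective middle term; it is well defined up to isomorphism in the stable category.\<close>

definition shift_obj :: "('o, 'm) acat \<Rightarrow> ('o, 'm) conflations \<Rightarrow> 'o \<Rightarrow> 'o" where
  "shift_obj C E B = (SOME T. \<exists>i I p. injective_obj C E I \<and> E B i I p T)"

definition Ext1 :: "('o, 'm) acat \<Rightarrow> ('o, 'm) conflations \<Rightarrow> 'o \<Rightarrow> 'o \<Rightarrow> 'm set set" where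
  "Ext1 C E A B = stable_hom C E A (shift_obj C E B)"

definition Ext1_vanishes :: "('o, 'm) acat \<Rightarrow> ('o, 'm) conflations \<Rightarrow> 'o \<Rightarrow> 'o \<Rightarrow> bool" where
  "Ext1_vanishes C E A B \<longleftrightarrow>
     Ext1 C E A B = {stable_class C E A (shift_obj C E B) (Zer C A (shift_obj C E B))}"

definition compatible_obj :: "('o, 'm) acat \<Rightarrow> ('o, 'm) conflations \<Rightarrow> 'o \<Rightarrow> 'o \<Rightarrow> bool" where
  "compatible_obj C E A B \<longleftrightarrow> Ext1_vanishes C E A B \<and> Ext1_vanishes C E B A"


section \<open>The continuous Frobenius categories\<close>

datatype sign = Pos | Neg

fun opp :: "sign \<Rightarrow> sign" where
  "opp Pos = Neg"
| "opp Neg = Pos"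

type_synonym point = "real \<times> real \<times> sign"

definition point_le :: "point \<Rightarrow> point \<Rightarrow> bool" where
  "point_le p q \<longleftrightarrow> fst p \<le> fst q \<and> fst (snd p) \<le> fst (snd q)"

definition sigma :: "point \<Rightarrow> point" where
  "sigma = (\<lambda>(x, y, e). (y + pi, x + pi, opp e))"

definition sigma_pow :: "int \<Rightarrow> point \<Rightarrow> point" where
  "sigma_pow i = (if 0 \<le> i then sigma ^^ nat i else (inv_into UNIV sigma) ^^ nat (- i))"

definition orbit :: "point \<Rightarrow> point set" where
  "orbit p = {sigma_pow i p | i. True}"

definition Xset :: "real \<Rightarrow> point set set" where
  "Xset b = {orbit (x, y, e) | x y e. \<bar>x - y\<bar> \<le> b}"

definition M_orb :: "real \<Rightarrow> real \<Rightarrow> point set" where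
  "M_orb x y = orbit (x, y, Pos)"

text \<open>The integers below depend on the chosen representatives, but \<open>cexp\<close> does not;
  moreover \<open>i + j - k\<close> is never negative, so \<open>nat\<close> loses nothing.\<close>

definition orbit_rep :: "point set \<Rightarrow> point" where
  "orbit_rep X = (SOME p. p \<in> X)"

definition orbit_deg :: "point set \<Rightarrow> point set \<Rightarrow> int" where
  "orbit_deg X Y = (LEAST i. point_le (orbit_rep X) (sigma_pow i (orbit_rep Y)))"

definition cexp :: "point set \<Rightarrow> point set \<Rightarrow> point set \<Rightarrow> nat" where
  "cexp X Y Z = nat (orbit_deg X Y + orbit_deg Y Z - orbit_deg X Z)"

text \<open>An object is the list of the summands of a finite direct sum.  The entry in row \<open>i\<close>,
  column \<open>j\<close> of the matrix of a morphism is the coefficient of the basic morphism from the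
  \<open>j\<close>-th summand of the source to the \<open>i\<close>-th summand of the target.\<close>

datatype 'r fmor = FMor (fdom: "point set list") (fcod: "point set list") (fmat: "'r mat")

definition Fcat :: "'r::comm_ring_1 \<Rightarrow> real \<Rightarrow> (point set list, 'r fmor) acat" where
  "Fcat u b =
    \<lparr> Ob = lists (Xset b),
      Mor = (\<lambda>A B. {f. fdom f = A \<and> fcod f = B \<and> fmat f \<in> carrier_mat (length B) (length A)}),
      Idt = (\<lambda>A. FMor A A (1\<^sub>m (length A))),
      Cmp = (\<lambda>g f. FMor (fdom f) (fcod g)
               (mat (length (fcod g)) (length (fdom f))
                 (\<lambda>(i, k). \<Sum>j<length (fcod f).
                    u ^ cexp (fdom f ! k) (fcod f ! j) (fcod g ! i)
                      * (fmat g $$ (i, j)) * (fmat f $$ (j, k))))),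
      Add = (\<lambda>f g. FMor (fdom f) (fcod f) (fmat f + fmat g)),
      Zer = (\<lambda>A B. FMor A B (0\<^sub>m (length B) (length A))) \<rparr>"

text \<open>This property characterizes the exact structure on \<open>Fcat u b\<close>.\<close>

definition is_standard_exact_structure ::
  "'r::comm_ring_1 \<Rightarrow> real \<Rightarrow> (point set list, 'r fmor) conflations \<Rightarrow> bool" where
  "is_standard_exact_structure u b E \<longleftrightarrow>
     frobenius_category (Fcat u b) E \<and>
     (\<forall>P\<in>Ob (Fcat u b).
        indecomposable_obj (Fcat u b) P \<and> projective_obj (Fcat u b) E P \<longleftrightarrow>
        (\<exists>x y. \<bar>x - y\<bar> = b \<and> iso_obj (Fcat u b) P [M_orb x y]))"


section \<open>The involution and the equivariant category\<close>

definition psi_orbit :: "point set \<Rightarrow> point set" where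
  "psi_orbit X = (\<lambda>(x, y, e). (x + pi, y + pi, e)) ` X"

definition psi_obj :: "point set list \<Rightarrow> point set list" where
  "psi_obj A = map psi_orbit A"

definition psi_mor :: "'r fmor \<Rightarrow> 'r fmor" where
  "psi_mor f = FMor (psi_obj (fdom f)) (psi_obj (fcod f)) (fmat f)"

type_synonym 'r psiobj = "point set list \<times> 'r fmor"

definition Psicat :: "'r::comm_ring_1 \<Rightarrow> real \<Rightarrow> ('r psiobj, 'r fmor) acat" where
  "Psicat u b =
    \<lparr> Ob = {(A, xi). A \<in> Ob (Fcat u b) \<and> iso_mor (Fcat u b) (psi_obj A) A xi \<and>
                    Cmp (Fcat u b) xi (psi_mor xi) = Idt (Fcat u b) A},
      Mor = (\<lambda>(A, xi) (B, eta). {f \<in> Mor (Fcat u b) A B.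
                    Cmp (Fcat u b) f xi = Cmp (Fcat u b) eta (psi_mor f)}),
      Idt = (\<lambda>(A, xi). Idt (Fcat u b) A),
      Cmp = Cmp (Fcat u b),
      Add = Add (Fcat u b),
      Zer = (\<lambda>(A, xi) (B, eta). Zer (Fcat u b) A B) \<rparr>"

definition psi_exact ::
  "'r::comm_ring_1 \<Rightarrow> real \<Rightarrow> (point set list, 'r fmor) conflations \<Rightarrow>
     ('r psiobj, 'r fmor) conflations" where
  "psi_exact u b E A i B p T \<longleftrightarrow>
     A \<in> Ob (Psicat u b) \<and> B \<in> Ob (Psicat u b) \<and> T \<in> Ob (Psicat u b) \<and>
     i \<in> Mor (Psicat u b) A B \<and> p \<in> Mor (Psicat u b) B T \<and>
     E (fst A) i (fst B) p (fst T)"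

text \<open>The second component swaps the summands: its source is \<open>\<psi>X \<oplus> \<psi>\<psi>X = \<psi>X \<oplus> X\<close>.\<close>

definition S_obj :: "point set list \<Rightarrow> 'r::comm_ring_1 psiobj" where
  "S_obj X = (X @ psi_obj X,
     FMor (psi_obj (X @ psi_obj X)) (X @ psi_obj X)
       (let n = length X in four_block_mat (0\<^sub>m n n) (1\<^sub>m n) (1\<^sub>m n) (0\<^sub>m n n)))"

fun sign_val :: "sign \<Rightarrow> 'r::comm_ring_1" where
  "sign_val Pos = 1"
| "sign_val Neg = - 1"

definition Z_obj :: "sign \<Rightarrow> real \<Rightarrow> 'r::comm_ring_1 psiobj" where
  "Z_obj e x = ([M_orb x x], FMor (psi_obj [M_orb x x]) [M_orb x x] (mat 1 1 (\<lambda>_. sign_val e)))"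

text \<open>Names of the indecomposable objects of the stable categories.  Different names may
  denote isomorphic objects.\<close>

datatype indec = SM real real | Zs sign real

fun denote :: "indec \<Rightarrow> 'r::comm_ring_1 psiobj" where
  "denote (SM x y) = S_obj [M_orb x y]"
| "denote (Zs e x) = Z_obj e x"

fun is_regular :: "indec \<Rightarrow> bool" where
  "is_regular (SM x y) \<longleftrightarrow> 0 < \<bar>x - y\<bar> \<and> \<bar>x - y\<bar> < pi"
| "is_regular (Zs e x) \<longleftrightarrow> False"

fun is_singular :: "indec \<Rightarrow> bool" where
  "is_singular (SM x y) \<longleftrightarrow> False"
| "is_singular (Zs e x) \<longleftrightarrow> True"

text \<open>From here on \<open>E b\<close> is the exact structure of \<open>Fcat u b\<close>.\<close>

definition isomorphic_pi ::
  "'r::comm_ring_1 \<Rightarrow> (real \<Rightarrow> (point set list, 'r fmor) conflations) \<Rightarrow> indec \<Rightarrow> indec \<Rightarrow> bool"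
  where "isomorphic_pi u E X Y \<longleftrightarrow>
     stably_isomorphic (Psicat u pi) (psi_exact u pi (E pi)) (denote X) (denote Y)"

definition compatible_pi ::
  "'r::comm_ring_1 \<Rightarrow> (real \<Rightarrow> (point set list, 'r fmor) conflations) \<Rightarrow> indec \<Rightarrow> indec \<Rightarrow> bool"
  where "compatible_pi u E X Y \<longleftrightarrow>
     (\<forall>\<^sub>F b in at_left pi.
        compatible_obj (Psicat u b) (psi_exact u b (E b)) (denote X) (denote Y))"

definition maximal_compatible ::
  "'r::comm_ring_1 \<Rightarrow> (real \<Rightarrow> (point set list, 'r fmor) conflations) \<Rightarrow>
     indec set \<Rightarrow> indec set \<Rightarrow> bool" where
  "maximal_compatible u E U L \<longleftrightarrow>
     (let ok = (\<lambda>L. L \<subseteq> U \<and>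
                  pairwise (\<lambda>X Y. compatible_pi u E X Y \<and> \<not> isomorphic_pi u E X Y) L)
      in ok L \<and> (\<forall>L'. ok L' \<and> L \<subseteq> L' \<longrightarrow> L' = L))"

definition lamination ::
  "'r::comm_ring_1 \<Rightarrow> (real \<Rightarrow> (point set list, 'r fmor) conflations) \<Rightarrow> indec set \<Rightarrow> bool" where
  "lamination u E L \<longleftrightarrow> maximal_compatible u E {X. is_regular X \<or> is_singular X} L"


section \<open>Supports\<close>

definition quot_topology :: "'a topology \<Rightarrow> ('a \<Rightarrow> 'b) \<Rightarrow> 'b topology" where
  "quot_topology T q =
     topology (\<lambda>U. U \<subseteq> q ` topspace T \<and> openin T {x \<in> topspace T. q x \<in> U})"

lemma openin_quot_topology:
  "openin (quot_topology T q) U \<longleftrightarrow> U \<subseteq> q ` topspace T \<and> openin T {x \<in> topspace T. q x \<in> U}"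
proof -
  have "istopology (\<lambda>U. U \<subseteq> q ` topspace T \<and> openin T {x \<in> topspace T. q x \<in> U})"
    unfolding istopology_def
  proof (intro conjI allI impI)
    fix A B
    assume "A \<subseteq> q ` topspace T \<and> openin T {x \<in> topspace T. q x \<in> A}"
      and "B \<subseteq> q ` topspace T \<and> openin T {x \<in> topspace T. q x \<in> B}"
    moreover have "{x \<in> topspace T. q x \<in> A \<inter> B} =
        {x \<in> topspace T. q x \<in> A} \<inter> {x \<in> topspace T. q x \<in> B}" by auto
    ultimately show "A \<inter> B \<subseteq> q ` topspace T" "openin T {x \<in> topspace T. q x \<in> A \<inter> B}"
      by auto
  next
    fix \<U>
    assume *: "\<forall>A\<in>\<U>. A \<subseteq> q ` topspace T \<and> openin T {x \<in> topspace T. q x \<in> A}"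
    then show "\<Union>\<U> \<subseteq> q ` topspace T" by blast
    have "{x \<in> topspace T. q x \<in> \<Union>\<U>} = (\<Union>A\<in>\<U>. {x \<in> topspace T. q x \<in> A})" by auto
    with * show "openin T {x \<in> topspace T. q x \<in> \<Union>\<U>}" by auto
  qed
  then show ?thesis
    unfolding quot_topology_def by (simp add: topology_inverse')
qed

definition circ :: "real \<Rightarrow> real set" where
  "circ x = {x + of_int n * pi | n. True}"

definition circle :: "real set topology" where
  "circle = quot_topology euclideanreal circ"

definition circle_interval :: "real set set \<Rightarrow> bool" where
  "circle_interval I \<longleftrightarrow>
     I \<noteq> {} \<and> openin circle I \<and> connectedin circle I \<and> I \<noteq> topspace circle"

text \<open>\<open>SM x y\<close> is \<open>SE x y'\<close> with \<open>y' = y + \<pi>\<close>.  Both parts of the regular case below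
  are exhaustive for names satisfying \<open>is_regular\<close>.\<close>

fun supp_J :: "indec \<Rightarrow> real set set" where
  "supp_J (SM x y) = (let y' = y + pi in
     if x < y' \<and> y' < x + pi then circ ` {x<..<y'} else circ ` {y'<..<x + 2 * pi})"
| "supp_J (Zs e x) = {circ x}"

definition R_union :: "indec set \<Rightarrow> real set set" where
  "R_union L = \<Union> (supp_J ` {X \<in> L. is_regular X})"

definition sublamination ::
  "'r::comm_ring_1 \<Rightarrow> (real \<Rightarrow> (point set list, 'r fmor) conflations) \<Rightarrow>
     real set set \<Rightarrow> indec set \<Rightarrow> bool" where
  "sublamination u E I L \<longleftrightarrow> maximal_compatible u E {X. is_regular X \<and> supp_J X \<subseteq> I} L"


section \<open>Discreteness\<close>

definition Htilde :: "point set" where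
  "Htilde = {(x, y, e) | x y e. x < y \<and> y \<le> x + pi}"

definition Hrel :: "(point \<times> point) set" where
  "Hrel = {((x, y, Pos), (x, y, Neg)) | x y. x < y \<and> y < x + pi} \<union>
          {((x, y, e), (x + pi, y + pi, e)) | x y e. x < y \<and> y \<le> x + pi}"

definition Hclass :: "point \<Rightarrow> point set" where
  "Hclass p = (Hrel \<union> Hrel\<inverse>)\<^sup>* `` {p}"

definition Hspace :: "point set topology" where
  "Hspace = quot_topology
     (subtopology
        (prod_topology euclideanreal (prod_topology euclideanreal (discrete_topology UNIV)))
        Htilde)
     Hclass"

fun h_map :: "indec \<Rightarrow> point set" where
  "h_map (SM x y) = (let y' = y + pi in
     if x < y' \<and> y' < x + pi then Hclass (x, y', Pos) else Hclass (y', x + 2 * pi, Pos))"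
| "h_map (Zs e x) = Hclass (x, x + pi, e)"

definition discrete_indecs :: "indec set \<Rightarrow> bool" where
  "discrete_indecs L \<longleftrightarrow> subtopology Hspace (h_map ` L) = discrete_topology (h_map ` L)"


section \<open>Configurations of singular objects\<close>

text \<open>\<open>T\<close> consists of singular objects of the same sign, one for each point of \<open>P\<close>.\<close>

definition same_sign_at :: "indec set \<Rightarrow> real set set \<Rightarrow> bool" where
  "same_sign_at T P \<longleftrightarrow>
     (\<exists>e. \<forall>X\<in>T. \<exists>x. X = Zs e x) \<and> card T = card P \<and> \<Union> (supp_J ` T) = P"

text \<open>The two objects of a singular pair may be given by names with different real
  representatives of the point of support.\<close>

definition singular_pair_at :: "indec set \<Rightarrow> real set \<Rightarrow> bool" where
  "singular_pair_at T p \<longleftrightarrow> (\<exists>x y. circ x = p \<and> circ y = p \<and> T = {Zs Pos x, Zs Neg y})"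

definition admissible_singular :: "indec set \<Rightarrow> real set set \<Rightarrow> bool" where
  "admissible_singular T P \<longleftrightarrow>
     same_sign_at T P \<or> card P = 2 \<and> (\<exists>p\<in>P. singular_pair_at T p)"

end

theory Submission
  imports Defs
begin

text \<open>Whether two indecomposables are compatible is a question about intervals. By adjunction,
  extensions with a regular object \<open>SX\<close> are extensions with \<open>X\<close> in \<open>\<F>\<^sub>b\<close>, and those are controlled by
  the degrees \<open>c(X, Y, Z)\<close>; since \<open>2\<close> is a unit, a singular object has a presentation by a singular object
  of the opposite sign. In the limit \<open>b \<rightarrow> \<pi>\<close> two objects of which one is regular are compatible iff
  their intervals in \<open>\<real>/\<pi>\<int>\<close> do not cross, and two singular objects are compatible iff they have the same
  sign or the same support.

  For a discrete lamination, a maximality argument shows that the end points of the connected components of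
  \<open>R(\<L>)\<close> are uncovered and that every uncovered point supports a singular object, unless a singular
  pair occurs; then a second uncovered point is unique, and it exists because otherwise intervals of \<open>\<L>\<close>
  would accumulate at the pair. Finiteness is Bolzano-Weierstrass. Conversely, the interval between two
  neighbouring points of \<open>S\<close> crosses nothing in its sublamination and hence belongs to it; these
  intervals exclude further singular objects outside \<open>S\<close> and, in the case of a singular pair, regular
  objects across the other point of \<open>S\<close>.\<close>

section \<open>Preadditive categories\<close>

text \<open>The relation \<open>E b\<close> is known only through the Frobenius axioms and its list
  of indecomposable projectives, and \<open>shift_obj\<close> is a choice, so conflations cannot
  simply be exhibited. The vanishing of \<open>Ext1\<close> is therefore turned into a lifting
  problem along the chosen deflation, and then into an extension problem along the kernel of any map
  from a projective through which all maps from projectives factor. Such a kernel can be written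
  down with matrices before anything is known about its exactness. For \<open>M(x, y)\<close> it is
  a single summand inside a sum of two projectives, with coefficients 1 and - 1. Extending a
  morphism over it means solving \<open>u ^ m * h - u ^ n * h' = g\<close> in the valuation ring,
  which is always possible iff m = 0 or n = 0; this is a condition on the order of representatives
  alone. Equivariant solutions come from plain ones by averaging over the involution. Two singular
  objects are where this is too coarse: the plain extension problem does not see their signs, so it
  has to be posed for equivariant morphisms.\<close>

definition hom :: "('o, 'm) acat \<Rightarrow> 'm \<Rightarrow> 'o \<Rightarrow> 'o \<Rightarrow> bool" where
  "hom C f A B \<longleftrightarrow> A \<in> Ob C \<and> B \<in> Ob C \<and> f \<in> Mor C A B"

text \<open>The rules are stated with \<open>hom\<close> because membership in \<open>Mor\<close>
  alone does not force the end points to be objects.\<close>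

locale preadditive =
  fixes C :: "('o, 'm) acat"
  assumes cmp_hom: "hom C f A B \<Longrightarrow> hom C g B D \<Longrightarrow> hom C (Cmp C g f) A D"
    and cmp_assoc: "hom C f A B \<Longrightarrow> hom C g B D \<Longrightarrow> hom C h D F \<Longrightarrow>
      Cmp C h (Cmp C g f) = Cmp C (Cmp C h g) f"
    and idt_hom: "A \<in> Ob C \<Longrightarrow> hom C (Idt C A) A A"
    and idt_left: "hom C f A B \<Longrightarrow> Cmp C (Idt C B) f = f"
    and idt_right: "hom C f A B \<Longrightarrow> Cmp C f (Idt C A) = f"
    and add_hom: "hom C f A B \<Longrightarrow> hom C g A B \<Longrightarrow> hom C (Add C f g) A B"
    and add_assoc: "hom C f A B \<Longrightarrow> hom C g A B \<Longrightarrow> hom C h A B \<Longrightarrow>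
      Add C (Add C f g) h = Add C f (Add C g h)"
    and add_comm: "hom C f A B \<Longrightarrow> hom C g A B \<Longrightarrow> Add C f g = Add C g f"
    and zer_hom: "A \<in> Ob C \<Longrightarrow> B \<in> Ob C \<Longrightarrow> hom C (Zer C A B) A B"
    and add_zer: "hom C f A B \<Longrightarrow> Add C f (Zer C A B) = f"
    and neg_ex: "hom C f A B \<Longrightarrow> \<exists>g. hom C g A B \<and> Add C f g = Zer C A B"
    and cmp_add: "hom C f A B \<Longrightarrow> hom C g A B \<Longrightarrow> hom C h B D \<Longrightarrow>
      Cmp C h (Add C f g) = Add C (Cmp C h f) (Cmp C h g)"
    and add_cmp: "hom C f A B \<Longrightarrow> hom C g B D \<Longrightarrow> hom C h B D \<Longrightarrow>
      Cmp C (Add C g h) f = Add C (Cmp C g f) (Cmp C h f)"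
begin

abbreviation comp (infixl "\<diamondop>" 70) where "g \<diamondop> f \<equiv> Cmp C g f"
abbreviation plus' (infixl "\<boxplus>" 65) where "f \<boxplus> g \<equiv> Add C f g"

lemma hom_ob: "hom C f A B \<Longrightarrow> A \<in> Ob C" "hom C f A B \<Longrightarrow> B \<in> Ob C"
  by (auto simp: hom_def)

lemma zer_add: "hom C f A B \<Longrightarrow> Zer C A B \<boxplus> f = f"
  by (metis add_comm add_zer hom_ob zer_hom)

lemma add_cancel:
  assumes "hom C f A B" "hom C g A B" "hom C h A B" "f \<boxplus> g = f \<boxplus> h"
  shows "g = h"
proof -
  obtain n where n: "hom C n A B" "f \<boxplus> n = Zer C A B" using neg_ex assms(1) by blast
  have "n \<boxplus> (f \<boxplus> g) = n \<boxplus> (f \<boxplus> h)" using assms by simp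
  moreover have "n \<boxplus> f = Zer C A B" using n assms add_comm by metis
  ultimately show ?thesis
    using add_assoc[OF n(1) assms(1) assms(2)] add_assoc[OF n(1) assms(1) assms(3)]
      zer_add assms by metis
qed

lemma add_eq_selfD: "hom C f A B \<Longrightarrow> hom C g A B \<Longrightarrow> f \<boxplus> g = f \<Longrightarrow> g = Zer C A B"
  by (metis add_cancel add_zer zer_hom hom_ob)

lemma diff_ex:
  assumes "hom C f A B" "hom C g A B"
  obtains d where "hom C d A B" "f = g \<boxplus> d"
proof -
  obtain n where n: "hom C n A B" "g \<boxplus> n = Zer C A B" using neg_ex assms(2) by blast
  have "g \<boxplus> (n \<boxplus> f) = f"
    using add_assoc[OF assms(2) n(1) assms(1)] n zer_add assms by metis
  then show ?thesis using that[of "n \<boxplus> f"] add_hom n assms by metis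
qed

lemma cmp_zer:
  assumes "hom C g B D" "A \<in> Ob C"
  shows "g \<diamondop> Zer C A B = Zer C A D"
proof -
  have z: "hom C (Zer C A B) A B" using assms zer_hom hom_ob by blast
  show ?thesis
    using cmp_add[OF z z assms(1)] add_zer[OF z]
      add_eq_selfD[OF cmp_hom[OF z assms(1)] cmp_hom[OF z assms(1)]] by simp
qed

lemma zer_cmp:
  assumes "hom C f A B" "D \<in> Ob C"
  shows "Zer C B D \<diamondop> f = Zer C A D"
proof -
  have z: "hom C (Zer C B D) B D" using assms zer_hom hom_ob by blast
  show ?thesis
    using add_cmp[OF assms(1) z z] add_zer[OF z]
      add_eq_selfD[OF cmp_hom[OF assms(1) z] cmp_hom[OF assms(1) z]] by simp
qed

section \<open>Kernels and cokernels\<close>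

definition is_ker :: "'o \<Rightarrow> 'm \<Rightarrow> 'o \<Rightarrow> 'm \<Rightarrow> 'o \<Rightarrow> bool" where
  "is_ker A i B p T \<longleftrightarrow> hom C i A B \<and> hom C p B T \<and> p \<diamondop> i = Zer C A T \<and>
     (\<forall>W w. hom C w W B \<longrightarrow> p \<diamondop> w = Zer C W T \<longrightarrow> (\<exists>!v. hom C v W A \<and> i \<diamondop> v = w))"

definition is_coker :: "'o \<Rightarrow> 'm \<Rightarrow> 'o \<Rightarrow> 'm \<Rightarrow> 'o \<Rightarrow> bool" where
  "is_coker A i B p T \<longleftrightarrow> hom C i A B \<and> hom C p B T \<and> p \<diamondop> i = Zer C A T \<and>
     (\<forall>W w. hom C w B W \<longrightarrow> w \<diamondop> i = Zer C A W \<longrightarrow> (\<exists>!v. hom C v T W \<and> v \<diamondop> p = w))"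

text \<open>The two halves are separated because a presentation will only be known to be a
  kernel.\<close>

lemma kernel_cokernel_iff: "kernel_cokernel C A i B p T \<longleftrightarrow> is_ker A i B p T \<and> is_coker A i B p T"
proof (cases "A \<in> Ob C \<and> B \<in> Ob C \<and> T \<in> Ob C")
  case True
  then show ?thesis
    by (simp add: kernel_cokernel_def is_ker_def is_coker_def hom_def Ball_def imp_conjL cong: conj_cong)
qed (auto simp: kernel_cokernel_def is_ker_def is_coker_def hom_def)

lemma ker_hom: "is_ker A i B p T \<Longrightarrow> hom C i A B" "is_ker A i B p T \<Longrightarrow> hom C p B T"
  "is_ker A i B p T \<Longrightarrow> p \<diamondop> i = Zer C A T"
  by (auto simp: is_ker_def)

lemma ker_lift:
  assumes "is_ker A i B p T" "hom C w W B" "p \<diamondop> w = Zer C W T"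
  obtains v where "hom C v W A" "i \<diamondop> v = w"
proof -
  have "\<exists>!v. hom C v W A \<and> i \<diamondop> v = w" using assms by (simp add: is_ker_def)
  then show ?thesis using that by (elim ex1E conjE)
qed

lemma ker_mono:
  assumes "is_ker A i B p T" "hom C v W A" "hom C v' W A" "i \<diamondop> v = i \<diamondop> v'"
  shows "v = v'"
proof -
  have "p \<diamondop> (i \<diamondop> v) = Zer C W T"
    using cmp_assoc[OF assms(2) ker_hom(1)[OF assms(1)] ker_hom(2)[OF assms(1)]]
      ker_hom[OF assms(1)] zer_cmp[OF assms(2)] by (simp add: hom_ob)
  moreover have "hom C (i \<diamondop> v) W B" using cmp_hom assms ker_hom by blast
  ultimately show ?thesis using assms unfolding is_ker_def by metis
qed

lemma coker_hom: "is_coker A i B p T \<Longrightarrow> hom C i A B" "is_coker A i B p T \<Longrightarrow> hom C p B T"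
  "is_coker A i B p T \<Longrightarrow> p \<diamondop> i = Zer C A T"
  by (auto simp: is_coker_def)

lemma coker_lift:
  assumes "is_coker A i B p T" "hom C w B W" "w \<diamondop> i = Zer C A W"
  obtains v where "hom C v T W" "v \<diamondop> p = w"
proof -
  have "\<exists>!v. hom C v T W \<and> v \<diamondop> p = w" using assms by (simp add: is_coker_def)
  then show ?thesis using that by (elim ex1E conjE)
qed

lemma coker_epi:
  assumes "is_coker A i B p T" "hom C v T W" "hom C v' T W" "v \<diamondop> p = v' \<diamondop> p"
  shows "v = v'"
proof -
  have "(v \<diamondop> p) \<diamondop> i = Zer C A W"
    using cmp_assoc[OF coker_hom(1)[OF assms(1)] coker_hom(2)[OF assms(1)] assms(2)]
      coker_hom[OF assms(1)] cmp_zer[OF assms(2)] by (simp add: hom_ob)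
  moreover have "hom C (v \<diamondop> p) B W" using cmp_hom assms coker_hom by blast
  ultimately show ?thesis using assms unfolding is_coker_def by metis
qed

text \<open>Both conditions below say that every extension of \<open>A\<close> by \<open>B\<close> splits.\<close>

lemma lifting_iff_extension:
  assumes 1: "is_ker A' j P q A" "is_coker A' j P q A"
    and 2: "is_ker B i I p T" "is_coker B i I p T"
    and inj: "\<And>f. hom C f A' I \<Longrightarrow> \<exists>g. hom C g P I \<and> g \<diamondop> j = f"
    and proj: "\<And>f. hom C f P T \<Longrightarrow> \<exists>g. hom C g P I \<and> p \<diamondop> g = f"
  shows "(\<forall>f. hom C f A T \<longrightarrow> (\<exists>s. hom C s A I \<and> p \<diamondop> s = f)) \<longleftrightarrow>
         (\<forall>g. hom C g A' B \<longrightarrow> (\<exists>h. hom C h P B \<and> h \<diamondop> j = g))" (is "?L \<longleftrightarrow> ?R")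
proof -
  note H = ker_hom[OF 1(1)] ker_hom[OF 2(1)]
  show ?thesis
  proof
    assume L: ?L
    show ?R
    proof (intro allI impI)
      fix g assume g: "hom C g A' B"
      \<comment> \<open>Injectivity of I extends i g over P. The extension followed by p kills A',
        so it descends to a map f on A, to which the lifting hypothesis applies.\<close>
      obtain h where h: "hom C h P I" "h \<diamondop> j = i \<diamondop> g" using inj cmp_hom[OF g H(4)] by blast
      have "(p \<diamondop> h) \<diamondop> j = p \<diamondop> (i \<diamondop> g)" using cmp_assoc[OF H(1) h(1) H(5)] h by simp
      also have "\<dots> = Zer C A' T" using cmp_assoc[OF g H(4) H(5)] H zer_cmp[OF g] hom_ob by metis
      finally obtain f where f: "hom C f A T" "f \<diamondop> q = p \<diamondop> h"
        using coker_lift[OF 1(2) cmp_hom[OF h(1) H(5)]] by blast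
      obtain s where s: "hom C s A I" "p \<diamondop> s = f" using L f by blast
      have sq: "hom C (s \<diamondop> q) P I" using s H cmp_hom by blast
      \<comment> \<open>The difference of h and s q is killed by p, hence comes from B; restricted
        to A' it still gives g, because s q vanishes there.\<close>
      obtain d where d: "hom C d P I" "h = (s \<diamondop> q) \<boxplus> d" using diff_ex[OF h(1) sq] by blast
      have "p \<diamondop> h = (p \<diamondop> h) \<boxplus> (p \<diamondop> d)"
        using cmp_add[OF sq d(1) H(5)] d(2) f s cmp_assoc[OF H(2) s(1) H(5)] by simp
      then have "p \<diamondop> d = Zer C P T"
        using add_eq_selfD cmp_hom[OF h(1) H(5)] cmp_hom[OF d(1) H(5)] by metis
      then obtain g' where g': "hom C g' P B" "i \<diamondop> g' = d" using ker_lift[OF 2(1) d(1)] by blast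
      have "i \<diamondop> g = (s \<diamondop> q \<diamondop> j) \<boxplus> (d \<diamondop> j)"
        using h d add_cmp[OF H(1) sq d(1)] by simp
      also have "s \<diamondop> q \<diamondop> j = Zer C A' I"
        using cmp_assoc[OF H(1) H(2) s(1)] H(3) cmp_zer[OF s(1)] H(1) hom_ob by metis
      also have "Zer C A' I \<boxplus> (d \<diamondop> j) = i \<diamondop> (g' \<diamondop> j)"
        using zer_add cmp_hom[OF H(1) d(1)] g' cmp_assoc[OF H(1) g'(1) H(4)] by simp
      finally have "g = g' \<diamondop> j" using ker_mono[OF 2(1) g cmp_hom[OF H(1) g'(1)]] by simp
      then show "\<exists>h. hom C h P B \<and> h \<diamondop> j = g" using g' by blast
    qed
  next
    assume R: ?R
    show ?L
    proof (intro allI impI)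
      fix f assume f: "hom C f A T"
      \<comment> \<open>The dual construction: projectivity of P lifts f q through p, the
        restriction to A' lands in B and is extended over P, and the corrected lift descends along
        q.\<close>
      obtain h where h: "hom C h P I" "p \<diamondop> h = f \<diamondop> q" using proj cmp_hom[OF H(2) f] by blast
      have "p \<diamondop> (h \<diamondop> j) = f \<diamondop> (q \<diamondop> j)"
        using cmp_assoc[OF H(1) h(1) H(5)] h cmp_assoc[OF H(1) H(2) f] by simp
      also have "\<dots> = Zer C A' T" using H(3) cmp_zer[OF f] H(1) hom_ob by metis
      finally obtain g where g: "hom C g A' B" "i \<diamondop> g = h \<diamondop> j"
        using ker_lift[OF 2(1) cmp_hom[OF H(1) h(1)]] by blast
      obtain g' where g': "hom C g' P B" "g' \<diamondop> j = g" using R g by blast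
      have ig: "hom C (i \<diamondop> g') P I" using g' H cmp_hom by blast
      obtain d where d: "hom C d P I" "h = (i \<diamondop> g') \<boxplus> d" using diff_ex[OF h(1) ig] by blast
      have "h \<diamondop> j = (h \<diamondop> j) \<boxplus> (d \<diamondop> j)"
        using add_cmp[OF H(1) ig d(1)] d(2) g g' cmp_assoc[OF H(1) g'(1) H(4)] by simp
      then have "d \<diamondop> j = Zer C A' I"
        using add_eq_selfD cmp_hom[OF H(1) h(1)] cmp_hom[OF H(1) d(1)] by metis
      then obtain s where s: "hom C s A I" "s \<diamondop> q = d" using coker_lift[OF 1(2) d(1)] by blast
      have "f \<diamondop> q = (p \<diamondop> (i \<diamondop> g')) \<boxplus> (p \<diamondop> d)"
        using h d cmp_add[OF ig d(1) H(5)] by simp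
      also have "p \<diamondop> (i \<diamondop> g') = Zer C P T"
        using cmp_assoc[OF g'(1) H(4) H(5)] H(6) zer_cmp[OF g'(1)] H(5) hom_ob by metis
      also have "Zer C P T \<boxplus> (p \<diamondop> d) = (p \<diamondop> s) \<diamondop> q"
        using zer_add cmp_hom[OF d(1) H(5)] s cmp_assoc[OF H(2) s(1) H(5)] by simp
      finally have "f = p \<diamondop> s" using coker_epi[OF 1(2) f cmp_hom[OF s(1) H(5)]] by simp
      then show "\<exists>s. hom C s A I \<and> p \<diamondop> s = f" using s by blast
    qed
  qed
qed

text \<open>A form of Schanuel's lemma.\<close>

lemma extension_transfer:
  assumes 1: "is_ker A' i P p A" and 2: "is_ker A'' j Q q A"
    and r: "hom C r Q P" "p \<diamondop> r = q" and s: "hom C s P Q" "q \<diamondop> s = p"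
    and ext: "\<forall>g. hom C g A'' B \<longrightarrow> (\<exists>h. hom C h Q B \<and> h \<diamondop> j = g)"
    and g: "hom C g A' B"
  shows "\<exists>h. hom C h P B \<and> h \<diamondop> i = g"
proof -
  note H = ker_hom[OF 1] ker_hom[OF 2]
  have "p \<diamondop> (r \<diamondop> j) = Zer C A'' A" using cmp_assoc[OF H(4) r(1) H(2)] r H by simp
  then obtain r' where r': "hom C r' A'' A'" "i \<diamondop> r' = r \<diamondop> j"
    using ker_lift[OF 1 cmp_hom[OF H(4) r(1)]] by blast
  have "q \<diamondop> (s \<diamondop> i) = Zer C A' A" using cmp_assoc[OF H(1) s(1) H(5)] s H by simp
  then obtain s' where s': "hom C s' A' A''" "j \<diamondop> s' = s \<diamondop> i"
    using ker_lift[OF 2 cmp_hom[OF H(1) s(1)]] by blast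
  have rs: "hom C (r \<diamondop> s) P P" "hom C (r' \<diamondop> s') A' A'" using cmp_hom r s r' s' by blast+
  have ob: "P \<in> Ob C" "A' \<in> Ob C" using H hom_ob by blast+
  \<comment> \<open>The difference of the identity and r s lands in the kernel of p. Restricted to
    A', the identity is therefore r' s' plus a map that extends over P, and g can be extended
    summand by summand.\<close>
  obtain d where d: "hom C d P P" "Idt C P = (r \<diamondop> s) \<boxplus> d"
    using diff_ex[OF idt_hom[OF ob(1)] rs(1)] by blast
  have "p = (p \<diamondop> (r \<diamondop> s)) \<boxplus> (p \<diamondop> d)"
    using cmp_add[OF rs(1) d(1) H(2)] d idt_right[OF H(2)] by simp
  moreover have prs: "p \<diamondop> (r \<diamondop> s) = p" using cmp_assoc[OF s(1) r(1) H(2)] r s by simp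
  ultimately have "p \<diamondop> d = Zer C P A" using add_eq_selfD[OF H(2) cmp_hom[OF d(1) H(2)]] by simp
  then obtain t where t: "hom C t P A'" "i \<diamondop> t = d" using ker_lift[OF 1 d(1)] by blast
  have ti: "hom C (t \<diamondop> i) A' A'" using cmp_hom t H by blast
  have "i = (r \<diamondop> s \<diamondop> i) \<boxplus> (d \<diamondop> i)"
    using add_cmp[OF H(1) rs(1) d(1)] d idt_left[OF H(1)] by simp
  also have "r \<diamondop> s \<diamondop> i = i \<diamondop> (r' \<diamondop> s')"
    using cmp_assoc[OF H(1) s(1) r(1)] s' r' cmp_assoc[OF s'(1) H(4) r(1)]
      cmp_assoc[OF s'(1) r'(1) H(1)] by simp
  also have "d \<diamondop> i = i \<diamondop> (t \<diamondop> i)" using t cmp_assoc[OF H(1) t(1) H(1)] by simp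
  also have "(i \<diamondop> (r' \<diamondop> s')) \<boxplus> (i \<diamondop> (t \<diamondop> i)) = i \<diamondop> ((r' \<diamondop> s') \<boxplus> (t \<diamondop> i))"
    using cmp_add[OF rs(2) ti H(1)] by simp
  finally have id: "Idt C A' = (r' \<diamondop> s') \<boxplus> (t \<diamondop> i)"
    using ker_mono[OF 1 idt_hom[OF ob(2)] add_hom[OF rs(2) ti]] idt_right[OF H(1)] by simp
  obtain h where h: "hom C h Q B" "h \<diamondop> j = g \<diamondop> r'" using ext cmp_hom[OF r'(1) g] by blast
  have hs: "hom C (h \<diamondop> s) P B" and gt: "hom C (g \<diamondop> t) P B" using cmp_hom h s t g by blast+
  have "g = (g \<diamondop> (r' \<diamondop> s')) \<boxplus> (g \<diamondop> (t \<diamondop> i))"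
    using cmp_add[OF rs(2) ti g] id idt_right[OF g] by simp
  also have "g \<diamondop> (r' \<diamondop> s') = h \<diamondop> s \<diamondop> i"
    using cmp_assoc[OF s'(1) r'(1) g] h cmp_assoc[OF s'(1) H(4) h(1)] s'
      cmp_assoc[OF H(1) s(1) h(1)] by simp
  also have "g \<diamondop> (t \<diamondop> i) = g \<diamondop> t \<diamondop> i" using cmp_assoc[OF H(1) t(1) g] by simp
  also have "(h \<diamondop> s \<diamondop> i) \<boxplus> (g \<diamondop> t \<diamondop> i) = ((h \<diamondop> s) \<boxplus> (g \<diamondop> t)) \<diamondop> i"
    using add_cmp[OF H(1) hs gt] by simp
  finally show ?thesis using add_hom[OF hs gt] by metis
qed

section \<open>Biproducts with explicit structure maps\<close>

definition is_biproduct :: "'o \<Rightarrow> 'o \<Rightarrow> 'o \<Rightarrow> 'm \<Rightarrow> 'm \<Rightarrow> 'm \<Rightarrow> 'm \<Rightarrow> bool" where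
  "is_biproduct P A B i j p q \<longleftrightarrow>
     hom C i A P \<and> hom C j B P \<and> hom C p P A \<and> hom C q P B \<and>
     p \<diamondop> i = Idt C A \<and> q \<diamondop> j = Idt C B \<and> p \<diamondop> j = Zer C B A \<and> q \<diamondop> i = Zer C A B \<and>
     (i \<diamondop> p) \<boxplus> (j \<diamondop> q) = Idt C P"

lemma biproductE:
  assumes "biproduct C P A B" "P \<in> Ob C" "A \<in> Ob C" "B \<in> Ob C"
  obtains i j p q where "is_biproduct P A B i j p q"
  using assms unfolding biproduct_def is_biproduct_def hom_def Bex_def by (elim exE conjE) simp

lemma is_biproduct_swap:
  assumes "is_biproduct P A B i j p q"
  shows "is_biproduct P B A j i q p"
proof -
  have H: "hom C i A P" "hom C j B P" "hom C p P A" "hom C q P B"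
    using assms by (auto simp: is_biproduct_def)
  show ?thesis
    using assms unfolding is_biproduct_def
    by (simp add: add_comm[OF cmp_hom[OF H(4) H(2)] cmp_hom[OF H(3) H(1)]])
qed

lemma biproduct_decomp:
  assumes b: "is_biproduct P A B i j p q" and f: "hom C f W P"
  shows "f = (i \<diamondop> (p \<diamondop> f)) \<boxplus> (j \<diamondop> (q \<diamondop> f))"
proof -
  have H: "hom C i A P" "hom C j B P" "hom C p P A" "hom C q P B"
    using b by (auto simp: is_biproduct_def)
  have "f = ((i \<diamondop> p) \<boxplus> (j \<diamondop> q)) \<diamondop> f"
    using b idt_left[OF f] by (simp add: is_biproduct_def)
  also have "\<dots> = (i \<diamondop> p \<diamondop> f) \<boxplus> (j \<diamondop> q \<diamondop> f)"
    using add_cmp[OF f cmp_hom[OF H(3) H(1)] cmp_hom[OF H(4) H(2)]] .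
  finally show ?thesis using cmp_assoc[OF f H(3) H(1)] cmp_assoc[OF f H(4) H(2)] by simp
qed

lemma biproduct_proj:
  assumes b: "is_biproduct P A B i j p q" and f: "hom C f W A" and g: "hom C g W B"
  shows "p \<diamondop> ((i \<diamondop> f) \<boxplus> (j \<diamondop> g)) = f" "q \<diamondop> ((i \<diamondop> f) \<boxplus> (j \<diamondop> g)) = g"
proof -
  have H: "hom C i A P" "hom C j B P" "hom C p P A" "hom C q P B"
    using b by (auto simp: is_biproduct_def)
  note fg = cmp_hom[OF f H(1)] cmp_hom[OF g H(2)]
  have E: "p \<diamondop> i = Idt C A" "q \<diamondop> j = Idt C B" "p \<diamondop> j = Zer C B A" "q \<diamondop> i = Zer C A B"
    using b by (auto simp: is_biproduct_def)
  have "p \<diamondop> (i \<diamondop> f) = f" "q \<diamondop> (j \<diamondop> g) = g" "p \<diamondop> (j \<diamondop> g) = Zer C W A" "q \<diamondop> (i \<diamondop> f) = Zer C W B"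
    using cmp_assoc[OF f H(1) H(3)] cmp_assoc[OF g H(2) H(3)] cmp_assoc[OF f H(1) H(4)]
      cmp_assoc[OF g H(2) H(4)] idt_left[OF f] idt_left[OF g] zer_cmp[OF f hom_ob(2)[OF g]]
      zer_cmp[OF g hom_ob(2)[OF f]] unfolding E by simp_all
  then show "p \<diamondop> ((i \<diamondop> f) \<boxplus> (j \<diamondop> g)) = f" "q \<diamondop> ((i \<diamondop> f) \<boxplus> (j \<diamondop> g)) = g"
    using cmp_add[OF fg H(3)] cmp_add[OF fg H(4)] add_zer[OF f] zer_add[OF g] by simp_all
qed

lemma biproduct_inj:
  assumes b: "is_biproduct P A B i j p q" and f: "hom C f A W" and g: "hom C g B W"
  shows "((f \<diamondop> p) \<boxplus> (g \<diamondop> q)) \<diamondop> i = f" "((f \<diamondop> p) \<boxplus> (g \<diamondop> q)) \<diamondop> j = g"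
proof -
  have H: "hom C i A P" "hom C j B P" "hom C p P A" "hom C q P B"
    using b by (auto simp: is_biproduct_def)
  note fg = cmp_hom[OF H(3) f] cmp_hom[OF H(4) g]
  have E: "p \<diamondop> i = Idt C A" "q \<diamondop> j = Idt C B" "p \<diamondop> j = Zer C B A" "q \<diamondop> i = Zer C A B"
    using b by (auto simp: is_biproduct_def)
  have "f \<diamondop> p \<diamondop> i = f" "g \<diamondop> q \<diamondop> j = g" "f \<diamondop> p \<diamondop> j = Zer C B W" "g \<diamondop> q \<diamondop> i = Zer C A W"
    using cmp_assoc[OF H(1) H(3) f] cmp_assoc[OF H(2) H(3) f] cmp_assoc[OF H(1) H(4) g]
      cmp_assoc[OF H(2) H(4) g] idt_right[OF f] idt_right[OF g] cmp_zer[OF f hom_ob(1)[OF g]]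
      cmp_zer[OF g hom_ob(1)[OF f]] unfolding E by simp_all
  then show "((f \<diamondop> p) \<boxplus> (g \<diamondop> q)) \<diamondop> i = f" "((f \<diamondop> p) \<boxplus> (g \<diamondop> q)) \<diamondop> j = g"
    using add_cmp[OF H(1) fg] add_cmp[OF H(2) fg] add_zer[OF f] zer_add[OF g] by simp_all
qed

lemma biproduct_ker:
  assumes b: "is_biproduct P A B i j p q"
  shows "is_ker A i P q B"
  unfolding is_ker_def
proof (intro conjI allI impI)
  show H: "hom C i A P" "hom C q P B" "q \<diamondop> i = Zer C A B"
    using b by (auto simp: is_biproduct_def)
  fix W w assume w: "hom C w W P" "q \<diamondop> w = Zer C W B"
  have p: "hom C p P A" and j: "hom C j B P" and pi: "p \<diamondop> i = Idt C A"
    using b by (auto simp: is_biproduct_def)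
  have "j \<diamondop> (q \<diamondop> w) = Zer C W P" using w cmp_zer[OF j] hom_ob by metis
  then have "i \<diamondop> (p \<diamondop> w) = w"
    using biproduct_decomp[OF b w(1), symmetric] add_zer[OF cmp_hom[OF cmp_hom[OF w(1) p] H(1)]] by simp
  moreover have "v = p \<diamondop> w" if "hom C v W A" "i \<diamondop> v = w" for v
    using that cmp_assoc[OF that(1) H(1) p] pi idt_left by metis
  ultimately show "\<exists>!v. hom C v W A \<and> i \<diamondop> v = w" using cmp_hom[OF w(1) p] by blast
qed

end

section \<open>Frobenius categories\<close>

locale frobenius = preadditive C for C :: "('o, 'm) acat" +
  fixes E :: "('o, 'm) conflations"
  assumes frobenius: "frobenius_category C E"
    and biproduct_ex: "A \<in> Ob C \<Longrightarrow> B \<in> Ob C \<Longrightarrow> \<exists>P i j p q. is_biproduct P A B i j p q"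
begin

abbreviation "proj \<equiv> projective_obj C E"
abbreviation "infl \<equiv> inflation E"
abbreviation "defl \<equiv> deflation E"

lemma exact: "exact_structure C E"
  using frobenius unfolding frobenius_category_def by (rule conjunct1)

lemma proj_cover: "T \<in> Ob C \<Longrightarrow> \<exists>A i P p. proj P \<and> E A i P p T"
  using frobenius[unfolded frobenius_category_def, THEN conjunct2, THEN conjunct1, rule_format] .

lemma inj_iff_proj: "injective_obj C E P \<longleftrightarrow> proj P"
  using frobenius unfolding frobenius_category_def by simp

lemma inj_hull: "A \<in> Ob C \<Longrightarrow> \<exists>i I p T. proj I \<and> E A i I p T"
  using frobenius unfolding frobenius_category_def by simp

lemmas exactD = exact[unfolded exact_structure_def]

lemma conf_kernel_cokernel: "E A i B p T \<Longrightarrow> kernel_cokernel C A i B p T"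
  by (rule exactD[THEN conjunct1, rule_format])

lemma conf_iso: "E A i B p T \<Longrightarrow> A' \<in> Ob C \<Longrightarrow> B' \<in> Ob C \<Longrightarrow> T' \<in> Ob C \<Longrightarrow>
    i' \<in> Mor C A' B' \<Longrightarrow> p' \<in> Mor C B' T' \<Longrightarrow> iso_mor C A A' a \<Longrightarrow> iso_mor C B B' b \<Longrightarrow>
    iso_mor C T T' t \<Longrightarrow> b \<diamondop> i = i' \<diamondop> a \<Longrightarrow> t \<diamondop> p = p' \<diamondop> b \<Longrightarrow> E A' i' B' p' T'"
  by (rule exactD[THEN conjunct2, THEN conjunct1, rule_format, of A i B p T]) (intro conjI)

lemma infl_idt: "A \<in> Ob C \<Longrightarrow> infl A A (Idt C A)"
  using exactD[THEN conjunct2, THEN conjunct2, THEN conjunct1] by simp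

lemma infl_cmp: "infl A B i \<Longrightarrow> infl B D j \<Longrightarrow> infl A D (j \<diamondop> i)"
  by (rule exactD[THEN conjunct2, THEN conjunct2, THEN conjunct2, THEN conjunct1, rule_format])
    (rule conjI)

lemma defl_cmp: "defl A B p \<Longrightarrow> defl B D q \<Longrightarrow> defl A D (q \<diamondop> p)"
  by (rule exactD[THEN conjunct2, THEN conjunct2, THEN conjunct2, THEN conjunct2, THEN conjunct1,
        rule_format]) (rule conjI)

lemma defl_pullback: "defl B T p \<Longrightarrow> T' \<in> Ob C \<Longrightarrow> f \<in> Mor C T' T \<Longrightarrow>
    \<exists>B'\<in>Ob C. \<exists>p' f'. pullback_square C B T B' T' p f p' f' \<and> defl B' T' p'"
  by (rule exactD[THEN conjunct2, THEN conjunct2, THEN conjunct2, THEN conjunct2, THEN conjunct2,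
        THEN conjunct2, rule_format]) (intro conjI)

lemma conf_ker: "E A i B p T \<Longrightarrow> is_ker A i B p T"
  and conf_coker: "E A i B p T \<Longrightarrow> is_coker A i B p T"
  using conf_kernel_cokernel kernel_cokernel_iff by blast+

text \<open>Conflations are closed under isomorphism, so a kernel sequence may be compared with one
  that the axioms supply: an isomorphism of the middle terms over B restricts to the
  kernels.\<close>

lemma conf_of_defl:
  assumes d: "defl P' B p'" and th: "hom C th P P'" "hom C th' P' P"
    and inv: "th' \<diamondop> th = Idt C P" "th \<diamondop> th' = Idt C P'" and q: "p' \<diamondop> th = q"
    and k: "is_ker A i P q B"
  shows "E A i P q B"
proof -
  obtain K k where E: "E K k P' p' B" using d by (auto simp: deflation_def)
  note H = ker_hom[OF k] ker_hom[OF conf_ker[OF E]]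
  have "p' \<diamondop> (th \<diamondop> i) = Zer C A B" using cmp_assoc[OF H(1) th(1) H(5)] q H by simp
  then obtain al where al: "hom C al A K" "k \<diamondop> al = th \<diamondop> i"
    using ker_lift[OF conf_ker[OF E] cmp_hom[OF H(1) th(1)]] by blast
  have qth: "q \<diamondop> th' = p'"
    using cmp_assoc[OF th(2) th(1) H(5)] q inv idt_right[OF H(5)] by simp
  have "q \<diamondop> (th' \<diamondop> k) = Zer C K B" using cmp_assoc[OF H(4) th(2) H(2)] qth H by simp
  then obtain be where be: "hom C be K A" "i \<diamondop> be = th' \<diamondop> k"
    using ker_lift[OF k cmp_hom[OF H(4) th(2)]] by blast
  have ob: "A \<in> Ob C" "K \<in> Ob C" "B \<in> Ob C" "P \<in> Ob C" "P' \<in> Ob C"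
    using al H th hom_ob by blast+
  have "i \<diamondop> (be \<diamondop> al) = i \<diamondop> Idt C A"
    using cmp_assoc[OF al(1) be(1) H(1)] be(2) cmp_assoc[OF al(1) H(4) th(2)] al(2)
      cmp_assoc[OF H(1) th(1) th(2)] inv idt_left[OF H(1)] idt_right[OF H(1)] by simp
  then have 1: "be \<diamondop> al = Idt C A"
    using ker_mono[OF k cmp_hom[OF al(1) be(1)] idt_hom[OF ob(1)]] by simp
  have "k \<diamondop> (al \<diamondop> be) = k \<diamondop> Idt C K"
    using cmp_assoc[OF be(1) al(1) H(4)] be(2) cmp_assoc[OF be(1) H(1) th(1)] al(2)
      cmp_assoc[OF H(4) th(2) th(1)] inv idt_left[OF H(4)] idt_right[OF H(4)] by simp
  then have 2: "al \<diamondop> be = Idt C K"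
    using ker_mono[OF conf_ker[OF E] cmp_hom[OF be(1) al(1)] idt_hom[OF ob(2)]] by simp
  have m: "i \<in> Mor C A P" "q \<in> Mor C P B" "be \<in> Mor C K A" "al \<in> Mor C A K"
    "th \<in> Mor C P P'" "th' \<in> Mor C P' P" "Idt C B \<in> Mor C B B"
    using H al be th idt_hom[OF ob(3)] by (auto simp: hom_def)
  show ?thesis
  proof (rule conf_iso[OF E ob(1) ob(4) ob(3) m(1) m(2)])
    show "iso_mor C K A be" unfolding iso_mor_def using m 1 2 by blast
    show "iso_mor C P' P th'" unfolding iso_mor_def using m inv by blast
    show "iso_mor C B B (Idt C B)"
      unfolding iso_mor_def using m idt_left[OF idt_hom[OF ob(3)]] by blast
    show "th' \<diamondop> k = i \<diamondop> be" using be by simp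
    show "Idt C B \<diamondop> p' = q \<diamondop> th'" using qth idt_left[OF H(5)] by simp
  qed
qed

text \<open>Split sequences are not among the axioms. The deflation belonging to the identity
  inflation of A is the zero map, and its pullback along the zero map from B is a product of A and B
  whose projection to B is a deflation; this product is then identified with P.\<close>

lemma biproduct_conf:
  assumes b: "is_biproduct P A B i j p q"
  shows "E A i P q B"
proof -
  have H: "hom C i A P" "hom C j B P" "hom C p P A" "hom C q P B"
    using b by (auto simp: is_biproduct_def)
  have ob: "A \<in> Ob C" "B \<in> Ob C" "P \<in> Ob C" using H hom_ob by blast+
  obtain z T where E: "E A (Idt C A) A z T"
    using infl_idt[OF ob(1)] by (auto simp: inflation_def)
  have z: "hom C z A T" "z \<diamondop> Idt C A = Zer C A T" using ker_hom[OF conf_ker[OF E]] by blast+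
  have z0: "z = Zer C A T" using z idt_right by simp
  have T: "T \<in> Ob C" using z hom_ob by blast
  have "defl A T z" using E by (auto simp: deflation_def)
  then obtain P' p' f' where P': "P' \<in> Ob C" "pullback_square C A T P' B z (Zer C B T) p' f'"
    and d: "defl P' B p'"
    using defl_pullback ob(2) zer_hom[OF ob(2) T] by (meson hom_def)
  have f: "hom C f' P' A" "hom C p' P' B"
    using P' ob by (auto simp: pullback_square_def hom_def)
  have U: "\<exists>!v. v \<in> Mor C W P' \<and> f' \<diamondop> v = s \<and> p' \<diamondop> v = t" if "hom C s W A" "hom C t W B" for W s t
  proof -
    have "z \<diamondop> s = Zer C B T \<diamondop> t" using zer_cmp that T z0 by simp
    then show ?thesis using P'(2) that by (simp add: pullback_square_def hom_def)
  qed
  obtain th where th: "hom C th P P'" "f' \<diamondop> th = p" "p' \<diamondop> th = q"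
    using U[OF H(3) H(4)] ob P' unfolding hom_def by (elim ex1E) blast
  note fp = cmp_hom[OF f(1) H(1)] cmp_hom[OF f(2) H(2)]
  define th' where "th' = (i \<diamondop> f') \<boxplus> (j \<diamondop> p')"
  have th': "hom C th' P' P" unfolding th'_def using add_hom fp by blast
  have 1: "th' \<diamondop> th = Idt C P"
    unfolding th'_def using add_cmp[OF th(1) fp] cmp_assoc[OF th(1) f(1) H(1)]
      cmp_assoc[OF th(1) f(2) H(2)] th b by (simp add: is_biproduct_def)
  have 2: "th \<diamondop> th' = Idt C P'"
  proof -
    have "f' \<diamondop> (th \<diamondop> th') = f'" "p' \<diamondop> (th \<diamondop> th') = p'"
      using cmp_assoc[OF th' th(1) f(1)] cmp_assoc[OF th' th(1) f(2)] th
        biproduct_proj[OF b f] by (simp_all add: th'_def)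
    moreover have "f' \<diamondop> Idt C P' = f'" "p' \<diamondop> Idt C P' = p'" using idt_right f by blast+
    moreover have "th \<diamondop> th' \<in> Mor C P' P'" "Idt C P' \<in> Mor C P' P'"
      using cmp_hom[OF th' th(1)] idt_hom P' by (auto simp: hom_def)
    ultimately show ?thesis using U[OF f] by (elim ex1E) metis
  qed
  show ?thesis by (rule conf_of_defl[OF d th(1) th' 1 2 th(3) biproduct_ker[OF b]])
qed

lemma proj_lift: "proj P \<Longrightarrow> defl B T p \<Longrightarrow> hom C f P T \<Longrightarrow> \<exists>g. hom C g P B \<and> p \<diamondop> g = f"
proof -
  assume a: "proj P" "defl B T p" "hom C f P T"
  then obtain A i where E: "E A i B p T" by (auto simp: deflation_def)
  then have "B \<in> Ob C" using ker_hom[OF conf_ker] hom_ob by metis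
  then show ?thesis using a E unfolding projective_obj_def hom_def by meson
qed

lemma inj_extend: "proj I \<Longrightarrow> infl A B i \<Longrightarrow> hom C f A I \<Longrightarrow> \<exists>g. hom C g B I \<and> g \<diamondop> i = f"
proof -
  assume a: "proj I" "infl A B i" "hom C f A I"
  then obtain p T where E: "E A i B p T" by (auto simp: inflation_def)
  then have "B \<in> Ob C" using ker_hom[OF conf_ker] hom_ob by metis
  moreover have "injective_obj C E I" using a inj_iff_proj by blast
  ultimately show ?thesis using a E unfolding injective_obj_def hom_def by meson
qed

lemma conf_infl: "E A i B p T \<Longrightarrow> infl A B i"
  and conf_defl: "E A i B p T \<Longrightarrow> defl B T p"
  by (auto simp: inflation_def deflation_def)

lemma proj_retract:
  assumes "proj P" "hom C s Q P" "hom C r P Q" "r \<diamondop> s = Idt C Q"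
  shows "proj Q"
  unfolding projective_obj_def
proof (intro conjI allI impI ballI)
  show "Q \<in> Ob C" using assms hom_ob by blast
  fix A i B p T f assume E: "E A i B p T" and f: "f \<in> Mor C Q T"
  have p: "hom C p B T" using ker_hom[OF conf_ker[OF E]] by blast
  have f: "hom C f Q T" using f p \<open>Q \<in> Ob C\<close> by (simp add: hom_def)
  obtain g where g: "hom C g P B" "p \<diamondop> g = f \<diamondop> r"
    using proj_lift[OF assms(1) conf_defl[OF E] cmp_hom[OF assms(3) f]] by blast
  have "p \<diamondop> (g \<diamondop> s) = f"
    using cmp_assoc[OF assms(2) g(1) p] g(2) cmp_assoc[OF assms(2) assms(3) f] assms(4)
      idt_right[OF f] by simp
  then show "\<exists>g\<in>Mor C Q B. p \<diamondop> g = f" using cmp_hom[OF assms(2) g(1)] by (auto simp: hom_def)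
qed

lemma proj_biproduct:
  assumes b: "is_biproduct P A B i j p q" and "proj A" "proj B"
  shows "proj P"
  unfolding projective_obj_def
proof (intro conjI allI impI ballI)
  have H: "hom C i A P" "hom C j B P" "hom C p P A" "hom C q P B"
    using b by (auto simp: is_biproduct_def)
  show P: "P \<in> Ob C" using H hom_ob by blast
  fix K k D r T f assume E: "E K k D r T" and f: "f \<in> Mor C P T"
  have r: "hom C r D T" using ker_hom[OF conf_ker[OF E]] by blast
  have f: "hom C f P T" using f r P by (simp add: hom_def)
  obtain g where g: "hom C g A D" "r \<diamondop> g = f \<diamondop> i"
    using proj_lift[OF assms(2) conf_defl[OF E] cmp_hom[OF H(1) f]] by blast
  obtain h where h: "hom C h B D" "r \<diamondop> h = f \<diamondop> j"
    using proj_lift[OF assms(3) conf_defl[OF E] cmp_hom[OF H(2) f]] by blast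
  note gp = cmp_hom[OF H(3) g(1)] cmp_hom[OF H(4) h(1)]
  have "r \<diamondop> ((g \<diamondop> p) \<boxplus> (h \<diamondop> q)) = (f \<diamondop> (i \<diamondop> p)) \<boxplus> (f \<diamondop> (j \<diamondop> q))"
    using cmp_add[OF gp r] cmp_assoc[OF H(3) g(1) r] cmp_assoc[OF H(4) h(1) r] g(2) h(2)
      cmp_assoc[OF H(3) H(1) f] cmp_assoc[OF H(4) H(2) f] by simp
  also have "\<dots> = f"
    using cmp_add[OF cmp_hom[OF H(3) H(1)] cmp_hom[OF H(4) H(2)] f] b idt_right[OF f]
    by (simp add: is_biproduct_def)
  finally show "\<exists>g\<in>Mor C P D. r \<diamondop> g = f" using add_hom[OF gp] by (auto simp: hom_def)
qed

text \<open>Projectivity of Q' gives g = f t, so the map in question is f after p + t q. The latter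
  is the projection of a sheared decomposition of P, hence a deflation, and deflations
  compose.\<close>

lemma defl_sum:
  assumes b: "is_biproduct P Q Q' i j p q" and d: "defl Q A f" and Q': "proj Q'"
    and f: "hom C f Q A" and g: "hom C g Q' A"
  shows "defl P A ((f \<diamondop> p) \<boxplus> (g \<diamondop> q))"
proof -
  have H: "hom C i Q P" "hom C j Q' P" "hom C p P Q" "hom C q P Q'"
    using b by (auto simp: is_biproduct_def)
  obtain t where t: "hom C t Q' Q" "f \<diamondop> t = g" using proj_lift[OF Q' d g] by blast
  have tq: "hom C (t \<diamondop> q) P Q" and it: "hom C (i \<diamondop> t) Q' P" using cmp_hom H t by blast+
  obtain n where n: "hom C n Q' P" "(i \<diamondop> t) \<boxplus> n = Zer C Q' P" using neg_ex it by blast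
  have pn: "t \<boxplus> (p \<diamondop> n) = Zer C Q' Q" "q \<diamondop> n = Zer C Q' Q'"
  proof -
    have "(p \<diamondop> (i \<diamondop> t)) \<boxplus> (p \<diamondop> n) = Zer C Q' Q"
      using cmp_add[OF it n(1) H(3)] n(2) cmp_zer[OF H(3)] H hom_ob by metis
    then show "t \<boxplus> (p \<diamondop> n) = Zer C Q' Q"
      using cmp_assoc[OF t(1) H(1) H(3)] b idt_left[OF t(1)] by (simp add: is_biproduct_def)
    have "(q \<diamondop> (i \<diamondop> t)) \<boxplus> (q \<diamondop> n) = Zer C Q' Q'"
      using cmp_add[OF it n(1) H(4)] n(2) cmp_zer[OF H(4)] H hom_ob by metis
    moreover have "q \<diamondop> (i \<diamondop> t) = Zer C Q' Q'"
      using cmp_assoc[OF t(1) H(1) H(4)] b zer_cmp[OF t(1)] hom_ob(2)[OF H(4)]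
      by (simp add: is_biproduct_def)
    ultimately show "q \<diamondop> n = Zer C Q' Q'" using zer_add[OF cmp_hom[OF n(1) H(4)]] by simp
  qed
  \<comment> \<open>Here n is the negative of i t: the second inclusion has to be sheared the other
    way for the new projection \<open>p1\<close> to kill it.\<close>
  define j1 where "j1 = j \<boxplus> n"
  define p1 where "p1 = p \<boxplus> (t \<diamondop> q)"
  have h1: "hom C j1 Q' P" "hom C p1 P Q" unfolding j1_def p1_def using add_hom H n tq by blast+
  have B: "p \<diamondop> i = Idt C Q" "q \<diamondop> j = Idt C Q'" "p \<diamondop> j = Zer C Q' Q" "q \<diamondop> i = Zer C Q Q'"
    "(i \<diamondop> p) \<boxplus> (j \<diamondop> q) = Idt C P" using b by (auto simp: is_biproduct_def)
  have qj1: "q \<diamondop> j1 = Idt C Q'"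
    unfolding j1_def using cmp_add[OF H(2) n(1) H(4)] B pn add_zer[OF idt_hom] H(4) hom_ob by simp
  have "p1 \<diamondop> i = Idt C Q"
    unfolding p1_def using add_cmp[OF H(1) H(3) tq] cmp_assoc[OF H(1) H(4) t(1)] B cmp_zer[OF t(1)]
      add_zer[OF idt_hom] H hom_ob by metis
  moreover have "p1 \<diamondop> j1 = Zer C Q' Q"
  proof -
    have "p1 \<diamondop> j1 = (p \<diamondop> j1) \<boxplus> (t \<diamondop> (q \<diamondop> j1))"
      unfolding p1_def using add_cmp[OF h1(1) H(3) tq] cmp_assoc[OF h1(1) H(4) t(1)] by simp
    also have "\<dots> = (p \<diamondop> n) \<boxplus> t"
      using qj1 idt_right[OF t(1)] cmp_add[OF H(2) n(1) H(3)] B zer_add[OF cmp_hom[OF n(1) H(3)]]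
      by (simp add: j1_def)
    finally show ?thesis using pn add_comm[OF t(1) cmp_hom[OF n(1) H(3)]] by simp
  qed
  moreover have "(i \<diamondop> p1) \<boxplus> (j1 \<diamondop> q) = Idt C P"
  proof -
    note c = cmp_hom[OF H(3) H(1)] cmp_hom[OF tq H(1)] cmp_hom[OF H(4) H(2)] cmp_hom[OF H(4) n(1)]
    have "i \<diamondop> (t \<diamondop> q) = (i \<diamondop> t) \<diamondop> q" using cmp_assoc[OF H(4) t(1) H(1)] .
    then have z: "(i \<diamondop> (t \<diamondop> q)) \<boxplus> (n \<diamondop> q) = Zer C P P"
      using add_cmp[OF H(4) it n(1)] n(2) zer_cmp[OF H(4) hom_ob(2)[OF H(1)]] by simp
    have "(i \<diamondop> p1) \<boxplus> (j1 \<diamondop> q) = ((i \<diamondop> p) \<boxplus> (i \<diamondop> (t \<diamondop> q))) \<boxplus> ((j \<diamondop> q) \<boxplus> (n \<diamondop> q))"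
      unfolding p1_def j1_def using cmp_add[OF H(3) tq H(1)] add_cmp[OF H(4) H(2) n(1)] by simp
    also have "\<dots> = (i \<diamondop> p) \<boxplus> ((i \<diamondop> (t \<diamondop> q)) \<boxplus> ((n \<diamondop> q) \<boxplus> (j \<diamondop> q)))"
      using add_assoc[OF c(1) c(2) add_hom[OF c(3) c(4)]] add_comm[OF c(3) c(4)] by simp
    also have "\<dots> = (i \<diamondop> p) \<boxplus> (j \<diamondop> q)"
      using add_assoc[OF c(2) c(4) c(3)] z zer_add[OF c(3)] by simp
    finally show ?thesis using B by simp
  qed
  ultimately have "is_biproduct P Q Q' i j1 p1 q"
    using H h1 B qj1 by (simp add: is_biproduct_def)
  then have "defl P Q p1" using biproduct_conf[OF is_biproduct_swap] conf_defl by blast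
  then have "defl P A (f \<diamondop> p1)" using d defl_cmp by blast
  then show ?thesis
    unfolding p1_def using cmp_add[OF H(3) tq f] cmp_assoc[OF H(4) t(1) f] t by simp
qed

text \<open>Dual to \<open>defl_sum\<close>: with g = t f by injectivity of J', the map is a + c t
  after f, and a + c t is the inclusion of a sheared decomposition.\<close>

lemma infl_sum:
  assumes b: "is_biproduct P J J' a c p q" and d: "infl A J f" and J': "proj J'"
    and f: "hom C f A J" and g: "hom C g A J'"
  shows "infl A P ((a \<diamondop> f) \<boxplus> (c \<diamondop> g))"
proof -
  have H: "hom C a J P" "hom C c J' P" "hom C p P J" "hom C q P J'"
    using b by (auto simp: is_biproduct_def)
  obtain t where t: "hom C t J J'" "t \<diamondop> f = g" using inj_extend[OF J' d g] by blast
  have ct: "hom C (c \<diamondop> t) J P" and tp: "hom C (t \<diamondop> p) P J'" using cmp_hom H t by blast+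
  have B: "p \<diamondop> a = Idt C J" "q \<diamondop> c = Idt C J'" "p \<diamondop> c = Zer C J' J" "q \<diamondop> a = Zer C J J'"
    "(a \<diamondop> p) \<boxplus> (c \<diamondop> q) = Idt C P" using b by (auto simp: is_biproduct_def)
  have ob: "J \<in> Ob C" "J' \<in> Ob C" "P \<in> Ob C" using H hom_ob by blast+
  obtain q1 where q1: "hom C q1 P J'" "q = (t \<diamondop> p) \<boxplus> q1" using diff_ex[OF H(4) tp] by blast
  define a1 where "a1 = a \<boxplus> (c \<diamondop> t)"
  have a1: "hom C a1 J P" unfolding a1_def using add_hom H ct by blast
  have qc: "q1 \<diamondop> c = Idt C J'"
  proof -
    have "Idt C J' = (t \<diamondop> (p \<diamondop> c)) \<boxplus> (q1 \<diamondop> c)"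
      using B(2) q1 add_cmp[OF H(2) tp q1(1)] cmp_assoc[OF H(2) H(3) t(1)] by simp
    then show ?thesis using B(3) cmp_zer[OF t(1) ob(2)] zer_add[OF cmp_hom[OF H(2) q1(1)]] by simp
  qed
  have "p \<diamondop> a1 = Idt C J"
    unfolding a1_def using cmp_add[OF H(1) ct H(3)] cmp_assoc[OF t(1) H(2) H(3)] B zer_cmp[OF t(1) ob(1)]
      add_zer[OF idt_hom[OF ob(1)]] by simp
  moreover have "q1 \<diamondop> a1 = Zer C J J'"
  proof -
    have q1a: "hom C (q1 \<diamondop> a) J J'" using cmp_hom H q1 by blast
    have "Zer C J J' = (t \<diamondop> (p \<diamondop> a)) \<boxplus> (q1 \<diamondop> a)"
      using B(4) q1 add_cmp[OF H(1) tp q1(1)] cmp_assoc[OF H(1) H(3) t(1)] by simp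
    then have "(q1 \<diamondop> a) \<boxplus> t = Zer C J J'" using B(1) idt_right[OF t(1)] add_comm[OF t(1) q1a] by simp
    moreover have "q1 \<diamondop> (c \<diamondop> t) = t" using cmp_assoc[OF t(1) H(2) q1(1)] qc idt_left[OF t(1)] by simp
    ultimately show ?thesis unfolding a1_def using cmp_add[OF H(1) ct q1(1)] by simp
  qed
  moreover have "(a1 \<diamondop> p) \<boxplus> (c \<diamondop> q1) = Idt C P"
  proof -
    note e = cmp_hom[OF H(3) H(1)] cmp_hom[OF H(3) ct] cmp_hom[OF q1(1) H(2)]
    have "(a1 \<diamondop> p) \<boxplus> (c \<diamondop> q1) = (a \<diamondop> p) \<boxplus> (((c \<diamondop> t) \<diamondop> p) \<boxplus> (c \<diamondop> q1))"
      unfolding a1_def using add_cmp[OF H(3) H(1) ct] add_assoc[OF e] by simp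
    also have "((c \<diamondop> t) \<diamondop> p) \<boxplus> (c \<diamondop> q1) = c \<diamondop> ((t \<diamondop> p) \<boxplus> q1)"
      using cmp_add[OF tp q1(1) H(2)] cmp_assoc[OF H(3) t(1) H(2)] by simp
    finally show ?thesis using q1(2) B(5) by simp
  qed
  ultimately have "is_biproduct P J J' a1 c p q1"
    using H a1 B qc q1 by (simp add: is_biproduct_def)
  then have "infl J P a1" using biproduct_conf conf_infl by blast
  then have "infl A P (a1 \<diamondop> f)" using d infl_cmp by blast
  then show ?thesis
    unfolding a1_def using add_cmp[OF f H(1) ct] cmp_assoc[OF f t(1) H(2)] t by simp
qed

text \<open>Weaker than a conflation with projective middle term, but it can be verified on matrices
  and decides the same vanishing question.\<close>

definition presentation :: "'o \<Rightarrow> 'm \<Rightarrow> 'o \<Rightarrow> 'm \<Rightarrow> 'o \<Rightarrow> bool" where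
  "presentation A' i P p A \<longleftrightarrow> is_ker A' i P p A \<and> proj P \<and>
     (\<forall>Q f. proj Q \<longrightarrow> hom C f Q A \<longrightarrow> (\<exists>g. hom C g Q P \<and> p \<diamondop> g = f))"

text \<open>The equivalence is known for a projective cover taken from the exact structure. That
  cover and the presentation map to each other over A, and such comparison maps transfer the
  extension property.\<close>

lemma lifting_iff_extension_presentation:
  assumes p: "presentation A' i P p A" and E: "E B k I r T" and I: "proj I"
  shows "(\<forall>f. hom C f A T \<longrightarrow> (\<exists>s. hom C s A I \<and> r \<diamondop> s = f)) \<longleftrightarrow>
         (\<forall>g. hom C g A' B \<longrightarrow> (\<exists>h. hom C h P B \<and> h \<diamondop> i = g))"
proof -
  have ki: "is_ker A' i P p A" using p by (simp add: presentation_def)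
  have "A \<in> Ob C" using ker_hom[OF ki] hom_ob by blast
  then obtain K j Q q where Q: "proj Q" "E K j Q q A" using proj_cover by blast
  have kq: "is_ker K j Q q A" using Q conf_ker by blast
  obtain f1 where f1: "hom C f1 Q P" "p \<diamondop> f1 = q"
    using p Q ker_hom[OF kq] unfolding presentation_def by blast
  obtain f2 where f2: "hom C f2 P Q" "q \<diamondop> f2 = p"
    using proj_lift[OF _ conf_defl[OF Q(2)]] p ker_hom[OF ki] unfolding presentation_def by blast
  have "(\<forall>f. hom C f A T \<longrightarrow> (\<exists>s. hom C s A I \<and> r \<diamondop> s = f)) \<longleftrightarrow>
        (\<forall>g. hom C g K B \<longrightarrow> (\<exists>h. hom C h Q B \<and> h \<diamondop> j = g))"
    using lifting_iff_extension[OF kq conf_coker[OF Q(2)] conf_ker[OF E] conf_coker[OF E]]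
      inj_extend[OF I conf_infl[OF Q(2)]] proj_lift[OF Q(1) conf_defl[OF E]] by blast
  also have "\<dots> \<longleftrightarrow> (\<forall>g. hom C g A' B \<longrightarrow> (\<exists>h. hom C h P B \<and> h \<diamondop> i = g))"
    using extension_transfer[OF ki kq f1 f2] extension_transfer[OF kq ki f2 f1] by blast
  finally show ?thesis .
qed

end

section \<open>Equivariant objects\<close>

text \<open>The pattern of \<open>Psicat\<close> over an arbitrary category, so that only formal
  properties of the involution enter; \<open>Psicat_eq\<close> recovers the concrete case.\<close>

definition equivariant_cat ::
  "('o, 'm) acat \<Rightarrow> ('o \<Rightarrow> 'o) \<Rightarrow> ('m \<Rightarrow> 'm) \<Rightarrow> ('o \<times> 'm, 'm) acat" where
  "equivariant_cat C po pm =
    \<lparr> Ob = {(A, xi). A \<in> Ob C \<and> iso_mor C (po A) A xi \<and> Cmp C xi (pm xi) = Idt C A},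
      Mor = (\<lambda>(A, xi) (B, eta). {f \<in> Mor C A B. Cmp C f xi = Cmp C eta (pm f)}),
      Idt = (\<lambda>(A, xi). Idt C A),
      Cmp = Cmp C,
      Add = Add C,
      Zer = (\<lambda>(A, xi) (B, eta). Zer C A B) \<rparr>"

definition equivariant_conf ::
  "('o, 'm) acat \<Rightarrow> ('o \<Rightarrow> 'o) \<Rightarrow> ('m \<Rightarrow> 'm) \<Rightarrow> ('o, 'm) conflations \<Rightarrow>
     ('o \<times> 'm, 'm) conflations" where
  "equivariant_conf C po pm E A i B p T \<longleftrightarrow>
     A \<in> Ob (equivariant_cat C po pm) \<and> B \<in> Ob (equivariant_cat C po pm) \<and>
     T \<in> Ob (equivariant_cat C po pm) \<and>
     i \<in> Mor (equivariant_cat C po pm) A B \<and> p \<in> Mor (equivariant_cat C po pm) B T \<and>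
     E (fst A) i (fst B) p (fst T)"

text \<open>The last two assumptions say that 2 acts invertibly on every Hom-group, without
  mentioning scalars.\<close>

locale frobenius_involution = frobenius C E
  for C :: "('o, 'm) acat" and E :: "('o, 'm) conflations" +
  fixes po :: "'o \<Rightarrow> 'o" and pm :: "'m \<Rightarrow> 'm"
  assumes po_ob: "A \<in> Ob C \<Longrightarrow> po A \<in> Ob C"
    and pm_hom: "hom C f A B \<Longrightarrow> hom C (pm f) (po A) (po B)"
    and pm_cmp: "hom C f A B \<Longrightarrow> hom C g B D \<Longrightarrow> pm (Cmp C g f) = Cmp C (pm g) (pm f)"
    and pm_add: "hom C f A B \<Longrightarrow> hom C g A B \<Longrightarrow> pm (Add C f g) = Add C (pm f) (pm g)"
    and pm_idt: "A \<in> Ob C \<Longrightarrow> pm (Idt C A) = Idt C (po A)"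
    and po_po: "A \<in> Ob C \<Longrightarrow> po (po A) = A"
    and pm_pm: "hom C f A B \<Longrightarrow> pm (pm f) = f"
    and po_proj: "projective_obj C E P \<Longrightarrow> projective_obj C E (po P)"
    and half_ex: "hom C f A B \<Longrightarrow> \<exists>h. hom C h A B \<and> Add C h h = f"
    and double_inj: "hom C f A B \<Longrightarrow> hom C g A B \<Longrightarrow> Add C f f = Add C g g \<Longrightarrow> f = g"
begin

abbreviation "PC \<equiv> equivariant_cat C po pm"
abbreviation "PE \<equiv> equivariant_conf C po pm E"

lemma pm_zer:
  assumes "A \<in> Ob C" "B \<in> Ob C"
  shows "pm (Zer C A B) = Zer C (po A) (po B)"
proof -
  have z: "hom C (Zer C A B) A B" using zer_hom assms by blast
  show ?thesis
    using pm_add[OF z z] add_zer[OF z] add_eq_selfD[OF pm_hom[OF z] pm_hom[OF z]] by simp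
qed

lemma PC_ob:
  assumes "A \<in> Ob PC"
  shows "fst A \<in> Ob C" "hom C (snd A) (po (fst A)) (fst A)" "hom C (pm (snd A)) (fst A) (po (fst A))"
    "snd A \<diamondop> pm (snd A) = Idt C (fst A)" "pm (snd A) \<diamondop> snd A = Idt C (po (fst A))"
proof -
  obtain X xi where A: "A = (X, xi)" by (cases A)
  show o: "fst A \<in> Ob C" and x: "hom C (snd A) (po (fst A)) (fst A)"
    and e: "snd A \<diamondop> pm (snd A) = Idt C (fst A)"
    using assms po_ob by (auto simp: equivariant_cat_def hom_def iso_mor_def A)
  show y: "hom C (pm (snd A)) (fst A) (po (fst A))" using pm_hom[OF x] po_po[OF o] by simp
  have "pm (snd A \<diamondop> pm (snd A)) = pm (snd A) \<diamondop> snd A" using pm_cmp[OF y x] pm_pm[OF x] by simp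
  then show "pm (snd A) \<diamondop> snd A = Idt C (po (fst A))" using e pm_idt[OF o] by simp
qed

lemma PC_obI:
  assumes "X \<in> Ob C" "hom C xi (po X) X" "xi \<diamondop> pm xi = Idt C X"
  shows "(X, xi) \<in> Ob PC"
proof -
  have y: "hom C (pm xi) X (po X)" using pm_hom[OF assms(2)] po_po assms by simp
  have "pm xi \<diamondop> xi = Idt C (po X)"
    using pm_cmp[OF y assms(2)] pm_pm[OF assms(2)] assms(3) pm_idt[OF assms(1)] by simp
  then show ?thesis using assms y by (auto simp: equivariant_cat_def iso_mor_def hom_def)
qed

lemma PC_hom: "hom PC f A B \<longleftrightarrow> A \<in> Ob PC \<and> B \<in> Ob PC \<and> hom C f (fst A) (fst B) \<and>
    f \<diamondop> snd A = snd B \<diamondop> pm f"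
  using PC_ob(1)[of A] PC_ob(1)[of B]
  by (cases A; cases B) (auto simp: hom_def equivariant_cat_def)

lemma PC_hom_C: "hom PC f A B \<Longrightarrow> hom C f (fst A) (fst B)"
  by (simp add: PC_hom)

lemma PC_sel [simp]: "Cmp PC = Cmp C" "Add PC = Add C" "Idt PC A = Idt C (fst A)"
    "Zer PC A B = Zer C (fst A) (fst B)"
  by (simp_all add: equivariant_cat_def case_prod_unfold)

lemma PC_preadditive: "preadditive PC"
proof
  fix f g h A B D F
  show "hom PC (Cmp PC g f) A D" if f: "hom PC f A B" and g: "hom PC g B D"
  proof -
    note F = PC_hom_C[OF f] PC_hom_C[OF g]
    have ob: "A \<in> Ob PC" "B \<in> Ob PC" "D \<in> Ob PC" using f g by (auto simp: PC_hom)
    have "g \<diamondop> f \<diamondop> snd A = g \<diamondop> (snd B \<diamondop> pm f)"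
      using cmp_assoc[OF PC_ob(2)[OF ob(1)] F] f by (simp add: PC_hom)
    also have "\<dots> = snd D \<diamondop> pm g \<diamondop> pm f"
      using cmp_assoc[OF pm_hom[OF F(1)] PC_ob(2)[OF ob(2)] F(2)] g by (simp add: PC_hom)
    also have "\<dots> = snd D \<diamondop> pm (g \<diamondop> f)"
      using cmp_assoc[OF pm_hom[OF F(1)] pm_hom[OF F(2)] PC_ob(2)[OF ob(3)]] pm_cmp[OF F] by simp
    finally show ?thesis using f g cmp_hom[OF F] by (simp add: PC_hom)
  qed
  show "Cmp PC h (Cmp PC g f) = Cmp PC (Cmp PC h g) f"
    if "hom PC f A B" "hom PC g B D" "hom PC h D F"
    using cmp_assoc[OF that[THEN PC_hom_C]] by simp
  show "hom PC (Idt PC A) A A" if "A \<in> Ob PC"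
    using that idt_hom[OF PC_ob(1)[OF that]] idt_left[OF PC_ob(2)[OF that]]
      idt_right[OF PC_ob(2)[OF that]] pm_idt[OF PC_ob(1)[OF that]] by (simp add: PC_hom)
  show "Cmp PC (Idt PC B) f = f" if "hom PC f A B"
    using idt_left[OF that[THEN PC_hom_C]] by simp
  show "Cmp PC f (Idt PC A) = f" if "hom PC f A B"
    using idt_right[OF that[THEN PC_hom_C]] by simp
  show "hom PC (Add PC f g) A B" if f: "hom PC f A B" and g: "hom PC g A B"
  proof -
    note F = PC_hom_C[OF f] PC_hom_C[OF g]
    have ob: "A \<in> Ob PC" "B \<in> Ob PC" using f g by (auto simp: PC_hom)
    show ?thesis
      using f g add_cmp[OF PC_ob(2)[OF ob(1)] F] cmp_add[OF pm_hom[OF F(1)] pm_hom[OF F(2)]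
          PC_ob(2)[OF ob(2)]] pm_add[OF F] add_hom[OF F] by (simp add: PC_hom)
  qed
  show "Add PC (Add PC f g) h = Add PC f (Add PC g h)"
    if "hom PC f A B" "hom PC g A B" "hom PC h A B"
    using add_assoc[OF that[THEN PC_hom_C]] by simp
  show "Add PC f g = Add PC g f" if "hom PC f A B" "hom PC g A B"
    using add_comm[OF that[THEN PC_hom_C]] by simp
  show "hom PC (Zer PC A B) A B" if "A \<in> Ob PC" "B \<in> Ob PC"
    using that zer_hom[OF PC_ob(1)[OF that(1)] PC_ob(1)[OF that(2)]]
      zer_cmp[OF PC_ob(2)[OF that(1)] PC_ob(1)[OF that(2)]]
      cmp_zer[OF PC_ob(2)[OF that(2)] po_ob[OF PC_ob(1)[OF that(1)]]]
      pm_zer[OF PC_ob(1)[OF that(1)] PC_ob(1)[OF that(2)]] by (simp add: PC_hom)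
  show "Add PC f (Zer PC A B) = f" if "hom PC f A B"
    using add_zer[OF that[THEN PC_hom_C]] by simp
  show "\<exists>g. hom PC g A B \<and> Add PC f g = Zer PC A B" if f: "hom PC f A B"
  proof -
    note F = PC_hom_C[OF f]
    have ob: "A \<in> Ob PC" "B \<in> Ob PC" using f by (auto simp: PC_hom)
    note x = PC_ob(2)[OF ob(1)] PC_ob(2)[OF ob(2)]
    obtain n where n: "hom C n (fst A) (fst B)" "f \<boxplus> n = Zer C (fst A) (fst B)"
      using neg_ex F by blast
    have "(f \<diamondop> snd A) \<boxplus> (n \<diamondop> snd A) = Zer C (po (fst A)) (fst B)"
      using add_cmp[OF x(1) F n(1)] n(2) zer_cmp[OF x(1)] PC_ob(1)[OF ob(2)] by simp
    moreover have "(snd B \<diamondop> pm f) \<boxplus> (snd B \<diamondop> pm n) = Zer C (po (fst A)) (fst B)"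
      using cmp_add[OF pm_hom[OF F] pm_hom[OF n(1)] x(2)] pm_add[OF F n(1), symmetric] n(2)
        pm_zer[OF PC_ob(1)[OF ob(1)] PC_ob(1)[OF ob(2)]] cmp_zer[OF x(2) po_ob[OF PC_ob(1)[OF ob(1)]]]
      by simp
    ultimately have "n \<diamondop> snd A = snd B \<diamondop> pm n"
      using f add_cancel[OF cmp_hom[OF x(1) F] cmp_hom[OF x(1) n(1)] cmp_hom[OF pm_hom[OF n(1)] x(2)]]
      by (simp add: PC_hom)
    then show ?thesis using n ob by (auto simp: PC_hom)
  qed
  show "Cmp PC h (Add PC f g) = Add PC (Cmp PC h f) (Cmp PC h g)"
    if "hom PC f A B" "hom PC g A B" "hom PC h B D"
    using cmp_add[OF that[THEN PC_hom_C]] by simp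
  show "Cmp PC (Add PC g h) f = Add PC (Cmp PC g f) (Cmp PC h f)"
    if "hom PC f A B" "hom PC g B D" "hom PC h B D"
    using add_cmp[OF that[THEN PC_hom_C]] by simp
qed

sublocale P: preadditive PC
  by (rule PC_preadditive)

section \<open>Averaging over the involution\<close>

definition conj_mor :: "'o \<times> 'm \<Rightarrow> 'o \<times> 'm \<Rightarrow> 'm \<Rightarrow> 'm" where
  "conj_mor A B g = snd B \<diamondop> pm g \<diamondop> pm (snd A)"

lemma conj_hom:
  assumes "A \<in> Ob PC" "B \<in> Ob PC" "hom C g (fst A) (fst B)"
  shows "hom C (conj_mor A B g) (fst A) (fst B)"
  unfolding conj_mor_def
  by (rule cmp_hom[OF PC_ob(3)[OF assms(1)] cmp_hom[OF pm_hom[OF assms(3)] PC_ob(2)[OF assms(2)]]])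

text \<open>Since \<open>pm (snd A)\<close> is inverse to \<open>snd A\<close>,
  \<open>conj_mor\<close> is the conjugation action of the involution on plain morphisms, and being
  fixed means commuting with the structure maps.\<close>

lemma conj_fixed_iff:
  assumes "A \<in> Ob PC" "B \<in> Ob PC" "hom C g (fst A) (fst B)"
  shows "hom PC g A B \<longleftrightarrow> conj_mor A B g = g"
proof -
  note x = PC_ob[OF assms(1)] note y = PC_ob[OF assms(2)]
  note bg = cmp_hom[OF pm_hom[OF assms(3)] y(2)]
  have 1: "snd B \<diamondop> pm g = conj_mor A B g \<diamondop> snd A"
    unfolding conj_mor_def using cmp_assoc[OF x(2) x(3) bg] x(5) idt_right[OF bg] by simp
  have 2: "conj_mor A B g = g" if "g \<diamondop> snd A = snd B \<diamondop> pm g"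
    unfolding conj_mor_def that[symmetric]
    using cmp_assoc[OF x(3) x(2) assms(3)] x(4) idt_right[OF assms(3)] by simp
  show ?thesis using 1 2 assms by (auto simp: PC_hom)
qed

lemma conj_add:
  assumes "A \<in> Ob PC" "B \<in> Ob PC" "hom C f (fst A) (fst B)" "hom C g (fst A) (fst B)"
  shows "conj_mor A B (f \<boxplus> g) = conj_mor A B f \<boxplus> conj_mor A B g"
proof -
  note x = PC_ob[OF assms(1)] note y = PC_ob[OF assms(2)]
  note fg = pm_hom[OF assms(3)] pm_hom[OF assms(4)]
  show ?thesis
    unfolding conj_mor_def
    using pm_add[OF assms(3,4)] cmp_add[OF fg y(2)]
      add_cmp[OF x(3) cmp_hom[OF fg(1) y(2)] cmp_hom[OF fg(2) y(2)]] by simp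
qed

lemma conj_conj:
  assumes "A \<in> Ob PC" "B \<in> Ob PC" "hom C g (fst A) (fst B)"
  shows "conj_mor A B (conj_mor A B g) = g"
proof -
  note x = PC_ob[OF assms(1)] note y = PC_ob[OF assms(2)]
  note pg = pm_hom[OF assms(3)]
  have "pm (conj_mor A B g) = pm (snd B) \<diamondop> g \<diamondop> snd A"
    unfolding conj_mor_def
    using pm_cmp[OF x(3) cmp_hom[OF pg y(2)]] pm_cmp[OF pg y(2)] pm_pm[OF assms(3)] pm_pm[OF x(2)]
    by simp
  moreover have "snd B \<diamondop> (pm (snd B) \<diamondop> g) = g"
    using cmp_assoc[OF assms(3) y(3) y(2)] y(4) idt_left[OF assms(3)] by simp
  ultimately have "snd B \<diamondop> pm (conj_mor A B g) = g \<diamondop> snd A"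
    using cmp_assoc[OF x(2) cmp_hom[OF assms(3) y(3)] y(2)] by simp
  then show ?thesis
    using cmp_assoc[OF x(3) x(2) assms(3)] x(4) idt_right[OF assms(3)] by (simp add: conj_mor_def)
qed

lemma conj_cmp_left:
  assumes "A \<in> Ob PC" "hom C g (fst A) (fst B)" "hom PC p B T"
  shows "p \<diamondop> conj_mor A B g = conj_mor A T (p \<diamondop> g)"
proof -
  have ob: "B \<in> Ob PC" "T \<in> Ob PC" using assms by (auto simp: PC_hom)
  note x = PC_ob[OF assms(1)] note y = PC_ob[OF ob(1)] note z = PC_ob[OF ob(2)]
  note p = PC_hom_C[OF assms(3)] note pg = pm_hom[OF assms(2)]
  have "p \<diamondop> conj_mor A B g = p \<diamondop> snd B \<diamondop> pm g \<diamondop> pm (snd A)"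
    unfolding conj_mor_def using cmp_assoc[OF x(3) cmp_hom[OF pg y(2)] p] cmp_assoc[OF pg y(2) p]
    by simp
  also have "p \<diamondop> snd B \<diamondop> pm g = snd T \<diamondop> pm (p \<diamondop> g)"
    using assms(3) cmp_assoc[OF pg pm_hom[OF p] z(2)] pm_cmp[OF assms(2) p] by (simp add: PC_hom)
  finally show ?thesis by (simp add: conj_mor_def)
qed

lemma conj_cmp_right:
  assumes "B \<in> Ob PC" "hom C g (fst A) (fst B)" "hom PC i A' A"
  shows "conj_mor A B g \<diamondop> i = conj_mor A' B (g \<diamondop> i)"
proof -
  have ob: "A \<in> Ob PC" "A' \<in> Ob PC" using assms by (auto simp: PC_hom)
  note x = PC_ob[OF ob(1)] note y = PC_ob[OF ob(2)] note z = PC_ob[OF assms(1)]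
  note i = PC_hom_C[OF assms(3)] note pg = pm_hom[OF assms(2)]
  have "pm (snd A) \<diamondop> i = pm i \<diamondop> pm (snd A')"
    using assms(3) pm_cmp[OF y(2) i] pm_cmp[OF pm_hom[OF i] x(2)] pm_pm[OF i] by (simp add: PC_hom)
  then have "conj_mor A B g \<diamondop> i = snd B \<diamondop> pm g \<diamondop> (pm i \<diamondop> pm (snd A'))"
    unfolding conj_mor_def using cmp_assoc[OF i x(3) cmp_hom[OF pg z(2)]] by simp
  also have "\<dots> = snd B \<diamondop> pm (g \<diamondop> i) \<diamondop> pm (snd A')"
    using cmp_assoc[OF y(3) pm_hom[OF i] cmp_hom[OF pg z(2)]] cmp_assoc[OF pm_hom[OF i] pg z(2)]
      pm_cmp[OF i assms(2)] by simp
  finally show ?thesis by (simp add: conj_mor_def)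
qed

text \<open>Conjugation exchanges the two terms on the right, so half of their sum and its conjugate
  have the same double and hence agree.\<close>

lemma average:
  assumes "A \<in> Ob PC" "B \<in> Ob PC" "hom C g (fst A) (fst B)"
  obtains h where "hom PC h A B" "h \<boxplus> h = g \<boxplus> conj_mor A B g"
proof -
  note c = conj_hom[OF assms]
  obtain h where h: "hom C h (fst A) (fst B)" "h \<boxplus> h = g \<boxplus> conj_mor A B g"
    using half_ex add_hom[OF assms(3) c] by blast
  note ch = conj_hom[OF assms(1,2) h(1)]
  have "conj_mor A B h \<boxplus> conj_mor A B h = h \<boxplus> h"
    using conj_add[OF assms(1,2) h(1) h(1)] conj_add[OF assms c] conj_conj[OF assms] h(2)
      add_comm[OF assms(3) c] by simp
  then have "conj_mor A B h = h" using double_inj ch h by blast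
  then show ?thesis using that conj_fixed_iff[OF assms(1,2) h(1)] h by blast
qed

text \<open>Maschke's argument: conjugation commutes with composition by an equivariant p, so
  averaging a plain lift of an equivariant map leaves it a lift.\<close>

lemma average_lift:
  assumes "A \<in> Ob PC" "hom C g (fst A) (fst B)" "hom PC p B T" "hom PC f A T" "p \<diamondop> g = f"
  shows "\<exists>h. hom PC h A B \<and> p \<diamondop> h = f"
proof -
  have ob: "B \<in> Ob PC" "T \<in> Ob PC" using assms by (auto simp: PC_hom)
  obtain h where h: "hom PC h A B" "h \<boxplus> h = g \<boxplus> conj_mor A B g"
    using average[OF assms(1) ob(1) assms(2)] .
  note H = PC_hom_C[OF h(1)] note p = PC_hom_C[OF assms(3)] note f = PC_hom_C[OF assms(4)]
  have "conj_mor A T f = f" using conj_fixed_iff[OF assms(1) ob(2) f] assms(4) by blast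
  then have "(p \<diamondop> h) \<boxplus> (p \<diamondop> h) = f \<boxplus> f"
    using cmp_add[OF H H p] h(2) cmp_add[OF assms(2) conj_hom[OF assms(1) ob(1) assms(2)] p]
      conj_cmp_left[OF assms(1-3)] assms(5) by simp
  then show ?thesis using double_inj[OF cmp_hom[OF H p] f] h by blast
qed

lemma average_extend:
  assumes "B \<in> Ob PC" "hom C g (fst A) (fst B)" "hom PC i A' A" "hom PC f A' B" "g \<diamondop> i = f"
  shows "\<exists>h. hom PC h A B \<and> h \<diamondop> i = f"
proof -
  have ob: "A \<in> Ob PC" "A' \<in> Ob PC" using assms by (auto simp: PC_hom)
  obtain h where h: "hom PC h A B" "h \<boxplus> h = g \<boxplus> conj_mor A B g"
    using average[OF ob(1) assms(1) assms(2)] .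
  note H = PC_hom_C[OF h(1)] note i = PC_hom_C[OF assms(3)] note f = PC_hom_C[OF assms(4)]
  have "conj_mor A' B f = f" using conj_fixed_iff[OF ob(2) assms(1) f] assms(4) by blast
  then have "(h \<diamondop> i) \<boxplus> (h \<diamondop> i) = f \<boxplus> f"
    using add_cmp[OF i H H] h(2) add_cmp[OF i assms(2) conj_hom[OF ob(1) assms(1) assms(2)]]
      conj_cmp_right[OF assms(1-3)] assms(5) by simp
  then show ?thesis using double_inj[OF cmp_hom[OF i H] f] h by blast
qed

lemma PE_E: "PE A i B p T \<longleftrightarrow> hom PC i A B \<and> hom PC p B T \<and> E (fst A) i (fst B) p (fst T)"
  by (auto simp: equivariant_conf_def hom_def)

text \<open>The plain factorization of an equivariant map is unique, so it agrees with its conjugate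
  and is itself equivariant.\<close>

lemma PE_ker:
  assumes "hom PC i A B" "hom PC p B T" "is_ker (fst A) i (fst B) p (fst T)"
  shows "P.is_ker A i B p T"
  unfolding P.is_ker_def
proof (intro conjI allI impI)
  show "hom PC i A B" "hom PC p B T" "Cmp PC p i = Zer PC A T"
    using assms(1,2) ker_hom[OF assms(3)] by simp_all
  fix W w assume w: "hom PC w W B" "Cmp PC p w = Zer PC W T"
  note H = PC_hom_C[OF assms(1)] PC_hom_C[OF assms(2)] PC_hom_C[OF w(1)]
  have ob: "A \<in> Ob PC" "W \<in> Ob PC" "B \<in> Ob PC" using assms w by (auto simp: PC_hom)
  obtain v where v: "hom C v (fst W) (fst A)" "i \<diamondop> v = w"
    using ker_lift[OF assms(3) H(3)] w(2) unfolding PC_sel by blast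
  have "i \<diamondop> conj_mor W A v = conj_mor W B w" using conj_cmp_left[OF ob(2) v(1) assms(1)] v by simp
  also have "\<dots> = i \<diamondop> v" using conj_fixed_iff[OF ob(2) ob(3) H(3)] w v by simp
  finally have "conj_mor W A v = v"
    using ker_mono[OF assms(3) conj_hom[OF ob(2,1) v(1)] v(1)] by simp
  then have 1: "hom PC v W A \<and> i \<diamondop> v = w" using conj_fixed_iff[OF ob(2,1) v(1)] v(2) by blast
  have 2: "v' = v" if "hom PC v' W A \<and> i \<diamondop> v' = w" for v'
    using ker_mono[OF assms(3) PC_hom_C[OF conjunct1[OF that]] v(1)] that v by simp
  show "\<exists>!v. hom PC v W A \<and> Cmp PC i v = w" unfolding PC_sel by (rule ex1I[of "\<lambda>v. hom PC v W A \<and> i \<diamondop> v = w" v], rule 1, erule 2)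
qed

lemma PE_coker:
  assumes "hom PC i A B" "hom PC p B T" "is_coker (fst A) i (fst B) p (fst T)"
  shows "P.is_coker A i B p T"
  unfolding P.is_coker_def
proof (intro conjI allI impI)
  show "hom PC i A B" "hom PC p B T" "Cmp PC p i = Zer PC A T"
    using assms(1,2) coker_hom[OF assms(3)] by simp_all
  fix W w assume w: "hom PC w B W" "Cmp PC w i = Zer PC A W"
  note H = PC_hom_C[OF assms(1)] PC_hom_C[OF assms(2)] PC_hom_C[OF w(1)]
  have ob: "T \<in> Ob PC" "W \<in> Ob PC" "B \<in> Ob PC" using assms w by (auto simp: PC_hom)
  obtain v where v: "hom C v (fst T) (fst W)" "v \<diamondop> p = w"
    using coker_lift[OF assms(3) H(3)] w(2) unfolding PC_sel by blast
  have "conj_mor T W v \<diamondop> p = conj_mor B W w" using conj_cmp_right[OF ob(2) v(1) assms(2)] v by simp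
  also have "\<dots> = v \<diamondop> p" using conj_fixed_iff[OF ob(3) ob(2) H(3)] w v by simp
  finally have "conj_mor T W v = v"
    using coker_epi[OF assms(3) conj_hom[OF ob(1,2) v(1)] v(1)] by simp
  then have 1: "hom PC v T W \<and> v \<diamondop> p = w" using conj_fixed_iff[OF ob(1,2) v(1)] v(2) by blast
  have 2: "v' = v" if "hom PC v' T W \<and> v' \<diamondop> p = w" for v'
    using coker_epi[OF assms(3) PC_hom_C[OF conjunct1[OF that]] v(1)] that v by simp
  show "\<exists>!v. hom PC v T W \<and> Cmp PC v p = w" unfolding PC_sel by (rule ex1I[of "\<lambda>v. hom PC v T W \<and> v \<diamondop> p = w" v], rule 1, erule 2)
qed

text \<open>The free equivariant object on \<open>X\<close>, on any biproduct of \<open>X\<close> and \<open>\<psi>X\<close>.\<close>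

definition is_free :: "'o \<times> 'm \<Rightarrow> 'o \<Rightarrow> 'm \<Rightarrow> 'm \<Rightarrow> 'm \<Rightarrow> 'm \<Rightarrow> bool" where
  "is_free A X i j p q \<longleftrightarrow> X \<in> Ob C \<and> is_biproduct (fst A) X (po X) i j p q \<and>
     snd A = (i \<diamondop> pm q) \<boxplus> (j \<diamondop> pm p)"

lemma is_free_hom:
  assumes "is_free A X i j p q"
  shows "X \<in> Ob C" "hom C i X (fst A)" "hom C j (po X) (fst A)" "hom C p (fst A) X"
    "hom C q (fst A) (po X)" "hom C (pm i) (po X) (po (fst A))" "hom C (pm j) X (po (fst A))"
    "hom C (pm p) (po (fst A)) (po X)" "hom C (pm q) (po (fst A)) X"
    "hom C (snd A) (po (fst A)) (fst A)"
proof -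
  show X: "X \<in> Ob C" and h: "hom C i X (fst A)" "hom C j (po X) (fst A)" "hom C p (fst A) X"
    "hom C q (fst A) (po X)"
    using assms by (auto simp: is_free_def is_biproduct_def)
  show h2: "hom C (pm i) (po X) (po (fst A))" "hom C (pm j) X (po (fst A))"
    "hom C (pm p) (po (fst A)) (po X)" "hom C (pm q) (po (fst A)) X"
    using h[THEN pm_hom] po_po[OF X] by simp_all
  show "hom C (snd A) (po (fst A)) (fst A)"
    using assms add_hom[OF cmp_hom[OF h2(4) h(1)] cmp_hom[OF h2(3) h(2)]] by (simp add: is_free_def)
qed

lemma is_free_swap:
  assumes "is_free A X i j p q"
  shows "snd A \<diamondop> pm i = j" "snd A \<diamondop> pm j = i" "p \<diamondop> snd A = pm q" "q \<diamondop> snd A = pm p"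
    "A \<in> Ob PC"
proof -
  note H = is_free_hom[OF assms]
  have B: "is_biproduct (fst A) X (po X) i j p q"
    and s: "snd A = (i \<diamondop> pm q) \<boxplus> (j \<diamondop> pm p)" using assms by (auto simp: is_free_def)
  have b: "p \<diamondop> i = Idt C X" "q \<diamondop> j = Idt C (po X)" "p \<diamondop> j = Zer C (po X) X"
    "q \<diamondop> i = Zer C X (po X)" "(i \<diamondop> p) \<boxplus> (j \<diamondop> q) = Idt C (fst A)"
    using B by (auto simp: is_biproduct_def)
  have b': "pm p \<diamondop> pm i = Idt C (po X)" "pm q \<diamondop> pm j = Idt C X" "pm p \<diamondop> pm j = Zer C X (po X)"
    "pm q \<diamondop> pm i = Zer C (po X) X"
    using pm_cmp[OF H(2) H(4)] pm_cmp[OF H(3) H(5)] pm_cmp[OF H(3) H(4)] pm_cmp[OF H(2) H(5)] b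
      pm_idt[OF H(1)] pm_idt[OF po_ob[OF H(1)]] po_po[OF H(1)] pm_zer[OF H(1) po_ob[OF H(1)]]
      pm_zer[OF po_ob[OF H(1)] H(1)] by simp_all
  note c = cmp_hom[OF H(9) H(2)] cmp_hom[OF H(8) H(3)]
  show i: "snd A \<diamondop> pm i = j"
    unfolding s using add_cmp[OF H(6) c] cmp_assoc[OF H(6) H(9) H(2)] cmp_assoc[OF H(6) H(8) H(3)] b'
      cmp_zer[OF H(2)] po_ob[OF H(1)] idt_right[OF H(3)] zer_add[OF H(3)] by simp
  show j: "snd A \<diamondop> pm j = i"
    unfolding s using add_cmp[OF H(7) c] cmp_assoc[OF H(7) H(9) H(2)] cmp_assoc[OF H(7) H(8) H(3)] b'
      cmp_zer[OF H(3)] H(1) idt_right[OF H(2)] add_zer[OF H(2)] by simp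
  show "p \<diamondop> snd A = pm q" "q \<diamondop> snd A = pm p"
    unfolding s using biproduct_proj[OF B H(9) H(8)] by simp_all
  have fA: "fst A \<in> Ob C" using H(2) hom_ob by blast
  have "pm (snd A) = (pm i \<diamondop> q) \<boxplus> (pm j \<diamondop> p)"
    unfolding s using pm_add[OF c] pm_cmp[OF H(9) H(2)] pm_cmp[OF H(8) H(3)] pm_pm[OF H(4)] pm_pm[OF H(5)]
    by simp
  then have "snd A \<diamondop> pm (snd A) = (j \<diamondop> q) \<boxplus> (i \<diamondop> p)"
    using cmp_add[OF cmp_hom[OF H(5) H(6)] cmp_hom[OF H(4) H(7)] H(10)]
      cmp_assoc[OF H(5) H(6) H(10)] cmp_assoc[OF H(4) H(7) H(10)] i j by simp
  also have "\<dots> = Idt C (fst A)" using b(5) add_comm[OF cmp_hom[OF H(4) H(2)] cmp_hom[OF H(5) H(3)]] by simp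
  finally show "A \<in> Ob PC" using PC_obI[OF fA H(10)] by simp
qed

lemma is_free_ex:
  assumes "X \<in> Ob C"
  obtains A i j p q where "is_free A X i j p q"
proof -
  obtain P i j p q where "is_biproduct P X (po X) i j p q"
    using biproduct_ex[OF assms po_ob[OF assms]] by blast
  then show ?thesis using that[of "(P, (i \<diamondop> pm q) \<boxplus> (j \<diamondop> pm p))" i j p q] assms
    by (simp add: is_free_def)
qed

lemma is_free_proj: "is_free A X i j p q \<Longrightarrow> proj X \<Longrightarrow> proj (fst A)"
  unfolding is_free_def by (elim conjE) (rule proj_biproduct[OF _ _ po_proj])

text \<open>Adjunction: an equivariant morphism out of, or into, a free object is determined by one
  component.\<close>

lemma is_free_from:
  assumes A: "is_free A X i j p q" and B: "B \<in> Ob PC" and f: "hom C f X (fst B)"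
  shows "hom PC ((f \<diamondop> p) \<boxplus> ((snd B \<diamondop> pm f) \<diamondop> q)) A B"
    "((f \<diamondop> p) \<boxplus> ((snd B \<diamondop> pm f) \<diamondop> q)) \<diamondop> i = f"
proof -
  note H = is_free_hom[OF A] note sw = is_free_swap[OF A] note y = PC_ob[OF B]
  note pf = pm_hom[OF f] note g = cmp_hom[OF pf y(2)]
  note c = cmp_hom[OF H(4) f] cmp_hom[OF H(5) g]
  let ?F = "(f \<diamondop> p) \<boxplus> ((snd B \<diamondop> pm f) \<diamondop> q)"
  show "?F \<diamondop> i = f" using biproduct_inj(1)[OF A[unfolded is_free_def, THEN conjunct2, THEN conjunct1] f g] .
  have pq: "snd B \<diamondop> pm (snd B \<diamondop> pm f) = f"
    using pm_cmp[OF pf y(2)] pm_pm[OF f] cmp_assoc[OF f y(3) y(2)] y(4) idt_left[OF f] by simp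
  have "?F \<diamondop> snd A = (f \<diamondop> pm q) \<boxplus> ((snd B \<diamondop> pm f) \<diamondop> pm p)"
    using add_cmp[OF H(10) c] cmp_assoc[OF H(10) H(4) f] cmp_assoc[OF H(10) H(5) g] sw by simp
  moreover have "snd B \<diamondop> pm ?F = (snd B \<diamondop> (pm f \<diamondop> pm p)) \<boxplus> (snd B \<diamondop> (pm (snd B \<diamondop> pm f) \<diamondop> pm q))"
    using pm_add[OF c] pm_cmp[OF H(4) f] pm_cmp[OF H(5) g]
      cmp_add[OF pm_hom[OF c(1)] pm_hom[OF c(2)] y(2)] by simp
  moreover have pg: "hom C (pm (snd B \<diamondop> pm f)) X (po (fst B))"
    using pm_hom[OF g] po_po[OF H(1)] by simp
  have "snd B \<diamondop> (pm f \<diamondop> pm p) = (snd B \<diamondop> pm f) \<diamondop> pm p"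
    "snd B \<diamondop> (pm (snd B \<diamondop> pm f) \<diamondop> pm q) = f \<diamondop> pm q"
    using cmp_assoc[OF H(8) pf y(2)] cmp_assoc[OF H(9) pg y(2)] pq by simp_all
  ultimately have "?F \<diamondop> snd A = snd B \<diamondop> pm ?F"
    using add_comm[OF cmp_hom[OF H(8) g] cmp_hom[OF H(9) f]] by simp
  then show "hom PC ?F A B" using sw B add_hom[OF c] by (simp add: PC_hom)
qed

lemma is_free_to:
  assumes A: "is_free A X i j p q" and B: "B \<in> Ob PC" and f: "hom C f (fst B) X"
  shows "hom PC ((i \<diamondop> f) \<boxplus> (j \<diamondop> (pm f \<diamondop> pm (snd B)))) B A"
    "p \<diamondop> ((i \<diamondop> f) \<boxplus> (j \<diamondop> (pm f \<diamondop> pm (snd B)))) = f"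
proof -
  note H = is_free_hom[OF A] note sw = is_free_swap[OF A] note y = PC_ob[OF B]
  note pf = pm_hom[OF f] note g = cmp_hom[OF y(3) pf]
  note c = cmp_hom[OF f H(2)] cmp_hom[OF g H(3)]
  let ?F = "(i \<diamondop> f) \<boxplus> (j \<diamondop> (pm f \<diamondop> pm (snd B)))"
  show "p \<diamondop> ?F = f" using biproduct_proj(1)[OF A[unfolded is_free_def, THEN conjunct2, THEN conjunct1] f g] .
  have 1: "(pm f \<diamondop> pm (snd B)) \<diamondop> snd B = pm f"
    using cmp_assoc[OF y(2) y(3) pf] y(5) idt_right[OF pf] by simp
  have 2: "pm (pm f \<diamondop> pm (snd B)) = f \<diamondop> snd B"
    using pm_cmp[OF y(3) pf] pm_pm[OF f] pm_pm[OF y(2)] by simp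
  have fB: "hom C (f \<diamondop> snd B) (po (fst B)) X" using cmp_hom[OF y(2) f] .
  have "?F \<diamondop> snd B = (i \<diamondop> (f \<diamondop> snd B)) \<boxplus> (j \<diamondop> pm f)"
    using add_cmp[OF y(2) c] cmp_assoc[OF y(2) f H(2)] cmp_assoc[OF y(2) g H(3)] 1 by simp
  moreover have "snd A \<diamondop> pm ?F = (snd A \<diamondop> (pm i \<diamondop> pm f)) \<boxplus> (snd A \<diamondop> (pm j \<diamondop> (f \<diamondop> snd B)))"
    using pm_add[OF c] pm_cmp[OF f H(2)] pm_cmp[OF g H(3)] 2
      cmp_add[OF pm_hom[OF c(1)] pm_hom[OF c(2)] H(10)] by simp
  moreover have "snd A \<diamondop> (pm i \<diamondop> pm f) = j \<diamondop> pm f" "snd A \<diamondop> (pm j \<diamondop> (f \<diamondop> snd B)) = i \<diamondop> (f \<diamondop> snd B)"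
    using cmp_assoc[OF pf H(6) H(10)] cmp_assoc[OF fB H(7) H(10)] sw by simp_all
  ultimately have "?F \<diamondop> snd B = snd A \<diamondop> pm ?F"
    using add_comm[OF cmp_hom[OF fB H(2)] cmp_hom[OF pf H(3)]] by simp
  then show "hom PC ?F B A" using sw B add_hom[OF c] by (simp add: PC_hom)
qed

end

section \<open>Exact sequences, projectives and extensions of equivariant objects\<close>

context frobenius_involution
begin

text \<open>Equivariance of p makes the structure map of B restrict to the kernel, and k being a
  monomorphism makes the restriction an involution again.\<close>

lemma PE_of_defl:
  assumes p: "hom PC p B T" and d: "defl (fst B) (fst T) p"
  obtains A i where "PE A i B p T"
proof -
  obtain K k where E: "E K k (fst B) p (fst T)" using d by (auto simp: deflation_def)
  have ob: "B \<in> Ob PC" "T \<in> Ob PC" using p by (auto simp: PC_hom)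
  note y = PC_ob[OF ob(1)] note z = PC_ob[OF ob(2)]
  note ker = conf_ker[OF E] note H = ker_hom[OF ker]
  have K: "K \<in> Ob C" using H hom_ob by blast
  note pk = pm_hom[OF H(1)] note pp = pm_hom[OF H(2)]
  have "p \<diamondop> (snd B \<diamondop> pm k) = snd T \<diamondop> pm (p \<diamondop> k)"
    using cmp_assoc[OF pk y(2) H(2)] cmp_assoc[OF pk pp z(2)] pm_cmp[OF H(1) H(2)] p
    by (simp add: PC_hom)
  also have "\<dots> = Zer C (po K) (fst T)"
    using H(3) pm_zer[OF K z(1)] cmp_zer[OF z(2) po_ob[OF K]] by simp
  finally obtain x where x: "hom C x (po K) K" "k \<diamondop> x = snd B \<diamondop> pm k"
    using ker_lift[OF ker cmp_hom[OF pk y(2)]] by blast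
  have px: "hom C (pm x) K (po K)" using pm_hom[OF x(1)] po_po[OF K] by simp
  have "k \<diamondop> (x \<diamondop> pm x) = snd B \<diamondop> pm (k \<diamondop> x)"
    using cmp_assoc[OF px x(1) H(1)] x(2) cmp_assoc[OF px pk y(2)] pm_cmp[OF x(1) H(1)] by simp
  also have "\<dots> = snd B \<diamondop> (pm (snd B) \<diamondop> k)" using x(2) pm_cmp[OF pk y(2)] pm_pm[OF H(1)] by simp
  also have "\<dots> = k \<diamondop> Idt C K"
    using cmp_assoc[OF H(1) y(3) y(2)] y(4) idt_left[OF H(1)] idt_right[OF H(1)] by simp
  finally have "x \<diamondop> pm x = Idt C K"
    using ker_mono[OF ker cmp_hom[OF px x(1)] idt_hom[OF K]] by simp
  then have "(K, x) \<in> Ob PC" using PC_obI K x(1) by blast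
  then have "PE (K, x) k B p T" using ob H x p E by (simp add: PE_E PC_hom)
  then show ?thesis by (rule that)
qed

lemma PE_of_infl:
  assumes i: "hom PC i A B" and d: "infl (fst A) (fst B) i"
  obtains p T where "PE A i B p T"
proof -
  obtain T p where E: "E (fst A) i (fst B) p T" using d by (auto simp: inflation_def)
  have ob: "A \<in> Ob PC" "B \<in> Ob PC" using i by (auto simp: PC_hom)
  note y = PC_ob[OF ob(1)] note z = PC_ob[OF ob(2)]
  note cok = conf_coker[OF E] note H = coker_hom[OF cok]
  have T: "T \<in> Ob C" using H hom_ob by blast
  note pi = pm_hom[OF H(1)] note pp = pm_hom[OF H(2)]
  have ip: "pm (snd B) \<diamondop> i = pm i \<diamondop> pm (snd A)"
  proof -
    have "pm (i \<diamondop> snd A) = pm (snd B) \<diamondop> i"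
      using i pm_cmp[OF pi z(2)] pm_pm[OF H(1)] by (simp add: PC_hom)
    then show ?thesis using pm_cmp[OF y(2) H(1)] by simp
  qed
  have "(pm p \<diamondop> pm (snd B)) \<diamondop> i = pm (p \<diamondop> i) \<diamondop> pm (snd A)"
    using cmp_assoc[OF H(1) z(3) pp] ip cmp_assoc[OF y(3) pi pp] pm_cmp[OF H(1) H(2)] by simp
  also have "\<dots> = Zer C (fst A) (po T)"
    using H(3) pm_zer[OF y(1) T] zer_cmp[OF y(3) po_ob[OF T]] by simp
  \<comment> \<open>A cokernel yields maps out of T, so v is the inverse of the structure map
    wanted; \<open>pm v\<close> points in the right direction.\<close>
  finally obtain v where v: "hom C v T (po T)" "v \<diamondop> p = pm p \<diamondop> pm (snd B)"
    using coker_lift[OF cok cmp_hom[OF z(3) pp]] by blast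
  have x: "hom C (pm v) (po T) T" using pm_hom[OF v(1)] po_po[OF T] by simp
  have e: "pm v \<diamondop> pm p = p \<diamondop> snd B"
    using pm_cmp[OF H(2) v(1)] v(2) pm_cmp[OF z(3) pp] pm_pm[OF H(2)] pm_pm[OF z(2)] by simp
  have "(pm v \<diamondop> v) \<diamondop> p = Idt C T \<diamondop> p"
    using cmp_assoc[OF H(2) v(1) x] v(2) cmp_assoc[OF z(3) pp x] e cmp_assoc[OF z(3) z(2) H(2)] z(4)
      idt_right[OF H(2)] idt_left[OF H(2)] by simp
  then have "pm v \<diamondop> v = Idt C T"
    using coker_epi[OF cok cmp_hom[OF v(1) x] idt_hom[OF T]] by simp
  then have "(T, pm v) \<in> Ob PC" using PC_obI[OF T x] pm_pm[OF v(1)] by simp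
  then have "PE A i B p (T, pm v)" using ob H e i E by (simp add: PE_E PC_hom)
  then show ?thesis by (rule that)
qed

text \<open>A projective cover of the underlying object extends to the free equivariant object on
  its source. The extension is still a deflation by \<open>defl_sum\<close>, and its source stays
  projective because the involution preserves projectives.\<close>

lemma PE_cover:
  assumes "A \<in> Ob PC"
  obtains K k Q q where "PE K k Q q A" "proj (fst Q)"
proof -
  obtain K0 k0 Q0 q0 where Q0: "proj Q0" "E K0 k0 Q0 q0 (fst A)"
    using proj_cover PC_ob(1)[OF assms] by blast
  note q0 = ker_hom(2)[OF conf_ker[OF Q0(2)]]
  obtain S i j p q where S: "is_free S Q0 i j p q" using is_free_ex hom_ob(1)[OF q0] by blast
  have b: "is_biproduct (fst S) Q0 (po Q0) i j p q" using S by (simp add: is_free_def)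
  have d: "defl (fst S) (fst A) ((q0 \<diamondop> p) \<boxplus> ((snd A \<diamondop> pm q0) \<diamondop> q))"
    by (rule defl_sum[OF b conf_defl[OF Q0(2)] po_proj[OF Q0(1)] q0
          cmp_hom[OF pm_hom[OF q0] PC_ob(2)[OF assms]]])
  obtain K k where "PE K k S ((q0 \<diamondop> p) \<boxplus> ((snd A \<diamondop> pm q0) \<diamondop> q)) A"
    using PE_of_defl[OF is_free_from(1)[OF S assms q0] d] .
  then show ?thesis using is_free_proj[OF S Q0(1)] by (rule that)
qed

lemma PE_hull:
  assumes "A \<in> Ob PC"
  obtains i I p T where "PE A i I p T" "proj (fst I)"
proof -
  obtain i0 I0 p0 T0 where I0: "proj I0" "E (fst A) i0 I0 p0 T0"
    using inj_hull PC_ob(1)[OF assms] by blast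
  note i0 = ker_hom(1)[OF conf_ker[OF I0(2)]]
  obtain S i j p q where S: "is_free S I0 i j p q" using is_free_ex hom_ob(2)[OF i0] by blast
  have b: "is_biproduct (fst S) I0 (po I0) i j p q" using S by (simp add: is_free_def)
  have d: "infl (fst A) (fst S) ((i \<diamondop> i0) \<boxplus> (j \<diamondop> (pm i0 \<diamondop> pm (snd A))))"
    by (rule infl_sum[OF b conf_infl[OF I0(2)] po_proj[OF I0(1)] i0
          cmp_hom[OF PC_ob(3)[OF assms] pm_hom[OF i0]]])
  obtain r T where "PE A ((i \<diamondop> i0) \<boxplus> (j \<diamondop> (pm i0 \<diamondop> pm (snd A)))) S r T"
    using PE_of_infl[OF is_free_to(1)[OF S assms i0] d] .
  then show ?thesis using is_free_proj[OF S I0(1)] by (rule that)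
qed

lemma PE_D:
  assumes "PE A i B p T"
  shows "hom PC i A B" "hom PC p B T" "E (fst A) i (fst B) p (fst T)"
    "P.is_ker A i B p T" "P.is_coker A i B p T" "A \<in> Ob PC" "B \<in> Ob PC" "T \<in> Ob PC"
proof -
  show 1: "hom PC i A B" and 2: "hom PC p B T" and E: "E (fst A) i (fst B) p (fst T)"
    using assms by (auto simp: PE_E)
  show "A \<in> Ob PC" "B \<in> Ob PC" "T \<in> Ob PC" using 1 2 by (auto simp: PC_hom)
  show "P.is_ker A i B p T" using PE_ker[OF 1 2 conf_ker[OF E]] .
  show "P.is_coker A i B p T" using PE_coker[OF 1 2 conf_coker[OF E]] .
qed

lemma PE_lift:
  assumes "proj (fst P)" "P \<in> Ob PC" "PE A i B p T" "hom PC f P T"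
  shows "\<exists>g. hom PC g P B \<and> p \<diamondop> g = f"
proof -
  note D = PE_D[OF assms(3)]
  obtain g where "hom C g (fst P) (fst B)" "p \<diamondop> g = f"
    using proj_lift[OF assms(1) conf_defl[OF D(3)] PC_hom_C[OF assms(4)]] by blast
  then show ?thesis using average_lift[OF assms(2) _ D(2) assms(4)] by blast
qed

lemma PE_extend:
  assumes "proj (fst I)" "I \<in> Ob PC" "PE A i B p T" "hom PC f A I"
  shows "\<exists>g. hom PC g B I \<and> g \<diamondop> i = f"
proof -
  note D = PE_D[OF assms(3)]
  obtain g where "hom C g (fst B) (fst I)" "g \<diamondop> i = f"
    using inj_extend[OF assms(1) conf_infl[OF D(3)] PC_hom_C[OF assms(4)]] by blast
  then show ?thesis using average_extend[OF assms(2) _ D(1) assms(4)] by blast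
qed

text \<open>An equivariant projective splits off from its cover by \<open>PE_cover\<close>, whose
  underlying object is projective. Conversely, a plain lift can be averaged.\<close>

lemma PC_proj_iff: "projective_obj PC PE P \<longleftrightarrow> P \<in> Ob PC \<and> proj (fst P)"
proof
  assume P: "projective_obj PC PE P"
  then have ob: "P \<in> Ob PC" by (simp add: projective_obj_def)
  obtain K k Q q where Q: "PE K k Q q P" "proj (fst Q)" using PE_cover[OF ob] .
  note D = PE_D[OF Q(1)]
  have "Idt PC P \<in> Mor PC P P" using P.idt_hom[OF ob] by (simp only: hom_def)
  then obtain s where s: "s \<in> Mor PC P Q" "q \<diamondop> s = Idt C (fst P)"
    using P Q(1) unfolding projective_obj_def PC_sel by blast
  then have "hom C s (fst P) (fst Q)" using ob D(7) PC_hom_C unfolding hom_def[of PC] by blast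
  then show "P \<in> Ob PC \<and> proj (fst P)"
    using proj_retract[OF Q(2) _ PC_hom_C[OF D(2)]] s(2) ob by blast
next
  assume P: "P \<in> Ob PC \<and> proj (fst P)"
  show "projective_obj PC PE P"
    unfolding projective_obj_def
  proof (intro conjI allI impI ballI)
    show "P \<in> Ob PC" using P by blast
    fix A i B p T f assume E: "PE A i B p T" and f: "f \<in> Mor PC P T"
    have "hom PC f P T" using f P PE_D(8)[OF E] unfolding hom_def by blast
    then show "\<exists>g\<in>Mor PC P B. Cmp PC p g = f"
      using PE_lift[OF conjunct2[OF P] conjunct1[OF P] E] unfolding PC_sel hom_def[of PC] by blast
  qed
qed

lemma PC_inj_iff: "injective_obj PC PE I \<longleftrightarrow> I \<in> Ob PC \<and> proj (fst I)"
proof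
  assume I: "injective_obj PC PE I"
  then have ob: "I \<in> Ob PC" by (simp add: injective_obj_def)
  obtain i J p T where J: "PE I i J p T" "proj (fst J)" using PE_hull[OF ob] .
  note D = PE_D[OF J(1)]
  have "Idt PC I \<in> Mor PC I I" using P.idt_hom[OF ob] by (simp only: hom_def)
  then obtain r where r: "r \<in> Mor PC J I" "r \<diamondop> i = Idt C (fst I)"
    using I J(1) unfolding injective_obj_def PC_sel by blast
  then have "hom C r (fst J) (fst I)" using ob D(7) PC_hom_C unfolding hom_def[of PC] by blast
  then show "I \<in> Ob PC \<and> proj (fst I)"
    using proj_retract[OF J(2) PC_hom_C[OF D(1)]] r(2) ob by blast
next
  assume I: "I \<in> Ob PC \<and> proj (fst I)"
  show "injective_obj PC PE I"
    unfolding injective_obj_def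
  proof (intro conjI allI impI ballI)
    show "I \<in> Ob PC" using I by blast
    fix A i B p T f assume E: "PE A i B p T" and f: "f \<in> Mor PC A I"
    have "hom PC f A I" using f I PE_D(6)[OF E] unfolding hom_def by blast
    then show "\<exists>g\<in>Mor PC B I. Cmp PC g i = f"
      using PE_extend[OF conjunct2[OF I] conjunct1[OF I] E] unfolding PC_sel hom_def[of PC] by blast
  qed
qed

lemma stably_null_iff:
  assumes "A \<in> Ob PC" "T \<in> Ob PC"
  shows "f \<in> stably_null PC PE A T \<longleftrightarrow>
    (\<exists>h g P. P \<in> Ob PC \<and> proj (fst P) \<and> hom PC g A P \<and> hom PC h P T \<and> f = h \<diamondop> g)"
  unfolding stably_null_def PC_proj_iff PC_inj_iff PC_sel hom_def[of PC] using assms by blast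

text \<open>The conflation behind the choice made by \<open>shift_obj\<close> is obtained, not
  given. Maps from projectives lift along its deflation, so a map into its end term is stably null
  iff it factors through the middle term.\<close>

lemma Ext1_vanishes_lifting:
  assumes A: "A \<in> Ob PC" and B: "B \<in> Ob PC"
  obtains i I p T where "PE B i I p T" "proj (fst I)"
    "Ext1_vanishes PC PE A B \<longleftrightarrow>
      (\<forall>f. hom PC f A T \<longrightarrow> (\<exists>s. hom PC s A I \<and> p \<diamondop> s = f))"
proof -
  define T where "T = shift_obj PC PE B"
  obtain i0 I0 p0 T0 where "PE B i0 I0 p0 T0" "proj (fst I0)" using PE_hull[OF B] .
  then have "\<exists>T i I p. injective_obj PC PE I \<and> PE B i I p T"
    using PC_inj_iff[of I0] PE_D(7) by blast
  then have "\<exists>i I p. injective_obj PC PE I \<and> PE B i I p T"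
    unfolding T_def shift_obj_def by (rule someI_ex)
  then obtain i I p where I: "injective_obj PC PE I" and E: "PE B i I p T" by blast
  have I: "I \<in> Ob PC" "proj (fst I)" using I PC_inj_iff by blast+
  note D = PE_D[OF E]
  let ?N = "stably_null PC PE A T"
  have N: "f \<in> ?N \<longleftrightarrow> (\<exists>s. hom PC s A I \<and> p \<diamondop> s = f)" for f
  proof
    assume "f \<in> ?N"
    then obtain h g Q where Q: "Q \<in> Ob PC" "proj (fst Q)" "hom PC g A Q" "hom PC h Q T" "f = h \<diamondop> g"
      using stably_null_iff[OF A D(8)] by blast
    obtain l where l: "hom PC l Q I" "p \<diamondop> l = h" using PE_lift[OF Q(2,1) E Q(4)] by blast
    have "p \<diamondop> (l \<diamondop> g) = f" using P.cmp_assoc[OF Q(3) l(1) D(2)] l(2) Q(5) by simp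
    then show "\<exists>s. hom PC s A I \<and> p \<diamondop> s = f" using P.cmp_hom[OF Q(3) l(1)] by auto
  next
    assume "\<exists>s. hom PC s A I \<and> p \<diamondop> s = f"
    then obtain s where "hom PC s A I" "f = p \<diamondop> s" by blast
    then show "f \<in> ?N" unfolding stably_null_iff[OF A D(8)] using I D(2) by blast
  qed
  have N0: "n \<in> ?N \<Longrightarrow> hom PC n A T" for n
  proof -
    assume "n \<in> ?N"
    then obtain s where "hom PC s A I" "n = p \<diamondop> s" using N[of n] by blast
    then show "hom PC n A T" using P.cmp_hom[OF _ D(2), of s A] by simp
  qed
  have Z: "hom PC (Zer PC A T) A T" using P.zer_hom[OF A D(8)] .
  have cl: "stable_class PC PE A T f = {f \<boxplus> n | n. n \<in> ?N}" for f
    by (simp add: stable_class_def)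
  have ZN: "Zer PC A T \<in> ?N"
    unfolding N using P.zer_hom[OF A I(1)] P.cmp_zer[OF D(2) A, unfolded PC_sel(1)] by blast
  have "Ext1_vanishes PC PE A B \<longleftrightarrow> (\<forall>f. hom PC f A T \<longrightarrow> f \<in> ?N)"
  proof
    assume "Ext1_vanishes PC PE A B"
    then have *: "stable_class PC PE A T f = stable_class PC PE A T (Zer PC A T)"
      if "f \<in> Mor PC A T" for f
      using that unfolding Ext1_vanishes_def Ext1_def stable_hom_def T_def by blast
    show "\<forall>f. hom PC f A T \<longrightarrow> f \<in> ?N"
    proof (intro allI impI)
      fix f assume f: "hom PC f A T"
      \<comment> \<open>Zero is stably null, so f lies in its own coset; if that coset equals the
        coset of zero, f is stably null.\<close>
      have "f \<boxplus> Zer PC A T \<in> stable_class PC PE A T f" unfolding cl using ZN by blast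
      then have "f \<in> stable_class PC PE A T (Zer PC A T)"
        using P.add_zer[OF f, unfolded PC_sel(2)] *[of f] f by (simp only: hom_def)
      then obtain n where n: "n \<in> ?N" "f = Zer PC A T \<boxplus> n" unfolding cl by blast
      then have "f = n" using P.zer_add[OF N0[OF n(1)]] by simp
      then show "f \<in> ?N" using n by blast
    qed
  next
    assume all: "\<forall>f. hom PC f A T \<longrightarrow> f \<in> ?N"
    have "stable_class PC PE A T f = ?N" if f: "hom PC f A T" for f
    proof
      show "stable_class PC PE A T f \<subseteq> ?N"
        unfolding cl using all P.add_hom[OF f N0, unfolded PC_sel] by blast
      show "?N \<subseteq> stable_class PC PE A T f"
      proof
        fix n assume "n \<in> ?N"
        from P.diff_ex[OF N0[OF this] f, unfolded PC_sel]
        obtain d where d: "hom PC d A T" "n = f \<boxplus> d" by blast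
        then show "n \<in> stable_class PC PE A T f" unfolding cl using all by blast
      qed
    qed
    then have "stable_class PC PE A T ` Mor PC A T = {stable_class PC PE A T (Zer PC A T)}"
      using Z A D(8) unfolding hom_def by blast
    then show "Ext1_vanishes PC PE A B"
      by (simp only: Ext1_vanishes_def Ext1_def stable_hom_def T_def)
  qed
  then have "Ext1_vanishes PC PE A B \<longleftrightarrow>
      (\<forall>f. hom PC f A T \<longrightarrow> (\<exists>s. hom PC s A I \<and> p \<diamondop> s = f))"
    using N by simp
  then show ?thesis using that E I by blast
qed

end

context frobenius_involution
begin

lemma is_free_expand:
  assumes S: "is_free A X i j p q" and F: "hom PC F A B"
  shows "F = ((F \<diamondop> i) \<diamondop> p) \<boxplus> ((snd B \<diamondop> pm (F \<diamondop> i)) \<diamondop> q)"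
proof -
  note H = is_free_hom[OF S] note f = PC_hom_C[OF F]
  have ob: "A \<in> Ob PC" "B \<in> Ob PC" using F by (auto simp: PC_hom)
  have b: "(i \<diamondop> p) \<boxplus> (j \<diamondop> q) = Idt C (fst A)"
    using S by (auto simp: is_free_def is_biproduct_def)
  have "F \<diamondop> j = F \<diamondop> (snd A \<diamondop> pm i)" using is_free_swap(1)[OF S] by simp
  also have "\<dots> = snd B \<diamondop> pm F \<diamondop> pm i" using cmp_assoc[OF H(6) H(10) f] F by (simp add: PC_hom)
  also have "\<dots> = snd B \<diamondop> pm (F \<diamondop> i)"
    using cmp_assoc[OF H(6) pm_hom[OF f] PC_ob(2)[OF ob(2)]] pm_cmp[OF H(2) f] by simp
  finally have j: "F \<diamondop> j = snd B \<diamondop> pm (F \<diamondop> i)" .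
  have "F = F \<diamondop> ((i \<diamondop> p) \<boxplus> (j \<diamondop> q))" using b idt_right[OF f] by simp
  also have "\<dots> = ((F \<diamondop> i) \<diamondop> p) \<boxplus> ((F \<diamondop> j) \<diamondop> q)"
    using cmp_add[OF cmp_hom[OF H(4) H(2)] cmp_hom[OF H(5) H(3)] f] cmp_assoc[OF H(4) H(2) f]
      cmp_assoc[OF H(5) H(3) f] by simp
  finally show ?thesis unfolding j .
qed

text \<open>An equivariant map out of a free object is determined by its component on X, and every
  plain map out of X occurs. The equivariant lifting problem over A thus becomes a plain one over X,
  for which the presentation can be used.\<close>

lemma Ext1_vanishes_free:
  assumes S: "is_free A X i j p q" and B: "B \<in> Ob PC" and pres: "presentation X' k P r X"
  shows "Ext1_vanishes PC PE A B \<longleftrightarrow>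
    (\<forall>g. hom C g X' (fst B) \<longrightarrow> (\<exists>h. hom C h P (fst B) \<and> h \<diamondop> k = g))"
proof -
  note A = is_free_swap(5)[OF S] note H = is_free_hom[OF S]
  obtain iB I pT T where E: "PE B iB I pT T" and I: "proj (fst I)"
    and ext: "Ext1_vanishes PC PE A B \<longleftrightarrow>
      (\<forall>f. hom PC f A T \<longrightarrow> (\<exists>s. hom PC s A I \<and> pT \<diamondop> s = f))"
    using Ext1_vanishes_lifting[OF A B] .
  note D = PE_D[OF E] note pT = PC_hom_C[OF D(2)]
  have "(\<forall>f. hom PC f A T \<longrightarrow> (\<exists>s. hom PC s A I \<and> pT \<diamondop> s = f)) \<longleftrightarrow>
        (\<forall>f. hom C f X (fst T) \<longrightarrow> (\<exists>s. hom C s X (fst I) \<and> pT \<diamondop> s = f))" (is "?L \<longleftrightarrow> ?R")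
  proof
    assume L: ?L
    show ?R
    proof (intro allI impI)
      fix f assume f: "hom C f X (fst T)"
      note F = is_free_from[OF S D(8) f]
      obtain s where s: "hom PC s A I" "pT \<diamondop> s = (f \<diamondop> p) \<boxplus> ((snd T \<diamondop> pm f) \<diamondop> q)"
        using L F(1) by blast
      have "pT \<diamondop> (s \<diamondop> i) = f" using cmp_assoc[OF H(2) PC_hom_C[OF s(1)] pT] s(2) F(2) by simp
      then show "\<exists>s. hom C s X (fst I) \<and> pT \<diamondop> s = f"
        using cmp_hom[OF H(2) PC_hom_C[OF s(1)]] by blast
    qed
  next
    assume R: ?R
    show ?L
    proof (intro allI impI)
      fix F assume F: "hom PC F A T"
      obtain s where s: "hom C s X (fst I)" "pT \<diamondop> s = F \<diamondop> i"
        using R cmp_hom[OF H(2) PC_hom_C[OF F]] by blast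
      note G = is_free_from[OF S D(7) s(1)]
      let ?G = "(s \<diamondop> p) \<boxplus> ((snd I \<diamondop> pm s) \<diamondop> q)"
      have e: "(pT \<diamondop> ?G) \<diamondop> i = F \<diamondop> i"
        using cmp_assoc[OF H(2) PC_hom_C[OF G(1)] pT] G(2) s(2) by simp
      have "hom PC (pT \<diamondop> ?G) A T" using P.cmp_hom[OF G(1) D(2)] by simp
      from is_free_expand[OF S this] is_free_expand[OF S F]
      have "pT \<diamondop> ?G = F" unfolding e by (rule trans[OF _ sym])
      then show "\<exists>s. hom PC s A I \<and> pT \<diamondop> s = F" using G(1) by blast
    qed
  qed
  then show ?thesis
    using ext lifting_iff_extension_presentation[OF pres D(3) I] by simp
qed

text \<open>Averaging makes the plain condition sufficient. It fails to be necessary for singular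
  objects of the same sign, which are treated by \<open>Ext1_vanishes_presentation\<close>.\<close>

lemma Ext1_vanishesI:
  assumes A: "A \<in> Ob PC" and B: "B \<in> Ob PC" and pres: "presentation X' k P r (fst A)"
    and ext: "\<forall>g. hom C g X' (fst B) \<longrightarrow> (\<exists>h. hom C h P (fst B) \<and> h \<diamondop> k = g)"
  shows "Ext1_vanishes PC PE A B"
proof -
  obtain iB I pT T where E: "PE B iB I pT T" and I: "proj (fst I)"
    and iff: "Ext1_vanishes PC PE A B \<longleftrightarrow>
      (\<forall>f. hom PC f A T \<longrightarrow> (\<exists>s. hom PC s A I \<and> pT \<diamondop> s = f))"
    using Ext1_vanishes_lifting[OF A B] .
  note D = PE_D[OF E]
  have *: "\<forall>f. hom C f (fst A) (fst T) \<longrightarrow> (\<exists>s. hom C s (fst A) (fst I) \<and> pT \<diamondop> s = f)"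
    using ext lifting_iff_extension_presentation[OF pres D(3) I] by blast
  show ?thesis
    unfolding iff
  proof (intro allI impI)
    fix f assume f: "hom PC f A T"
    obtain s where "hom C s (fst A) (fst I)" "pT \<diamondop> s = f" using * PC_hom_C[OF f] by blast
    then show "\<exists>s. hom PC s A I \<and> pT \<diamondop> s = f" using average_lift[OF A _ D(2) f] by blast
  qed
qed

text \<open>Here only equivariant maps have to be extended, which is where signs become visible. The
  comparison maps with an equivariant cover exist by lifting plainly and averaging.\<close>

lemma Ext1_vanishes_presentation:
  assumes B: "B \<in> Ob PC" and k: "hom PC k X' P" and r: "hom PC r P A"
    and pres: "presentation (fst X') k (fst P) r (fst A)"
  shows "Ext1_vanishes PC PE A B \<longleftrightarrow>
    (\<forall>g. hom PC g X' B \<longrightarrow> (\<exists>h. hom PC h P B \<and> h \<diamondop> k = g))"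
proof -
  have ob: "A \<in> Ob PC" "P \<in> Ob PC" "X' \<in> Ob PC" using k r by (auto simp: PC_hom)
  have pr: "proj (fst P)" and ker: "is_ker (fst X') k (fst P) r (fst A)"
    and fac: "\<And>Q f. proj Q \<Longrightarrow> hom C f Q (fst A) \<Longrightarrow> \<exists>g. hom C g Q (fst P) \<and> r \<diamondop> g = f"
    using pres unfolding presentation_def by blast+
  note kerP = PE_ker[OF k r ker]
  obtain iB I pT T where E: "PE B iB I pT T" and I: "proj (fst I)"
    and iff: "Ext1_vanishes PC PE A B \<longleftrightarrow>
      (\<forall>f. hom PC f A T \<longrightarrow> (\<exists>s. hom PC s A I \<and> pT \<diamondop> s = f))"
    using Ext1_vanishes_lifting[OF ob(1) B] .
  note D = PE_D[OF E]
  obtain K j Q q where Q: "PE K j Q q A" "proj (fst Q)" using PE_cover[OF ob(1)] .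
  note DQ = PE_D[OF Q(1)]
  obtain f0 where "hom C f0 (fst Q) (fst P)" "r \<diamondop> f0 = q" using fac[OF Q(2) PC_hom_C[OF DQ(2)]] by blast
  then obtain f1 where f1: "hom PC f1 Q P" "r \<diamondop> f1 = q"
    using average_lift[OF DQ(7) _ r DQ(2)] by blast
  obtain f2 where f2: "hom PC f2 P Q" "q \<diamondop> f2 = r" using PE_lift[OF pr ob(2) Q(1) r] by blast
  have "(\<forall>f. hom PC f A T \<longrightarrow> (\<exists>s. hom PC s A I \<and> pT \<diamondop> s = f)) \<longleftrightarrow>
        (\<forall>g. hom PC g K B \<longrightarrow> (\<exists>h. hom PC h Q B \<and> h \<diamondop> j = g))"
    by (rule P.lifting_iff_extension[OF DQ(4,5) D(4,5), unfolded PC_sel,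
          OF PE_extend[OF I D(7) Q(1)] PE_lift[OF Q(2) DQ(7) E]])
  also have "\<dots> \<longleftrightarrow> (\<forall>g. hom PC g X' B \<longrightarrow> (\<exists>h. hom PC h P B \<and> h \<diamondop> k = g))"
    using P.extension_transfer[OF kerP DQ(4), unfolded PC_sel, OF f1 f2]
      P.extension_transfer[OF DQ(4) kerP, unfolded PC_sel, OF f2 f1] by (intro iffI allI impI)
  finally show ?thesis using iff by simp
qed

text \<open>Only the composite on A is unpacked; its matrix entries modulo u will identify a common
  summand.\<close>

lemma stably_isomorphicD:
  assumes iso: "stably_isomorphic PC PE A B" and A: "A \<in> Ob PC" and B: "B \<in> Ob PC"
  obtains f g h s Q where "hom PC f A B" "hom PC g B A" "proj (fst Q)" "hom PC s A Q" "hom PC h Q A"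
    "g \<diamondop> f = Idt C (fst A) \<boxplus> (h \<diamondop> s)"
proof -
  obtain f g where f: "f \<in> Mor PC A B" and g: "g \<in> Mor PC B A"
    and e: "stable_class PC PE A A (g \<diamondop> f) = stable_class PC PE A A (Idt C (fst A))"
    using iso unfolding stably_isomorphic_def PC_sel by blast
  have f: "hom PC f A B" and g: "hom PC g B A" using f g A B by (simp_all add: hom_def)
  have gf: "hom PC (g \<diamondop> f) A A" using P.cmp_hom[OF f g] by simp
  obtain K k Q q where Q: "PE K k Q q A" "proj (fst Q)" using PE_cover[OF A] .
  note D = PE_D[OF Q(1)]
  have "Zer PC A A \<in> stably_null PC PE A A"
    unfolding stably_null_iff[OF A A]
    using Q(2) D(2,7) P.zer_hom[OF A D(7)] P.cmp_zer[OF D(2) A, symmetric] unfolding PC_sel by blast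
  then have "(g \<diamondop> f) \<boxplus> Zer PC A A \<in> stable_class PC PE A A (g \<diamondop> f)"
    unfolding stable_class_def PC_sel by blast
  then have "g \<diamondop> f \<in> stable_class PC PE A A (Idt C (fst A))"
    using P.add_zer[OF gf] e unfolding PC_sel by simp
  then obtain n where n: "n \<in> stably_null PC PE A A" "g \<diamondop> f = Idt C (fst A) \<boxplus> n"
    unfolding stable_class_def PC_sel by blast
  then obtain h s R where "proj (fst R)" "hom PC s A R" "hom PC h R A" "n = h \<diamondop> s"
    using stably_null_iff[OF A A, of n] by blast
  then show ?thesis using that[OF f g] n(2) by blast
qed

lemma stably_isomorphicI:
  assumes "hom PC f A B" "hom PC g B A" "g \<diamondop> f = Idt C (fst A)" "f \<diamondop> g = Idt C (fst B)"
  shows "stably_isomorphic PC PE A B"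
  using assms unfolding stably_isomorphic_def hom_def[of PC] PC_sel by metis

end

section \<open>Orbits and degrees\<close>

lemma opp_opp [simp]: "opp (opp e) = e"
  by (cases e) auto

lemma sigma_inv: "inv_into UNIV sigma (x, y, e) = (y - pi, x - pi, opp e)"
proof (rule inv_f_eq)
  show "inj sigma"
  proof (rule injI)
    fix p q assume "sigma p = sigma q"
    then show "p = q"
      by (cases p; cases q; cases "snd (snd p)"; cases "snd (snd q)") (auto simp: sigma_def)
  qed
qed (simp add: sigma_def)

lemma sigma_pow_eq: "sigma_pow i (x, y, e) =
  (if even i then (x + of_int i * pi, y + of_int i * pi, e)
   else (y + of_int i * pi, x + of_int i * pi, opp e))"
proof -
  have 1: "(sigma ^^ n) (x, y, e) = (if even n then (x + of_nat n * pi, y + of_nat n * pi, e)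
   else (y + of_nat n * pi, x + of_nat n * pi, opp e))" for n
    by (induction n) (auto simp: sigma_def algebra_simps)
  have 2: "(inv_into UNIV sigma ^^ n) (x, y, e) = (if even n then (x - of_nat n * pi, y - of_nat n * pi, e)
   else (y - of_nat n * pi, x - of_nat n * pi, opp e))" for n
    by (induction n) (auto simp: sigma_inv algebra_simps)
  show ?thesis
  proof (cases "0 \<le> i")
    case True
    then have "even (nat i) \<longleftrightarrow> even i" by (simp add: even_nat_iff)
    then show ?thesis using 1[of "nat i"] True by (simp add: sigma_pow_def)
  next
    case False
    then have "even (nat (- i)) \<longleftrightarrow> even i" by (simp add: even_nat_iff)
    then show ?thesis using 2[of "nat (- i)"] False by (simp add: sigma_pow_def)
  qed
qed

lemma sigma_pow_add: "sigma_pow i (sigma_pow j p) = sigma_pow (i + j) p"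
  by (cases p) (auto simp: sigma_pow_eq algebra_simps)

lemma sigma_pow_0 [simp]: "sigma_pow 0 p = p"
  by (cases p) (simp add: sigma_pow_eq)

definition narrow :: "real \<Rightarrow> point \<Rightarrow> bool" where
  "narrow b p \<longleftrightarrow> \<bar>fst p - fst (snd p)\<bar> \<le> b"

lemma narrow_sigma_pow [simp]: "narrow b (sigma_pow i p) \<longleftrightarrow> narrow b p"
  by (cases p) (auto simp: sigma_pow_eq narrow_def abs_minus_commute)

lemma point_le_refl [simp]: "point_le p p"
  by (simp add: point_le_def)

lemma point_le_trans: "point_le p q \<Longrightarrow> point_le q r \<Longrightarrow> point_le p r"
  by (auto simp: point_le_def)

lemma point_le_sigma_pow [simp]: "point_le (sigma_pow i p) (sigma_pow i q) \<longleftrightarrow> point_le p q"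
  by (cases p; cases q) (auto simp: sigma_pow_eq point_le_def)

text \<open>\<open>sigma\<close> exchanges the coordinates before adding pi, so it moves a point up
  exactly because the coordinates differ by at most pi.\<close>

lemma point_le_sigma_pow_mono:
  assumes "narrow pi q" "i \<le> j"
  shows "point_le (sigma_pow i q) (sigma_pow j q)"
proof -
  obtain x y e where q: "q = (x, y, e)" by (cases q)
  have xy: "\<bar>x - y\<bar> \<le> pi" using assms(1) q by (simp add: narrow_def)
  show ?thesis
  proof (cases "i = j")
    case False
    then have "real_of_int i + 1 \<le> real_of_int j" using assms(2) by linarith
    then have "(real_of_int i + 1) * pi \<le> real_of_int j * pi" by (intro mult_right_mono) auto
    then show ?thesis using xy assms(2) by (auto simp: q sigma_pow_eq point_le_def algebra_simps abs_le_iff)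
  qed simp
qed

text \<open>The degree for arbitrary points; \<open>orbit_deg\<close> is its value at the chosen
  representatives of two orbits.\<close>

definition pdeg :: "point \<Rightarrow> point \<Rightarrow> int" where
  "pdeg p q = (LEAST i. point_le p (sigma_pow i q))"

text \<open>The integers are not well ordered, so a bound is needed before \<open>LEAST\<close>
  means anything: for N large the comparison holds at N and fails at - N, and the minimum can be
  taken over naturals shifted by N. Monotonicity of the shifts gives the rest.\<close>

lemma pdeg_le_iff:
  assumes q: "narrow pi q"
  shows "pdeg p q \<le> i \<longleftrightarrow> point_le p (sigma_pow i q)"
proof -
  obtain x y e where p: "p = (x, y, e)" by (cases p)
  obtain s t f where q': "q = (s, t, f)" by (cases q)
  define R where "R = max \<bar>x\<bar> \<bar>y\<bar> + max \<bar>s\<bar> \<bar>t\<bar>"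
  have R: "0 \<le> R" by (auto simp: R_def)
  obtain N :: nat where N: "R < of_nat N * pi" using reals_Archimedean3[OF pi_gt_zero] by blast
  have hi: "point_le p (sigma_pow (int N) q)"
    using N by (auto simp: p q' sigma_pow_eq point_le_def R_def)
  have lo: "\<not> point_le p (sigma_pow (- int N) q)"
    using N by (auto simp: p q' sigma_pow_eq point_le_def R_def)
  define n where "n = (LEAST n. point_le p (sigma_pow (int n - int N) q))"
  have ex: "point_le p (sigma_pow (int (2 * N) - int N) q)" using hi by simp
  have n: "point_le p (sigma_pow (int n - int N) q)" unfolding n_def
    by (rule LeastI[of "\<lambda>n. point_le p (sigma_pow (int n - int N) q)", OF ex])
  have n': "n \<le> m" if "point_le p (sigma_pow (int m - int N) q)" for m
    unfolding n_def using that by (rule Least_le)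
  have iff: "point_le p (sigma_pow i q) \<longleftrightarrow> int n - int N \<le> i" for i
  proof
    assume a: "point_le p (sigma_pow i q)"
    have "- int N \<le> i"
    proof (rule ccontr)
      assume "\<not> - int N \<le> i"
      then have "i \<le> - int N" by simp
      then show False using lo point_le_trans[OF a point_le_sigma_pow_mono[OF q]] by blast
    qed
    then have "i = int (nat (i + int N)) - int N" by simp
    then have "n \<le> nat (i + int N)" using n'[of "nat (i + int N)"] a by simp
    then show "int n - int N \<le> i" using \<open>- int N \<le> i\<close> by linarith
  next
    assume "int n - int N \<le> i"
    then show "point_le p (sigma_pow i q)" using point_le_trans[OF n point_le_sigma_pow_mono[OF q]] by blast
  qed
  have "pdeg p q = int n - int N"
    unfolding pdeg_def using iff by (intro Least_equality) auto
  then show ?thesis using iff by simp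
qed

lemma pdeg_eqI:
  assumes "narrow pi q" "\<And>i. point_le p (sigma_pow i q) \<longleftrightarrow> d \<le> i"
  shows "pdeg p q = d"
  using pdeg_le_iff[OF assms(1)] assms(2) by (metis order.antisym order.refl)

lemma pdeg_sigma_pow:
  assumes "narrow pi q"
  shows "pdeg (sigma_pow a p) (sigma_pow b q) = pdeg p q + a - b"
proof (rule pdeg_eqI)
  fix i
  have "point_le (sigma_pow a p) (sigma_pow i (sigma_pow b q)) \<longleftrightarrow>
      point_le (sigma_pow a p) (sigma_pow a (sigma_pow (i + b - a) q))"
    by (simp add: sigma_pow_add)
  also have "\<dots> \<longleftrightarrow> pdeg p q \<le> i + b - a" by (simp add: pdeg_le_iff[OF assms])
  finally show "point_le (sigma_pow a p) (sigma_pow i (sigma_pow b q)) \<longleftrightarrow> pdeg p q + a - b \<le> i"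
    by linarith
qed (simp add: assms)

lemma pdeg_triangle:
  assumes "narrow pi q" "narrow pi r"
  shows "pdeg p r \<le> pdeg p q + pdeg q r"
proof -
  have "point_le p (sigma_pow (pdeg p q) q)" using pdeg_le_iff[OF assms(1)] by blast
  moreover have "point_le q (sigma_pow (pdeg q r) r)" using pdeg_le_iff[OF assms(2)] by blast
  then have "point_le (sigma_pow (pdeg p q) q) (sigma_pow (pdeg p q) (sigma_pow (pdeg q r) r))" by simp
  ultimately show ?thesis
    using point_le_trans pdeg_le_iff[OF assms(2)] by (simp add: sigma_pow_add)
qed

lemma pdeg_self: "narrow pi p \<Longrightarrow> pdeg p p = 0"
proof (rule pdeg_eqI)
  fix i assume p: "narrow pi p"
  show "point_le p (sigma_pow i p) \<longleftrightarrow> 0 \<le> i"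
  proof
    assume a: "point_le p (sigma_pow i p)"
    show "0 \<le> i"
    proof (rule ccontr)
      assume "\<not> 0 \<le> i"
      then have "real_of_int i \<le> - 1" by linarith
      then have "real_of_int i * pi \<le> - 1 * pi" by (intro mult_right_mono) auto
      then have "real_of_int i * pi < 0" using pi_gt_zero by linarith
      then show False using a by (cases p) (auto simp: point_le_def sigma_pow_eq split: if_splits)
    qed
  next
    assume "0 \<le> i"
    then show "point_le p (sigma_pow i p)" using point_le_sigma_pow_mono[OF p, of 0 i] by simp
  qed
qed

lemma M_orb_iff: "p \<in> M_orb x y \<longleftrightarrow> (\<exists>i. p = sigma_pow i (x, y, Pos))"
  by (auto simp: M_orb_def orbit_def)

lemma M_orb_self: "(x, y, Pos) \<in> M_orb x y"
  unfolding M_orb_iff by (rule exI[of _ 0]) simp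

lemma range_eqI:
  assumes "\<And>i. \<exists>j. f i = g j" "\<And>j. \<exists>i. g j = f i"
  shows "{f i | i. True} = {g i | i. True}"
  using assms by blast

lemma M_orb_eqI:
  assumes e: "sigma_pow i (x, y, Pos) = (x', y', Pos)"
  shows "M_orb x y = M_orb x' y'"
  unfolding M_orb_def orbit_def
proof (rule range_eqI)
  fix j
  have "sigma_pow j (x, y, Pos) = sigma_pow (j - i) (x', y', Pos)"
    by (simp add: e[symmetric] sigma_pow_add)
  then show "\<exists>k. sigma_pow j (x, y, Pos) = sigma_pow k (x', y', Pos)" by blast
  have "sigma_pow j (x', y', Pos) = sigma_pow (j + i) (x, y, Pos)"
    by (simp add: e[symmetric] sigma_pow_add)
  then show "\<exists>k. sigma_pow j (x', y', Pos) = sigma_pow k (x, y, Pos)" by blast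
qed

lemma orbit_Neg: "orbit (x, y, Neg) = M_orb (y + pi) (x + pi)"
  unfolding M_orb_def orbit_def
proof (rule range_eqI)
  have e: "sigma_pow i (x, y, Neg) = sigma_pow (i - 1) (y + pi, x + pi, Pos)" for i
    by (auto simp: sigma_pow_eq algebra_simps)
  fix i
  show "\<exists>j. sigma_pow i (x, y, Neg) = sigma_pow j (y + pi, x + pi, Pos)" using e by blast
  have "sigma_pow i (y + pi, x + pi, Pos) = sigma_pow (i + 1) (x, y, Neg)"
    using e[of "i + 1"] by simp
  then show "\<exists>j. sigma_pow i (y + pi, x + pi, Pos) = sigma_pow j (x, y, Neg)" by blast
qed

lemma Xset_iff: "X \<in> Xset b \<longleftrightarrow> (\<exists>x y. X = M_orb x y \<and> \<bar>x - y\<bar> \<le> b)"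
proof
  assume "X \<in> Xset b"
  then obtain x y e where X: "X = orbit (x, y, e)" "\<bar>x - y\<bar> \<le> b" by (auto simp: Xset_def)
  show "\<exists>x y. X = M_orb x y \<and> \<bar>x - y\<bar> \<le> b"
  proof (cases e)
    case Neg
    then have "X = M_orb (y + pi) (x + pi)" "\<bar>(y + pi) - (x + pi)\<bar> \<le> b" using X by (simp_all add: orbit_Neg)
    then show ?thesis by blast
  qed (use X in \<open>auto simp: M_orb_def\<close>)
qed (auto simp: Xset_def M_orb_def)

lemma M_orb_in_Xset [simp]: "\<bar>x - y\<bar> \<le> b \<Longrightarrow> M_orb x y \<in> Xset b"
  by (auto simp: Xset_iff)

lemma Xset_memD:
  assumes "X \<in> Xset b" "p \<in> X"
  shows "narrow b p" "q \<in> X \<longleftrightarrow> (\<exists>i. q = sigma_pow i p)"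
proof -
  obtain x y where X: "X = M_orb x y" "\<bar>x - y\<bar> \<le> b" using assms Xset_iff by blast
  obtain i where p: "p = sigma_pow i (x, y, Pos)" using assms X M_orb_iff by blast
  show "narrow b p" unfolding p narrow_sigma_pow using X by (simp add: narrow_def)
  have "sigma_pow j (x, y, Pos) = sigma_pow (j - i) p" for j by (simp add: p sigma_pow_add)
  then show "q \<in> X \<longleftrightarrow> (\<exists>i. q = sigma_pow i p)"
    unfolding X M_orb_iff p sigma_pow_add by (metis diff_add_cancel)
qed

lemma orbit_rep_mem: "X \<in> Xset b \<Longrightarrow> orbit_rep X \<in> X"
  unfolding orbit_rep_def Xset_iff using M_orb_self by (elim exE conjE) (rule someI, simp)

lemma narrow_mono: "narrow b p \<Longrightarrow> b \<le> b' \<Longrightarrow> narrow b' p"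
  by (simp add: narrow_def)

text \<open>Shifting the representatives of X, Y, Z by i, j, k changes the three degrees by i - j, j
  - k and i - k, which cancel; the triangle inequality justifies dropping
  \<open>nat\<close>.\<close>

lemma cexp_int:
  assumes "X \<in> Xset b" "Y \<in> Xset b" "Z \<in> Xset b" "b \<le> pi" "p \<in> X" "q \<in> Y" "r \<in> Z"
  shows "int (cexp X Y Z) = pdeg p q + pdeg q r - pdeg p r"
proof -
  have n: "narrow pi p" "narrow pi q" "narrow pi r"
    using assms Xset_memD(1) narrow_mono by metis+
  obtain i where i: "orbit_rep X = sigma_pow i p" using Xset_memD(2) assms orbit_rep_mem by metis
  obtain j where j: "orbit_rep Y = sigma_pow j q" using Xset_memD(2) assms orbit_rep_mem by metis
  obtain k where k: "orbit_rep Z = sigma_pow k r" using Xset_memD(2) assms orbit_rep_mem by metis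
  have "orbit_deg X Y = pdeg p q + i - j" "orbit_deg Y Z = pdeg q r + j - k"
    "orbit_deg X Z = pdeg p r + i - k"
    unfolding orbit_deg_def i j k pdeg_def[symmetric] using pdeg_sigma_pow n by blast+
  then show ?thesis using pdeg_triangle[OF n(2,3), of p] by (simp add: cexp_def)
qed

text \<open>The exponent is the coboundary of the degree, hence a cocycle. This identity is the
  associativity of composition.\<close>

lemma cexp_cocycle:
  assumes "X \<in> Xset b" "Y \<in> Xset b" "Z \<in> Xset b" "W \<in> Xset b" "b \<le> pi"
  shows "cexp X Y Z + cexp X Z W = cexp Y Z W + cexp X Y W"
proof -
  obtain p q r s where m: "p \<in> X" "q \<in> Y" "r \<in> Z" "s \<in> W" using assms orbit_rep_mem by metis
  have "int (cexp X Y Z) + int (cexp X Z W) = int (cexp Y Z W) + int (cexp X Y W)"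
    using cexp_int[OF assms(1,2,3,5) m(1-3)] cexp_int[OF assms(1,3,4,5) m(1,3,4)]
      cexp_int[OF assms(2,3,4,5) m(2-4)] cexp_int[OF assms(1,2,4,5) m(1,2,4)] by simp
  then show ?thesis by linarith
qed

lemma cexp_same:
  assumes "X \<in> Xset b" "Z \<in> Xset b" "b \<le> pi"
  shows "cexp X X Z = 0" "cexp X Z Z = 0"
proof -
  obtain p r where m: "p \<in> X" "r \<in> Z" using assms orbit_rep_mem by metis
  have n: "narrow pi p" "narrow pi r" using assms m Xset_memD(1) narrow_mono by metis+
  show "cexp X X Z = 0" "cexp X Z Z = 0"
    using cexp_int[OF assms(1,1,2,3) m(1,1,2)] cexp_int[OF assms(1,2,2,3) m(1,2,2)]
      pdeg_self n by auto
qed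

text \<open>Exponent zero means that the basic morphism from X to Z factors through Y without loss.
  On representatives this is a chain p, q, r in which r is the lowest translate above p;
  \<open>cexp_zeroD\<close> recovers such a chain.\<close>

lemma cexp_zeroI:
  assumes "X \<in> Xset b" "Y \<in> Xset b" "Z \<in> Xset b" "b \<le> pi" "p \<in> X" "q \<in> Y" "r \<in> Z"
    and "point_le p q" "point_le q r" "pdeg p r = 0"
  shows "cexp X Y Z = 0"
proof -
  have n: "narrow pi p" "narrow pi q" "narrow pi r"
    using assms Xset_memD(1) narrow_mono by metis+
  have "pdeg p q \<le> 0" "pdeg q r \<le> 0" using pdeg_le_iff[OF n(2)] pdeg_le_iff[OF n(3)] assms by auto
  then show ?thesis using cexp_int[OF assms(1-7)] assms(10) by linarith
qed

lemma cexp_zeroD: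
  assumes "X \<in> Xset b" "Y \<in> Xset b" "Z \<in> Xset b" "b \<le> pi" "p \<in> X" "cexp X Y Z = 0"
  obtains q r where "q \<in> Y" "r \<in> Z" "point_le p q" "point_le q r" "pdeg p r = 0"
proof -
  obtain q r where m: "q \<in> Y" "r \<in> Z" using assms orbit_rep_mem by metis
  have n: "narrow pi p" "narrow pi q" "narrow pi r"
    using assms m Xset_memD(1) narrow_mono by metis+
  let ?q = "sigma_pow (pdeg p q) q" and ?r = "sigma_pow (pdeg p r) r"
  have "?q \<in> Y" "?r \<in> Z" using Xset_memD(2) assms(2,3) m by blast+
  moreover have "point_le p ?q" using pdeg_le_iff[OF n(2)] by blast
  moreover have "point_le ?q ?r"
  proof -
    have "pdeg ?q ?r \<le> 0"
      using pdeg_sigma_pow[OF n(3)] cexp_int[OF assms(1-5) m] assms(6) by simp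
    then show ?thesis using pdeg_le_iff[of ?r ?q 0] n(3) by simp
  qed
  moreover have "pdeg p ?r = 0" using pdeg_sigma_pow[OF n(3), of 0 p "pdeg p r"] by simp
  ultimately show ?thesis using that by blast
qed

text \<open>Since \<open>\<le>\<close> ignores the sign, isomorphic orbits may have representatives of different sign.\<close>

lemma cexp_iso_zeroD:
  assumes "X \<in> Xset b" "Y \<in> Xset b" "b \<le> pi" "p \<in> X" "cexp X Y X = 0"
  obtains e where "(fst p, fst (snd p), e) \<in> Y"
proof -
  obtain q r where q: "q \<in> Y" "r \<in> X" "point_le p q" "point_le q r" "pdeg p r = 0"
    using cexp_zeroD[OF assms(1,2,1,3,4,5)] .
  have n: "narrow pi p" using assms Xset_memD(1) narrow_mono by metis
  obtain i where i: "r = sigma_pow i p" using Xset_memD(2) assms q by blast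
  \<comment> \<open>The translate r of p has degree zero, so it is p itself and q is squeezed
    between p and p.\<close>
  have "i = 0" using pdeg_sigma_pow[OF n, of 0 p i] pdeg_self[OF n] q(5) i by simp
  then have "point_le q p" using q i by simp
  then have "q = (fst p, fst (snd p), snd (snd q))"
    using q(3) by (cases p; cases q) (auto simp: point_le_def)
  then show ?thesis using q(1) that by metis
qed

lemma psi_M_orb: "psi_orbit (M_orb x y) = M_orb (x + pi) (y + pi)"
proof -
  have e: "(\<lambda>(x, y, e). (x + pi, y + pi, e)) (sigma_pow i (x, y, Pos)) =
      sigma_pow i (x + pi, y + pi, Pos)" for i
    by (auto simp: sigma_pow_eq)
  have "psi_orbit (M_orb x y) =
      {(\<lambda>(x, y, e). (x + pi, y + pi, e)) (sigma_pow i (x, y, Pos)) | i. True}"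
    unfolding psi_orbit_def M_orb_def orbit_def by blast
  then show ?thesis unfolding e M_orb_def orbit_def .
qed

lemma psi_Xset: "X \<in> Xset b \<Longrightarrow> psi_orbit X \<in> Xset b"
  by (auto simp: Xset_iff psi_M_orb) (metis add_diff_cancel_right)

lemma psi_psi: "X \<in> Xset b \<Longrightarrow> psi_orbit (psi_orbit X) = X"
proof -
  have "M_orb (x + pi + pi) (y + pi + pi) = M_orb x y" for x y
    by (rule M_orb_eqI[of "-2"]) (simp add: sigma_pow_eq)
  then show "X \<in> Xset b \<Longrightarrow> psi_orbit (psi_orbit X) = X"
    by (auto simp: Xset_iff psi_M_orb)
qed

lemma cexp_psi:
  assumes "X \<in> Xset b" "Y \<in> Xset b" "Z \<in> Xset b" "b \<le> pi"
  shows "cexp (psi_orbit X) (psi_orbit Y) (psi_orbit Z) = cexp X Y Z"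
proof -
  let ?s = "\<lambda>(x :: real, y :: real, e :: sign). (x + pi, y + pi, e)"
  obtain p q r where m: "p \<in> X" "q \<in> Y" "r \<in> Z" using assms orbit_rep_mem by metis
  have n: "narrow pi q" "narrow pi r"
    using assms m Xset_memD(1) narrow_mono by metis+
  have s: "pdeg (?s p) (?s q) = pdeg p q" if "narrow pi q" for p q
  proof (rule pdeg_eqI)
    show "narrow pi (?s q)" using that by (cases q) (simp add: narrow_def)
    show "point_le (?s p) (sigma_pow i (?s q)) \<longleftrightarrow> pdeg p q \<le> i" for i
      unfolding pdeg_le_iff[OF that] by (cases p; cases q) (auto simp: point_le_def sigma_pow_eq)
  qed
  have "?s p \<in> psi_orbit X" "?s q \<in> psi_orbit Y" "?s r \<in> psi_orbit Z"
    using m unfolding psi_orbit_def by blast+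
  from cexp_int[OF psi_Xset[OF assms(1)] psi_Xset[OF assms(2)] psi_Xset[OF assms(3)] assms(4) this]
  show ?thesis using cexp_int[OF assms m] s n by simp
qed

section \<open>The category of finite direct sums\<close>

abbreviation entry :: "'r fmor \<Rightarrow> nat \<Rightarrow> nat \<Rightarrow> 'r" where
  "entry f i k \<equiv> fmat f $$ (i, k)"

definition mk_mor :: "point set list \<Rightarrow> point set list \<Rightarrow> (nat \<Rightarrow> nat \<Rightarrow> 'r) \<Rightarrow> 'r fmor" where
  "mk_mor A B \<phi> = FMor A B (mat (length B) (length A) (\<lambda>(i, k). \<phi> i k))"

lemma entry_mk_mor [simp]: "i < length B \<Longrightarrow> k < length A \<Longrightarrow> entry (mk_mor A B \<phi>) i k = \<phi> i k"
  by (simp add: mk_mor_def)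

lemma Fcat_hom: "hom (Fcat u b) f A B \<longleftrightarrow> set A \<subseteq> Xset b \<and> set B \<subseteq> Xset b \<and> fdom f = A \<and> fcod f = B \<and>
    fmat f \<in> carrier_mat (length B) (length A)"
  by (auto simp: hom_def Fcat_def)

lemma mk_mor_hom [simp]: "hom (Fcat u b) (mk_mor A B \<phi>) A B \<longleftrightarrow> set A \<subseteq> Xset b \<and> set B \<subseteq> Xset b"
  by (simp add: Fcat_hom mk_mor_def)

lemma Fcat_eqI:
  assumes "hom (Fcat u b) f A B" "hom (Fcat u b) g A B"
    and "\<And>i k. i < length B \<Longrightarrow> k < length A \<Longrightarrow> entry f i k = entry g i k"
  shows "f = g"
proof -
  have "fmat f = fmat g" using assms by (intro eq_matI) (auto simp: Fcat_hom)
  then show ?thesis using assms by (cases f; cases g) (auto simp: Fcat_hom)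
qed

lemma Fcat_Ob: "A \<in> Ob (Fcat u b) \<longleftrightarrow> set A \<subseteq> Xset b"
  by (auto simp: Fcat_def)

lemma Fcat_Idt: "Idt (Fcat u b) A = mk_mor A A (\<lambda>i k. if i = k then 1 else 0)"
  by (auto simp: Fcat_def mk_mor_def intro!: eq_matI)

lemma Fcat_Zer: "Zer (Fcat u b) A B = mk_mor A B (\<lambda>i k. 0)"
  by (auto simp: Fcat_def mk_mor_def intro!: eq_matI)

lemma Fcat_Cmp:
  assumes "hom (Fcat u b) f A B" "hom (Fcat u b) g B D"
  shows "Cmp (Fcat u b) g f = mk_mor A D
    (\<lambda>i k. \<Sum>j<length B. u ^ cexp (A ! k) (B ! j) (D ! i) * entry g i j * entry f j k)"
  using assms unfolding Fcat_hom by (auto simp: Fcat_def mk_mor_def)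

lemma Fcat_Add:
  assumes "hom (Fcat u b) f A B" "hom (Fcat u b) g A B"
  shows "Add (Fcat u b) f g = mk_mor A B (\<lambda>i k. entry f i k + entry g i k)"
  using assms unfolding Fcat_hom by (auto simp: Fcat_def mk_mor_def intro!: eq_matI)

lemma entry_Cmp:
  assumes "hom (Fcat u b) f A B" "hom (Fcat u b) g B D" "i < length D" "k < length A"
  shows "entry (Cmp (Fcat u b) g f) i k =
    (\<Sum>j<length B. u ^ cexp (A ! k) (B ! j) (D ! i) * entry g i j * entry f j k)"
  using assms(3,4) by (simp add: Fcat_Cmp[OF assms(1,2)])

lemma entry_Add:
  assumes "hom (Fcat u b) f A B" "hom (Fcat u b) g A B" "i < length B" "k < length A"
  shows "entry (Add (Fcat u b) f g) i k = entry f i k + entry g i k"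
  using assms(3,4) by (simp add: Fcat_Add[OF assms(1,2)])

lemma Fcat_preadditive:
  fixes u :: "'r::comm_ring_1"
  assumes b: "b \<le> pi"
  shows "preadditive (Fcat u b)"
proof
  let ?C = "Fcat u b"
  fix f g h :: "'r fmor" and A B D F
  show cmp: "hom ?C (Cmp ?C g f) A D" if "hom ?C f A B" "hom ?C g B D" for f g A B D
    using that unfolding Fcat_Cmp[OF that] mk_mor_hom unfolding Fcat_hom by blast
  show add: "hom ?C (Add ?C f g) A B" if "hom ?C f A B" "hom ?C g A B" for f g A B
    using that unfolding Fcat_Add[OF that] mk_mor_hom unfolding Fcat_hom by blast
  show idt: "hom ?C (Idt ?C A) A A" if "A \<in> Ob ?C" for A
    using that by (simp add: Fcat_Idt Fcat_Ob)
  show zer: "hom ?C (Zer ?C A B) A B" if "A \<in> Ob ?C" "B \<in> Ob ?C" for A B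
    using that by (simp add: Fcat_Zer Fcat_Ob)
  show "Cmp ?C h (Cmp ?C g f) = Cmp ?C (Cmp ?C h g) f"
    if f: "hom ?C f A B" and g: "hom ?C g B D" and h: "hom ?C h D F"
  proof (rule Fcat_eqI[OF cmp[OF cmp[OF f g] h] cmp[OF f cmp[OF g h]]])
    fix i k assume i: "i < length F" and k: "k < length A"
    have X: "A ! k \<in> Xset b" "F ! i \<in> Xset b" "\<And>l. l < length B \<Longrightarrow> B ! l \<in> Xset b"
      "\<And>j. j < length D \<Longrightarrow> D ! j \<in> Xset b" using f h i k by (auto simp: Fcat_hom)
    \<comment> \<open>After both sides are expanded, associativity comes down to the cocycle
      identity for the exponents.\<close>
    have e: "u ^ cexp (A ! k) (D ! j) (F ! i) * u ^ cexp (A ! k) (B ! l) (D ! j) =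
        u ^ cexp (A ! k) (B ! l) (F ! i) * u ^ cexp (B ! l) (D ! j) (F ! i)"
      if "l < length B" "j < length D" for l j
      unfolding power_add[symmetric]
      using cexp_cocycle[OF X(1) X(3)[OF that(1)] X(4)[OF that(2)] X(2) b] by (simp add: add.commute)
    have "entry (Cmp ?C h (Cmp ?C g f)) i k =
      (\<Sum>j<length D. u ^ cexp (A ! k) (D ! j) (F ! i) * entry h i j *
        (\<Sum>l<length B. u ^ cexp (A ! k) (B ! l) (D ! j) * entry g j l * entry f l k))"
      unfolding entry_Cmp[OF cmp[OF f g] h i k] using k
      by (intro sum.cong refl) (simp add: entry_Cmp[OF f g])
    also have "\<dots> = (\<Sum>j<length D. \<Sum>l<length B. u ^ cexp (A ! k) (D ! j) (F ! i) *
        u ^ cexp (A ! k) (B ! l) (D ! j) * (entry h i j * entry g j l * entry f l k))"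
      by (simp add: sum_distrib_left mult.assoc mult.left_commute)
    also have "\<dots> = (\<Sum>j<length D. \<Sum>l<length B. u ^ cexp (A ! k) (B ! l) (F ! i) *
        u ^ cexp (B ! l) (D ! j) (F ! i) * (entry h i j * entry g j l * entry f l k))"
      using e by (intro sum.cong refl) simp
    also have "\<dots> = (\<Sum>l<length B. \<Sum>j<length D. u ^ cexp (A ! k) (B ! l) (F ! i) *
        u ^ cexp (B ! l) (D ! j) (F ! i) * (entry h i j * entry g j l * entry f l k))"
      by (rule sum.swap)
    also have "\<dots> = (\<Sum>l<length B. u ^ cexp (A ! k) (B ! l) (F ! i) *
        (\<Sum>j<length D. u ^ cexp (B ! l) (D ! j) (F ! i) * entry h i j * entry g j l) * entry f l k)"
      by (simp add: sum_distrib_left sum_distrib_right mult.assoc)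
    also have "\<dots> = entry (Cmp ?C (Cmp ?C h g) f) i k"
      unfolding entry_Cmp[OF f cmp[OF g h] i k] using i
      by (intro sum.cong refl) (simp add: entry_Cmp[OF g h])
    finally show "entry (Cmp ?C h (Cmp ?C g f)) i k = entry (Cmp ?C (Cmp ?C h g) f) i k" .
  qed
  show "Cmp ?C (Idt ?C B) f = f" if f: "hom ?C f A B"
  proof -
    have ob: "B \<in> Ob ?C" using f by (simp add: hom_def)
    show ?thesis
    proof (rule Fcat_eqI[OF cmp[OF f idt[OF ob]] f])
      fix i k assume i: "i < length B" and k: "k < length A"
      have X: "A ! k \<in> Xset b" "B ! i \<in> Xset b" using f i k by (auto simp: Fcat_hom)
      have "entry (Cmp ?C (Idt ?C B) f) i k =
          (\<Sum>j<length B. u ^ cexp (A ! k) (B ! j) (B ! i) * (if i = j then 1 else 0) * entry f j k)"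
        unfolding entry_Cmp[OF f idt[OF ob] i k] using i by (intro sum.cong refl) (simp add: Fcat_Idt)
      also have "\<dots> = (\<Sum>j<length B. if i = j then entry f j k else 0)"
        using cexp_same(2)[OF X b] by (intro sum.cong) auto
      finally show "entry (Cmp ?C (Idt ?C B) f) i k = entry f i k" using i by simp
    qed
  qed
  show "Cmp ?C f (Idt ?C A) = f" if f: "hom ?C f A B"
  proof -
    have ob: "A \<in> Ob ?C" using f by (simp add: hom_def)
    show ?thesis
    proof (rule Fcat_eqI[OF cmp[OF idt[OF ob] f] f])
      fix i k assume i: "i < length B" and k: "k < length A"
      have X: "A ! k \<in> Xset b" "B ! i \<in> Xset b" using f i k by (auto simp: Fcat_hom)
      have "entry (Cmp ?C f (Idt ?C A)) i k =
          (\<Sum>j<length A. u ^ cexp (A ! k) (A ! j) (B ! i) * entry f i j * (if j = k then 1 else 0))"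
        unfolding entry_Cmp[OF idt[OF ob] f i k] using k by (intro sum.cong refl) (simp add: Fcat_Idt)
      also have "\<dots> = (\<Sum>j<length A. if k = j then entry f i j else 0)"
        using cexp_same(1)[OF X b] by (intro sum.cong) auto
      finally show "entry (Cmp ?C f (Idt ?C A)) i k = entry f i k" using k by simp
    qed
  qed
  show "Add ?C (Add ?C f g) h = Add ?C f (Add ?C g h)"
    if f: "hom ?C f A B" and g: "hom ?C g A B" and h: "hom ?C h A B"
    by (rule Fcat_eqI[OF add[OF add[OF f g] h] add[OF f add[OF g h]]])
      (simp only: entry_Add[OF f g] entry_Add[OF g h] entry_Add[OF add[OF f g] h]
        entry_Add[OF f add[OF g h]] add.assoc)
  show "Add ?C f g = Add ?C g f" if f: "hom ?C f A B" and g: "hom ?C g A B"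
    by (rule Fcat_eqI[OF add[OF f g] add[OF g f]]) (simp add: Fcat_Add[OF f g] Fcat_Add[OF g f] add.commute)
  show "Add ?C f (Zer ?C A B) = f" if f: "hom ?C f A B"
  proof -
    have z: "hom ?C (Zer ?C A B) A B" using f zer by (simp add: hom_def)
    show ?thesis
      by (rule Fcat_eqI[OF add[OF f z] f]) (simp add: Fcat_Add[OF f z], simp add: Fcat_Zer)
  qed
  show "\<exists>g. hom ?C g A B \<and> Add ?C f g = Zer ?C A B" if f: "hom ?C f A B"
  proof -
    let ?n = "mk_mor A B (\<lambda>i k. - entry f i k)"
    have n: "hom ?C ?n A B" using f unfolding mk_mor_hom unfolding Fcat_hom by blast
    have z: "hom ?C (Zer ?C A B) A B" using f zer by (simp add: hom_def)
    have "Add ?C f ?n = Zer ?C A B"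
      by (rule Fcat_eqI[OF add[OF f n] z]) (simp add: Fcat_Add[OF f n] Fcat_Zer)
    then show ?thesis using n by blast
  qed
  show "Cmp ?C h (Add ?C f g) = Add ?C (Cmp ?C h f) (Cmp ?C h g)"
    if f: "hom ?C f A B" and g: "hom ?C g A B" and h: "hom ?C h B D"
  proof (rule Fcat_eqI[OF cmp[OF add[OF f g] h] add[OF cmp[OF f h] cmp[OF g h]]])
    fix i k assume "i < length D" "k < length A"
    then show "entry (Cmp ?C h (Add ?C f g)) i k = entry (Add ?C (Cmp ?C h f) (Cmp ?C h g)) i k"
      by (simp add: entry_Cmp[OF add[OF f g] h] entry_Add[OF cmp[OF f h] cmp[OF g h]] entry_Cmp[OF f h]
          entry_Cmp[OF g h] entry_Add[OF f g] distrib_left sum.distrib cong: sum.cong_simp)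
  qed
  show "Cmp ?C (Add ?C g h) f = Add ?C (Cmp ?C g f) (Cmp ?C h f)"
    if f: "hom ?C f A B" and g: "hom ?C g B D" and h: "hom ?C h B D"
  proof (rule Fcat_eqI[OF cmp[OF f add[OF g h]] add[OF cmp[OF f g] cmp[OF f h]]])
    fix i k assume "i < length D" "k < length A"
    then show "entry (Cmp ?C (Add ?C g h) f) i k = entry (Add ?C (Cmp ?C g f) (Cmp ?C h f)) i k"
      by (simp add: entry_Cmp[OF f add[OF g h]] entry_Add[OF cmp[OF f g] cmp[OF f h]] entry_Cmp[OF f g]
          entry_Cmp[OF f h] entry_Add[OF g h] distrib_left distrib_right sum.distrib cong: sum.cong_simp)
  qed
qed

definition inl_mor :: "point set list \<Rightarrow> point set list \<Rightarrow> 'r::comm_ring_1 fmor" where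
  "inl_mor A B = mk_mor A (A @ B) (\<lambda>i k. if i = k then 1 else 0)"

definition inr_mor :: "point set list \<Rightarrow> point set list \<Rightarrow> 'r::comm_ring_1 fmor" where
  "inr_mor A B = mk_mor B (A @ B) (\<lambda>i k. if i = length A + k then 1 else 0)"

definition prl_mor :: "point set list \<Rightarrow> point set list \<Rightarrow> 'r::comm_ring_1 fmor" where
  "prl_mor A B = mk_mor (A @ B) A (\<lambda>i k. if k = i then 1 else 0)"

definition prr_mor :: "point set list \<Rightarrow> point set list \<Rightarrow> 'r::comm_ring_1 fmor" where
  "prr_mor A B = mk_mor (A @ B) B (\<lambda>i k. if k = length A + i then 1 else 0)"

lemma entry_inl [simp]: "i < length A + length B \<Longrightarrow> k < length A \<Longrightarrow>
    entry (inl_mor A B) i k = (if i = k then 1 else 0)"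
  and entry_inr [simp]: "i < length A + length B \<Longrightarrow> k < length B \<Longrightarrow>
    entry (inr_mor A B) i k = (if i = length A + k then 1 else 0)"
  and entry_prl [simp]: "i < length A \<Longrightarrow> k < length A + length B \<Longrightarrow>
    entry (prl_mor A B) i k = (if k = i then 1 else 0)"
  and entry_prr [simp]: "i < length B \<Longrightarrow> k < length A + length B \<Longrightarrow>
    entry (prr_mor A B) i k = (if k = length A + i then 1 else 0)"
  by (simp_all add: inl_mor_def inr_mor_def prl_mor_def prr_mor_def)

text \<open>Wherever a product of entries is nonzero, the intermediate summand coincides with the
  source summand, so no power of u appears and the usual block matrices work.\<close>

lemma Fcat_biproduct:
  fixes u :: "'r::comm_ring_1"
  assumes b: "b \<le> pi" and A: "set A \<subseteq> Xset b" and B: "set B \<subseteq> Xset b"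
  shows "preadditive.is_biproduct (Fcat u b) (A @ B) A B (inl_mor A B) (inr_mor A B)
    (prl_mor A B) (prr_mor A B)"
proof -
  interpret preadditive "Fcat u b" by (rule Fcat_preadditive[OF b])
  let ?C = "Fcat u b"
  let ?i = "inl_mor A B :: 'r fmor" and ?j = "inr_mor A B :: 'r fmor"
  let ?p = "prl_mor A B :: 'r fmor" and ?q = "prr_mor A B :: 'r fmor"
  have h: "hom ?C ?i A (A @ B)" "hom ?C ?j B (A @ B)" "hom ?C ?p (A @ B) A" "hom ?C ?q (A @ B) B"
    using A B by (auto simp: inl_mor_def inr_mor_def prl_mor_def prr_mor_def)
  have ob: "A \<in> Ob ?C" "B \<in> Ob ?C" "A @ B \<in> Ob ?C" using A B by (auto simp: Fcat_Ob)
  have XA: "A ! k \<in> Xset b" if "k < length A" for k using that A by auto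
  have XB: "B ! k \<in> Xset b" if "k < length B" for k using that B by auto
  have sum1: "(\<Sum>j<n. u ^ c j * (if P j then 1 else 0) * (if j = m then 1 else 0)) =
      (if P m then u ^ c m else 0)" if "m < n" for n m :: nat and c :: "nat \<Rightarrow> nat" and P
  proof -
    have "(\<Sum>j<n. u ^ c j * (if P j then 1 else 0) * (if j = m then 1 else 0)) =
        (\<Sum>j<n. if m = j then (if P m then u ^ c m else 0) else 0)"
      by (intro sum.cong) auto
    then show ?thesis using that by simp
  qed
  have 1: "Cmp ?C ?p ?i = Idt ?C A"
  proof (rule Fcat_eqI[OF cmp_hom[OF h(1) h(3)] idt_hom[OF ob(1)]])
    fix i k assume "i < length A" "k < length A"
    then show "entry (Cmp ?C ?p ?i) i k = entry (Idt ?C A) i k"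
      using cexp_same(1)[OF XA XA b]
      by (simp add: entry_Cmp[OF h(1) h(3)] Fcat_Idt sum1 nth_append cong: sum.cong_simp)
  qed
  have 2: "Cmp ?C ?q ?j = Idt ?C B"
  proof (rule Fcat_eqI[OF cmp_hom[OF h(2) h(4)] idt_hom[OF ob(2)]])
    fix i k assume "i < length B" "k < length B"
    then show "entry (Cmp ?C ?q ?j) i k = entry (Idt ?C B) i k"
      using cexp_same(1)[OF XB XB b]
      by (simp add: entry_Cmp[OF h(2) h(4)] Fcat_Idt sum1 nth_append cong: sum.cong_simp)
  qed
  have 3: "Cmp ?C ?p ?j = Zer ?C B A"
  proof (rule Fcat_eqI[OF cmp_hom[OF h(2) h(3)] zer_hom[OF ob(2) ob(1)]])
    fix i k assume "i < length A" "k < length B"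
    then show "entry (Cmp ?C ?p ?j) i k = entry (Zer ?C B A) i k"
      by (simp add: entry_Cmp[OF h(2) h(3)] Fcat_Zer sum1 cong: sum.cong_simp)
  qed
  have 4: "Cmp ?C ?q ?i = Zer ?C A B"
  proof (rule Fcat_eqI[OF cmp_hom[OF h(1) h(4)] zer_hom[OF ob(1) ob(2)]])
    fix i k assume "i < length B" "k < length A"
    then show "entry (Cmp ?C ?q ?i) i k = entry (Zer ?C A B) i k"
      by (simp add: entry_Cmp[OF h(1) h(4)] Fcat_Zer sum1 cong: sum.cong_simp)
  qed
  note h' = cmp_hom[OF h(3) h(1)] cmp_hom[OF h(4) h(2)]
  have 5: "Add ?C (Cmp ?C ?i ?p) (Cmp ?C ?j ?q) = Idt ?C (A @ B)"
  proof (rule Fcat_eqI[OF add_hom[OF h'] idt_hom[OF ob(3)]])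
    fix i k assume i: "i < length (A @ B)" and k: "k < length (A @ B)"
    have "entry (Cmp ?C ?i ?p) i k = (if i = k \<and> i < length A then 1 else 0)"
    proof -
      have "entry (Cmp ?C ?i ?p) i k = (\<Sum>j<length A. u ^ cexp ((A @ B) ! k) (A ! j) ((A @ B) ! i) *
          (if i = j then 1 else 0) * (if k = j then 1 else 0))"
        using i k by (simp add: entry_Cmp[OF h(3) h(1)] cong: sum.cong_simp)
      also have "\<dots> = (\<Sum>j<length A. if k = j then (if i = k then 1 else 0) else 0)"
        using cexp_same(1)[OF XA XA b] by (intro sum.cong) (auto simp: nth_append)
      finally show ?thesis by auto
    qed
    moreover have "entry (Cmp ?C ?j ?q) i k = (if i = k \<and> length A \<le> i then 1 else 0)"
    proof -
      have "entry (Cmp ?C ?j ?q) i k = (\<Sum>j<length B. u ^ cexp ((A @ B) ! k) (B ! j) ((A @ B) ! i) *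
          (if i = length A + j then 1 else 0) * (if k = length A + j then 1 else 0))"
        using i k by (simp add: entry_Cmp[OF h(4) h(2)] cong: sum.cong_simp)
      also have "\<dots> = (\<Sum>j<length B. if k - length A = j then (if i = k \<and> length A \<le> i then 1 else 0) else 0)"
        using cexp_same(1)[OF XB XB b] by (intro sum.cong) (auto simp: nth_append)
      finally show ?thesis using k by auto
    qed
    ultimately show "entry (Add ?C (Cmp ?C ?i ?p) (Cmp ?C ?j ?q)) i k = entry (Idt ?C (A @ B)) i k"
      using i k unfolding entry_Add[OF h' i k] by (simp add: Fcat_Idt)
  qed
  show ?thesis unfolding is_biproduct_def using h 1 2 3 4 5 by blast
qed

text \<open>The boundary of the strip, that is, the indecomposable projective-injective objects; see
  \<open>proj_iff\<close>.\<close>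

definition bdry :: "real \<Rightarrow> point set \<Rightarrow> bool" where
  "bdry b X \<longleftrightarrow> (\<exists>x y. X = M_orb x y \<and> \<bar>x - y\<bar> = b)"

lemma bdry_Xset: "bdry b X \<Longrightarrow> X \<in> Xset b"
  by (auto simp: bdry_def)

lemma bdry_width: "bdry b X \<Longrightarrow> p \<in> X \<Longrightarrow> \<bar>fst p - fst (snd p)\<bar> = b"
  by (auto simp: bdry_def M_orb_iff sigma_pow_eq abs_minus_commute)

lemma bdry_psi: "bdry b X \<Longrightarrow> bdry b (psi_orbit X)"
  by (auto simp: bdry_def psi_M_orb) (metis add_diff_cancel_right)

lemma psi_obj_Xset: "set A \<subseteq> Xset b \<Longrightarrow> set (psi_obj A) \<subseteq> Xset b"
  using psi_Xset by (auto simp: psi_obj_def)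

lemma psi_mor_hom: "hom (Fcat u b) f A B \<Longrightarrow> hom (Fcat u b) (psi_mor f) (psi_obj A) (psi_obj B)"
  by (auto simp: Fcat_hom psi_mor_def dest: psi_obj_Xset) (auto simp: psi_obj_def)

lemma entry_psi [simp]: "entry (psi_mor f) i k = entry f i k"
  by (simp add: psi_mor_def)

lemma length_psi_obj [simp]: "length (psi_obj A) = length A"
  by (simp add: psi_obj_def)

lemma nth_psi_obj [simp]: "k < length A \<Longrightarrow> psi_obj A ! k = psi_orbit (A ! k)"
  by (simp add: psi_obj_def)

lemma psi_obj_psi_obj: "set A \<subseteq> Xset b \<Longrightarrow> psi_obj (psi_obj A) = A"
  unfolding psi_obj_def map_map using psi_psi by (intro map_idI) auto

section \<open>The Frobenius category for a fixed width\<close>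

locale continuous_frobenius =
  fixes u :: "'r::idom" and b :: real and E :: "(point set list, 'r fmor) conflations"
  assumes dvr: "dvr_uniformizer u" and two: "\<not> u dvd 2" and b_pos: "0 < b" and b_le: "b \<le> pi"
    and standard: "is_standard_exact_structure u b E"
begin

abbreviation "C \<equiv> Fcat u b"

lemma u_nonzero: "u \<noteq> 0"
  using dvr by (simp add: dvr_uniformizer_def)

lemma nonunit_iff: "\<not> x dvd 1 \<longleftrightarrow> u dvd x"
proof -
  have "{x. \<not> x dvd 1} = {r * u | r. True}" using dvr by (simp add: dvr_uniformizer_def)
  then have "\<not> x dvd 1 \<longleftrightarrow> x \<in> {r * u | r. True}" by blast
  then show ?thesis by (auto simp: dvd_def mult.commute)
qed

lemma u_nonunit: "\<not> u dvd 1"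
  by (simp add: nonunit_iff)

lemma two_unit: "2 dvd (1::'r)"
  using two nonunit_iff[of 2] by blast

lemma two_nonzero: "(2::'r) \<noteq> 0"
  using two by auto

lemma power_nonunit: "\<not> u ^ n dvd 1 \<longleftrightarrow> 0 < n"
  using u_nonunit by (cases n) (auto dest: dvd_mult_left)

text \<open>The combinations form the ideal generated by the smaller of the two powers of u, which
  is the whole ring iff that power is 1. This equation is the obstruction to extending a
  morphism.\<close>

lemma exists_coefficient_iff:
  "(\<forall>g. \<exists>h h'. u ^ m * h - u ^ n * h' = g) \<longleftrightarrow> m = 0 \<or> n = 0"
proof
  assume "\<forall>g. \<exists>h h'. u ^ m * h - u ^ n * h' = g"
  then obtain h h' where *: "u ^ m * h - u ^ n * h' = 1" by blast
  show "m = 0 \<or> n = 0"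
  proof (rule ccontr)
    assume "\<not> (m = 0 \<or> n = 0)"
    then have "u dvd u ^ m" "u dvd u ^ n" by (auto simp: dvd_power)
    then have "u dvd u ^ m * h - u ^ n * h'" by (intro dvd_diff dvd_mult2)
    then show False using * u_nonunit by simp
  qed
next
  assume "m = 0 \<or> n = 0"
  then show "\<forall>g. \<exists>h h'. u ^ m * h - u ^ n * h' = g"
  proof
    assume "m = 0"
    then show ?thesis by (intro allI exI[of _ "0"] exI) auto
  next
    assume n: "n = 0"
    have "u ^ m * 0 - u ^ n * (- g) = g" for g using n by simp
    then show ?thesis by blast
  qed
qed

sublocale F: preadditive C
  by (rule Fcat_preadditive[OF b_le])

sublocale F: frobenius C E
proof
  show "frobenius_category C E" using standard by (simp add: is_standard_exact_structure_def)
  show "\<exists>P i j p q. F.is_biproduct P A B i j p q" if "A \<in> Ob C" "B \<in> Ob C" for A B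
    using Fcat_biproduct[OF b_le] that unfolding Fcat_Ob by blast
qed

lemma standard_iff: "P \<in> Ob C \<Longrightarrow> indecomposable_obj C P \<and> F.proj P \<longleftrightarrow>
    (\<exists>x y. \<bar>x - y\<bar> = b \<and> iso_obj C P [M_orb x y])"
  using standard by (simp add: is_standard_exact_structure_def)

lemma cexp_refl: "X \<in> Xset b \<Longrightarrow> cexp X X X = 0"
  using cexp_same b_le by blast

lemma entry_Cmp_single:
  assumes "hom C f [X] A" "hom C g A [X]"
  shows "entry (Cmp C g f) 0 0 = (\<Sum>j<length A. u ^ cexp X (A ! j) X * entry g 0 j * entry f j 0)"
  using entry_Cmp[OF assms, of 0 0] by simp

text \<open>The endomorphisms of a single summand form the domain R, where an idempotent is 0 or
  1.\<close>

lemma indecomposable_single: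
  assumes X: "X \<in> Xset b"
  shows "indecomposable_obj C [X]"
  unfolding indecomposable_obj_def
proof (intro conjI ballI impI)
  have ob: "[X] \<in> Ob C" using X by (simp add: Fcat_Ob)
  show "[X] \<in> Ob C" by (rule ob)
  show "\<not> zero_obj C [X]"
  proof
    assume "zero_obj C [X]"
    then have "entry (Idt C [X]) 0 0 = entry (Zer C [X] [X]) 0 0" by (simp add: zero_obj_def)
    then show False by (simp add: Fcat_Idt Fcat_Zer)
  qed
  fix A B assume A: "A \<in> Ob C" and B: "B \<in> Ob C" and "biproduct C [X] A B"
  then obtain i j p q where bp: "F.is_biproduct [X] A B i j p q" using F.biproductE ob by blast
  have H: "hom C i A [X]" "hom C j B [X]" "hom C p [X] A" "hom C q [X] B"
    and e: "Cmp C p i = Idt C A" "Cmp C q j = Idt C B" "Add C (Cmp C i p) (Cmp C j q) = Idt C [X]"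
    using bp by (auto simp: F.is_biproduct_def)
  note ip = F.cmp_hom[OF H(3) H(1)] note jq = F.cmp_hom[OF H(4) H(2)]
  have z: "hom C (Zer C [X] [X]) [X] [X]" using F.zer_hom[OF ob ob] .
  define c where "c = entry (Cmp C i p) 0 0"
  have pip: "Cmp C (Cmp C p i) p = p" using e F.idt_left[OF H(3)] by simp
  have "Cmp C (Cmp C i p) (Cmp C i p) = Cmp C i p"
    using F.cmp_assoc[OF ip H(3) H(1)] F.cmp_assoc[OF H(3) H(1) H(3)] pip by simp
  then have "c * c = c"
    using entry_Cmp_single[OF ip ip] cexp_refl[OF X] by (simp add: c_def)
  then have "c = 0 \<or> c = 1" by (metis mult_cancel_right1 mult_cancel_right2 mult_cancel_left1)
  then show "zero_obj C A \<or> zero_obj C B"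
  proof
    assume "c = 0"
    then have "Cmp C i p = Zer C [X] [X]"
      by (intro Fcat_eqI[OF ip z]) (auto simp: Fcat_Zer c_def)
    then have "Cmp C p (Cmp C i p) = Zer C [X] A" using F.cmp_zer[OF H(3) ob] by simp
    then have "p = Zer C [X] A" using F.cmp_assoc[OF H(3) H(1) H(3)] pip by simp
    then have "Idt C A = Zer C A A" using e(1) F.zer_cmp[OF H(1) A] by simp
    then show ?thesis using A by (simp add: zero_obj_def)
  next
    assume c: "c = 1"
    have id: "hom C (Idt C [X]) [X] [X]" using F.idt_hom[OF ob] .
    have "Cmp C i p = Idt C [X]"
      using c by (intro Fcat_eqI[OF ip id]) (auto simp: Fcat_Idt c_def)
    then have "Cmp C j q = Zer C [X] [X]"
      using F.add_eq_selfD[OF ip jq] e(3) by simp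
    then have "Cmp C q (Cmp C j q) = Zer C [X] B" using F.cmp_zer[OF H(4) ob] by simp
    moreover have "Cmp C q (Cmp C j q) = q"
      using F.cmp_assoc[OF H(4) H(2) H(4)] e F.idt_left[OF H(4)] by simp
    ultimately have "q = Zer C [X] B" by simp
    then have "Idt C B = Zer C B B" using e(2) F.zer_cmp[OF H(2) B] by simp
    then show ?thesis using B by (simp add: zero_obj_def)
  qed
qed

lemma proj_single:
  assumes "bdry b X"
  shows "F.proj [X]"
proof -
  obtain x y where X: "X = M_orb x y" "\<bar>x - y\<bar> = b" using assms by (auto simp: bdry_def)
  have ob: "[X] \<in> Ob C" using bdry_Xset[OF assms] by (simp add: Fcat_Ob)
  note id = F.idt_hom[OF ob]
  have "iso_mor C [X] [X] (Idt C [X])"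
    unfolding iso_mor_def using id F.idt_left[OF id] unfolding hom_def by blast
  then have "iso_obj C [X] [M_orb x y]" unfolding iso_obj_def X(1) by blast
  then show ?thesis using standard_iff[OF ob] X by blast
qed

lemma proj_Nil: "F.proj []"
  unfolding projective_obj_def
proof (intro conjI allI impI ballI)
  show "[] \<in> Ob C" by (simp add: Fcat_Ob)
  fix A i B p T f assume E: "E A i B p T" and f: "f \<in> Mor C [] T"
  have p: "hom C p B T" using F.ker_hom[OF F.conf_ker[OF E]] by blast
  have f: "hom C f [] T" using f p by (simp add: hom_def Fcat_Ob)
  have g: "hom C (Zer C [] B) [] B" using F.zer_hom p f by (simp add: hom_def)
  have "Cmp C p (Zer C [] B) = f"
    by (rule Fcat_eqI[OF F.cmp_hom[OF g p] f]) simp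
  then show "\<exists>g\<in>Mor C [] B. Cmp C p g = f" using g by (auto simp: hom_def)
qed

text \<open>The standard structure names only the indecomposable projectives. A summand of a
  projective is a retract, hence projective, and indecomposable, hence isomorphic to a boundary
  object. The isomorphism forces a zero exponent, so both have representatives with the same
  coordinates and therefore the same width.\<close>

lemma proj_iff: "F.proj P \<longleftrightarrow> (\<forall>X\<in>set P. bdry b X)"
proof
  show "\<forall>X\<in>set P. bdry b X \<Longrightarrow> F.proj P"
  proof (induction P)
    case Nil
    then show ?case using proj_Nil by simp
  next
    case (Cons X P)
    have "set [X] \<subseteq> Xset b" "set P \<subseteq> Xset b" using Cons.prems bdry_Xset by auto
    then have "F.is_biproduct ([X] @ P) [X] P (inl_mor [X] P) (inr_mor [X] P) (prl_mor [X] P) (prr_mor [X] P)"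
      by (rule Fcat_biproduct[OF b_le])
    then have "F.proj ([X] @ P)"
      using F.proj_biproduct[OF _ proj_single] Cons by simp
    then show ?case by simp
  qed
next
  assume P: "F.proj P"
  then have ob: "set P \<subseteq> Xset b" by (simp add: projective_obj_def Fcat_Ob)
  show "\<forall>X\<in>set P. bdry b X"
  proof
    fix X assume "X \<in> set P"
    then obtain k where k: "k < length P" "X = P ! k" by (auto simp: in_set_conv_nth)
    have X: "X \<in> Xset b" using ob k by auto
    have obX: "[X] \<in> Ob C" using X by (simp add: Fcat_Ob)
    define s :: "'r fmor" where "s = mk_mor [X] P (\<lambda>i _. if i = k then 1 else 0)"
    define r :: "'r fmor" where "r = mk_mor P [X] (\<lambda>_ i. if k = i then 1 else 0)"
    have s: "hom C s [X] P" and r: "hom C r P [X]" using ob X by (auto simp: s_def r_def)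
    have "Cmp C r s = Idt C [X]"
    proof (rule Fcat_eqI[OF F.cmp_hom[OF s r] F.idt_hom[OF obX]])
      fix i l assume il: "i < length [X]" "l < length [X]"
      have "entry (Cmp C r s) 0 0 = (\<Sum>j<length P. if k = j then 1 else 0)"
        unfolding entry_Cmp_single[OF s r]
        using cexp_refl[OF X] k by (intro sum.cong refl) (auto simp: s_def r_def)
      then show "entry (Cmp C r s) i l = entry (Idt C [X]) i l" using il k by (simp add: Fcat_Idt)
    qed
    then have "F.proj [X]" by (rule F.proj_retract[OF P s r])
    then obtain x y where xy: "\<bar>x - y\<bar> = b" "iso_obj C [X] [M_orb x y]"
      using standard_iff[OF obX] indecomposable_single[OF X] by blast
    let ?Y = "M_orb x y"
    have Y: "?Y \<in> Xset b" using xy by simp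
    have obY: "[?Y] \<in> Ob C" using Y by (simp add: Fcat_Ob)
    obtain f g where fg: "f \<in> Mor C [X] [?Y]" "g \<in> Mor C [?Y] [X]" "Cmp C g f = Idt C [X]"
      using xy(2) unfolding iso_obj_def iso_mor_def by blast
    have f: "hom C f [X] [?Y]" and g: "hom C g [?Y] [X]" using fg obX obY by (auto simp: hom_def)
    have "u ^ cexp X ?Y X * entry g 0 0 * entry f 0 0 = 1"
      using entry_Cmp_single[OF f g] fg(3) by (simp add: Fcat_Idt)
    then have "u ^ cexp X ?Y X dvd 1" by (metis dvdI mult.assoc)
    then have c: "cexp X ?Y X = 0" using power_nonunit by blast
    obtain a a' where a: "X = M_orb a a'" using X by (auto simp: Xset_iff)
    have m: "(a, a', Pos) \<in> X" using a M_orb_self by simp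
    obtain e where e: "(a, a', e) \<in> ?Y" using cexp_iso_zeroD[OF X Y b_le m c] unfolding fst_conv snd_conv .
    have "bdry b ?Y" using xy by (auto simp: bdry_def)
    from bdry_width[OF this e] have "\<bar>a - a'\<bar> = b" by simp
    then show "bdry b X" using a by (auto simp: bdry_def)
  qed
qed

sublocale F: frobenius_involution C E psi_obj psi_mor
proof
  fix f g :: "'r fmor" and A B D :: "point set list"
  show "A \<in> Ob C \<Longrightarrow> psi_obj A \<in> Ob C" using psi_obj_Xset by (simp add: Fcat_Ob)
  show "hom C f A B \<Longrightarrow> hom C (psi_mor f) (psi_obj A) (psi_obj B)" by (rule psi_mor_hom)
  show "psi_mor (Cmp C g f) = Cmp C (psi_mor g) (psi_mor f)"
    if f: "hom C f A B" and g: "hom C g B D"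
  proof (rule Fcat_eqI[OF psi_mor_hom[OF F.cmp_hom[OF f g]] F.cmp_hom[OF psi_mor_hom[OF f] psi_mor_hom[OF g]]])
    fix i k assume "i < length (psi_obj D)" "k < length (psi_obj A)"
    then have i: "i < length D" "k < length A" by simp_all
    have "set A \<subseteq> Xset b" "set B \<subseteq> Xset b" "set D \<subseteq> Xset b" using f g by (auto simp: Fcat_hom)
    then have "cexp (psi_orbit (A ! k)) (psi_orbit (B ! j)) (psi_orbit (D ! i)) = cexp (A ! k) (B ! j) (D ! i)"
      if "j < length B" for j using that i by (intro cexp_psi[OF _ _ _ b_le]) auto
    then show "entry (psi_mor (Cmp C g f)) i k = entry (Cmp C (psi_mor g) (psi_mor f)) i k"
      using i by (simp add: entry_Cmp[OF f g] entry_Cmp[OF psi_mor_hom[OF f] psi_mor_hom[OF g]] cong: sum.cong_simp)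
  qed
  show "psi_mor (Add C f g) = Add C (psi_mor f) (psi_mor g)"
    if f: "hom C f A B" and g: "hom C g A B"
    by (rule Fcat_eqI[OF psi_mor_hom[OF F.add_hom[OF f g]] F.add_hom[OF psi_mor_hom[OF f] psi_mor_hom[OF g]]])
      (simp add: entry_Add[OF f g] entry_Add[OF psi_mor_hom[OF f] psi_mor_hom[OF g]])
  show "psi_mor (Idt C A) = Idt C (psi_obj A)" if A: "A \<in> Ob C"
  proof -
    have "psi_obj A \<in> Ob C" using A psi_obj_Xset by (simp add: Fcat_Ob)
    then show ?thesis
      by (intro Fcat_eqI[OF psi_mor_hom[OF F.idt_hom[OF A]] F.idt_hom]) (simp_all add: Fcat_Idt)
  qed
  show pp: "psi_obj (psi_obj A) = A" if "A \<in> Ob C" for A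
    using that psi_obj_psi_obj by (simp add: Fcat_Ob)
  show "psi_mor (psi_mor f) = f" if f: "hom C f A B"
    using f pp[of A] pp[of B] by (cases f) (auto simp: psi_mor_def Fcat_hom Fcat_Ob)
  show "F.proj A \<Longrightarrow> F.proj (psi_obj A)"
    using bdry_psi proj_iff[of A] proj_iff[of "psi_obj A"] by (auto simp: psi_obj_def)
  show "\<exists>h. hom C h A B \<and> Add C h h = f" if f: "hom C f A B"
  proof -
    obtain v :: 'r where v: "1 = 2 * v" using two_unit by (rule dvdE)
    define h where "h = mk_mor A B (\<lambda>i k. v * entry f i k)"
    have h: "hom C h A B" using f unfolding h_def mk_mor_hom unfolding Fcat_hom by blast
    have vx: "v * x + v * x = x" for x :: 'r
      using arg_cong[OF v, of "\<lambda>t. t * x"] by (simp add: algebra_simps)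
    have "Add C h h = f"
    proof (rule Fcat_eqI[OF F.add_hom[OF h h] f])
      fix i k assume ik: "i < length B" "k < length A"
      show "entry (Add C h h) i k = entry f i k"
        unfolding entry_Add[OF h h ik] unfolding h_def entry_mk_mor[OF ik] by (rule vx)
    qed
    then show ?thesis using h by (intro exI[of _ h] conjI)
  qed
  show "f = g" if f: "hom C f A B" and g: "hom C g A B" and e: "Add C f f = Add C g g"
  proof (rule Fcat_eqI[OF f g])
    fix i k assume ik: "i < length B" "k < length A"
    have "2 * entry f i k = 2 * entry g i k"
      unfolding mult_2 entry_Add[OF f f ik, symmetric] entry_Add[OF g g ik, symmetric] e ..
    then show "entry f i k = entry g i k" using two_nonzero by simp
  qed
qed

lemma Psicat_eq: "Psicat u b = F.PC"
  by (simp add: Psicat_def equivariant_cat_def)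

lemma psi_exact_eq: "psi_exact u b E = F.PE"
  by (intro ext) (simp add: psi_exact_def equivariant_conf_def Psicat_eq)

end

section \<open>Projective covers, syzygies and the extension criterion\<close>

lemma pdeg_zeroI:
  assumes "narrow pi q" "point_le p q" "\<not> point_le p (sigma_pow (- 1) q)"
  shows "pdeg p q = 0"
  using pdeg_le_iff[OF assms(1), of p 0] pdeg_le_iff[OF assms(1), of p "- 1"] assms(2,3) by simp

text \<open>For width less than b, this is the rectangle of points above the syzygy point (y - b, x
  - b) but above neither (x, x - b) nor (y - b, y). A representative of Y there receives from the
  syzygy a basic morphism that factors through neither covering projective without a power of
  u.\<close>

definition crosses :: "real \<Rightarrow> real \<Rightarrow> real \<Rightarrow> point set \<Rightarrow> bool" where
  "crosses b x y Y \<longleftrightarrow> (\<exists>s t e. (s, t, e) \<in> Y \<and> y - b \<le> s \<and> s < x \<and> x - b \<le> t \<and> t < y)"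

text \<open>The two maximal boundary points below (x, y) are (x, x - b) and (y - b, y). They give
  the covering projectives, and their coordinatewise minimum (y - b, x - b) gives the
  kernel.\<close>

definition syz :: "real \<Rightarrow> real \<Rightarrow> real \<Rightarrow> point set" where
  "syz b x y = M_orb (y - b) (x - b)"

definition cov1 :: "real \<Rightarrow> real \<Rightarrow> real \<Rightarrow> point set" where
  "cov1 b x y = M_orb x (x - b)"

definition cov2 :: "real \<Rightarrow> real \<Rightarrow> real \<Rightarrow> point set" where
  "cov2 b x y = M_orb (y - b) y"

definition syz_mor :: "real \<Rightarrow> real \<Rightarrow> real \<Rightarrow> 'r::idom fmor" where
  "syz_mor b x y = mk_mor [syz b x y] [cov1 b x y, cov2 b x y] (\<lambda>i _. if i = 0 then 1 else - 1)"

definition cov_mor :: "real \<Rightarrow> real \<Rightarrow> real \<Rightarrow> 'r::idom fmor" where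
  "cov_mor b x y = mk_mor [cov1 b x y, cov2 b x y] [M_orb x y] (\<lambda>_ _. 1)"

context continuous_frobenius
begin

lemma point_in [simp]:
  "(y - b, x - b, Pos) \<in> syz b x y" "(x, x - b, Pos) \<in> cov1 b x y" "(y - b, y, Pos) \<in> cov2 b x y"
  by (simp_all add: syz_def cov1_def cov2_def M_orb_self)

lemma orbits_in [simp]:
  "\<bar>x - y\<bar> \<le> b \<Longrightarrow> syz b x y \<in> Xset b" "cov1 b x y \<in> Xset b" "cov2 b x y \<in> Xset b"
  using b_pos by (simp_all add: syz_def cov1_def cov2_def)

lemma bdry_cov: "bdry b (cov1 b x y)" "bdry b (cov2 b x y)"
proof -
  have "\<bar>x - (x - b)\<bar> = b" "\<bar>(y - b) - y\<bar> = b" using b_pos by simp_all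
  then show "bdry b (cov1 b x y)" "bdry b (cov2 b x y)"
    unfolding cov1_def cov2_def bdry_def by blast+
qed

text \<open>Take the representative of Q that lies below (x, y) with degree zero. Its coordinates
  differ by exactly b, so it lies below one of the two covering points, depending on which
  coordinate is larger.\<close>

lemma covering_factor:
  assumes Q: "bdry b Q" and xy: "\<bar>x - y\<bar> \<le> b"
  shows "cexp Q (cov1 b x y) (M_orb x y) = 0 \<or> cexp Q (cov2 b x y) (M_orb x y) = 0"
proof -
  let ?m = "(x, y, Pos)"
  have n: "narrow pi ?m" using xy b_le by (simp add: narrow_def)
  obtain q0 where q0: "q0 \<in> Q" using orbit_rep_mem[OF bdry_Xset[OF Q]] by blast
  define q where "q = sigma_pow (- pdeg q0 ?m) q0"
  have q: "q \<in> Q" using Xset_memD(2)[OF bdry_Xset[OF Q] q0] by (auto simp: q_def)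
  have d: "pdeg q ?m = 0" using pdeg_sigma_pow[OF n, of _ q0 0] by (simp add: q_def)
  obtain s t e where st: "q = (s, t, e)" by (cases q)
  have le: "s \<le> x" "t \<le> y" using pdeg_le_iff[OF n, of q 0] d by (auto simp: st point_le_def)
  have w: "\<bar>s - t\<bar> = b" using bdry_width[OF Q q] by (simp add: st)
  note m = M_orb_self[of x y]
  have M: "M_orb x y \<in> Xset b" using xy by simp
  show ?thesis
  proof (cases "t \<le> s")
    case True
    then have "point_le q (x, x - b, Pos)" "point_le (x, x - b, Pos) ?m"
      using w le xy by (auto simp: st point_le_def)
    then have "cexp Q (cov1 b x y) (M_orb x y) = 0"
      by (rule cexp_zeroI[OF bdry_Xset[OF Q] orbits_in(2)[of x y] M b_le q point_in(2) m _ _ d])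
    then show ?thesis by simp
  next
    case False
    then have "point_le q (y - b, y, Pos)" "point_le (y - b, y, Pos) ?m"
      using w le xy by (auto simp: st point_le_def)
    then have "cexp Q (cov2 b x y) (M_orb x y) = 0"
      by (rule cexp_zeroI[OF bdry_Xset[OF Q] orbits_in(3)[of x y] M b_le q point_in(3) m _ _ d])
    then show ?thesis by simp
  qed
qed

text \<open>The syzygy point is the meet of the two covering points, so its degree from W is the
  maximum of theirs. One of the two exponents out of the syzygy is therefore zero, and the equation
  can be divided by the smaller power of u.\<close>

lemma kernel_solution:
  assumes xy: "\<bar>x - y\<bar> < b" and W: "W \<in> Xset b"
    and e: "u ^ cexp W (cov1 b x y) (M_orb x y) * w1 + u ^ cexp W (cov2 b x y) (M_orb x y) * w2 = 0"
  shows "\<exists>v. u ^ cexp W (syz b x y) (cov1 b x y) * v = w1 \<and>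
    u ^ cexp W (syz b x y) (cov2 b x y) * (- v) = w2"
proof -
  let ?a = "(y - b, x - b, Pos)" and ?p = "(x, x - b, Pos)" and ?q = "(y - b, y, Pos)" and ?m = "(x, y, Pos)"
  have n: "narrow pi ?a" "narrow pi ?p" "narrow pi ?q" "narrow pi ?m"
    using xy b_le b_pos by (auto simp: narrow_def)
  obtain p0 where p0: "p0 \<in> W" using orbit_rep_mem[OF W] by blast
  have s: "pdeg ?p ?m = 0" "pdeg ?q ?m = 0" "pdeg ?a ?p = 0" "pdeg ?a ?q = 0"
    using xy b_le b_pos pi_gt_zero n
    by (auto intro!: pdeg_zeroI simp: point_le_def sigma_pow_eq)
  have xy': "\<bar>x - y\<bar> \<le> b" using xy by simp
  have M: "M_orb x y \<in> Xset b" using xy' by simp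
  define d1 d2 d d' where "d1 = pdeg p0 ?p" and "d2 = pdeg p0 ?q" and "d = pdeg p0 ?m"
    and "d' = pdeg p0 ?a"
  note Y = orbits_in(1)[OF xy'] orbits_in(2,3)[of x y]
  have c: "int (cexp W (cov1 b x y) (M_orb x y)) = d1 - d" "int (cexp W (cov2 b x y) (M_orb x y)) = d2 - d"
    "int (cexp W (syz b x y) (cov1 b x y)) = d' - d1" "int (cexp W (syz b x y) (cov2 b x y)) = d' - d2"
    using cexp_int[OF W Y(2) M b_le p0 point_in(2) M_orb_self] cexp_int[OF W Y(3) M b_le p0 point_in(3) M_orb_self]
      cexp_int[OF W Y(1) Y(2) b_le p0 point_in(1) point_in(2)]
      cexp_int[OF W Y(1) Y(3) b_le p0 point_in(1) point_in(3)] s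
    by (simp_all add: d1_def d2_def d_def d'_def)
  have "d' \<le> i \<longleftrightarrow> d1 \<le> i \<and> d2 \<le> i" for i
    unfolding d1_def d2_def d'_def pdeg_le_iff[OF n(1)] pdeg_le_iff[OF n(2)] pdeg_le_iff[OF n(3)]
    using xy by (cases p0) (auto simp: point_le_def sigma_pow_eq)
  then have d': "d' = max d1 d2" by (metis max.cobounded1 max.cobounded2 max.bounded_iff order.antisym order.refl)
  show ?thesis
  proof (cases "d2 \<le> d1")
    case True
    define k where "k = nat (d1 - d2)"
    have 1: "cexp W (syz b x y) (cov1 b x y) = 0" "cexp W (syz b x y) (cov2 b x y) = k"
      "cexp W (cov1 b x y) (M_orb x y) = cexp W (cov2 b x y) (M_orb x y) + k"
      using c d' True by (auto simp: k_def)
    have "u ^ cexp W (cov2 b x y) (M_orb x y) * (u ^ k * w1 + w2) = 0"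
      using e by (simp add: 1 power_add algebra_simps)
    then have "u ^ k * w1 + w2 = 0" using u_nonzero by simp
    then have "w2 = - (u ^ k * w1)" by (simp add: eq_neg_iff_add_eq_0 add.commute)
    then have "u ^ k * (- w1) = w2" by simp
    then show ?thesis by (intro exI[of _ w1]) (simp add: 1)
  next
    case False
    define k where "k = nat (d2 - d1)"
    have 1: "cexp W (syz b x y) (cov1 b x y) = k" "cexp W (syz b x y) (cov2 b x y) = 0"
      "cexp W (cov2 b x y) (M_orb x y) = cexp W (cov1 b x y) (M_orb x y) + k"
      using c d' False by (auto simp: k_def)
    have "u ^ cexp W (cov1 b x y) (M_orb x y) * (w1 + u ^ k * w2) = 0"
      using e by (simp add: 1 power_add algebra_simps)
    then have "w1 + u ^ k * w2 = 0" using u_nonzero by simp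
    then have "w1 = - (u ^ k * w2)" by (simp add: eq_neg_iff_add_eq_0)
    then have "u ^ k * (- w2) = w1" by simp
    then show ?thesis by (intro exI[of _ "- w2"]) (simp add: 1)
  qed
qed

lemma presentation_single:
  assumes xy: "\<bar>x - y\<bar> < b"
  shows "F.presentation [syz b x y] (syz_mor b x y) [cov1 b x y, cov2 b x y] (cov_mor b x y) [M_orb x y]"
proof -
  have xy': "\<bar>x - y\<bar> \<le> b" using xy by simp
  note Y = orbits_in(1)[OF xy'] orbits_in(2,3)[of x y]
  have M: "M_orb x y \<in> Xset b" using xy' by simp
  let ?S = "[syz b x y]" and ?P = "[cov1 b x y, cov2 b x y]" and ?M = "[M_orb x y]"
  let ?k = "syz_mor b x y :: 'r fmor" and ?r = "cov_mor b x y :: 'r fmor"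
  have ob: "?S \<in> Ob C" "?P \<in> Ob C" "?M \<in> Ob C" using Y M by (auto simp: Fcat_Ob)
  have k: "hom C ?k ?S ?P" and r: "hom C ?r ?P ?M" using Y M by (auto simp: syz_mor_def cov_mor_def)
  have ent: "entry ?k 0 0 = 1" "entry ?k (Suc 0) 0 = - 1" "entry ?r 0 0 = 1" "entry ?r 0 (Suc 0) = 1"
    by (simp_all add: syz_mor_def cov_mor_def)
  let ?a = "(y - b, x - b, Pos)" and ?p = "(x, x - b, Pos)" and ?q = "(y - b, y, Pos)" and ?m = "(x, y, Pos)"
  have n: "narrow pi ?a" "narrow pi ?p" "narrow pi ?q" "narrow pi ?m"
    using xy b_le b_pos by (auto simp: narrow_def)
  have s: "pdeg ?p ?m = 0" "pdeg ?q ?m = 0" "pdeg ?a ?p = 0" "pdeg ?a ?q = 0"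
    using xy b_le b_pos pi_gt_zero n by (auto intro!: pdeg_zeroI simp: point_le_def sigma_pow_eq)
  have "int (cexp (syz b x y) (cov1 b x y) (M_orb x y)) = int (cexp (syz b x y) (cov2 b x y) (M_orb x y))"
    using cexp_int[OF Y(1) Y(2) M b_le point_in(1) point_in(2) M_orb_self]
      cexp_int[OF Y(1) Y(3) M b_le point_in(1) point_in(3) M_orb_self] s by simp
  then have eq: "cexp (syz b x y) (cov1 b x y) (M_orb x y) = cexp (syz b x y) (cov2 b x y) (M_orb x y)"
    by simp
  have rk: "Cmp C ?r ?k = Zer C ?S ?M"
    by (rule Fcat_eqI[OF F.cmp_hom[OF k r] F.zer_hom[OF ob(1,3)]])
      (simp add: entry_Cmp[OF k r] ent Fcat_Zer eq)
  have "F.is_ker ?S ?k ?P ?r ?M"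
    unfolding F.is_ker_def
  proof (intro conjI allI impI)
    show "hom C ?k ?S ?P" "hom C ?r ?P ?M" "Cmp C ?r ?k = Zer C ?S ?M" using k r rk by blast+
    fix W w assume w: "hom C w W ?P" "Cmp C ?r w = Zer C W ?M"
    have W: "W ! l \<in> Xset b" if "l < length W" for l using that w(1) by (auto simp: Fcat_hom)
    have "\<exists>v. u ^ cexp (W ! l) (syz b x y) (cov1 b x y) * v = entry w 0 l \<and>
      u ^ cexp (W ! l) (syz b x y) (cov2 b x y) * (- v) = entry w (Suc 0) l" if l: "l < length W" for l
    proof (rule kernel_solution[OF xy W[OF l]])
      have "entry (Cmp C ?r w) 0 l = 0" using w(2) l by (simp add: Fcat_Zer)
      then show "u ^ cexp (W ! l) (cov1 b x y) (M_orb x y) * entry w 0 l +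
        u ^ cexp (W ! l) (cov2 b x y) (M_orb x y) * entry w (Suc 0) l = 0"
        using l by (simp add: entry_Cmp[OF w(1) r] ent)
    qed
    then obtain v where v: "\<And>l. l < length W \<Longrightarrow>
      u ^ cexp (W ! l) (syz b x y) (cov1 b x y) * v l = entry w 0 l \<and>
      u ^ cexp (W ! l) (syz b x y) (cov2 b x y) * (- v l) = entry w (Suc 0) l" by metis
    define V where "V = mk_mor W ?S (\<lambda>_ l. v l)"
    have V: "hom C V W ?S" using w(1) Y by (auto simp: V_def Fcat_hom mk_mor_def)
    have cV: "entry (Cmp C ?k f) i l =
        (if i = 0 then u ^ cexp (W ! l) (syz b x y) (cov1 b x y) * entry f 0 l
         else u ^ cexp (W ! l) (syz b x y) (cov2 b x y) * (- entry f 0 l))"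
      if "hom C f W ?S" "i < 2" "l < length W" for f i l
      using that entry_Cmp[OF that(1) k] ent by (auto simp: less_2_cases_iff)
    have "Cmp C ?k V = w"
    proof (rule Fcat_eqI[OF F.cmp_hom[OF V k] w(1)])
      fix i l assume il: "i < length ?P" "l < length W"
      then have "i = 0 \<or> i = Suc 0" by auto
      then show "entry (Cmp C ?k V) i l = entry w i l"
        using cV[OF V _ il(2)] v[OF il(2)] il by (auto simp: V_def)
    qed
    moreover have "f = V" if f: "hom C f W ?S" "Cmp C ?k f = w" for f
    proof (rule Fcat_eqI[OF f(1) V])
      fix i l assume il: "i < length ?S" "l < length W"
      have "u ^ cexp (W ! l) (syz b x y) (cov1 b x y) * entry f 0 l =
          u ^ cexp (W ! l) (syz b x y) (cov1 b x y) * entry V 0 l"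
        using cV[OF f(1) _ il(2), of 0] cV[OF V _ il(2), of 0] f(2) \<open>Cmp C ?k V = w\<close> by simp
      then show "entry f i l = entry V i l" using u_nonzero il by simp
    qed
    ultimately show "\<exists>!v. hom C v W ?S \<and> Cmp C ?k v = w" using V by blast
  qed
  moreover have "F.proj ?P" using bdry_cov by (simp add: proj_iff)
  moreover have "\<exists>g. hom C g Q ?P \<and> Cmp C ?r g = f" if Q: "F.proj Q" and f: "hom C f Q ?M" for Q f
  proof -
    let ?c = "\<lambda>l. cexp (Q ! l) (cov1 b x y) (M_orb x y) = 0"
    \<comment> \<open>For each summand of Q, the coefficient goes to the first covering projective
      if the exponent there is zero and to the second otherwise; \<open>(i = 0) = ?c l\<close>
      encodes the choice.\<close>
    define g where "g = mk_mor Q ?P (\<lambda>i l. if (i = 0) = ?c l then entry f 0 l else 0)"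
    have g: "hom C g Q ?P" using f Y by (auto simp: g_def Fcat_hom mk_mor_def)
    have entg: "entry g 0 l = (if ?c l then entry f 0 l else 0)"
      "entry g (Suc 0) l = (if ?c l then 0 else entry f 0 l)" if "l < length Q" for l
      using that by (simp_all add: g_def)
    have "Cmp C ?r g = f"
    proof (rule Fcat_eqI[OF F.cmp_hom[OF g r] f])
      fix i l assume il: "i < length ?M" "l < length Q"
      have "bdry b (Q ! l)" using Q il by (simp add: proj_iff)
      then have "?c l \<or> cexp (Q ! l) (cov2 b x y) (M_orb x y) = 0"
        by (rule covering_factor[OF _ xy'])
      then show "entry (Cmp C ?r g) i l = entry f i l"
        using il by (auto simp: entry_Cmp[OF g r] ent entg)
    qed
    then show ?thesis using g by blast
  qed
  ultimately show ?thesis unfolding F.presentation_def by blast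
qed

text \<open>Let the representative of Y have degree zero from the syzygy. The morphism to it factors
  through a covering projective without loss iff it lies above that covering point; otherwise it
  lies in the rectangle of \<open>crosses\<close>.\<close>

lemma cexp_cov_iff:
  assumes xy: "\<bar>x - y\<bar> < b" and b: "b < pi" and Y: "Y \<in> Xset b"
  shows "cexp (syz b x y) (cov1 b x y) Y = 0 \<or> cexp (syz b x y) (cov2 b x y) Y = 0 \<longleftrightarrow>
    \<not> crosses b x y Y"
proof -
  have xy': "\<bar>x - y\<bar> \<le> b" using xy by simp
  note X = orbits_in(1)[OF xy'] orbits_in(2,3)[of x y]
  let ?a = "(y - b, x - b, Pos)" and ?p = "(x, x - b, Pos)" and ?q = "(y - b, y, Pos)"
  have n: "narrow pi ?a" "narrow pi ?p" "narrow pi ?q"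
    using xy b_le b_pos by (auto simp: narrow_def)
  have s: "pdeg ?a ?p = 0" "pdeg ?a ?q = 0"
    using xy b_le b_pos pi_gt_zero n by (auto intro!: pdeg_zeroI simp: point_le_def sigma_pow_eq)
  \<comment> \<open>The chain belonging to a zero exponent ends in the representative st, because
    its degree is fixed, and passes through a nonnegative shift of P, which is above P.\<close>
  have key: "point_le P st"
    if st: "st \<in> Y" "pdeg ?a st = 0" and P: "P \<in> Z" "pdeg ?a P = 0" "narrow pi P"
      and Z: "Z \<in> Xset b" "cexp (syz b x y) Z Y = 0" for st P Z
  proof -
    have nst: "narrow pi st" using Xset_memD(1)[OF Y st(1)] b_le narrow_mono by blast
    obtain q r where qr: "q \<in> Z" "r \<in> Y" "point_le ?a q" "point_le q r" "pdeg ?a r = 0"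
      using cexp_zeroD[OF X(1) Z(1) Y b_le point_in(1) Z(2)] .
    obtain i where i: "r = sigma_pow i st" using Xset_memD(2)[OF Y st(1)] qr by blast
    have "i = 0" using pdeg_sigma_pow[OF nst, of 0 ?a i] st(2) qr(5) i by simp
    then have r: "r = st" using i by simp
    obtain j where j: "q = sigma_pow j P" using Xset_memD(2)[OF Z(1) P(1)] qr by blast
    have "0 \<le> j" using pdeg_le_iff[OF P(3), of ?a j] P(2) qr(3) j by simp
    then have "point_le P q" using point_le_sigma_pow_mono[OF P(3), of 0 j] j by simp
    then show ?thesis using point_le_trans qr(4) r by blast
  qed
  show ?thesis
  proof
    assume c: "cexp (syz b x y) (cov1 b x y) Y = 0 \<or> cexp (syz b x y) (cov2 b x y) Y = 0"
    show "\<not> crosses b x y Y"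
    proof
      assume "crosses b x y Y"
      then obtain s0 t e where st: "(s0, t, e) \<in> Y" "y - b \<le> s0" "s0 < x" "x - b \<le> t" "t < y"
        by (auto simp: crosses_def)
      have "narrow pi (s0, t, e)" using Xset_memD(1)[OF Y st(1)] b_le narrow_mono by blast
      \<comment> \<open>Since b < pi, moving a point of the rectangle down by \<open>sigma\<close>
        brings its first coordinate below y - b.\<close>
      then have "pdeg ?a (s0, t, e) = 0"
        by (rule pdeg_zeroI) (use st b in \<open>auto simp: point_le_def sigma_pow_eq\<close>)
      then have "point_le ?p (s0, t, e) \<or> point_le ?q (s0, t, e)"
        using c key[OF st(1) _ point_in(2) s(1) n(2) X(2)] key[OF st(1) _ point_in(3) s(2) n(3) X(3)]
        by blast
      then show False using st by (auto simp: point_le_def)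
    qed
  next
    assume nc: "\<not> crosses b x y Y"
    obtain y0 where y0: "y0 \<in> Y" using orbit_rep_mem[OF Y] by blast
    define st where "st = sigma_pow (pdeg ?a y0) y0"
    have ny: "narrow pi y0" using Xset_memD(1)[OF Y y0] b_le narrow_mono by blast
    have stY: "st \<in> Y" using Xset_memD(2)[OF Y y0] by (auto simp: st_def)
    have d: "pdeg ?a st = 0" using pdeg_sigma_pow[OF ny, of 0 ?a "pdeg ?a y0"] by (simp add: st_def)
    have nst: "narrow pi st" using ny by (simp add: st_def)
    obtain s0 t e where ste: "st = (s0, t, e)" by (cases st)
    have ge: "y - b \<le> s0" "x - b \<le> t"
      using pdeg_le_iff[OF nst, of ?a 0] d by (auto simp: ste point_le_def)
    then have "x \<le> s0 \<or> y \<le> t" using nc stY unfolding crosses_def ste by force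
    then show "cexp (syz b x y) (cov1 b x y) Y = 0 \<or> cexp (syz b x y) (cov2 b x y) Y = 0"
    proof
      assume "x \<le> s0"
      then have "point_le ?a ?p" "point_le ?p st" using ge xy by (auto simp: point_le_def ste)
      then show ?thesis by (intro disjI1 cexp_zeroI[OF X(1,2) Y b_le point_in(1,2) stY _ _ d])
    next
      assume "y \<le> t"
      then have "point_le ?a ?q" "point_le ?q st" using ge xy by (auto simp: point_le_def ste)
      then show ?thesis by (intro disjI2 cexp_zeroI[OF X(1,3) Y b_le point_in(1,3) stY _ _ d])
    qed
  qed
qed

text \<open>The summands of B are independent, and each of them poses the scalar equation of
  \<open>exists_coefficient_iff\<close>.\<close>

lemma extension_iff:
  assumes xy: "\<bar>x - y\<bar> < b" and b: "b < pi" and B: "set B \<subseteq> Xset b"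
  shows "(\<forall>g. hom C g [syz b x y] B \<longrightarrow>
      (\<exists>h. hom C h [cov1 b x y, cov2 b x y] B \<and> Cmp C h (syz_mor b x y) = g)) \<longleftrightarrow>
    (\<forall>Y\<in>set B. \<not> crosses b x y Y)"
proof -
  have xy': "\<bar>x - y\<bar> \<le> b" using xy by simp
  note X = orbits_in(1)[OF xy'] orbits_in(2,3)[of x y]
  let ?S = "[syz b x y]" and ?P = "[cov1 b x y, cov2 b x y]"
  let ?k = "syz_mor b x y :: 'r fmor"
  have k: "hom C ?k ?S ?P" using X by (auto simp: syz_mor_def)
  have ent: "entry ?k 0 0 = 1" "entry ?k (Suc 0) 0 = - 1" by (simp_all add: syz_mor_def)
  let ?c1 = "\<lambda>i. cexp (syz b x y) (cov1 b x y) (B ! i)" and ?c2 = "\<lambda>i. cexp (syz b x y) (cov2 b x y) (B ! i)"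
  have comp: "entry (Cmp C h ?k) i 0 = u ^ ?c1 i * entry h i 0 - u ^ ?c2 i * entry h i (Suc 0)"
    if "hom C h ?P B" "i < length B" for h i
    using entry_Cmp[OF k that(1) that(2), of 0] ent by simp
  have Bi: "B ! i \<in> Xset b" if "i < length B" for i using that B by auto
  show ?thesis
  proof
    assume L: "\<forall>g. hom C g ?S B \<longrightarrow> (\<exists>h. hom C h ?P B \<and> Cmp C h ?k = g)"
    show "\<forall>Y\<in>set B. \<not> crosses b x y Y"
    proof
      fix Y assume "Y \<in> set B"
      then obtain i where i: "i < length B" "Y = B ! i" by (auto simp: in_set_conv_nth)
      have "\<forall>g. \<exists>h h'. u ^ ?c1 i * h - u ^ ?c2 i * h' = g"
      proof
        fix g0 :: 'r
        have "hom C (mk_mor ?S B (\<lambda>_ _. g0)) ?S B" using B X by simp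
        then obtain h where h: "hom C h ?P B" "Cmp C h ?k = mk_mor ?S B (\<lambda>_ _. g0)" using L by blast
        show "\<exists>h h'. u ^ ?c1 i * h - u ^ ?c2 i * h' = g0" using comp[OF h(1) i(1)] h(2) i(1) by auto
      qed
      then show "\<not> crosses b x y Y"
        using exists_coefficient_iff cexp_cov_iff[OF xy b Bi[OF i(1)]] i(2) by simp
    qed
  next
    assume R: "\<forall>Y\<in>set B. \<not> crosses b x y Y"
    show "\<forall>g. hom C g ?S B \<longrightarrow> (\<exists>h. hom C h ?P B \<and> Cmp C h ?k = g)"
    proof (intro allI impI)
      fix g assume g: "hom C g ?S B"
      have "\<exists>h h'. u ^ ?c1 i * h - u ^ ?c2 i * h' = entry g i 0" if "i < length B" for i
        using exists_coefficient_iff[of "?c1 i" "?c2 i"] cexp_cov_iff[OF xy b Bi[OF that]] R that by simp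
      then obtain h h' where hh: "\<And>i. i < length B \<Longrightarrow> u ^ ?c1 i * h i - u ^ ?c2 i * h' i = entry g i 0"
        by metis
      define H where "H = mk_mor ?P B (\<lambda>i k. if k = 0 then h i else h' i)"
      have H: "hom C H ?P B" using X B by (simp add: H_def)
      have "Cmp C H ?k = g"
        by (rule Fcat_eqI[OF F.cmp_hom[OF k H] g]) (simp add: comp[OF H] hh, simp add: H_def hh)
      then show "\<exists>h. hom C h ?P B \<and> Cmp C h ?k = g" using H by blast
    qed
  qed
qed

end

text \<open>\<open>psi\<close> and \<open>sigma\<close> both translate by pi, so the first followed
  by the inverse of the second merely exchanges the coordinates and the sign.\<close>

lemma psi_orbit_swap: "X \<in> Xset b \<Longrightarrow> (s, t, e) \<in> X \<Longrightarrow> (t, s, opp e) \<in> psi_orbit X"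
proof -
  assume X: "X \<in> Xset b" and m: "(s, t, e) \<in> X"
  have "(s + pi, t + pi, e) \<in> psi_orbit X" using m by (force simp: psi_orbit_def)
  moreover have "(t, s, opp e) = sigma_pow (- 1) (s + pi, t + pi, e)" by (simp add: sigma_pow_eq)
  ultimately show ?thesis using Xset_memD(2)[OF psi_Xset[OF X]] by blast
qed

lemma cexp_iso:
  assumes "X \<in> Xset b" "Y \<in> Xset b" "Z \<in> Xset b" "b \<le> pi" "(s, t, e) \<in> X" "(s, t, e') \<in> Y"
  shows "cexp X Y Z = 0" "cexp Z X Y = 0"
proof -
  obtain r where r: "r \<in> Z" using orbit_rep_mem[OF assms(3)] by blast
  let ?p = "(s, t, e)" and ?q = "(s, t, e')"
  have n: "narrow pi ?p" "narrow pi ?q" "narrow pi r"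
    using assms r Xset_memD(1) narrow_mono by metis+
  have "pdeg ?p v = pdeg ?q v" for v by (simp add: pdeg_def point_le_def)
  moreover have "pdeg v ?p = pdeg v ?q" if "narrow pi v" for v
  proof (rule pdeg_eqI[OF n(1)])
    show "point_le v (sigma_pow i ?p) \<longleftrightarrow> pdeg v ?q \<le> i" for i
      unfolding pdeg_le_iff[OF n(2)] by (auto simp: point_le_def sigma_pow_eq)
  qed
  ultimately show "cexp X Y Z = 0" "cexp Z X Y = 0"
    using cexp_int[OF assms(1,2,3,4,5,6) r] cexp_int[OF assms(3,1,2,4) r assms(5,6)]
      pdeg_self[OF n(1)] pdeg_self[OF n(2)] n(3) by simp_all
qed

section \<open>Extensions of regular and singular objects\<close>

context continuous_frobenius
begin

lemma S_mor: "X \<in> Xset b \<Longrightarrow> snd (S_obj [X] :: 'r psiobj) =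
    mk_mor [psi_orbit X, X] [X, psi_orbit X] (\<lambda>i k. if i = k then 0 else 1)"
  using psi_psi[of X b]
  by (auto simp: S_obj_def psi_obj_def Let_def mk_mor_def less_Suc_eq intro!: eq_matI)

lemma free_S:
  assumes X: "X \<in> Xset b"
  shows "F.is_free (S_obj [X]) [X] (inl_mor [X] [psi_orbit X]) (inr_mor [X] [psi_orbit X])
    (prl_mor [X] [psi_orbit X]) (prr_mor [X] [psi_orbit X])"
proof -
  let ?Y = "psi_orbit X"
  let ?i = "inl_mor [X] [?Y] :: 'r fmor" and ?j = "inr_mor [X] [?Y] :: 'r fmor"
  let ?p = "prl_mor [X] [?Y] :: 'r fmor" and ?q = "prr_mor [X] [?Y] :: 'r fmor"
  have Y: "?Y \<in> Xset b" using psi_Xset[OF X] .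
  have po: "psi_obj [X] = [?Y]" "psi_obj [?Y] = [X]" "psi_obj [X, ?Y] = [?Y, X]"
    using psi_psi[OF X] by (simp_all add: psi_obj_def)
  have b: "F.is_biproduct ([X] @ [?Y]) [X] [?Y] ?i ?j ?p ?q"
    using X Y by (intro Fcat_biproduct[OF b_le]) simp_all
  then have h: "hom C ?i [X] [X, ?Y]" "hom C ?j [?Y] [X, ?Y]" "hom C ?p [X, ?Y] [X]" "hom C ?q [X, ?Y] [?Y]"
    by (simp_all add: F.is_biproduct_def)
  have pq: "hom C (psi_mor ?q) [?Y, X] [X]" "hom C (psi_mor ?p) [?Y, X] [?Y]"
    using psi_mor_hom[OF h(4)] psi_mor_hom[OF h(3)] po by simp_all
  note c = F.cmp_hom[OF pq(1) h(1)] F.cmp_hom[OF pq(2) h(2)]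
  let ?S = "S_obj [X] :: 'r psiobj"
  have S: "hom C (snd ?S) [?Y, X] [X, ?Y]" unfolding S_mor[OF X] using X Y by simp
  have "snd ?S = Add C (Cmp C ?i (psi_mor ?q)) (Cmp C ?j (psi_mor ?p))"
  proof (rule Fcat_eqI[OF S F.add_hom[OF c]])
    fix i k assume ik: "i < length [X, ?Y]" "k < length [?Y, X]"
    have "entry (snd ?S) i k = (if i = k then 0 else 1)"
      using ik by (simp add: S_mor[OF X])
    moreover have "i = 0 \<or> i = Suc 0" "k = 0 \<or> k = Suc 0" using ik by auto
    ultimately show "entry (snd ?S) i k = entry (Add C (Cmp C ?i (psi_mor ?q)) (Cmp C ?j (psi_mor ?p))) i k"
      unfolding entry_Add[OF c ik]
      using ik by (auto simp: entry_Cmp[OF pq(1) h(1)] entry_Cmp[OF pq(2) h(2)] cexp_refl X Y)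
  qed
  then show ?thesis
    unfolding F.is_free_def using X b po by (simp add: Fcat_Ob S_obj_def)
qed

lemma S_in_PC: "X \<in> Xset b \<Longrightarrow> S_obj [X] \<in> Ob F.PC"
  using F.is_free_swap(5)[OF free_S] .

lemma fst_S: "fst (S_obj [X]) = [X, psi_orbit X]"
  by (simp add: S_obj_def psi_obj_def)

lemma Ext1_S_iff:
  assumes xy: "\<bar>x - y\<bar> < b" and b: "b < pi" and B: "B \<in> Ob F.PC"
  shows "Ext1_vanishes F.PC F.PE (S_obj [M_orb x y]) B \<longleftrightarrow> (\<forall>Y\<in>set (fst B). \<not> crosses b x y Y)"
proof -
  have X: "M_orb x y \<in> Xset b" using xy by simp
  have "set (fst B) \<subseteq> Xset b" using F.PC_ob(1)[OF B] by (simp add: Fcat_Ob)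
  then show ?thesis
    using F.Ext1_vanishes_free[OF free_S[OF X] B presentation_single[OF xy]] extension_iff[OF xy b]
    by simp
qed

lemma Z_mor: "snd (Z_obj e x :: 'r psiobj) =
    mk_mor (psi_obj [M_orb x x]) [M_orb x x] (\<lambda>_ _. sign_val e)"
  by (auto simp: Z_obj_def mk_mor_def intro!: eq_matI)

lemma sign_val_square [simp]: "sign_val e * sign_val e = (1::'r)"
  by (cases e) auto

lemma fst_Z [simp]: "fst (Z_obj e x) = [M_orb x x]"
  by (simp add: Z_obj_def)

lemma M_diag [simp]: "M_orb x x \<in> Xset b"
  using b_pos by simp

lemma psi_M_diag [simp]: "psi_orbit (M_orb x x) \<in> Xset b"
  using psi_Xset[OF M_diag] .

text \<open>On the diagonal the exchange of coordinates does nothing, so \<open>psi\<close> changes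
  only the sign, which the order ignores. This makes the basic morphism zeta an isomorphism.\<close>

lemma psi_diag_mem: "(x, x, Neg) \<in> psi_orbit (M_orb x x)"
  using psi_orbit_swap[OF M_diag M_orb_self[of x x]] by simp

lemma cexp_diag [simp]:
  "Z \<in> Xset b \<Longrightarrow> cexp (psi_orbit (M_orb x x)) (M_orb x x) Z = 0"
  "Z \<in> Xset b \<Longrightarrow> cexp (M_orb x x) (psi_orbit (M_orb x x)) Z = 0"
  "Z \<in> Xset b \<Longrightarrow> cexp Z (psi_orbit (M_orb x x)) (M_orb x x) = 0"
  using cexp_iso[OF psi_M_diag M_diag _ b_le psi_diag_mem M_orb_self]
    cexp_iso[OF M_diag psi_M_diag _ b_le M_orb_self psi_diag_mem] by blast+

lemma Z_in_PC: "(Z_obj e x :: 'r psiobj) \<in> Ob F.PC"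
proof -
  let ?M = "M_orb x x"
  let ?xi = "mk_mor (psi_obj [?M]) [?M] (\<lambda>_ _. sign_val e) :: 'r fmor"
  have ob: "[?M] \<in> Ob C" by (simp add: Fcat_Ob)
  have po: "psi_obj [?M] = [psi_orbit ?M]" by (simp add: psi_obj_def)
  have x: "hom C ?xi (psi_obj [?M]) [?M]" by (simp add: po)
  have px: "hom C (psi_mor ?xi) [?M] (psi_obj [?M])"
    using psi_mor_hom[OF x] F.po_po[OF ob] by simp
  have "Cmp C ?xi (psi_mor ?xi) = Idt C [?M]"
  proof (rule Fcat_eqI[OF F.cmp_hom[OF px x] F.idt_hom[OF ob]])
    fix i k assume ik: "i < length [?M]" "k < length [?M]"
    show "entry (Cmp C ?xi (psi_mor ?xi)) i k = entry (Idt C [?M]) i k"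
      unfolding entry_Cmp[OF px x ik] using ik by (simp add: Fcat_Idt po)
  qed
  moreover have "(Z_obj e x :: 'r psiobj) = ([?M], ?xi)"
    using Z_mor[of e x] by (simp add: prod_eq_iff)
  ultimately show ?thesis using F.PC_obI[OF ob x] by simp
qed

text \<open>For the single coefficient a, equivariance says that multiplication by the two signs
  gives the same result; for opposite signs this is 2 a = 0.\<close>

lemma Z_hom_iff: "hom F.PC f (Z_obj e x) (Z_obj e' x') \<longleftrightarrow>
    hom C f [M_orb x x] [M_orb x' x'] \<and> (entry f 0 0 = 0 \<or> e = e')"
proof -
  let ?M = "M_orb x x" and ?N = "M_orb x' x'"
  let ?z = "Z_obj e x :: 'r psiobj" and ?z' = "Z_obj e' x' :: 'r psiobj"
  have ob: "[?M] \<in> Ob C" "[?N] \<in> Ob C" by (simp_all add: Fcat_Ob)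
  have po: "psi_obj [?M] = [psi_orbit ?M]" "psi_obj [?N] = [psi_orbit ?N]" by (simp_all add: psi_obj_def)
  have zz: "hom C (snd ?z) (psi_obj [?M]) [?M]" "hom C (snd ?z') (psi_obj [?N]) [?N]"
    unfolding Z_mor by (simp_all add: po)
  have ent: "entry (snd ?z) 0 0 = sign_val e" "entry (snd ?z') 0 0 = sign_val e'"
    unfolding Z_mor by (simp_all add: po)
  have s: "entry f 0 0 * sign_val e = sign_val e' * entry f 0 0 \<longleftrightarrow> entry f 0 0 = 0 \<or> e = e'"
  proof -
    have "a = - a \<longleftrightarrow> a = 0" for a :: 'r
      using two_nonzero by (simp add: eq_neg_iff_add_eq_0 flip: mult_2)
    moreover from this have "- a = a \<longleftrightarrow> a = 0" for a :: 'r by metis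
    ultimately show ?thesis using sign.exhaust by (cases e; cases e') simp_all
  qed
  have "Cmp C f (snd ?z) = Cmp C (snd ?z') (psi_mor f) \<longleftrightarrow> entry f 0 0 = 0 \<or> e = e'"
    if f: "hom C f [?M] [?N]"
  proof -
    note pf = psi_mor_hom[OF f]
    note c = F.cmp_hom[OF zz(1) f] F.cmp_hom[OF pf zz(2)]
    have e1: "entry (Cmp C f (snd ?z)) 0 0 = entry f 0 0 * sign_val e"
      using ent by (simp add: entry_Cmp[OF zz(1) f] po)
    have e2: "entry (Cmp C (snd ?z') (psi_mor f)) 0 0 = sign_val e' * entry f 0 0"
      using ent by (simp add: entry_Cmp[OF pf zz(2)] po)
    have "Cmp C f (snd ?z) = Cmp C (snd ?z') (psi_mor f)" if "entry f 0 0 = 0 \<or> e = e'"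
      by (rule Fcat_eqI[OF c]) (use that s e1 e2 po in simp)
    then show ?thesis using s e1 e2 by auto
  qed
  then show ?thesis unfolding F.PC_hom using Z_in_PC by auto
qed

lemma Ext1_Z_vanishesI:
  assumes b: "b < pi" and B: "B \<in> Ob F.PC" and nc: "\<forall>Y\<in>set (fst B). \<not> crosses b x x Y"
  shows "Ext1_vanishes F.PC F.PE (Z_obj e x) B"
proof -
  have xx: "\<bar>x - x\<bar> < b" using b_pos by simp
  have B': "set (fst B) \<subseteq> Xset b" using F.PC_ob(1)[OF B] by (simp add: Fcat_Ob)
  have "F.presentation [syz b x x] (syz_mor b x x) [cov1 b x x, cov2 b x x] (cov_mor b x x)
      (fst (Z_obj e x :: 'r psiobj))"
    using presentation_single[OF xx] by simp
  then show ?thesis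
    by (rule F.Ext1_vanishesI[OF Z_in_PC B]) (use extension_iff[OF xx b B'] nc in blast)
qed

definition Z_cover :: "sign \<Rightarrow> real \<Rightarrow> 'r psiobj" where
  "Z_cover e x = ([cov1 b x x, cov2 b x x],
     mk_mor (psi_obj [cov1 b x x, cov2 b x x]) [cov1 b x x, cov2 b x x]
       (\<lambda>i k. if i = k then 0 else sign_val e))"

text \<open>The covering of \<open>Z\<^sub>\<epsilon>(x)\<close> is equivariant for \<open>\<epsilon>\<close> times the swap of its two summands, which
  makes the kernel \<open>(1, - 1)\<close> a singular object of the opposite sign.\<close>

lemma Z_presentation:
  shows "Z_cover e x \<in> Ob F.PC"
    and "hom F.PC (cov_mor b x x) (Z_cover e x) (Z_obj e x)"
    and "hom F.PC (syz_mor b x x) (Z_obj (opp e) (x - b)) (Z_cover e x)"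
proof -
  let ?P1 = "cov1 b x x" and ?P2 = "cov2 b x x" and ?S = "M_orb (x - b) (x - b)" and ?M = "M_orb x x"
  let ?P = "[?P1, ?P2]"
  let ?xi = "mk_mor (psi_obj ?P) ?P (\<lambda>i k. if i = k then 0 else sign_val e) :: 'r fmor"
  have X: "?P1 \<in> Xset b" "?P2 \<in> Xset b" by simp_all
  have pX: "psi_orbit ?P1 \<in> Xset b" "psi_orbit ?P2 \<in> Xset b" using psi_Xset X by blast+
  have ob: "?P \<in> Ob C" using X by (simp add: Fcat_Ob)
  have po: "psi_obj ?P = [psi_orbit ?P1, psi_orbit ?P2]" "psi_obj [?S] = [psi_orbit ?S]"
    "psi_obj [?M] = [psi_orbit ?M]" "psi_obj [psi_orbit ?P1, psi_orbit ?P2] = ?P"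
    using psi_psi[OF X(1)] psi_psi[OF X(2)] by (simp_all add: psi_obj_def)
  \<comment> \<open>Over the diagonal, \<open>psi\<close> carries each covering projective to one
    isomorphic to the other, so the swap makes sense.\<close>
  have m: "(x - b, x, Neg) \<in> psi_orbit ?P1" "(x, x - b, Neg) \<in> psi_orbit ?P2"
    using psi_orbit_swap[OF X(1) point_in(2)] psi_orbit_swap[OF X(2) point_in(3)] by simp_all
  have z: "cexp Z (psi_orbit ?P1) ?P2 = 0" "cexp Z (psi_orbit ?P2) ?P1 = 0"
    "cexp (psi_orbit ?P1) ?P2 Z = 0" "cexp (psi_orbit ?P2) ?P1 Z = 0" if "Z \<in> Xset b" for Z
    using cexp_iso[OF pX(1) X(2) that b_le m(1) point_in(3)] cexp_iso[OF pX(2) X(1) that b_le m(2) point_in(2)]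
    by simp_all
  have xi: "hom C ?xi (psi_obj ?P) ?P" using X pX po by simp
  have pxi: "hom C (psi_mor ?xi) ?P (psi_obj ?P)" using psi_mor_hom[OF xi] F.po_po[OF ob] by simp
  have two_cases: "i = 0 \<or> i = Suc 0" if "i < length ?P" for i using that by auto
  have "Cmp C ?xi (psi_mor ?xi) = Idt C ?P"
  proof (rule Fcat_eqI[OF F.cmp_hom[OF pxi xi] F.idt_hom[OF ob]])
    fix i k assume ik: "i < length ?P" "k < length ?P"
    show "entry (Cmp C ?xi (psi_mor ?xi)) i k = entry (Idt C ?P) i k"
      unfolding entry_Cmp[OF pxi xi ik] using two_cases[OF ik(1)] two_cases[OF ik(2)]
      by (auto simp: Fcat_Idt po z X)
  qed
  from F.PC_obI[OF ob xi this] show PZ: "Z_cover e x \<in> Ob F.PC" by (simp add: Z_cover_def)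
  let ?r = "cov_mor b x x :: 'r fmor" and ?k = "syz_mor b x x :: 'r fmor"
  have r: "hom C ?r ?P [?M]" and k: "hom C ?k [?S] ?P"
    using X by (simp_all add: cov_mor_def syz_mor_def syz_def)
  have entr: "entry ?r 0 0 = 1" "entry ?r 0 (Suc 0) = 1" "entry ?k 0 0 = 1" "entry ?k (Suc 0) 0 = - 1"
    by (simp_all add: cov_mor_def syz_mor_def)
  let ?zm = "mk_mor (psi_obj [?M]) [?M] (\<lambda>_ _. sign_val e) :: 'r fmor"
  let ?zs = "mk_mor (psi_obj [?S]) [?S] (\<lambda>_ _. sign_val (opp e)) :: 'r fmor"
  have zm: "hom C ?zm (psi_obj [?M]) [?M]" and zs: "hom C ?zs (psi_obj [?S]) [?S]"
    by (simp_all add: po)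
  note pr = psi_mor_hom[OF r] note pk = psi_mor_hom[OF k]
  have "Cmp C ?r ?xi = Cmp C ?zm (psi_mor ?r)"
  proof (rule Fcat_eqI[OF F.cmp_hom[OF xi r] F.cmp_hom[OF pr zm]])
    fix i l assume il: "i < length [?M]" "l < length (psi_obj ?P)"
    have "l = 0 \<or> l = Suc 0" using il by auto
    then show "entry (Cmp C ?r ?xi) i l = entry (Cmp C ?zm (psi_mor ?r)) i l"
      unfolding entry_Cmp[OF xi r il] entry_Cmp[OF pr zm il] using il
      by (auto simp: po z entr pX)
  qed
  then show "hom F.PC ?r (Z_cover e x) (Z_obj e x)"
    unfolding F.PC_hom Z_mor using PZ Z_in_PC r by (simp add: Z_cover_def)
  have so: "sign_val (opp e) = (- sign_val e :: 'r)" by (cases e) auto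
  have "Cmp C ?k ?zs = Cmp C ?xi (psi_mor ?k)"
  proof (rule Fcat_eqI[OF F.cmp_hom[OF zs k] F.cmp_hom[OF pk xi]])
    fix i l assume il: "i < length ?P" "l < length (psi_obj [?S])"
    show "entry (Cmp C ?k ?zs) i l = entry (Cmp C ?xi (psi_mor ?k)) i l"
      unfolding entry_Cmp[OF zs k il] entry_Cmp[OF pk xi il] using two_cases[OF il(1)] il
      by (auto simp: po z entr so X)
  qed
  then show "hom F.PC ?k (Z_obj (opp e) (x - b)) (Z_cover e x)"
    unfolding F.PC_hom Z_mor using PZ Z_in_PC k by (simp add: Z_cover_def)
qed

lemma Ext1_Z_presentation:
  assumes "B \<in> Ob F.PC"
  shows "Ext1_vanishes F.PC F.PE (Z_obj e x) B \<longleftrightarrow>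
    (\<forall>g. hom F.PC g (Z_obj (opp e) (x - b)) B \<longrightarrow>
      (\<exists>h. hom F.PC h (Z_cover e x) B \<and> Cmp C h (syz_mor b x x) = g))"
proof (rule F.Ext1_vanishes_presentation[OF assms Z_presentation(3) Z_presentation(2)])
  have "\<bar>x - x\<bar> < b" using b_pos by simp
  from presentation_single[OF this]
  show "F.presentation (fst (Z_obj (opp e) (x - b) :: 'r psiobj)) (syz_mor b x x) (fst (Z_cover e x))
     (cov_mor b x x) (fst (Z_obj e x :: 'r psiobj))"
    by (simp add: Z_cover_def syz_def)
qed

text \<open>The presenting singular object has the sign opposite to that of the target, so the only
  equivariant morphism to be extended is zero.\<close>

lemma Ext1_Z_same: "Ext1_vanishes F.PC F.PE (Z_obj e x) (Z_obj e x')"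
  unfolding Ext1_Z_presentation[OF Z_in_PC]
proof (intro allI impI)
  fix g assume g: "hom F.PC g (Z_obj (opp e) (x - b)) (Z_obj e x')"
  let ?z = "Zer C (fst (Z_cover e x)) [M_orb x' x']"
  have z: "hom F.PC ?z (Z_cover e x) (Z_obj e x')"
    using F.P.zer_hom[OF Z_presentation(1) Z_in_PC[of e x']] by simp
  have g': "hom C g [M_orb (x - b) (x - b)] [M_orb x' x']" and "entry g 0 0 = 0 \<or> opp e = e"
    using g Z_hom_iff by blast+
  then have g0: "entry g 0 0 = 0" by (cases e) auto
  have "Cmp C ?z (syz_mor b x x) = Zer C [M_orb (x - b) (x - b)] [M_orb x' x']"
    using F.zer_cmp[OF F.PC_hom_C[OF Z_presentation(3)], of "[M_orb x' x']"] by (simp add: Fcat_Ob)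
  also have "\<dots> = g"
    by (rule Fcat_eqI[OF F.zer_hom g']) (simp_all add: Fcat_Ob Fcat_Zer g0)
  finally show "\<exists>h. hom F.PC h (Z_cover e x) (Z_obj e x') \<and> Cmp C h (syz_mor b x x) = g"
    using z by (intro exI[of _ ?z] conjI)
qed

text \<open>Now the presenting object and the target have the same sign, so the basic morphism
  between them is equivariant. Both exponents are positive, and its coefficient 1 is not a multiple
  of u.\<close>

lemma Ext1_Z_opp:
  assumes b: "b < pi" and c: "crosses b x x (M_orb x' x')"
  shows "\<not> Ext1_vanishes F.PC F.PE (Z_obj e x) (Z_obj (opp e) x')"
proof
  assume "Ext1_vanishes F.PC F.PE (Z_obj e x) (Z_obj (opp e) x')"
  note ext = this[unfolded Ext1_Z_presentation[OF Z_in_PC]]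
  let ?N = "M_orb x' x'" and ?S = "[syz b x x]" and ?P = "[cov1 b x x, cov2 b x x]"
  have xx: "\<bar>x - x\<bar> < b" "\<bar>x - x\<bar> \<le> b" using b_pos by simp_all
  define g :: "'r fmor" where "g = mk_mor ?S [?N] (\<lambda>_ _. 1)"
  have "hom F.PC g (Z_obj (opp e) (x - b)) (Z_obj (opp e) x')"
    unfolding Z_hom_iff by (simp add: g_def syz_def)
  from ext[rule_format, OF this]
  obtain h where h: "hom F.PC h (Z_cover e x) (Z_obj (opp e) x')" "Cmp C h (syz_mor b x x) = g"
    by (elim exE conjE)
  have h': "hom C h ?P [?N]" using F.PC_hom_C[OF h(1)] by (simp add: Z_cover_def)
  have k: "hom C (syz_mor b x x) ?S ?P" using orbits_in(1)[OF xx(2)] by (simp add: syz_mor_def)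
  let ?c1 = "cexp (syz b x x) (cov1 b x x) ?N" and ?c2 = "cexp (syz b x x) (cov2 b x x) ?N"
  have "u ^ ?c1 * entry h 0 0 - u ^ ?c2 * entry h 0 (Suc 0) = 1"
    using entry_Cmp[OF k h', of 0 0] h(2) by (simp add: syz_mor_def g_def)
  moreover have "0 < ?c1" "0 < ?c2" using cexp_cov_iff[OF xx(1) b M_diag[of x']] c by auto
  then have "u dvd u ^ ?c1" "u dvd u ^ ?c2" by (simp_all add: dvd_power)
  then have "u dvd u ^ ?c1 * entry h 0 0 - u ^ ?c2 * entry h 0 (Suc 0)" by (intro dvd_diff dvd_mult2)
  ultimately show False using u_nonunit by simp
qed

end

section \<open>Isomorphism of the indecomposable objects\<close>

definition same_coords :: "point set \<Rightarrow> point set \<Rightarrow> bool" where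
  "same_coords X Y \<longleftrightarrow> (\<exists>s t e e'. (s, t, e) \<in> X \<and> (s, t, e') \<in> Y)"

lemma same_coords_sym: "same_coords X Y \<Longrightarrow> same_coords Y X"
  unfolding same_coords_def by blast

lemma same_coords_psi: "same_coords X Y \<Longrightarrow> same_coords (psi_orbit X) (psi_orbit Y)"
  unfolding same_coords_def psi_orbit_def by force

lemma M_orb_mem: "(s, t, e) \<in> M_orb x y \<longleftrightarrow> (\<exists>i::int. if even i
    then s = x + of_int i * pi \<and> t = y + of_int i * pi \<and> e = Pos
    else s = y + of_int i * pi \<and> t = x + of_int i * pi \<and> e = Neg)"
  unfolding M_orb_iff sigma_pow_eq by (rule ex_cong1) auto

definition shifts :: "real \<Rightarrow> real \<Rightarrow> real \<Rightarrow> real \<Rightarrow> bool" where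
  "shifts x y s t \<longleftrightarrow> (\<exists>m::int. s = x + of_int m * pi \<and> t = y + of_int m * pi)"

text \<open>In one orbit the parity of the translation decides the order of the coordinates. M and
  its image under \<open>psi\<close> together contain every translation with either order.\<close>

lemma M_orb_or_psi_mem:
  "(\<exists>e. (s, t, e) \<in> M_orb x y \<or> (s, t, e) \<in> psi_orbit (M_orb x y)) \<longleftrightarrow> shifts x y s t \<or> shifts y x s t"
proof
  assume "\<exists>e. (s, t, e) \<in> M_orb x y \<or> (s, t, e) \<in> psi_orbit (M_orb x y)"
  then obtain e where "(s, t, e) \<in> M_orb x y \<or> (s, t, e) \<in> psi_orbit (M_orb x y)" by blast
  then show "shifts x y s t \<or> shifts y x s t"
  proof
    assume "(s, t, e) \<in> M_orb x y"
    then show ?thesis unfolding M_orb_mem shifts_def by (elim exE) (auto split: if_splits)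
  next
    assume "(s, t, e) \<in> psi_orbit (M_orb x y)"
    then obtain i :: int where "if even i
      then s = x + pi + of_int i * pi \<and> t = y + pi + of_int i * pi \<and> e = Pos
      else s = y + pi + of_int i * pi \<and> t = x + pi + of_int i * pi \<and> e = Neg"
      unfolding psi_M_orb M_orb_mem by blast
    then have "(s = x + of_int (i + 1) * pi \<and> t = y + of_int (i + 1) * pi) \<or>
      (s = y + of_int (i + 1) * pi \<and> t = x + of_int (i + 1) * pi)"
      by (simp add: algebra_simps split: if_splits)
    then show ?thesis unfolding shifts_def by blast
  qed
next
  assume a: "shifts x y s t \<or> shifts y x s t"
  have "\<exists>e. (s, t, e) \<in> M_orb x y \<or> (s, t, e) \<in> psi_orbit (M_orb x y)"
    if e: "s = x + of_int m * pi" "t = y + of_int m * pi" for m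
  proof (cases "even m")
    case True
    then have "(s, t, Pos) \<in> M_orb x y" unfolding M_orb_mem using e by (intro exI[of _ m]) simp
    then show ?thesis by blast
  next
    case False
    then have "(s, t, Pos) \<in> psi_orbit (M_orb x y)"
      unfolding psi_M_orb M_orb_mem using e by (intro exI[of _ "m - 1"]) (simp add: algebra_simps)
    then show ?thesis by blast
  qed
  moreover have "\<exists>e. (s, t, e) \<in> M_orb x y \<or> (s, t, e) \<in> psi_orbit (M_orb x y)"
    if e: "s = y + of_int m * pi" "t = x + of_int m * pi" for m
  proof (cases "even m")
    case True
    then have "(s, t, Neg) \<in> psi_orbit (M_orb x y)"
      unfolding psi_M_orb M_orb_mem using e by (intro exI[of _ "m - 1"]) (simp add: algebra_simps)
    then show ?thesis by blast
  next
    case False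
    then have "(s, t, Neg) \<in> M_orb x y" unfolding M_orb_mem using e by (intro exI[of _ m]) simp
    then show ?thesis by blast
  qed
  ultimately show "\<exists>e. (s, t, e) \<in> M_orb x y \<or> (s, t, e) \<in> psi_orbit (M_orb x y)"
    using a unfolding shifts_def by blast
qed

lemma M_diag_mem: "(\<exists>e. (s, t, e) \<in> M_orb x x) \<longleftrightarrow> shifts x x s t"
proof
  assume "\<exists>e. (s, t, e) \<in> M_orb x x"
  then show "shifts x x s t" unfolding M_orb_mem shifts_def by (elim exE) (auto split: if_splits)
next
  assume "shifts x x s t"
  then obtain m where "s = x + of_int m * pi" "t = x + of_int m * pi" unfolding shifts_def by blast
  then have "(s, t, if even m then Pos else Neg) \<in> M_orb x x"
    unfolding M_orb_mem by (intro exI[of _ m]) simp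
  then show "\<exists>e. (s, t, e) \<in> M_orb x x" by blast
qed

text \<open>Lifts of the end points of \<open>h(X)\<close>; recall \<open>M(x, y) = E(x, y + \<pi>)\<close>.\<close>

definition lo :: "indec \<Rightarrow> real" where
  "lo X = (case X of SM x y \<Rightarrow> max x y | Zs e x \<Rightarrow> x)"

definition hi :: "indec \<Rightarrow> real" where
  "hi X = (case X of SM x y \<Rightarrow> min x y + pi | Zs e x \<Rightarrow> x + pi)"

lemma lo_hi_simps [simp]:
  "lo (SM x y) = max x y" "hi (SM x y) = min x y + pi" "lo (Zs e x) = x" "hi (Zs e x) = x + pi"
  by (simp_all add: lo_def hi_def)

text \<open>Isomorphism in the stable category of width pi, expressed on names; justified by
  \<open>stably_isomorphic_iff\<close>.\<close>

definition same :: "indec \<Rightarrow> indec \<Rightarrow> bool" where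
  "same X Y \<longleftrightarrow> (is_regular X \<longleftrightarrow> is_regular Y) \<and> shifts (lo Y) (hi Y) (lo X) (hi X) \<and>
     (\<forall>e x e' x'. X = Zs e x \<longrightarrow> Y = Zs e' x' \<longrightarrow> e = e')"

lemma shifts_sym: "shifts x y s t \<longleftrightarrow> shifts s t x y"
proof -
  have "shifts x y s t \<Longrightarrow> shifts s t x y" for x y s t
    unfolding shifts_def by (elim exE) (rule exI[of _ "- m" for m], auto)
  then show ?thesis by blast
qed

lemma shifts_lo_hi: "shifts x' y' x y \<or> shifts y' x' x y \<longleftrightarrow>
    shifts (max x' y') (min x' y' + pi) (max x y) (min x y + pi)"
proof
  assume "shifts x' y' x y \<or> shifts y' x' x y"
  then show "shifts (max x' y') (min x' y' + pi) (max x y) (min x y + pi)"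
    unfolding shifts_def by (elim disjE exE) (rule exI, auto simp: max_def min_def)+
next
  assume "shifts (max x' y') (min x' y' + pi) (max x y) (min x y + pi)"
  then obtain m where m: "max x y = max x' y' + of_int m * pi" "min x y = min x' y' + of_int m * pi"
    by (auto simp: shifts_def)
  then have "(x = x' + of_int m * pi \<and> y = y' + of_int m * pi) \<or>
      (x = y' + of_int m * pi \<and> y = x' + of_int m * pi)"
    by (auto simp: max_def min_def split: if_splits)
  then show "shifts x' y' x y \<or> shifts y' x' x y" unfolding shifts_def by blast
qed

context continuous_frobenius
begin

lemma same_coords_cexp:
  assumes "X \<in> Xset b" "Y \<in> Xset b" "Z \<in> Xset b" "same_coords X Y"
  shows "cexp X Y Z = 0" "cexp Z X Y = 0"
  using assms(4) cexp_iso[OF assms(1-3) b_le] unfolding same_coords_def by blast+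

lemma denote_in_PC:
  "\<bar>x - y\<bar> \<le> b \<Longrightarrow> (denote (SM x y) :: 'r psiobj) \<in> Ob F.PC" "(denote (Zs e x) :: 'r psiobj) \<in> Ob F.PC"
  using S_in_PC Z_in_PC by simp_all

lemma hd_denote: "fst (denote (SM x y)) = [M_orb x y, psi_orbit (M_orb x y)]"
  "fst (denote (Zs e x)) = [M_orb x x]"
  by (simp_all add: fst_S)

text \<open>Compare the first diagonal entry of g f = 1 + h s modulo u. Boundary summands have
  positive exponents with X, so h s contributes only multiples of u. Some summand of B then
  contributes a term that is not a multiple of u, which forces exponent zero and equal
  coordinates.\<close>

lemma stably_isomorphic_same_coords:
  assumes iso: "stably_isomorphic F.PC F.PE A B" and A: "A \<in> Ob F.PC" and B: "B \<in> Ob F.PC"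
    and X: "fst A = X # As" and nb: "\<not> bdry b X"
  obtains f j where "hom F.PC f A B" "j < length (fst B)" "same_coords X (fst B ! j)" "entry f j 0 \<noteq> 0"
proof -
  obtain f g h s Q where f: "hom F.PC f A B" and g: "hom F.PC g B A" and Q: "F.proj (fst Q)"
    and s: "hom F.PC s A Q" and h: "hom F.PC h Q A"
    and e: "Cmp C g f = Add C (Idt C (fst A)) (Cmp C h s)"
    using F.stably_isomorphicD[OF iso A B] .
  note f' = F.PC_hom_C[OF f] and g' = F.PC_hom_C[OF g] and s' = F.PC_hom_C[OF s] and h' = F.PC_hom_C[OF h]
  have Xs: "X \<in> Xset b" using F.PC_ob(1)[OF A] X by (simp add: Fcat_Ob)
  have Bs: "fst B ! j \<in> Xset b" if "j < length (fst B)" for j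
    using F.PC_ob(1)[OF B] that by (auto simp: Fcat_Ob)
  have c: "same_coords X Y" if Y: "Y \<in> Xset b" and z: "cexp X Y X = 0" for Y
  proof -
    obtain p where p: "p \<in> X" using orbit_rep_mem[OF Xs] by blast
    obtain e where "(fst p, fst (snd p), e) \<in> Y" using cexp_iso_zeroD[OF Xs Y b_le p z] .
    moreover have "(fst p, fst (snd p), snd (snd p)) \<in> X" using p by simp
    ultimately show ?thesis unfolding same_coords_def by blast
  qed
  have len: "0 < length (fst A)" "fst A ! 0 = X" using X by simp_all
  have idh: "hom C (Idt C (fst A)) (fst A) (fst A)" using F.idt_hom F.PC_ob(1)[OF A] by blast
  have ent: "(\<Sum>j<length (fst B). u ^ cexp X (fst B ! j) X * entry g 0 j * entry f j 0) =
      1 + (\<Sum>j<length (fst Q). u ^ cexp X (fst Q ! j) X * entry h 0 j * entry s j 0)"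
    using entry_Cmp[OF f' g' len(1) len(1)] entry_Cmp[OF s' h' len(1) len(1)]
      entry_Add[OF idh F.cmp_hom[OF s' h'] len(1) len(1)] e len by (simp add: Fcat_Idt)
  have "u dvd (\<Sum>j<length (fst Q). u ^ cexp X (fst Q ! j) X * entry h 0 j * entry s j 0)"
  proof (rule dvd_sum)
    fix j assume "j \<in> {..<length (fst Q)}"
    then have bd: "bdry b (fst Q ! j)" using Q by (simp add: proj_iff)
    have "cexp X (fst Q ! j) X \<noteq> 0"
    proof
      assume "cexp X (fst Q ! j) X = 0"
      then obtain a c e e' where ac: "(a, c, e) \<in> X" "(a, c, e') \<in> fst Q ! j"
        using c[OF bdry_Xset[OF bd]] unfolding same_coords_def by blast
      obtain x y where xy: "X = M_orb x y" using Xs Xset_iff by blast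
      have w: "\<bar>a - c\<bar> = b" using bdry_width[OF bd ac(2)] by simp
      have "\<bar>a - c\<bar> = \<bar>x - y\<bar>"
        using ac(1) unfolding xy M_orb_mem by (elim exE) (auto split: if_splits simp: abs_minus_commute)
      then show False using nb w xy unfolding bdry_def by metis
    qed
    then show "u dvd u ^ cexp X (fst Q ! j) X * entry h 0 j * entry s j 0"
      by (intro dvd_mult2 dvd_power) simp
  qed
  from dvd_add_left_iff[OF this, of 1]
  have nd: "\<not> u dvd (\<Sum>j<length (fst B). u ^ cexp X (fst B ! j) X * entry g 0 j * entry f j 0)"
    unfolding ent using u_nonunit by blast
  have "\<exists>j<length (fst B). \<not> u dvd u ^ cexp X (fst B ! j) X * entry g 0 j * entry f j 0"
  proof (rule ccontr)
    assume "\<not> ?thesis"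
    then have "u dvd (\<Sum>j<length (fst B). u ^ cexp X (fst B ! j) X * entry g 0 j * entry f j 0)"
      by (intro dvd_sum) blast
    then show False using nd by blast
  qed
  then obtain j where j: "j < length (fst B)" "\<not> u dvd u ^ cexp X (fst B ! j) X * entry g 0 j * entry f j 0"
    by blast
  have "cexp X (fst B ! j) X = 0"
  proof (rule ccontr)
    assume "cexp X (fst B ! j) X \<noteq> 0"
    then have "u dvd u ^ cexp X (fst B ! j) X * entry g 0 j * entry f j 0"
      by (intro dvd_mult2 dvd_power) simp
    then show False using j by simp
  qed
  moreover have "entry f j 0 \<noteq> 0" using j(2) by auto
  ultimately show ?thesis using that[OF f j(1) c[OF Bs[OF j(1)]]] by simp
qed

lemma not_bdry: "\<bar>x - y\<bar> < b \<Longrightarrow> \<not> bdry b (M_orb x y)"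
  using bdry_width[of b "M_orb x y" "(x, y, Pos)"] M_orb_self[of x y] by auto

text \<open>The Boolean chooses between the diagonal and the antidiagonal permutation matrix:
  \<open>True\<close> if X shares coordinates with Y, \<open>False\<close> if it shares them with
  the image of Y under \<open>psi\<close>.\<close>

lemma S_S_isoI:
  assumes X: "X \<in> Xset b" and Y: "Y \<in> Xset b"
    and t: "\<And>i k. i < 2 \<Longrightarrow> k < 2 \<Longrightarrow> (i = k) = \<tau> \<Longrightarrow>
      same_coords ([X, psi_orbit X] ! k) ([Y, psi_orbit Y] ! i)"
  shows "stably_isomorphic F.PC F.PE (S_obj [X]) (S_obj [Y])"
proof -
  let ?P = "[X, psi_orbit X]" and ?R = "[Y, psi_orbit Y]"
  let ?f = "\<lambda>A B. mk_mor A B (\<lambda>i k. if (i = k) = \<tau> then 1 else 0) :: 'r fmor"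
  have main: "hom F.PC (?f [X, psi_orbit X] [Y, psi_orbit Y]) (S_obj [X]) (S_obj [Y]) \<and>
      Cmp C (?f [Y, psi_orbit Y] [X, psi_orbit X]) (?f [X, psi_orbit X] [Y, psi_orbit Y]) =
        Idt C [X, psi_orbit X]"
    if X: "X \<in> Xset b" and Y: "Y \<in> Xset b"
      and t: "\<And>i k. i < 2 \<Longrightarrow> k < 2 \<Longrightarrow> (i = k) = \<tau> \<Longrightarrow>
        same_coords ([X, psi_orbit X] ! k) ([Y, psi_orbit Y] ! i)" for X Y
  proof -
    let ?P = "[X, psi_orbit X]" and ?R = "[Y, psi_orbit Y]"
    have pX: "psi_orbit X \<in> Xset b" "psi_orbit Y \<in> Xset b" using psi_Xset X Y by blast+
    have P: "?P ! i \<in> Xset b" "?R ! i \<in> Xset b" if "i < 2" for i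
      using that X Y pX by (auto simp: less_2_cases_iff)
    have po: "psi_obj ?P = [psi_orbit X, X]" "psi_obj ?R = [psi_orbit Y, Y]"
      using psi_psi[OF X] psi_psi[OF Y] by (simp_all add: psi_obj_def)
    have ob: "?P \<in> Ob C" using X pX by (simp add: Fcat_Ob)
    let ?F = "?f ?P ?R" and ?G = "?f ?R ?P"
    let ?x = "snd (S_obj [X]) :: 'r fmor" and ?y = "snd (S_obj [Y]) :: 'r fmor"
    have F: "hom C ?F ?P ?R" and G: "hom C ?G ?R ?P" using X Y pX by simp_all
    have pF: "hom C (psi_mor ?F) [psi_orbit X, X] [psi_orbit Y, Y]" using psi_mor_hom[OF F] po by simp
    have x: "hom C ?x [psi_orbit X, X] ?P" and y: "hom C ?y [psi_orbit Y, Y] ?R"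
      unfolding S_mor[OF X] S_mor[OF Y] using X Y pX by simp_all
    have two: "i = 0 \<or> i = Suc 0" if "i < Suc (Suc 0)" for i using that by auto
    have t': "same_coords (psi_obj ?P ! k) (psi_obj ?R ! i)" if "i < 2" "k < 2" "(i = k) = \<tau>" for i k
      using same_coords_psi[OF t[OF that]] that by simp
    have z: "cexp (?P ! k) (?R ! i) Z = 0" "cexp Z (?P ! k) (?R ! i) = 0"
      "cexp ([psi_orbit X, X] ! k) ([psi_orbit Y, Y] ! i) Z = 0"
      if "i < 2" "k < 2" "(i = k) = \<tau>" "Z \<in> Xset b" for i k Z
    proof -
      show "cexp (?P ! k) (?R ! i) Z = 0" "cexp Z (?P ! k) (?R ! i) = 0"
        using same_coords_cexp[OF P(1)[OF that(2)] P(2)[OF that(1)] that(4) t[OF that(1-3)]] by blast+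
      have "[psi_orbit X, X] ! k \<in> Xset b" "[psi_orbit Y, Y] ! i \<in> Xset b"
        using that X Y pX by (auto simp: less_2_cases_iff)
      from same_coords_cexp(1)[OF this that(4)]
      show "cexp ([psi_orbit X, X] ! k) ([psi_orbit Y, Y] ! i) Z = 0"
        using t'[OF that(1-3)] po by simp
    qed
    have z0: "\<tau> \<Longrightarrow> i < 2 \<Longrightarrow> Z \<in> Xset b \<Longrightarrow> cexp (?P ! i) (?R ! i) Z = 0 \<and> cexp Z (?P ! i) (?R ! i) = 0 \<and>
      cexp ([psi_orbit X, X] ! i) ([psi_orbit Y, Y] ! i) Z = 0" for i Z using z[of i i Z] by simp
    have z1: "\<not> \<tau> \<Longrightarrow> i < 2 \<Longrightarrow> k < 2 \<Longrightarrow> i \<noteq> k \<Longrightarrow> Z \<in> Xset b \<Longrightarrow> cexp (?P ! k) (?R ! i) Z = 0 \<and>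
      cexp Z (?P ! k) (?R ! i) = 0 \<and> cexp ([psi_orbit X, X] ! k) ([psi_orbit Y, Y] ! i) Z = 0" for i k Z
      using z[of i k Z] by simp
    note zs = z0[of 0, simplified] z0[of "Suc 0", simplified] z1[of 0 "Suc 0", simplified]
      z1[of "Suc 0" 0, simplified]
    have "Cmp C ?F ?x = Cmp C ?y (psi_mor ?F)"
    proof (rule Fcat_eqI[OF F.cmp_hom[OF x F] F.cmp_hom[OF pF y]])
      fix i k assume ik: "i < length ?R" "k < length [psi_orbit X, X]"
      have "i = 0 \<or> i = Suc 0" "k = 0 \<or> k = Suc 0" using ik by auto
      then show "entry (Cmp C ?F ?x) i k = entry (Cmp C ?y (psi_mor ?F)) i k"
        unfolding entry_Cmp[OF x F ik] entry_Cmp[OF pF y ik] unfolding S_mor[OF X] S_mor[OF Y]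
        using zs X Y pX by (cases \<tau>) auto
    qed
    then have "hom F.PC ?F (S_obj [X]) (S_obj [Y])"
      unfolding F.PC_hom using S_in_PC X Y F by (simp add: fst_S)
    moreover have "Cmp C ?G ?F = Idt C ?P"
    proof (rule Fcat_eqI[OF F.cmp_hom[OF F G] F.idt_hom[OF ob]])
      fix i k assume ik: "i < length ?P" "k < length ?P"
      have "i = 0 \<or> i = Suc 0" "k = 0 \<or> k = Suc 0" using ik by auto
      then show "entry (Cmp C ?G ?F) i k = entry (Idt C ?P) i k"
        unfolding entry_Cmp[OF F G ik] unfolding Fcat_Idt using zs X Y pX by (cases \<tau>) auto
    qed
    ultimately show ?thesis by blast
  qed
  have t2: "same_coords (?R ! k) (?P ! i)" if "i < 2" "k < 2" "(i = k) = \<tau>" for i k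
    by (rule same_coords_sym, rule t) (use that in auto)
  have m1: "hom F.PC (?f ?P ?R) (S_obj [X]) (S_obj [Y]) \<and> Cmp C (?f ?R ?P) (?f ?P ?R) = Idt C ?P"
    by (rule main[OF X Y], rule t)
  have m2: "hom F.PC (?f ?R ?P) (S_obj [Y]) (S_obj [X]) \<and> Cmp C (?f ?P ?R) (?f ?R ?P) = Idt C ?R"
    by (rule main[OF Y X], rule t2)
  show ?thesis
    by (rule F.stably_isomorphicI[of "?f ?P ?R" _ _ "?f ?R ?P"]) (use m1 m2 in \<open>simp_all add: fst_S\<close>)
qed

lemma Z_Z_isoI:
  assumes "shifts x' x' x x"
  shows "stably_isomorphic F.PC F.PE (Z_obj e x) (Z_obj e x')"
proof -
  have c: "cexp (M_orb x x) (M_orb x' x') (M_orb x x) = 0"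
    "cexp (M_orb x' x') (M_orb x x) (M_orb x' x') = 0"
  proof -
    obtain e where "(x, x, e) \<in> M_orb x' x'" using M_diag_mem assms by blast
    from cexp_iso(1)[OF M_diag M_diag M_diag b_le M_orb_self this]
    show "cexp (M_orb x x) (M_orb x' x') (M_orb x x) = 0" .
    obtain e' where "(x', x', e') \<in> M_orb x x" using M_diag_mem assms shifts_sym by blast
    from cexp_iso(1)[OF M_diag M_diag M_diag b_le M_orb_self this]
    show "cexp (M_orb x' x') (M_orb x x) (M_orb x' x') = 0" .
  qed
  let ?f = "mk_mor [M_orb x x] [M_orb x' x'] (\<lambda>_ _. 1) :: 'r fmor"
  let ?g = "mk_mor [M_orb x' x'] [M_orb x x] (\<lambda>_ _. 1) :: 'r fmor"
  have f: "hom C ?f [M_orb x x] [M_orb x' x']" and g: "hom C ?g [M_orb x' x'] [M_orb x x]" by simp_all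
  have ob: "[M_orb z z] \<in> Ob C" for z by (simp add: Fcat_Ob)
  show ?thesis
  proof (rule F.stably_isomorphicI[of ?f _ _ ?g])
    show "hom F.PC ?f (Z_obj e x) (Z_obj e x')" "hom F.PC ?g (Z_obj e x') (Z_obj e x)"
      by (simp_all add: Z_hom_iff)
    show "Cmp C ?g ?f = Idt C (fst (Z_obj e x))" unfolding fst_Z
      by (rule Fcat_eqI[OF F.cmp_hom[OF f g] F.idt_hom[OF ob]]) (simp add: entry_Cmp[OF f g] Fcat_Idt c)
    show "Cmp C ?f ?g = Idt C (fst (Z_obj e x'))" unfolding fst_Z
      by (rule Fcat_eqI[OF F.cmp_hom[OF g f] F.idt_hom[OF ob]]) (simp add: entry_Cmp[OF g f] Fcat_Idt c)
  qed
qed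

lemma same_coords_cases:
  assumes "\<bar>x - y\<bar> \<le> b" "\<bar>x' - y'\<bar> \<le> b"
    and "same_coords (M_orb x y) (M_orb x' y') \<or> same_coords (M_orb x y) (psi_orbit (M_orb x' y'))"
  shows "stably_isomorphic F.PC F.PE (S_obj [M_orb x y]) (S_obj [M_orb x' y'])"
  using assms(3)
proof
  have X: "M_orb x y \<in> Xset b" and Y: "M_orb x' y' \<in> Xset b" using assms by simp_all
  show ?thesis if a: "same_coords (M_orb x y) (M_orb x' y')"
    by (rule S_S_isoI[OF X Y, of True])
      (use a same_coords_psi[OF a] in \<open>auto simp: less_2_cases_iff\<close>)
  show ?thesis if a: "same_coords (M_orb x y) (psi_orbit (M_orb x' y'))"
    by (rule S_S_isoI[OF X Y, of False])
      (use a same_coords_psi[OF a] psi_psi[OF Y] in \<open>auto simp: less_2_cases_iff\<close>)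
qed

lemma stably_isomorphic_iff:
  assumes b: "b = pi" and X: "is_regular X \<or> is_singular X" and Y: "is_regular Y \<or> is_singular Y"
  shows "stably_isomorphic F.PC F.PE (denote X) (denote Y) \<longleftrightarrow> same X Y"
proof (cases X)
  case XS: (SM x y)
  then have xy: "0 < \<bar>x - y\<bar>" "\<bar>x - y\<bar> < b" using X b by simp_all
  have PX: "denote X \<in> Ob F.PC" using denote_in_PC xy XS by simp
  have mem: "(\<exists>e. (s, t, e) \<in> M_orb x y) \<Longrightarrow> shifts x y s t \<or> shifts y x s t" for s t
    using M_orb_or_psi_mem by blast
  show ?thesis
  proof (cases Y)
    case YS: (SM x' y')
    then have xy': "0 < \<bar>x' - y'\<bar>" "\<bar>x' - y'\<bar> < b" using Y b by simp_all
    have PY: "denote Y \<in> Ob F.PC" using denote_in_PC xy' YS by simp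
    have s: "same X Y \<longleftrightarrow> shifts x' y' x y \<or> shifts y' x' x y"
      using xy xy' b by (simp add: same_def XS YS shifts_lo_hi)
    show ?thesis
    proof
      assume "stably_isomorphic F.PC F.PE (denote X) (denote Y)"
      then obtain f j where j: "j < length (fst (denote Y :: 'r psiobj))"
        and c: "same_coords (M_orb x y) (fst (denote Y :: 'r psiobj) ! j)"
        using stably_isomorphic_same_coords[OF _ PX PY _ not_bdry[OF xy(2)]] XS hd_denote(1)[of x y] by metis
      have "j = 0 \<or> j = 1" using j YS by (simp add: hd_denote fst_S less_Suc_eq)
      then have "same_coords (M_orb x y) (M_orb x' y') \<or> same_coords (M_orb x y) (psi_orbit (M_orb x' y'))"
        using c YS by (auto simp: fst_S)
      then obtain s t where st: "\<exists>e. (s, t, e) \<in> M_orb x y"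
        "\<exists>e. (s, t, e) \<in> M_orb x' y' \<or> (s, t, e) \<in> psi_orbit (M_orb x' y')"
        unfolding same_coords_def by blast
      have "shifts x y s t \<or> shifts y x s t" "shifts x' y' s t \<or> shifts y' x' s t"
        using mem st M_orb_or_psi_mem by blast+
      then obtain m n :: int where
        "(s = x + of_int m * pi \<and> t = y + of_int m * pi) \<or> (s = y + of_int m * pi \<and> t = x + of_int m * pi)"
        "(s = x' + of_int n * pi \<and> t = y' + of_int n * pi) \<or> (s = y' + of_int n * pi \<and> t = x' + of_int n * pi)"
        unfolding shifts_def by blast
      then have "(x = x' + of_int (n - m) * pi \<and> y = y' + of_int (n - m) * pi) \<or>
        (x = y' + of_int (n - m) * pi \<and> y = x' + of_int (n - m) * pi)"
        by (auto simp: algebra_simps)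
      then show "same X Y" unfolding s shifts_def by blast
    next
      assume "same X Y"
      then obtain e where "(x, y, e) \<in> M_orb x' y' \<or> (x, y, e) \<in> psi_orbit (M_orb x' y')"
        using s M_orb_or_psi_mem by blast
      then have "same_coords (M_orb x y) (M_orb x' y') \<or> same_coords (M_orb x y) (psi_orbit (M_orb x' y'))"
        unfolding same_coords_def using M_orb_self by blast
      then show "stably_isomorphic F.PC F.PE (denote X) (denote Y)"
        using same_coords_cases[of x y x' y'] xy xy' XS YS by simp
    qed
  next
    case YZ: (Zs e' x')
    have PY: "denote Y \<in> Ob F.PC" using denote_in_PC YZ by simp
    have "\<not> stably_isomorphic F.PC F.PE (denote X) (denote Y)"
    proof
      assume "stably_isomorphic F.PC F.PE (denote X) (denote Y)"
      then obtain f j where j: "j < length (fst (denote Y :: 'r psiobj))"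
        and c: "same_coords (M_orb x y) (fst (denote Y :: 'r psiobj) ! j)"
        using stably_isomorphic_same_coords[OF _ PX PY _ not_bdry[OF xy(2)]] XS hd_denote(1)[of x y] by metis
      have "same_coords (M_orb x y) (M_orb x' x')" using c j YZ by simp
      then obtain s t where st: "\<exists>e. (s, t, e) \<in> M_orb x y" "\<exists>e. (s, t, e) \<in> M_orb x' x'"
        unfolding same_coords_def by blast
      then have "s = t" "shifts x y s t \<or> shifts y x s t"
        using mem unfolding M_diag_mem by (auto simp: shifts_def)
      then show False using xy by (auto simp: shifts_def)
    qed
    moreover have "\<not> same X Y" using xy b by (simp add: same_def XS YZ)
    ultimately show ?thesis by simp
  qed
next
  case XZ: (Zs e x)
  have xx: "\<bar>x - x\<bar> < b" using b_pos by simp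
  have PX: "denote X \<in> Ob F.PC" using denote_in_PC XZ by simp
  show ?thesis
  proof (cases Y)
    case YS: (SM x' y')
    then have xy': "0 < \<bar>x' - y'\<bar>" "\<bar>x' - y'\<bar> < b" using Y b by simp_all
    have PY: "denote Y \<in> Ob F.PC" using denote_in_PC xy' YS by simp
    have "\<not> stably_isomorphic F.PC F.PE (denote X) (denote Y)"
    proof
      assume "stably_isomorphic F.PC F.PE (denote X) (denote Y)"
      then obtain f j where j: "j < length (fst (denote Y :: 'r psiobj))"
        and c: "same_coords (M_orb x x) (fst (denote Y :: 'r psiobj) ! j)"
        using stably_isomorphic_same_coords[OF _ PX PY _ not_bdry[OF xx]] XZ hd_denote(2)[of e x] by metis
      have "j = 0 \<or> j = 1" using j YS by (simp add: hd_denote fst_S less_Suc_eq)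
      then have "same_coords (M_orb x x) (M_orb x' y') \<or> same_coords (M_orb x x) (psi_orbit (M_orb x' y'))"
        using c YS by (auto simp: fst_S)
      then obtain s t where st: "\<exists>e. (s, t, e) \<in> M_orb x x"
        "\<exists>e. (s, t, e) \<in> M_orb x' y' \<or> (s, t, e) \<in> psi_orbit (M_orb x' y')"
        unfolding same_coords_def by blast
      then have "s = t" "shifts x' y' s t \<or> shifts y' x' s t"
        unfolding M_diag_mem M_orb_or_psi_mem by (auto simp: shifts_def)
      then show False using xy' by (auto simp: shifts_def)
    qed
    moreover have "\<not> same X Y" using xy' b by (simp add: same_def XZ YS)
    ultimately show ?thesis by simp
  next
    case YZ: (Zs e' x')
    have PY: "denote Y \<in> Ob F.PC" using denote_in_PC YZ by simp
    have s: "same X Y \<longleftrightarrow> shifts x' x' x x \<and> e = e'"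
      by (auto simp: same_def XZ YZ shifts_def)
    show ?thesis
    proof
      assume "stably_isomorphic F.PC F.PE (denote X) (denote Y)"
      then obtain f j where f: "hom F.PC f (denote X) (denote Y)"
        and j: "j < length (fst (denote Y :: 'r psiobj))"
        and c: "same_coords (M_orb x x) (fst (denote Y :: 'r psiobj) ! j)" and n: "entry f j 0 \<noteq> 0"
        using stably_isomorphic_same_coords[OF _ PX PY _ not_bdry[OF xx]] XZ hd_denote(2)[of e x] by metis
      have j0: "j = 0" using j YZ by simp
      have "e = e'" using f n j0 by (simp add: XZ YZ Z_hom_iff)
      moreover obtain s t where st: "\<exists>e. (s, t, e) \<in> M_orb x x" "\<exists>e. (s, t, e) \<in> M_orb x' x'"
        using c j0 YZ unfolding same_coords_def by auto
      then have "shifts x x s t" "shifts x' x' s t" unfolding M_diag_mem by blast+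
      then obtain m n :: int where "s = x + of_int m * pi" "s = x' + of_int n * pi"
        unfolding shifts_def by blast
      then have "x = x' + of_int (n - m) * pi" by (simp add: algebra_simps)
      then have "shifts x' x' x x" unfolding shifts_def by blast
      ultimately show "same X Y" using s by blast
    next
      assume "same X Y"
      then show "stably_isomorphic F.PC F.PE (denote X) (denote Y)" using Z_Z_isoI s XZ YZ by simp
    qed
  qed
qed

end

section \<open>Compatibility as the absence of crossings\<close>

definition cross :: "indec \<Rightarrow> indec \<Rightarrow> bool" where
  "cross X Y \<longleftrightarrow> (\<exists>m::int. (lo X < lo Y + of_int m * pi \<and> lo Y + of_int m * pi < hi X \<and> hi X < hi Y + of_int m * pi) \<or>
     (lo Y + of_int m * pi < lo X \<and> lo X < hi Y + of_int m * pi \<and> hi Y + of_int m * pi < hi X))"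

text \<open>Singular names at different points always satisfy \<open>cross\<close>, since their
  intervals are full turns; between two singular names the sign has to decide instead.\<close>

fun noncrossing :: "indec \<Rightarrow> indec \<Rightarrow> bool" where
  "noncrossing (Zs e x) (Zs e' y) \<longleftrightarrow> e = e' \<or> circ x = circ y"
| "noncrossing X Y \<longleftrightarrow> \<not> cross X Y"

lemma circ_eq_iff: "circ x = circ y \<longleftrightarrow> (\<exists>m::int. y = x + of_int m * pi)"
proof
  assume "circ x = circ y"
  moreover have "y \<in> circ y" unfolding circ_def by (auto intro: exI[of _ 0])
  ultimately show "\<exists>m::int. y = x + of_int m * pi" unfolding circ_def by blast
next
  assume "\<exists>m::int. y = x + of_int m * pi"
  then obtain m :: int where m: "y = x + of_int m * pi" by blast
  have "x + of_int n * pi = y + of_int (n - m) * pi" "y + of_int n * pi = x + of_int (n + m) * pi" for n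
    by (simp_all add: m algebra_simps)
  then show "circ x = circ y" unfolding circ_def by (intro Collect_eqI) metis
qed

lemma cross_sym: "cross X Y \<longleftrightarrow> cross Y X"
proof -
  have "cross X Y \<Longrightarrow> cross Y X" for X Y
  proof -
    assume "cross X Y"
    then obtain m :: int where
      "(lo X < lo Y + of_int m * pi \<and> lo Y + of_int m * pi < hi X \<and> hi X < hi Y + of_int m * pi) \<or>
       (lo Y + of_int m * pi < lo X \<and> lo X < hi Y + of_int m * pi \<and> hi Y + of_int m * pi < hi X)"
      unfolding cross_def by blast
    then show "cross Y X" unfolding cross_def by (intro exI[of _ "- m"]) auto
  qed
  then show ?thesis by blast
qed

lemma noncrossing_sym: "noncrossing X Y \<longleftrightarrow> noncrossing Y X"
  by (cases X; cases Y) (auto simp: cross_sym)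

text \<open>\<open>meets b\<close> is the vanishing condition for the extension group in \<open>\<C>\<^sub>b\<close>, for one representative.\<close>

definition meets :: "real \<Rightarrow> real \<Rightarrow> real \<Rightarrow> real \<Rightarrow> real \<Rightarrow> bool" where
  "meets b x y s t \<longleftrightarrow> y - b \<le> s \<and> s < x \<and> x - b \<le> t \<and> t < y"

definition meets_lim :: "real \<Rightarrow> real \<Rightarrow> real \<Rightarrow> real \<Rightarrow> bool" where
  "meets_lim x y s t \<longleftrightarrow> y - pi < s \<and> s < x \<and> x - pi < t \<and> t < y"

lemma meets_lim_swap: "meets_lim x y s t \<longleftrightarrow> meets_lim y x t s"
  by (auto simp: meets_lim_def)

lemma meets_imp: "b < pi \<Longrightarrow> meets b x y s t \<Longrightarrow> meets_lim x y s t"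
  by (auto simp: meets_lim_def meets_def)

text \<open>The weak inequalities of \<open>meets\<close> are those that depend on b. Strict
  inequalities at pi leave room for b slightly smaller.\<close>

lemma eventually_meets:
  assumes "meets_lim x y s t"
  shows "\<forall>\<^sub>F b in at_left pi. meets b x y s t"
proof -
  have "max (y - s) (x - t) < pi" using assms by (auto simp: meets_lim_def)
  then have "\<forall>\<^sub>F b in at_left pi. b \<in> {max (y - s) (x - t)<..<pi}" by (rule eventually_at_leftI[rotated]) simp
  then show ?thesis
    by eventually_elim (use assms in \<open>auto simp: meets_lim_def meets_def\<close>)
qed

lemma eventually_below_pi: "\<forall>\<^sub>F b in at_left pi. c < b \<and> b < pi \<and> 0 < b" if "c < pi"
proof -
  have "max c 0 < pi" using that by simp
  then have "\<forall>\<^sub>F b in at_left pi. b \<in> {max c 0<..<pi}" by (rule eventually_at_leftI[rotated]) simp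
  then show ?thesis by eventually_elim auto
qed

lemma crosses_iff: "crosses b x y Y \<longleftrightarrow> (\<exists>s t e. (s, t, e) \<in> Y \<and> meets b x y s t)"
  by (auto simp: crosses_def meets_def)

lemma crosses_regular_iff:
  "(crosses b x y (M_orb x' y') \<or> crosses b x y (psi_orbit (M_orb x' y'))) \<longleftrightarrow>
    (\<exists>s t. (shifts x' y' s t \<or> shifts y' x' s t) \<and> meets b x y s t)"
  unfolding crosses_iff M_orb_or_psi_mem[symmetric] by blast

lemma crosses_diag_iff: "crosses b x y (M_orb x' x') \<longleftrightarrow> (\<exists>s t. shifts x' x' s t \<and> meets b x y s t)"
  unfolding crosses_iff M_diag_mem[symmetric] by blast

text \<open>With the larger coordinate written first, a translate of the second point with its
  coordinates in this order gives one crossing pattern. The exchanged order gives the other pattern,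
  one turn further on, hence the shift between m and m + 1.\<close>

lemma cross_SM_iff:
  assumes X: "is_regular (SM x y)" and Y: "Y = SM x' y' \<and> is_regular Y \<or> Y = Zs e x' \<and> y' = x'"
  shows "(\<exists>s t. (shifts x' y' s t \<or> shifts y' x' s t) \<and> meets_lim x y s t) \<longleftrightarrow> cross (SM x y) Y"
proof -
  define l h where "l = max x y" and "h = min x y + pi"
  define l' h' where "l' = max x' y'" and "h' = min x' y' + pi"
  have lh: "l < h" "h < l + pi" using X by (auto simp: l_def h_def)
  have lh': "l' < h'" "h' \<le> l' + pi" using Y by (auto simp: l'_def h'_def)
  have "lo Y = l'" "hi Y = h'" using Y by (auto simp: l'_def h'_def)
  then have c: "cross (SM x y) Y \<longleftrightarrow> (\<exists>m::int. (l < l' + of_int m * pi \<and> l' + of_int m * pi < h \<and> h < h' + of_int m * pi) \<or>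
     (l' + of_int m * pi < l \<and> l < h' + of_int m * pi \<and> h' + of_int m * pi < h))"
    by (simp add: cross_def l_def h_def)
  have "(\<exists>s t. (shifts x' y' s t \<or> shifts y' x' s t) \<and> meets_lim x y s t) \<longleftrightarrow>
      (\<exists>m::int. meets_lim x y (x' + of_int m * pi) (y' + of_int m * pi) \<or>
        meets_lim x y (y' + of_int m * pi) (x' + of_int m * pi))"
    unfolding shifts_def by blast
  also have "\<dots> \<longleftrightarrow> (\<exists>m::int. meets_lim l (h - pi) (l' + of_int m * pi) (h' - pi + of_int m * pi) \<or>
        meets_lim l (h - pi) (h' - pi + of_int m * pi) (l' + of_int m * pi))"
    using meets_lim_swap by (intro ex_cong1) (auto simp: l_def h_def l'_def h'_def max_def min_def)
  also have "\<dots> \<longleftrightarrow> cross (SM x y) Y"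
  proof
    assume "\<exists>m::int. meets_lim l (h - pi) (l' + of_int m * pi) (h' - pi + of_int m * pi) \<or>
        meets_lim l (h - pi) (h' - pi + of_int m * pi) (l' + of_int m * pi)"
    then obtain m :: int where "meets_lim l (h - pi) (l' + of_int m * pi) (h' - pi + of_int m * pi) \<or>
        meets_lim l (h - pi) (h' - pi + of_int m * pi) (l' + of_int m * pi)" by blast
    then show "cross (SM x y) Y"
    proof
      assume "meets_lim l (h - pi) (l' + of_int m * pi) (h' - pi + of_int m * pi)"
      then show ?thesis unfolding c meets_lim_def by (intro exI[of _ m]) auto
    next
      assume "meets_lim l (h - pi) (h' - pi + of_int m * pi) (l' + of_int m * pi)"
      then show ?thesis unfolding c meets_lim_def by (intro exI[of _ "m + 1"]) (auto simp: algebra_simps)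
    qed
  next
    assume "cross (SM x y) Y"
    then obtain m :: int where "(l < l' + of_int m * pi \<and> l' + of_int m * pi < h \<and> h < h' + of_int m * pi) \<or>
     (l' + of_int m * pi < l \<and> l < h' + of_int m * pi \<and> h' + of_int m * pi < h)" unfolding c by blast
    then show "\<exists>m::int. meets_lim l (h - pi) (l' + of_int m * pi) (h' - pi + of_int m * pi) \<or>
        meets_lim l (h - pi) (h' - pi + of_int m * pi) (l' + of_int m * pi)"
    proof
      assume "l < l' + of_int m * pi \<and> l' + of_int m * pi < h \<and> h < h' + of_int m * pi"
      then show ?thesis unfolding meets_lim_def using lh lh'
        by (intro exI[of _ "m - 1"] disjI2) (auto simp: algebra_simps)
    next
      assume "l' + of_int m * pi < l \<and> l < h' + of_int m * pi \<and> h' + of_int m * pi < h"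
      then show ?thesis unfolding meets_lim_def using lh lh'
        by (intro exI[of _ m] disjI1) (auto simp: algebra_simps)
    qed
  qed
  finally show ?thesis .
qed

text \<open>In the limit all four inequalities are strict, so the roles of the two points can be
  exchanged; the translation by m turns becomes one by - m - 1, with the coordinates
  swapped.\<close>

lemma meets_lim_dual:
  "(\<exists>s t. (shifts x' y' s t \<or> shifts y' x' s t) \<and> meets_lim x y s t) \<longleftrightarrow>
   (\<exists>s t. (shifts x y s t \<or> shifts y x s t) \<and> meets_lim x' y' s t)"
proof -
  have "\<exists>s t. (shifts x y s t \<or> shifts y x s t) \<and> meets_lim x' y' s t"
    if "\<exists>s t. (shifts x' y' s t \<or> shifts y' x' s t) \<and> meets_lim x y s t" for x y x' y'
  proof -
    obtain m :: int where "meets_lim x y (x' + of_int m * pi) (y' + of_int m * pi) \<or>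
        meets_lim x y (y' + of_int m * pi) (x' + of_int m * pi)"
      using \<open>\<exists>s t. (shifts x' y' s t \<or> shifts y' x' s t) \<and> meets_lim x y s t\<close> unfolding shifts_def by blast
    then have "meets_lim x' y' (y + of_int (- m - 1) * pi) (x + of_int (- m - 1) * pi) \<or>
        meets_lim x' y' (x + of_int (- m - 1) * pi) (y + of_int (- m - 1) * pi)"
      by (auto simp: meets_lim_def algebra_simps)
    then show ?thesis unfolding shifts_def by blast
  qed
  then show ?thesis by blast
qed

locale frobenius_family =
  fixes u :: "'r::idom" and E :: "real \<Rightarrow> (point set list, 'r fmor) conflations"
  assumes dvr: "dvr_uniformizer u" and two: "\<not> u dvd 2"
    and standard: "\<And>b. 0 < b \<Longrightarrow> b \<le> pi \<Longrightarrow> is_standard_exact_structure u b (E b)"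
begin

lemma continuous_frobenius: "0 < b \<Longrightarrow> b \<le> pi \<Longrightarrow> continuous_frobenius u b (E b)"
  using dvr two standard by unfold_locales

lemma isomorphic_pi_iff:
  assumes "is_regular X \<or> is_singular X" "is_regular Y \<or> is_singular Y"
  shows "isomorphic_pi u E X Y \<longleftrightarrow> same X Y"
proof -
  interpret continuous_frobenius u pi "E pi" by (rule continuous_frobenius) simp_all
  show ?thesis
    unfolding isomorphic_pi_def Psicat_eq psi_exact_eq by (rule stably_isomorphic_iff[OF refl assms])
qed

lemma Ext1_SM:
  assumes "0 < b" "b < pi" "\<bar>x - y\<bar> < b" "\<bar>x' - y'\<bar> \<le> b"
  shows "Ext1_vanishes (Psicat u b) (psi_exact u b (E b)) (denote (SM x y)) (denote (SM x' y')) \<longleftrightarrow>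
      \<not> (\<exists>s t. (shifts x' y' s t \<or> shifts y' x' s t) \<and> meets b x y s t)"
    "Ext1_vanishes (Psicat u b) (psi_exact u b (E b)) (denote (SM x y)) (denote (Zs e x')) \<longleftrightarrow>
      \<not> (\<exists>s t. shifts x' x' s t \<and> meets b x y s t)"
    "\<not> (\<exists>s t. (shifts x y s t \<or> shifts y x s t) \<and> meets b x' x' s t) \<Longrightarrow>
      Ext1_vanishes (Psicat u b) (psi_exact u b (E b)) (denote (Zs e x')) (denote (SM x y))"
proof -
  interpret continuous_frobenius u b "E b" by (rule continuous_frobenius) (use assms in simp_all)
  show "Ext1_vanishes (Psicat u b) (psi_exact u b (E b)) (denote (SM x y)) (denote (SM x' y')) \<longleftrightarrow>
      \<not> (\<exists>s t. (shifts x' y' s t \<or> shifts y' x' s t) \<and> meets b x y s t)"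
    unfolding Psicat_eq psi_exact_eq crosses_regular_iff[symmetric]
    using Ext1_S_iff[OF assms(3,2) denote_in_PC(1)[OF assms(4)]] by (simp add: fst_S)
  show "Ext1_vanishes (Psicat u b) (psi_exact u b (E b)) (denote (SM x y)) (denote (Zs e x')) \<longleftrightarrow>
      \<not> (\<exists>s t. shifts x' x' s t \<and> meets b x y s t)"
    unfolding Psicat_eq psi_exact_eq crosses_diag_iff[symmetric]
    using Ext1_S_iff[OF assms(3,2) denote_in_PC(2)[of e x']] by simp
  show "Ext1_vanishes (Psicat u b) (psi_exact u b (E b)) (denote (Zs e x')) (denote (SM x y))"
    if "\<not> (\<exists>s t. (shifts x y s t \<or> shifts y x s t) \<and> meets b x' x' s t)"
    unfolding Psicat_eq psi_exact_eq
    using that Ext1_Z_vanishesI[OF assms(2) denote_in_PC(1)[of x y]] assms(3)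
    unfolding crosses_regular_iff[symmetric] by (simp add: fst_S)
qed

lemma Ext1_ZZ:
  assumes "0 < b" "b < pi"
  shows "Ext1_vanishes (Psicat u b) (psi_exact u b (E b)) (denote (Zs e x)) (denote (Zs e x'))"
    "\<not> (\<exists>s t. shifts x' x' s t \<and> meets b x x s t) \<Longrightarrow>
      Ext1_vanishes (Psicat u b) (psi_exact u b (E b)) (denote (Zs e x)) (denote (Zs e' x'))"
    "(\<exists>s t. shifts x' x' s t \<and> meets b x x s t) \<Longrightarrow>
      \<not> Ext1_vanishes (Psicat u b) (psi_exact u b (E b)) (denote (Zs e x)) (denote (Zs (opp e) x'))"
proof -
  interpret continuous_frobenius u b "E b" by (rule continuous_frobenius) (use assms in simp_all)
  show "Ext1_vanishes (Psicat u b) (psi_exact u b (E b)) (denote (Zs e x)) (denote (Zs e x'))"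
    unfolding Psicat_eq psi_exact_eq denote.simps by (rule Ext1_Z_same)
  show "Ext1_vanishes (Psicat u b) (psi_exact u b (E b)) (denote (Zs e x)) (denote (Zs e' x'))"
    if "\<not> (\<exists>s t. shifts x' x' s t \<and> meets b x x s t)"
    unfolding Psicat_eq psi_exact_eq denote.simps
    by (rule Ext1_Z_vanishesI[OF assms(2) Z_in_PC]) (use that in \<open>simp add: crosses_diag_iff\<close>)
  show "\<not> Ext1_vanishes (Psicat u b) (psi_exact u b (E b)) (denote (Zs e x)) (denote (Zs (opp e) x'))"
    if "\<exists>s t. shifts x' x' s t \<and> meets b x x s t"
    unfolding Psicat_eq psi_exact_eq denote.simps
    by (rule Ext1_Z_opp[OF assms(2)]) (use that in \<open>simp add: crosses_diag_iff\<close>)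
qed

lemma compatible_piI:
  assumes "c < pi" "\<And>b. 0 < b \<Longrightarrow> c < b \<Longrightarrow> b < pi \<Longrightarrow>
    compatible_obj (Psicat u b) (psi_exact u b (E b)) (denote X) (denote Y)"
  shows "compatible_pi u E X Y"
  unfolding compatible_pi_def using eventually_below_pi[OF assms(1)]
  by eventually_elim (use assms(2) in auto)

lemma not_compatible_piI:
  assumes "c < pi" "meets_lim x y s t"
    "\<And>b. 0 < b \<Longrightarrow> c < b \<Longrightarrow> b < pi \<Longrightarrow> meets b x y s t \<Longrightarrow>
    \<not> compatible_obj (Psicat u b) (psi_exact u b (E b)) (denote X) (denote Y)"
  shows "\<not> compatible_pi u E X Y"
proof
  assume "compatible_pi u E X Y"
  then have "\<forall>\<^sub>F b in at_left pi. False"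
    unfolding compatible_pi_def using eventually_below_pi[OF assms(1)] eventually_meets[OF assms(2)]
    by eventually_elim (use assms(3) in auto)
  then show False by (simp add: trivial_limit_at_left_real)
qed

lemma compatible_pi_sym: "compatible_pi u E X Y \<longleftrightarrow> compatible_pi u E Y X"
  unfolding compatible_pi_def compatible_obj_def by (simp add: conj_commute)

text \<open>Out of the singular object there is only a sufficient condition for vanishing. In the
  limit it is dual to the exact condition for the other direction, so the two together decide
  compatibility.\<close>

lemma compatible_pi_SM_Z:
  assumes X: "is_regular (SM x y)"
  shows "compatible_pi u E (SM x y) (Zs e x') \<longleftrightarrow> \<not> cross (SM x y) (Zs e x')"
proof -
  have c: "\<bar>x - y\<bar> < pi" using X by simp
  have iff: "(\<exists>s t. shifts x' x' s t \<and> meets_lim x y s t) \<longleftrightarrow> cross (SM x y) (Zs e x')"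
    using cross_SM_iff[OF X, of "Zs e x'" x' x' e] by simp
  show ?thesis
  proof
    assume "\<not> cross (SM x y) (Zs e x')"
    then have 1: "\<not> (\<exists>s t. shifts x' x' s t \<and> meets_lim x y s t)" using iff by blast
    then have 2: "\<not> (\<exists>s t. (shifts x y s t \<or> shifts y x s t) \<and> meets_lim x' x' s t)"
      using meets_lim_dual[of x' x' x y] by blast
    show "compatible_pi u E (SM x y) (Zs e x')"
    proof (rule compatible_piI[OF c])
      fix b :: real assume b: "0 < b" "\<bar>x - y\<bar> < b" "b < pi"
      have "\<bar>x' - x'\<bar> \<le> b" using b by simp
      note E = Ext1_SM(2,3)[OF b(1,3,2) this]
      show "compatible_obj (Psicat u b) (psi_exact u b (E b)) (denote (SM x y)) (denote (Zs e x'))"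
        unfolding compatible_obj_def
        using E(1)[of e] E(2)[of e] 1 2 meets_imp[OF b(3)] by blast
    qed
  next
    assume comp: "compatible_pi u E (SM x y) (Zs e x')"
    show "\<not> cross (SM x y) (Zs e x')"
    proof
      assume "cross (SM x y) (Zs e x')"
      then obtain s t where st: "shifts x' x' s t" "meets_lim x y s t" using iff by blast
      have "\<not> compatible_pi u E (SM x y) (Zs e x')"
      proof (rule not_compatible_piI[OF c st(2)])
        fix b :: real assume b: "0 < b" "\<bar>x - y\<bar> < b" "b < pi" and m: "meets b x y s t"
        have "\<bar>x' - x'\<bar> \<le> b" using b by simp
        from Ext1_SM(2)[OF b(1,3,2) this, of e]
        show "\<not> compatible_obj (Psicat u b) (psi_exact u b (E b)) (denote (SM x y)) (denote (Zs e x'))"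
          unfolding compatible_obj_def using m st(1) by blast
      qed
      then show False using comp by blast
    qed
  qed
qed

lemma compatible_pi_SM_SM:
  assumes X: "is_regular (SM x y)" and Y: "is_regular (SM x' y')"
  shows "compatible_pi u E (SM x y) (SM x' y') \<longleftrightarrow> \<not> cross (SM x y) (SM x' y')"
proof -
  have c: "max \<bar>x - y\<bar> \<bar>x' - y'\<bar> < pi" using X Y by simp
  have iff: "(\<exists>s t. (shifts x' y' s t \<or> shifts y' x' s t) \<and> meets_lim x y s t) \<longleftrightarrow> cross (SM x y) (SM x' y')"
    using cross_SM_iff[OF X, of "SM x' y'" x' y'] Y by simp
  show ?thesis
  proof
    assume "\<not> cross (SM x y) (SM x' y')"
    then have 1: "\<not> (\<exists>s t. (shifts x' y' s t \<or> shifts y' x' s t) \<and> meets_lim x y s t)" using iff by blast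
    then have 2: "\<not> (\<exists>s t. (shifts x y s t \<or> shifts y x s t) \<and> meets_lim x' y' s t)"
      using meets_lim_dual[of x' y' x y] by blast
    show "compatible_pi u E (SM x y) (SM x' y')"
    proof (rule compatible_piI[OF c])
      fix b :: real assume b: "0 < b" "max \<bar>x - y\<bar> \<bar>x' - y'\<bar> < b" "b < pi"
      then have w: "\<bar>x - y\<bar> < b" "\<bar>x' - y'\<bar> < b" "\<bar>x - y\<bar> \<le> b" "\<bar>x' - y'\<bar> \<le> b" by auto
      show "compatible_obj (Psicat u b) (psi_exact u b (E b)) (denote (SM x y)) (denote (SM x' y'))"
        unfolding compatible_obj_def Ext1_SM(1)[OF b(1,3) w(1,4)] Ext1_SM(1)[OF b(1,3) w(2,3)]
        using 1 2 meets_imp[OF b(3)] by blast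
    qed
  next
    assume comp: "compatible_pi u E (SM x y) (SM x' y')"
    show "\<not> cross (SM x y) (SM x' y')"
    proof
      assume "cross (SM x y) (SM x' y')"
      then obtain s t where st: "shifts x' y' s t \<or> shifts y' x' s t" "meets_lim x y s t" using iff by blast
      have "\<not> compatible_pi u E (SM x y) (SM x' y')"
      proof (rule not_compatible_piI[OF c st(2)])
        fix b :: real assume b: "0 < b" "max \<bar>x - y\<bar> \<bar>x' - y'\<bar> < b" "b < pi" and m: "meets b x y s t"
        then have w: "\<bar>x - y\<bar> < b" "\<bar>x' - y'\<bar> \<le> b" by auto
        show "\<not> compatible_obj (Psicat u b) (psi_exact u b (E b)) (denote (SM x y)) (denote (SM x' y'))"
          unfolding compatible_obj_def Ext1_SM(1)[OF b(1,3) w] using m st(1) by blast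
      qed
      then show False using comp by blast
    qed
  qed
qed

lemma compatible_pi_Z_Z:
  "compatible_pi u E (Zs e x) (Zs e' x') \<longleftrightarrow> e = e' \<or> circ x = circ x'"
proof
  assume "e = e' \<or> circ x = circ x'"
  then show "compatible_pi u E (Zs e x) (Zs e' x')"
  proof
    assume e: "e = e'"
    show ?thesis
      by (rule compatible_piI[of 0]) (use Ext1_ZZ(1) e in \<open>auto simp: compatible_obj_def\<close>)
  next
    assume "circ x = circ x'"
    then obtain k :: int where k: "x' = x + of_int k * pi" unfolding circ_eq_iff by blast
    \<comment> \<open>A translate of w in the interval from w - b to w would lie strictly between w
      - pi and w.\<close>
    have no: "\<not> (\<exists>s t. shifts z z s t \<and> meets b w w s t)"
      if b: "b < pi" and z: "z = w + of_int n * pi" for b z w :: real and n :: int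
    proof
      assume "\<exists>s t. shifts z z s t \<and> meets b w w s t"
      then obtain m :: int where m: "w - b \<le> z + of_int m * pi" "z + of_int m * pi < w"
        unfolding shifts_def meets_def by blast
      then have "- 1 * pi < of_int (n + m) * pi" "of_int (n + m) * pi < 0 * pi"
        using b z by (auto simp: algebra_simps)
      then have "- 1 < real_of_int (n + m)" "real_of_int (n + m) < 0"
        using pi_gt_zero mult_less_cancel_right_pos by blast+
      then have "real_of_int (- 1) < real_of_int (n + m)" "n + m < 0"
        by (simp_all only: of_int_less_0_iff of_int_minus of_int_1)
      then have "- 1 < n + m" "n + m < 0" by (simp_all only: of_int_less_iff)
      then show False by simp
    qed
    have k': "x = x' + of_int (- k) * pi" using k by simp
    show ?thesis
    proof (rule compatible_piI[of 0])
      fix b :: real assume b: "0 < b" "b < pi"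
      show "compatible_obj (Psicat u b) (psi_exact u b (E b)) (denote (Zs e x)) (denote (Zs e' x'))"
        unfolding compatible_obj_def
        using Ext1_ZZ(2)[OF b no[OF b(2) k]] Ext1_ZZ(2)[OF b no[OF b(2) k']] by blast
    qed simp
  qed
next
  assume comp: "compatible_pi u E (Zs e x) (Zs e' x')"
  show "e = e' \<or> circ x = circ x'"
  proof (rule ccontr)
    assume n: "\<not> (e = e' \<or> circ x = circ x')"
    then have e: "e' = opp e" by (cases e; cases e') auto
    \<comment> \<open>This picks the last translate of x' that does not exceed x. It is not x
      itself, since the supports differ.\<close>
    define k where "k = \<lfloor>(x - x') / pi\<rfloor>"
    have "of_int k * pi \<le> x - x'" "x - x' < of_int k * pi + pi"
      unfolding k_def using floor_divide_lower[OF pi_gt_zero, of "x - x'"]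
        floor_divide_upper[OF pi_gt_zero, of "x - x'"] by (simp_all add: distrib_right)
    moreover have "x' + of_int k * pi \<noteq> x"
      using n circ_eq_iff[of x' x] by (metis (mono_tags))
    ultimately have m: "meets_lim x x (x' + of_int k * pi) (x' + of_int k * pi)"
      by (auto simp: meets_lim_def)
    have "\<not> compatible_pi u E (Zs e x) (Zs e' x')"
    proof (rule not_compatible_piI[OF pi_gt_zero m])
      fix b :: real assume b: "0 < b" "b < pi" and mb: "meets b x x (x' + of_int k * pi) (x' + of_int k * pi)"
      then have "\<exists>s t. shifts x' x' s t \<and> meets b x x s t" unfolding shifts_def by blast
      from Ext1_ZZ(3)[OF b this, of e]
      show "\<not> compatible_obj (Psicat u b) (psi_exact u b (E b)) (denote (Zs e x)) (denote (Zs e' x'))"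
        unfolding compatible_obj_def e by blast
    qed
    then show False using comp by blast
  qed
qed

lemma compatible_pi_iff:
  assumes "is_regular X \<or> is_singular X" "is_regular Y \<or> is_singular Y"
  shows "compatible_pi u E X Y \<longleftrightarrow> noncrossing X Y"
proof (cases X)
  case X: (SM x y)
  show ?thesis
    by (cases Y) (use assms X compatible_pi_SM_SM compatible_pi_SM_Z in auto)
next
  case X: (Zs e x)
  show ?thesis
    by (cases Y) (use assms X compatible_pi_Z_Z compatible_pi_SM_Z compatible_pi_sym cross_sym in auto)
qed

end

section \<open>Arcs on the circle\<close>

lemma circ_shift [simp]: "circ (x + of_int m * pi) = circ x"
  unfolding circ_eq_iff by (rule exI[of _ "- m"]) simp

lemma topspace_circle: "topspace circle = range circ"
proof -
  have "openin circle U \<Longrightarrow> U \<subseteq> range circ" for U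
    unfolding circle_def openin_quot_topology by simp
  moreover have "openin circle (range circ)"
    unfolding circle_def openin_quot_topology by simp
  ultimately show ?thesis by (meson openin_subset openin_topspace subset_antisym)
qed

lemma openin_circle_iff: "openin circle U \<longleftrightarrow> U \<subseteq> range circ \<and> open {t. circ t \<in> U}"
  unfolding circle_def openin_quot_topology by simp

definition circ_arc :: "real \<Rightarrow> real \<Rightarrow> real set set" where
  "circ_arc a c = circ ` {a<..<c}"

lemma in_arc_iff: "circ t \<in> circ_arc a c \<longleftrightarrow> (\<exists>m::int. a < t + of_int m * pi \<and> t + of_int m * pi < c)"
proof
  assume "circ t \<in> circ_arc a c"
  then obtain r where "a < r" "r < c" "circ t = circ r" by (auto simp: circ_arc_def)
  then show "\<exists>m::int. a < t + of_int m * pi \<and> t + of_int m * pi < c" unfolding circ_eq_iff by blast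
next
  assume "\<exists>m::int. a < t + of_int m * pi \<and> t + of_int m * pi < c"
  then obtain m :: int where "a < t + of_int m * pi" "t + of_int m * pi < c" by blast
  then have "circ (t + of_int m * pi) \<in> circ_arc a c" unfolding circ_arc_def by (intro imageI) simp
  then show "circ t \<in> circ_arc a c" by simp
qed

lemma arc_shift: "circ_arc (a + of_int m * pi) (c + of_int m * pi) = circ_arc a c"
proof -
  have "circ_arc (a + of_int m * pi) (c + of_int m * pi) \<subseteq> circ_arc a c" for a c and m :: int
  proof
    fix z assume "z \<in> circ_arc (a + of_int m * pi) (c + of_int m * pi)"
    then obtain r where r: "a + of_int m * pi < r" "r < c + of_int m * pi" "z = circ r"
      by (auto simp: circ_arc_def)
    have "circ r \<in> circ_arc a c" unfolding in_arc_iff by (rule exI[of _ "- m"]) (use r in simp)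
    then show "z \<in> circ_arc a c" using r by simp
  qed
  from this[of a m c] this[of "a + of_int m * pi" "- m" "c + of_int m * pi"]
  show ?thesis by (simp add: algebra_simps)
qed

lemma arc_subset_range: "circ_arc a c \<subseteq> range circ"
  by (auto simp: circ_arc_def)

lemma openin_arc: "openin circle (circ_arc a c)"
  unfolding openin_circle_iff
proof
  have "{t. circ t \<in> circ_arc a c} = (\<Union>m::int. (\<lambda>t. t + of_int m * pi) -` {a<..<c})"
    by (auto simp: in_arc_iff)
  moreover have "open ((\<lambda>t. t + of_int m * pi) -` {a<..<c})" for m :: int
    by (intro open_vimage continuous_intros open_greaterThanLessThan)
  ultimately show "open {t. circ t \<in> circ_arc a c}" by auto
qed (rule arc_subset_range)

lemma continuous_map_circ: "continuous_map euclideanreal circle circ"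
  unfolding continuous_map_def topspace_circle by (auto simp: openin_circle_iff)

lemma connectedin_arc: "connectedin circle (circ_arc a c)"
  unfolding circ_arc_def
  by (rule connectedin_continuous_map_image[OF continuous_map_circ]) simp

lemma arc_nonempty: "a < c \<Longrightarrow> circ_arc a c \<noteq> {}"
  by (simp add: circ_arc_def)

lemma circ_representative:
  obtains m :: int where "a \<le> t + of_int m * pi" "t + of_int m * pi < a + pi"
proof -
  let ?k = "\<lfloor>(t - a) / pi\<rfloor>"
  have "of_int ?k * pi \<le> t - a" "t - a < (of_int ?k + 1) * pi"
    using floor_divide_lower[OF pi_gt_zero] floor_divide_upper[OF pi_gt_zero] by blast+
  then show ?thesis using that[of "- ?k"] by (simp add: algebra_simps)
qed

lemma shift_less_pi:
  assumes "a \<le> t" "t < a + pi" "a \<le> t + of_int m * pi" "t + of_int m * pi < a + pi"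
  shows "m = 0"
proof -
  have "real_of_int m * pi < 1 * pi" "- 1 * pi < real_of_int m * pi" using assms by linarith+
  then have "real_of_int m < 1" "- 1 < real_of_int m"
    by (simp_all only: mult_less_cancel_right_pos[OF pi_gt_zero])
  then show ?thesis by linarith
qed

lemma circ_inj_on: "inj_on circ {a..<a + pi}"
proof (rule inj_onI)
  fix s t assume st: "s \<in> {a..<a + pi}" "t \<in> {a..<a + pi}" "circ s = circ t"
  then obtain m :: int where m: "t = s + of_int m * pi" unfolding circ_eq_iff by blast
  then have "m = 0" using shift_less_pi[of a s m] st by auto
  then show "s = t" using m by simp
qed

lemma in_arc_disjoint:
  assumes "c \<le> a + pi" "circ t \<in> circ_arc a c" "a \<le> t" "t < a + pi"
  shows "a < t \<and> t < c"
proof -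
  obtain m :: int where m: "a < t + of_int m * pi" "t + of_int m * pi < c"
    using assms(2) in_arc_iff by blast
  have "m = 0" by (rule shift_less_pi[of a t]) (use assms m in auto)
  then show ?thesis using m by simp
qed

section \<open>Regular names as intervals\<close>

lemma regular_lo_hi: "is_regular X \<Longrightarrow> lo X < hi X \<and> hi X < lo X + pi"
  by (cases X) auto

lemma regular_supp: "is_regular X \<Longrightarrow> supp_J X = circ_arc (lo X) (hi X)"
proof (cases X)
  case (SM x y)
  assume X: "is_regular X"
  show ?thesis
  proof (cases "y < x")
    case True
    then show ?thesis using X SM by (auto simp: Let_def circ_arc_def max_def min_def)
  next
    case False
    \<comment> \<open>In this case \<open>supp_J\<close> uses the lift one turn above
      \<open>lo\<close> and \<open>hi\<close>.\<close>
    then have "supp_J X = circ_arc (y + pi) (x + 2 * pi)" using X SM by (auto simp: Let_def circ_arc_def)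
    also have "\<dots> = circ_arc y (x + pi)" using arc_shift[of y 1 "x + pi"] by (simp add: algebra_simps)
    finally show ?thesis using False SM by (simp add: max_def min_def)
  qed
qed simp

definition mkI :: "real \<Rightarrow> real \<Rightarrow> indec" where
  "mkI a c = SM a (c - pi)"

lemma mkI_simps:
  assumes "a < c" "c < a + pi"
  shows "is_regular (mkI a c)" "lo (mkI a c) = a" "hi (mkI a c) = c" "supp_J (mkI a c) = circ_arc a c"
proof -
  show 1: "is_regular (mkI a c)" "lo (mkI a c) = a" "hi (mkI a c) = c"
    using assms by (auto simp: mkI_def)
  show "supp_J (mkI a c) = circ_arc a c" using regular_supp[OF 1(1)] 1 by simp
qed

text \<open>A singular name stands for the full turn from t to t + pi. A shorter interval crosses it
  iff it contains a lift of one of its ends, and both ends lie over the same point.\<close>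

lemma cross_Z_iff:
  assumes "is_regular X"
  shows "cross X (Zs e t) \<longleftrightarrow> circ t \<in> supp_J X"
proof -
  note lh = regular_lo_hi[OF assms]
  show ?thesis
    unfolding regular_supp[OF assms] in_arc_iff
  proof
    assume "cross X (Zs e t)"
    then obtain m :: int where "(lo X < t + of_int m * pi \<and> t + of_int m * pi < hi X) \<or>
        (lo X < t + pi + of_int m * pi \<and> t + pi + of_int m * pi < hi X)"
      by (auto simp: cross_def)
    then show "\<exists>m::int. lo X < t + of_int m * pi \<and> t + of_int m * pi < hi X"
    proof
      assume "lo X < t + pi + of_int m * pi \<and> t + pi + of_int m * pi < hi X"
      then show ?thesis by (intro exI[of _ "m + 1"]) (simp add: algebra_simps)
    qed blast
  next
    assume "\<exists>m::int. lo X < t + of_int m * pi \<and> t + of_int m * pi < hi X"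
    then obtain m :: int where "lo X < t + of_int m * pi" "t + of_int m * pi < hi X" by blast
    then show "cross X (Zs e t)" unfolding cross_def using lh by (intro exI[of _ m]) auto
  qed
qed

lemma noncrossing_regular:
  assumes "is_regular X"
  shows "noncrossing X Y \<longleftrightarrow> \<not> cross X Y" "noncrossing Y X \<longleftrightarrow> \<not> cross Y X"
  using assms by (cases X; cases Y; simp)+

lemma cross_supp_meet:
  assumes "is_regular X" "is_regular Y" "cross X Y"
  shows "supp_J X \<inter> supp_J Y \<noteq> {}"
proof -
  obtain m :: int where m:
    "(lo X < lo Y + of_int m * pi \<and> lo Y + of_int m * pi < hi X \<and> hi X < hi Y + of_int m * pi) \<or>
     (lo Y + of_int m * pi < lo X \<and> lo X < hi Y + of_int m * pi \<and> hi Y + of_int m * pi < hi X)"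
    using assms(3) unfolding cross_def by blast
  obtain t where t: "lo X < t" "t < hi X" "lo Y + of_int m * pi < t" "t < hi Y + of_int m * pi"
    using m dense[of "lo Y + of_int m * pi" "hi X"] dense[of "lo X" "hi Y + of_int m * pi"]
    by (meson less_trans)
  have "circ t \<in> supp_J X" unfolding regular_supp[OF assms(1)] circ_arc_def using t by simp
  moreover have "circ t \<in> supp_J Y"
    unfolding regular_supp[OF assms(2)] in_arc_iff by (rule exI[of _ "- m"]) (use t in simp)
  ultimately show ?thesis by blast
qed

lemma not_cross_mkI:
  assumes "s < t" "t < s + pi" "is_regular Y" "circ s \<notin> supp_J Y" "circ t \<notin> supp_J Y"
  shows "\<not> cross (mkI s t) Y"
proof
  assume "cross (mkI s t) Y"
  then obtain m :: int where m:
    "(s < lo Y + of_int m * pi \<and> lo Y + of_int m * pi < t \<and> t < hi Y + of_int m * pi) \<or>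
     (lo Y + of_int m * pi < s \<and> s < hi Y + of_int m * pi \<and> hi Y + of_int m * pi < t)"
    unfolding cross_def mkI_simps[OF assms(1,2)] by blast
  have "circ s \<in> supp_J Y \<or> circ t \<in> supp_J Y"
    unfolding regular_supp[OF assms(3)] in_arc_iff using m
    by (elim disjE) (rule disjI2, rule exI[of _ "- m"], simp, rule disjI1, rule exI[of _ "- m"], simp)
  then show False using assms by blast
qed

lemma same_refl: "same X X"
  unfolding same_def shifts_def by (auto intro: exI[of _ 0])

lemma same_sym: "same X Y \<Longrightarrow> same Y X"
  unfolding same_def using shifts_sym by blast

lemma same_regularD:
  assumes "same X Y" "is_regular X"
  shows "is_regular Y" "supp_J X = supp_J Y"
proof -
  show Y: "is_regular Y" using assms by (simp add: same_def)
  obtain m :: int where "lo X = lo Y + of_int m * pi" "hi X = hi Y + of_int m * pi"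
    using assms by (auto simp: same_def shifts_def)
  then show "supp_J X = supp_J Y"
    unfolding regular_supp[OF assms(2)] regular_supp[OF Y] using arc_shift by simp
qed

lemma same_Z_iff: "same (Zs e x) (Zs e' y) \<longleftrightarrow> e = e' \<and> circ x = circ y"
proof -
  have "shifts y (y + pi) x (x + pi) \<longleftrightarrow> circ y = circ x" by (auto simp: shifts_def circ_eq_iff)
  then show ?thesis by (auto simp: same_def)
qed

lemma cross_same:
  assumes "same Y Y'" "cross X Y"
  shows "cross X Y'"
proof -
  obtain k :: int where k: "lo Y = lo Y' + of_int k * pi" "hi Y = hi Y' + of_int k * pi"
    using assms by (auto simp: same_def shifts_def)
  obtain m :: int where
    "(lo X < lo Y + of_int m * pi \<and> lo Y + of_int m * pi < hi X \<and> hi X < hi Y + of_int m * pi) \<or>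
     (lo Y + of_int m * pi < lo X \<and> lo X < hi Y + of_int m * pi \<and> hi Y + of_int m * pi < hi X)"
    using assms(2) unfolding cross_def by blast
  then show ?thesis unfolding cross_def k by (intro exI[of _ "k + m"]) (auto simp: algebra_simps)
qed

text \<open>Maximality is tested by adding one name at a time, which is equivalent because all
  conditions are pairwise and symmetric.\<close>

definition max_noncrossing :: "indec set \<Rightarrow> indec set \<Rightarrow> bool" where
  "max_noncrossing U L \<longleftrightarrow> L \<subseteq> U \<and> pairwise (\<lambda>X Y. noncrossing X Y \<and> \<not> same X Y) L \<and>
     (\<forall>X\<in>U. (\<forall>Y\<in>L. noncrossing X Y \<and> \<not> same X Y) \<longrightarrow> X \<in> L)"

text \<open>The form in which maximality is applied: a set contains only one name from each
  isomorphism class, so the name found may differ from the given one.\<close>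

lemma max_noncrossing_same:
  assumes "max_noncrossing U L" "X \<in> U" "\<forall>Y\<in>L. noncrossing X Y"
  obtains Y where "Y \<in> L" "same X Y"
proof (cases "X \<in> L")
  case True
  then show ?thesis using that same_refl by blast
next
  case False
  then show ?thesis using that assms unfolding max_noncrossing_def by blast
qed

context frobenius_family
begin

lemma maximal_compatible_iff:
  assumes U: "\<And>X. X \<in> U \<Longrightarrow> is_regular X \<or> is_singular X"
  shows "maximal_compatible u E U L \<longleftrightarrow> max_noncrossing U L"
proof -
  define R where "R = (\<lambda>X Y. compatible_pi u E X Y \<and> \<not> isomorphic_pi u E X Y)"
  define Q where "Q = (\<lambda>X Y. noncrossing X Y \<and> \<not> same X Y)"
  have RQ: "R X Y \<longleftrightarrow> Q X Y" if "X \<in> U" "Y \<in> U" for X Y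
    using that U compatible_pi_iff isomorphic_pi_iff by (simp add: R_def Q_def)
  have Qs: "Q X Y \<Longrightarrow> Q Y X" for X Y
    unfolding Q_def using noncrossing_sym same_sym by blast
  have pw: "pairwise R L \<longleftrightarrow> pairwise Q L" if "L \<subseteq> U" for L
    using that RQ unfolding pairwise_def by blast
  have mdef: "max_noncrossing U L \<longleftrightarrow>
      L \<subseteq> U \<and> pairwise Q L \<and> (\<forall>X\<in>U. (\<forall>Y\<in>L. Q X Y) \<longrightarrow> X \<in> L)"
    by (simp add: max_noncrossing_def Q_def)
  have "maximal_compatible u E U L \<longleftrightarrow> (L \<subseteq> U \<and> pairwise R L) \<and>
      (\<forall>L'. (L' \<subseteq> U \<and> pairwise R L') \<and> L \<subseteq> L' \<longrightarrow> L' = L)"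
    by (simp add: maximal_compatible_def R_def)
  also have "\<dots> \<longleftrightarrow> (L \<subseteq> U \<and> pairwise Q L) \<and>
      (\<forall>L'. (L' \<subseteq> U \<and> pairwise Q L') \<and> L \<subseteq> L' \<longrightarrow> L' = L)"
    using pw by (metis (no_types, lifting))
  also have "\<dots> \<longleftrightarrow> max_noncrossing U L"
  proof
    assume a: "(L \<subseteq> U \<and> pairwise Q L) \<and> (\<forall>L'. (L' \<subseteq> U \<and> pairwise Q L') \<and> L \<subseteq> L' \<longrightarrow> L' = L)"
    have "X \<in> L" if "X \<in> U" "\<forall>Y\<in>L. Q X Y" for X
    proof -
      have "insert X L \<subseteq> U" "pairwise Q (insert X L)" using a that Qs by (auto simp: pairwise_insert)
      then have "insert X L = L" using a by blast
      then show ?thesis by blast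
    qed
    then show "max_noncrossing U L" unfolding mdef using a by blast
  next
    assume m: "max_noncrossing U L"
    have "L' = L" if L': "L' \<subseteq> U" "pairwise Q L'" "L \<subseteq> L'" for L'
    proof (rule ccontr)
      assume "L' \<noteq> L"
      then have "\<not> L' \<subseteq> L" using L'(3) by (metis subset_antisym)
      then obtain X where X: "X \<in> L'" "X \<notin> L" by blast
      have "Q X Y" if "Y \<in> L" for Y
        using L'(2) X that L'(3) by (intro pairwiseD[of Q L']) auto
      then have "\<forall>Y\<in>L. Q X Y" ..
      then show False using X(2) subsetD[OF L'(1) X(1)] m unfolding mdef by blast
    qed
    then show "(L \<subseteq> U \<and> pairwise Q L) \<and> (\<forall>L'. (L' \<subseteq> U \<and> pairwise Q L') \<and> L \<subseteq> L' \<longrightarrow> L' = L)"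
      using m unfolding mdef by blast
  qed
  finally show ?thesis .
qed

lemma lamination_iff: "lamination u E L \<longleftrightarrow> max_noncrossing {X. is_regular X \<or> is_singular X} L"
  unfolding lamination_def by (rule maximal_compatible_iff) simp

lemma sublamination_iff:
  "sublamination u E I L \<longleftrightarrow> max_noncrossing {X. is_regular X \<and> supp_J X \<subseteq> I} L"
  unfolding sublamination_def by (rule maximal_compatible_iff) simp

end

section \<open>The space of intervals\<close>

text \<open>On representatives in \<open>Htilde\<close>, this is the relation generated by
  \<open>Hrel\<close>: points agree up to translation, and the sign is remembered only on the
  boundary y = x + pi.\<close>

definition Heq :: "point \<Rightarrow> point \<Rightarrow> bool" where
  "Heq p q \<longleftrightarrow> (\<exists>n::int. fst q = fst p + of_int n * pi \<and> fst (snd q) = fst (snd p) + of_int n * pi) \<and>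
     (fst (snd p) = fst p + pi \<longrightarrow> snd (snd p) = snd (snd q))"

lemma Heq_refl: "Heq p p"
  by (auto simp: Heq_def intro: exI[of _ 0])

lemma Heq_trans: "Heq p q \<Longrightarrow> Heq q r \<Longrightarrow> Heq p r"
proof -
  assume pq: "Heq p q" and qr: "Heq q r"
  obtain m n :: int where m: "fst q = fst p + of_int m * pi" "fst (snd q) = fst (snd p) + of_int m * pi"
    and n: "fst r = fst q + of_int n * pi" "fst (snd r) = fst (snd q) + of_int n * pi"
    using pq qr unfolding Heq_def by blast
  have "fst r = fst p + of_int (m + n) * pi" "fst (snd r) = fst (snd p) + of_int (m + n) * pi"
    using m n by (simp_all add: algebra_simps)
  moreover have "fst (snd p) = fst p + pi \<longrightarrow> snd (snd p) = snd (snd r)"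
    using pq qr m unfolding Heq_def by simp
  ultimately show ?thesis unfolding Heq_def by blast
qed

abbreviation "Hsteps \<equiv> (Hrel \<union> Hrel\<inverse>)\<^sup>*"

lemma Hsteps_sym: "(p, q) \<in> Hsteps \<Longrightarrow> (q, p) \<in> Hsteps"
  by (rule symD[OF sym_rtrancl]) (simp add: sym_Un_converse)

lemma Hsteps_imp_Heq:
  assumes "(p, q) \<in> Hsteps"
  shows "Heq p q"
  using assms
proof (induction rule: rtrancl_induct)
  case base
  show ?case by (rule Heq_refl)
next
  case (step q r)
  have "Heq q r" if "(q, r) \<in> Hrel" for q r
  proof -
    have "fst r = fst q \<and> fst (snd r) = fst (snd q) \<and> fst (snd q) \<noteq> fst q + pi \<or>
      fst r = fst q + pi \<and> fst (snd r) = fst (snd q) + pi \<and> snd (snd q) = snd (snd r)"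
      using that by (auto simp: Hrel_def)
    then show ?thesis unfolding Heq_def by (elim disjE) (auto intro: exI[of _ 0] exI[of _ 1])
  qed
  moreover have "Heq r q" if "(q, r) \<in> Hrel" for q r
  proof -
    have "fst r = fst q \<and> fst (snd r) = fst (snd q) \<and> fst (snd q) \<noteq> fst q + pi \<or>
      fst r = fst q + pi \<and> fst (snd r) = fst (snd q) + pi \<and> snd (snd q) = snd (snd r)"
      using that by (auto simp: Hrel_def)
    then show ?thesis unfolding Heq_def
      by (elim disjE) (auto intro: exI[of _ 0] exI[of _ "- 1"])
  qed
  ultimately show ?case using step Heq_trans by blast
qed

lemma Htilde_iff: "(x, y, e) \<in> Htilde \<longleftrightarrow> x < y \<and> y \<le> x + pi"
  by (simp add: Htilde_def)

lemma Hsteps_shift: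
  assumes "x < y" "y \<le> x + pi"
  shows "((x, y, e), (x + of_int n * pi, y + of_int n * pi, e)) \<in> Hsteps"
proof -
  have nat: "((x, y, e), (x + of_nat n * pi, y + of_nat n * pi, e)) \<in> Hsteps" if "x < y" "y \<le> x + pi"
    for n :: nat and x y
  proof (induction n)
    case 0
    then show ?case by simp
  next
    case (Suc n)
    have "((x + of_nat n * pi, y + of_nat n * pi, e),
        (x + of_nat n * pi + pi, y + of_nat n * pi + pi, e)) \<in> Hrel"
      using that by (auto simp: Hrel_def)
    then have "((x + of_nat n * pi, y + of_nat n * pi, e), (x + of_nat (Suc n) * pi, y + of_nat (Suc n) * pi, e)) \<in> Hrel \<union> Hrel\<inverse>"
      by (simp add: algebra_simps)
    with Suc show ?case by (rule rtrancl_into_rtrancl)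
  qed
  show ?thesis
  proof (cases "0 \<le> n")
    case True
    then show ?thesis using nat[OF assms, of "nat n"] by simp
  next
    case False
    have "x + of_int n * pi < y + of_int n * pi" "y + of_int n * pi \<le> x + of_int n * pi + pi"
      using assms by auto
    from nat[OF this, of "nat (- n)"]
    have "((x + of_int n * pi, y + of_int n * pi, e), (x, y, e)) \<in> Hsteps" using False by simp
    then show ?thesis by (rule Hsteps_sym)
  qed
qed

lemma Heq_imp_Hsteps:
  assumes p: "p \<in> Htilde" and "Heq p q"
  shows "(p, q) \<in> Hsteps"
proof -
  obtain x y e where pe: "p = (x, y, e)" by (cases p)
  obtain x' y' e' where qe: "q = (x', y', e')" by (cases q)
  have xy: "x < y" "y \<le> x + pi" using p by (auto simp: pe Htilde_iff)
  obtain n :: int where n: "x' = x + of_int n * pi" "y' = y + of_int n * pi"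
    using assms(2) by (auto simp: Heq_def pe qe)
  have 1: "(p, (x', y', e)) \<in> Hsteps" unfolding pe n by (rule Hsteps_shift[OF xy])
  show ?thesis
  proof (cases "e = e'")
    case True
    then show ?thesis using 1 qe by simp
  next
    case False
    then have "y < x + pi" using assms(2) xy by (auto simp: Heq_def pe qe)
    then have "x' < y'" "y' < x' + pi" using xy n by auto
    then have "((x', y', Pos), (x', y', Neg)) \<in> Hrel" by (auto simp: Hrel_def)
    then have "((x', y', e), q) \<in> Hrel \<union> Hrel\<inverse>" unfolding qe using False by (cases e; cases e') auto
    with 1 show ?thesis by (rule rtrancl_into_rtrancl)
  qed
qed

lemma Hclass_eq_iff:
  assumes "p \<in> Htilde"
  shows "Hclass p = Hclass q \<longleftrightarrow> Heq p q"
proof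
  assume "Hclass p = Hclass q"
  moreover have "q \<in> Hclass q" by (simp add: Hclass_def)
  ultimately have "q \<in> Hclass p" by simp
  then have "(p, q) \<in> Hsteps" by (simp add: Hclass_def)
  then show "Heq p q" by (rule Hsteps_imp_Heq)
next
  assume "Heq p q"
  then have pq: "(p, q) \<in> Hsteps" by (rule Heq_imp_Hsteps[OF assms])
  then have qp: "(q, p) \<in> Hsteps" by (rule Hsteps_sym)
  show "Hclass p = Hclass q"
    unfolding Hclass_def using pq qp by (auto intro: rtrancl_trans)
qed

abbreviation "Hbase \<equiv> subtopology
  (prod_topology euclideanreal (prod_topology euclideanreal (discrete_topology (UNIV :: sign set)))) Htilde"

lemma topspace_Hbase: "topspace Hbase = Htilde"
  by (simp add: topspace_prod_topology)

lemma openin_Hspace: "openin Hspace U \<longleftrightarrow> U \<subseteq> Hclass ` Htilde \<and> openin Hbase {p \<in> Htilde. Hclass p \<in> U}"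
  unfolding Hspace_def openin_quot_topology topspace_Hbase ..

lemma topspace_Hspace: "topspace Hspace = Hclass ` Htilde"
proof -
  have "openin Hspace (Hclass ` Htilde)"
  proof -
    have "{p \<in> Htilde. Hclass p \<in> Hclass ` Htilde} = topspace Hbase" unfolding topspace_Hbase by blast
    then show ?thesis unfolding openin_Hspace using openin_topspace[of Hbase] by simp
  qed
  then show ?thesis using openin_Hspace openin_topspace openin_subset by (metis subset_antisym)
qed

lemma openin_HbaseD:
  assumes "openin Hbase W" "(x, y, e) \<in> W"
  shows "\<exists>\<delta>>0. \<forall>x' y'. \<bar>x' - x\<bar> < \<delta> \<longrightarrow> \<bar>y' - y\<bar> < \<delta> \<longrightarrow> (x', y', e) \<in> Htilde \<longrightarrow> (x', y', e) \<in> W"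
proof -
  obtain T where T: "openin (prod_topology euclideanreal (prod_topology euclideanreal (discrete_topology (UNIV :: sign set)))) T"
    and W: "W = T \<inter> Htilde" using assms(1) unfolding openin_subtopology by blast
  have "(x, (y, e)) \<in> T" using assms(2) W by simp
  then obtain A B where A: "openin euclideanreal A" "x \<in> A"
    and B: "openin (prod_topology euclideanreal (discrete_topology (UNIV :: sign set))) B" "(y, e) \<in> B"
    and AB: "A \<times> B \<subseteq> T" using T unfolding openin_prod_topology_alt by meson
  obtain B1 B2 where B1: "openin euclideanreal B1" "y \<in> B1" and B2: "e \<in> B2" "B1 \<times> B2 \<subseteq> B"
    using B unfolding openin_prod_topology_alt by meson
  obtain d1 where d1: "0 < d1" "\<And>z. dist z x < d1 \<Longrightarrow> z \<in> A"
    using A open_dist by (metis open_openin)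
  obtain d2 where d2: "0 < d2" "\<And>z. dist z y < d2 \<Longrightarrow> z \<in> B1"
    using B1 open_dist by (metis open_openin)
  show ?thesis
  proof (intro exI[of _ "min d1 d2"] conjI allI impI)
    show "0 < min d1 d2" using d1 d2 by simp
    fix x' y' assume "\<bar>x' - x\<bar> < min d1 d2" "\<bar>y' - y\<bar> < min d1 d2" and H: "(x', y', e) \<in> Htilde"
    then have "x' \<in> A" "y' \<in> B1" using d1 d2 by (simp_all add: dist_real_def)
    then have "(x', y', e) \<in> T" using AB B2 by blast
    then show "(x', y', e) \<in> W" using W H by blast
  qed
qed

lemma openin_HbaseI:
  assumes "\<And>e. open (G e)"
  shows "openin Hbase {(x, y, e). (x, y) \<in> G e \<and> (x, y, e) \<in> Htilde}"
proof -
  have "openin (prod_topology euclideanreal (prod_topology euclideanreal (discrete_topology (UNIV :: sign set))))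
    {(x, y, e). (x, y) \<in> G e}"
  proof (subst openin_prod_topology_alt, intro allI impI)
    fix x ye assume a: "(x, ye) \<in> {(x, y, e). (x, y) \<in> G e}"
    obtain y e where ye: "ye = (y, e)" by (cases ye)
    have xy: "(x, y) \<in> G e" using a unfolding ye by simp
    obtain A B where AB: "open A" "open B" "(x, y) \<in> A \<times> B" "A \<times> B \<subseteq> G e"
      by (rule open_prod_elim[OF assms[of e] xy])
    have "openin (prod_topology euclideanreal (discrete_topology (UNIV :: sign set))) (B \<times> {e})"
      using AB by (simp add: openin_prod_Times_iff)
    moreover have "A \<times> (B \<times> {e}) \<subseteq> {(x, y, e). (x, y) \<in> G e}" using AB by auto
    ultimately show "\<exists>U V. openin euclideanreal U \<and>
      openin (prod_topology euclideanreal (discrete_topology (UNIV :: sign set))) V \<and> x \<in> U \<and> ye \<in> V \<and>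
      U \<times> V \<subseteq> {(x, y, e). (x, y) \<in> G e}"
      using AB ye by (intro exI[of _ A] exI[of _ "B \<times> {e}"]) auto
  qed
  then have "openin Hbase ({(x, y, e). (x, y) \<in> G e} \<inter> Htilde)"
    by (rule openin_subtopology_Int)
  moreover have "{(x, y, e). (x, y) \<in> G e} \<inter> Htilde = {(x, y, e). (x, y) \<in> G e \<and> (x, y, e) \<in> Htilde}" by auto
  ultimately show ?thesis by simp
qed

text \<open>A saturated open set of representatives descends to the quotient. It may be given by one
  planar open set per sign because the sign carries the discrete topology.\<close>

lemma openin_HspaceI:
  assumes G: "\<And>e. open (G e)"
    and sat: "\<And>x y e x' y' e'. (x, y, e) \<in> Htilde \<Longrightarrow> (x', y', e') \<in> Htilde \<Longrightarrow>
      Heq (x, y, e) (x', y', e') \<Longrightarrow> (x, y) \<in> G e \<Longrightarrow> (x', y') \<in> G e'"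
  obtains W where "openin Hspace W"
    "\<And>x y e. (x, y, e) \<in> Htilde \<Longrightarrow> Hclass (x, y, e) \<in> W \<longleftrightarrow> (x, y) \<in> G e"
proof -
  define V where "V = {(x, y, e). (x, y) \<in> G e \<and> (x, y, e) \<in> Htilde}"
  have V: "V \<subseteq> Htilde" "\<And>x y e. (x, y, e) \<in> Htilde \<Longrightarrow> (x, y, e) \<in> V \<longleftrightarrow> (x, y) \<in> G e"
    by (auto simp: V_def)
  have iff: "Hclass p \<in> Hclass ` V \<longleftrightarrow> p \<in> V" if p: "p \<in> Htilde" for p
  proof
    assume "Hclass p \<in> Hclass ` V"
    then obtain q where q: "q \<in> V" "Hclass q = Hclass p" by auto
    then have qp: "Heq q p" using Hclass_eq_iff[of q p] V(1) by blast
    obtain x y e where q': "q = (x, y, e)" by (cases q)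
    obtain x' y' e' where p': "p = (x', y', e')" by (cases p)
    have "(x, y) \<in> G e" "(x, y, e) \<in> Htilde" using q(1) V unfolding q' by blast+
    then have "(x', y') \<in> G e'" using sat[of x y e x' y' e'] qp p unfolding p' q' by blast
    then show "p \<in> V" using V(2)[of x' y' e'] p unfolding p' by blast
  qed blast
  have "openin Hspace (Hclass ` V)"
    unfolding openin_Hspace
  proof
    have "{p \<in> Htilde. Hclass p \<in> Hclass ` V} = V" using iff V(1) by blast
    then show "openin Hbase {p \<in> Htilde. Hclass p \<in> Hclass ` V}"
      using openin_HbaseI[OF G] by (simp add: V_def)
  qed (rule image_mono[OF V(1)])
  then show ?thesis
  proof (rule that)
    fix x y e assume p: "(x, y, e) \<in> Htilde"
    show "Hclass (x, y, e) \<in> Hclass ` V \<longleftrightarrow> (x, y) \<in> G e" using iff[OF p] V(2)[OF p] by simp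
  qed
qed

text \<open>For regular names both signs give the same class; \<open>Pos\<close> is the one that
  \<open>h_map\<close> uses.\<close>

definition sg :: "indec \<Rightarrow> sign" where
  "sg X = (case X of SM x y \<Rightarrow> Pos | Zs e x \<Rightarrow> e)"

lemma sg_Zs [simp]: "sg (Zs e x) = e"
  by (simp add: sg_def)

lemma h_point_Htilde: "is_regular X \<or> is_singular X \<Longrightarrow> (lo X, hi X, e) \<in> Htilde"
  by (cases X) (auto simp: Htilde_iff)

lemma h_map_eq:
  assumes "is_regular X \<or> is_singular X"
  shows "h_map X = Hclass (lo X, hi X, sg X)"
proof (cases X)
  case (SM x y)
  then have X: "0 < \<bar>x - y\<bar>" "\<bar>x - y\<bar> < pi" using assms by auto
  show ?thesis
  proof (cases "y < x")
    case True
    then show ?thesis using SM X by (simp add: Let_def sg_def)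
  next
    case False
    then have "h_map X = Hclass (y + pi, x + 2 * pi, Pos)" using SM X by (simp add: Let_def)
    also have "\<dots> = Hclass (y, x + pi, Pos)"
    proof (subst eq_commute, subst Hclass_eq_iff)
      show "(y, x + pi, Pos) \<in> Htilde" using X False by (auto simp: Htilde_iff)
      show "Heq (y, x + pi, Pos) (y + pi, x + 2 * pi, Pos)"
        unfolding Heq_def by (auto intro: exI[of _ 1])
    qed
    finally show ?thesis using SM False by (simp add: sg_def max_def min_def)
  qed
qed simp

lemma h_map_regular:
  assumes "is_regular X"
  shows "h_map X = Hclass (lo X + of_int m * pi, hi X + of_int m * pi, e)"
proof -
  have "Heq (lo X, hi X, sg X) (lo X + of_int m * pi, hi X + of_int m * pi, e)"
    using regular_lo_hi[OF assms] by (auto simp: Heq_def)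
  then show ?thesis
    using h_map_eq[of X] Hclass_eq_iff[OF h_point_Htilde] assms by simp
qed

lemma h_map_Z_shift: "h_map (Zs e x) = Hclass (x + of_int m * pi, x + pi + of_int m * pi, e)"
proof -
  have "Heq (x, x + pi, e) (x + of_int m * pi, x + pi + of_int m * pi, e)" by (auto simp: Heq_def)
  then show ?thesis using Hclass_eq_iff[of "(x, x + pi, e)"] by (simp add: Htilde_iff)
qed

lemma discrete_indecs_iff:
  assumes L: "\<forall>X\<in>L. is_regular X \<or> is_singular X"
  shows "discrete_indecs L \<longleftrightarrow> (\<forall>X\<in>L. \<exists>W. openin Hspace W \<and> W \<inter> h_map ` L = {h_map X})"
proof -
  have sub: "h_map ` L \<subseteq> topspace Hspace"
    unfolding topspace_Hspace
  proof (rule image_subsetI)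
    fix X assume "X \<in> L"
    then have X: "is_regular X \<or> is_singular X" using L by blast
    show "h_map X \<in> Hclass ` Htilde" unfolding h_map_eq[OF X] by (rule imageI[OF h_point_Htilde[OF X]])
  qed
  then have top: "topspace (subtopology Hspace (h_map ` L)) = h_map ` L" by auto
  have "discrete_indecs L \<longleftrightarrow> discrete_topology (h_map ` L) = subtopology Hspace (h_map ` L)"
    unfolding discrete_indecs_def by (rule eq_commute)
  also have "\<dots> \<longleftrightarrow> (\<forall>x\<in>h_map ` L. openin (subtopology Hspace (h_map ` L)) {x})"
    unfolding discrete_topology_unique using top by simp
  also have "\<dots> \<longleftrightarrow> (\<forall>X\<in>L. \<exists>W. openin Hspace W \<and> W \<inter> h_map ` L = {h_map X})"
  proof -
    have "openin (subtopology Hspace (h_map ` L)) {z} \<longleftrightarrow> (\<exists>W. openin Hspace W \<and> W \<inter> h_map ` L = {z})" for z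
      unfolding openin_subtopology by (rule ex_cong1, rule conj_cong, rule refl, rule eq_commute)
    then show ?thesis by simp
  qed
  finally show ?thesis .
qed

text \<open>An isolating neighbourhood contains a box around (x, x + pi) on the sheet of sign e.
  Regular intervals near that point lie on both sheets, so they are excluded, as are nearby singular
  objects of the same sign at other points.\<close>

lemma discrete_singularD:
  assumes L: "\<forall>X\<in>L. is_regular X \<or> is_singular X" and d: "discrete_indecs L" and X: "Zs e x \<in> L"
  obtains \<delta> where "0 < \<delta>"
    "\<And>Y m. Y \<in> L \<Longrightarrow> is_regular Y \<Longrightarrow> \<bar>lo Y + of_int m * pi - x\<bar> < \<delta> \<Longrightarrow>
      \<bar>hi Y + of_int m * pi - (x + pi)\<bar> < \<delta> \<Longrightarrow> False"
    "\<And>y m. Zs e y \<in> L \<Longrightarrow> \<bar>y + of_int m * pi - x\<bar> < \<delta> \<Longrightarrow> circ y = circ x"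
proof -
  from bspec[OF d[unfolded discrete_indecs_iff[OF L]] X]
  obtain W where W: "openin Hspace W" "W \<inter> h_map ` L = {h_map (Zs e x)}" by (elim exE conjE)
  have 1: "openin Hbase {p \<in> Htilde. Hclass p \<in> W}" using W(1) unfolding openin_Hspace by (rule conjunct2)
  have "h_map (Zs e x) \<in> W" using W(2) by auto
  then have 2: "(x, x + pi, e) \<in> {p \<in> Htilde. Hclass p \<in> W}" by (simp add: Htilde_iff)
  from openin_HbaseD[OF 1 2] obtain \<delta> where \<delta>0: "0 < \<delta>"
    "\<forall>x' y'. \<bar>x' - x\<bar> < \<delta> \<longrightarrow> \<bar>y' - (x + pi)\<bar> < \<delta> \<longrightarrow> (x', y', e) \<in> Htilde \<longrightarrow>
      (x', y', e) \<in> {p \<in> Htilde. Hclass p \<in> W}"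
    by (elim exE conjE)
  note \<delta> = \<delta>0(1) \<delta>0(2)[rule_format]
  have eqD: "h_map Y = h_map (Zs e x)" if Y: "Y \<in> L" "h_map Y \<in> W" for Y
  proof -
    have "h_map Y \<in> W \<inter> h_map ` L" using Y by simp
    then show ?thesis unfolding W(2) by simp
  qed
  show ?thesis
  proof (rule that[OF \<delta>(1)])
    fix Y and m :: int
    assume Y: "Y \<in> L" "is_regular Y" "\<bar>lo Y + of_int m * pi - x\<bar> < \<delta>" "\<bar>hi Y + of_int m * pi - (x + pi)\<bar> < \<delta>"
    note lh = regular_lo_hi[OF Y(2)]
    have "(lo Y + of_int m * pi, hi Y + of_int m * pi, e) \<in> Htilde" using lh by (auto simp: Htilde_iff)
    then have "h_map Y \<in> W" using \<delta>(2)[OF Y(3,4)] h_map_regular[OF Y(2), of m e] by simp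
    then have "Hclass (x, x + pi, e) = Hclass (lo Y, hi Y, sg Y)"
      using eqD[OF Y(1)] h_map_eq[of Y] Y(2) by simp
    then have "Heq (x, x + pi, e) (lo Y, hi Y, sg Y)"
      using Hclass_eq_iff[of "(x, x + pi, e)"] by (simp add: Htilde_iff)
    then have "hi Y = lo Y + pi" by (auto simp: Heq_def)
    then show False using lh by simp
  next
    fix y and m :: int
    assume y: "Zs e y \<in> L" "\<bar>y + of_int m * pi - x\<bar> < \<delta>"
    have "h_map (Zs e y) \<in> W"
      using \<delta>(2)[of "y + of_int m * pi" "y + pi + of_int m * pi"] y(2) h_map_Z_shift[of e y m]
      by (simp add: Htilde_iff algebra_simps)
    then have "Hclass (y, y + pi, e) = Hclass (x, x + pi, e)" using eqD[OF y(1)] by simp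
    then have "Heq (y, y + pi, e) (x, x + pi, e)"
      using Hclass_eq_iff[of "(y, y + pi, e)"] by (simp add: Htilde_iff)
    then show "circ y = circ x" unfolding circ_eq_iff by (auto simp: Heq_def)
  qed
qed

section \<open>The structure of a discrete lamination\<close>

lemma not_in_own_arc: "c \<le> a + pi \<Longrightarrow> circ a \<notin> circ_arc a c"
proof
  assume c: "c \<le> a + pi" and "circ a \<in> circ_arc a c"
  from in_arc_disjoint[OF this] show False by simp
qed

text \<open>The complement of finitely many points on the circle is a union of arcs.\<close>

lemma circle_arcs:
  assumes F: "finite F" "F \<subseteq> {a..<a + pi}" and k: "k = card F" "2 \<le> k"
  shows "\<exists>x::nat \<Rightarrow> real. strict_mono_on {1..k} x \<and> x k < x 1 + pi \<and> x ` {1..k} = F \<and>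
    (\<exists>\<I>. card \<I> = k \<and> (\<forall>I\<in>\<I>. circle_interval I) \<and> pairwise disjnt \<I> \<and>
       \<Union>\<I> = topspace circle - circ ` F)"
proof -
  define l where "l = sorted_list_of_set F"
  have l: "set l = F" "length l = k" "sorted_wrt (<) l"
    using F k by (simp_all add: l_def strict_sorted_list_of_set)
  have mono: "l ! i < l ! j" if "i < j" "j < k" for i j
    using sorted_wrt_nth_less[OF l(3), of i j] that l(2) by simp
  have mem: "l ! i \<in> F" if "i < k" for i using that l nth_mem by metis
  have F_eq: "F = (\<lambda>i. l ! i) ` {..<k}"
    unfolding l(1)[symmetric] l(2)[symmetric] by (auto simp: in_set_conv_nth)
  have k0: "0 < k" using k by simp
  \<comment> \<open>The point after the i-th one; after the last comes the first again, one turn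
    later.\<close>
  define nx where "nx i = (if i + 1 < k then l ! (i + 1) else l ! 0 + pi)" for i
  have rng: "a \<le> l ! i" "l ! i < a + pi" if "i < k" for i using mem[OF that] F(2) by auto
  have l0: "l ! 0 \<le> l ! i" if "i < k" for i using mono[of 0 i] that by (cases "i = 0") auto
  have lub: "l ! i < l ! 0 + pi" if "i < k" for i using rng[OF that] rng[OF k0] by simp
  have nx: "l ! i < nx i" "nx i \<le> l ! 0 + pi" if "i < k" for i
    using that mono[of i "i + 1"] lub by (auto simp: nx_def intro: less_imp_le)
  have nx': "nx i \<le> l ! i + pi" if "i < k" for i using nx(2)[OF that] l0[OF that] by simp
  have nxj: "nx i \<le> l ! j" if "i < j" "j < k" for i j
  proof (cases "i + 1 = j")
    case False
    then have "i + 1 < j" using that by simp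
    then show ?thesis using that mono[of "i + 1" j] by (simp add: nx_def)
  qed (use that in \<open>simp add: nx_def\<close>)
  let ?A = "\<lambda>i. circ_arc (l ! i) (nx i)"
  have disj: "?A i \<inter> ?A j = {}" if "i < j" "j < k" for i j
  proof (rule ccontr)
    assume "?A i \<inter> ?A j \<noteq> {}"
    then obtain z where z: "z \<in> ?A i" "z \<in> ?A j" by blast
    then obtain t where t: "z = circ t" "l ! i < t" "t < nx i" by (auto simp: circ_arc_def)
    obtain m :: int where m: "l ! j < t + of_int m * pi" "t + of_int m * pi < nx j"
      using z(2) unfolding t(1) in_arc_iff by (elim exE conjE)
    have i: "i < k" using that by simp
    have "m = 0"
      by (rule shift_less_pi[of "l ! 0" t])
        (use t m l0[OF i] l0[OF that(2)] nx(2)[OF i] nx(2)[OF that(2)] in linarith)+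
    then show False using m t nxj[OF that] by simp
  qed
  have ne: "?A i \<noteq> {}" if "i < k" for i using arc_nonempty[OF nx(1)[OF that]] .
  have inj: "inj_on ?A {..<k}"
  proof (rule inj_onI)
    fix i j assume ij: "i \<in> {..<k}" "j \<in> {..<k}" "?A i = ?A j"
    show "i = j"
    proof (rule ccontr)
      assume "i \<noteq> j"
      then have "i < j \<or> j < i" by auto
      then have "?A i \<inter> ?A j = {}" using disj[of i j] disj[of j i] ij(1,2) by auto
      then show False using ij ne[of i] by auto
    qed
  qed
  have un: "(\<Union>i<k. ?A i) = topspace circle - circ ` F"
  proof
    show "(\<Union>i<k. ?A i) \<subseteq> topspace circle - circ ` F"
    proof (rule UN_least)
      fix i assume "i \<in> {..<k}"
      then have i: "i < k" by simp
      show "?A i \<subseteq> topspace circle - circ ` F"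
      proof
        fix z assume "z \<in> ?A i"
        then obtain t where t: "z = circ t" "l ! i < t" "t < nx i" by (auto simp: circ_arc_def)
        have "circ t \<notin> circ ` F"
        proof
          assume "circ t \<in> circ ` F"
          then obtain j where j: "j < k" "circ t = circ (l ! j)" unfolding F_eq by auto
          have "t = l ! j"
            by (rule inj_onD[OF circ_inj_on[of "l ! 0"] j(2)])
              (use t l0[OF i] nx(2)[OF i] l0[OF j(1)] lub[OF j(1)] in auto)
          then show False using t nxj[of i j] mono[of j i] i j(1) by (cases "i = j"; cases "i < j") auto
        qed
        then show "z \<in> topspace circle - circ ` F" using t by (auto simp: topspace_circle)
      qed
    qed
    show "topspace circle - circ ` F \<subseteq> (\<Union>i<k. ?A i)"
    proof
      fix z assume z: "z \<in> topspace circle - circ ` F"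
      then obtain r where r: "z = circ r" by (auto simp: topspace_circle)
      obtain m :: int where m: "l ! 0 \<le> r + of_int m * pi" "r + of_int m * pi < l ! 0 + pi"
        using circ_representative .
      define t where "t = r + of_int m * pi"
      have t: "z = circ t" "l ! 0 \<le> t" "t < l ! 0 + pi" using r m by (simp_all add: t_def)
      have tF: "t \<noteq> l ! i" if "i < k" for i using z mem[OF that] t(1) by auto
      \<comment> \<open>The arc containing z starts at the last point of F that does not exceed the
        lift t of z.\<close>
      define S where "S = {j. j < k \<and> l ! j \<le> t}"
      have S: "finite S" "S \<noteq> {}" using t(2) k0 by (auto simp: S_def)
      define i where "i = Max S"
      have "i \<in> S" using Max_in[OF S] by (simp add: i_def)
      then have i: "i < k" "l ! i \<le> t" by (simp_all add: S_def)
      have "t < nx i"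
      proof (cases "i + 1 < k")
        case True
        have "i + 1 \<notin> S" using Max_ge[OF S(1), of "i + 1"] by (auto simp: i_def)
        then show ?thesis using True by (simp add: S_def nx_def)
      qed (use t(3) in \<open>simp add: nx_def\<close>)
      moreover have "l ! i < t" using i tF[OF i(1)] by simp
      ultimately have "z \<in> ?A i" unfolding t(1) circ_arc_def by simp
      then show "z \<in> (\<Union>i<k. ?A i)" using i(1) by blast
    qed
  qed
  have int: "circle_interval (?A i)" if "i < k" for i
    unfolding circle_interval_def
  proof (intro conjI)
    have "circ (l ! i) \<notin> ?A i" using not_in_own_arc[OF nx'[OF that]] .
    moreover have "circ (l ! i) \<in> topspace circle" by (simp add: topspace_circle)
    ultimately show "?A i \<noteq> topspace circle" by metis
  qed (use ne[OF that] openin_arc connectedin_arc in auto)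
  \<comment> \<open>The list is indexed from 0, the points of the statement from 1.\<close>
  define x where "x i = l ! (i - 1)" for i
  have "strict_mono_on {1..k} x"
    by (rule strict_mono_onI) (auto simp: x_def intro!: mono)
  moreover have "x k < x 1 + pi" using lub[of "k - 1"] k0 by (simp add: x_def)
  moreover have "x ` {1..k} = F"
  proof -
    have "x ` {1..k} = (\<lambda>i. l ! i) ` ((\<lambda>i. i - 1) ` {1..k})" by (simp add: image_image x_def)
    also have "(\<lambda>i. i - 1) ` {1..k} = {..<k}"
    proof
      show "{..<k} \<subseteq> (\<lambda>i. i - 1) ` {1..k}"
      proof
        fix i assume "i \<in> {..<k}"
        then have "i = (i + 1) - 1" "i + 1 \<in> {1..k}" by auto
        then show "i \<in> (\<lambda>i. i - 1) ` {1..k}" by (rule image_eqI)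
      qed
    qed auto
    finally show ?thesis using F_eq by simp
  qed
  moreover have "card (?A ` {..<k}) = k" using card_image[OF inj] by simp
  moreover have "\<forall>I\<in>?A ` {..<k}. circle_interval I" using int by auto
  moreover have "pairwise disjnt (?A ` {..<k})"
  proof (rule pairwiseI)
    fix I J assume "I \<in> ?A ` {..<k}" "J \<in> ?A ` {..<k}" "I \<noteq> J"
    then obtain i j where ij: "i < k" "j < k" "I = ?A i" "J = ?A j" "i \<noteq> j" by auto
    then have "i < j \<or> j < i" by auto
    then show "disjnt I J" unfolding disjnt_def ij(3,4) using disj[of i j] disj[of j i] ij(1,2) by auto
  qed
  ultimately show ?thesis using un by (intro exI[of _ x] conjI exI[of _ "?A ` {..<k}"]) simp_all
qed

text \<open>A nonzero number of turns moves an interval shorter than pi off itself, and with zero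
  turns the strict inequalities fail.\<close>

lemma not_cross_self: "is_regular X \<Longrightarrow> \<not> cross X X"
proof
  assume X: "is_regular X" and "cross X X"
  note lh = regular_lo_hi[OF X]
  obtain m :: int where "(lo X < lo X + of_int m * pi \<and> lo X + of_int m * pi < hi X) \<or>
     (lo X + of_int m * pi < lo X \<and> lo X < hi X + of_int m * pi)"
    using \<open>cross X X\<close> unfolding cross_def by blast
  then have b: "0 < real_of_int m * pi \<and> real_of_int m * pi < pi \<or> - pi < real_of_int m * pi \<and> real_of_int m * pi < 0"
    using lh by linarith
  then have "m = 0"
    using shift_less_pi[of 0 0 m] shift_less_pi[of "- pi" "- pi" "m + 1"] shift_less_pi[of 0 0 "- m"] by auto
  then show False using b by simp
qed

section \<open>Covered and uncovered points of a discrete lamination\<close>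

locale discrete_lamination =
  fixes L :: "indec set"
  assumes max: "max_noncrossing {X. is_regular X \<or> is_singular X} L"
    and disc: "discrete_indecs L"
begin

lemma names: "\<forall>X\<in>L. is_regular X \<or> is_singular X"
  using max unfolding max_noncrossing_def by blast

lemma L_noncrossing: "X \<in> L \<Longrightarrow> Y \<in> L \<Longrightarrow> X \<noteq> Y \<Longrightarrow> noncrossing X Y \<and> \<not> same X Y"
proof -
  assume "X \<in> L" "Y \<in> L" "X \<noteq> Y"
  moreover have "pairwise (\<lambda>X Y. noncrossing X Y \<and> \<not> same X Y) L"
    using max by (simp add: max_noncrossing_def)
  ultimately show ?thesis by (auto dest: pairwiseD)
qed

text \<open>All lifts to the line are included, so that suprema and infima of end points can be
  taken.\<close>

definition iv :: "real \<Rightarrow> real \<Rightarrow> bool" where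
  "iv a c \<longleftrightarrow> (\<exists>X m. X \<in> L \<and> is_regular X \<and> a = lo X + of_int m * pi \<and> c = hi X + of_int m * pi)"

definition covered :: "real \<Rightarrow> bool" where
  "covered t \<longleftrightarrow> (\<exists>a c. iv a c \<and> a < t \<and> t < c)"

lemma iv_length: "iv a c \<Longrightarrow> a < c \<and> c < a + pi"
  using regular_lo_hi unfolding iv_def by auto

lemma iv_noncrossing: "iv a c \<Longrightarrow> iv a' c' \<Longrightarrow> a < a' \<Longrightarrow> a' < c \<Longrightarrow> c < c' \<Longrightarrow> False"
proof -
  assume i: "iv a c" "iv a' c'" and lt: "a < a'" "a' < c" "c < c'"
  obtain X m where X: "X \<in> L" "is_regular X" "a = lo X + of_int m * pi" "c = hi X + of_int m * pi"
    using i(1) unfolding iv_def by blast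
  obtain Y n where Y: "Y \<in> L" "is_regular Y" "a' = lo Y + of_int n * pi" "c' = hi Y + of_int n * pi"
    using i(2) unfolding iv_def by blast
  have "lo X < lo Y + of_int (n - m) * pi \<and> lo Y + of_int (n - m) * pi < hi X \<and>
      hi X < hi Y + of_int (n - m) * pi" using X Y lt by (simp add: algebra_simps)
  then have "cross X Y" unfolding cross_def by blast
  then show False
    using L_noncrossing[OF X(1) Y(1)] noncrossing_regular(1)[OF X(2), of Y] not_cross_self[OF X(2)]
    by (cases "X = Y") auto
qed

lemma covered_iff: "covered t \<longleftrightarrow> (\<exists>X\<in>L. is_regular X \<and> circ t \<in> supp_J X)"
proof
  assume "covered t"
  then obtain X m where X: "X \<in> L" "is_regular X" "lo X + of_int m * pi < t" "t < hi X + of_int m * pi"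
    unfolding covered_def iv_def by blast
  have "circ t \<in> supp_J X"
    unfolding regular_supp[OF X(2)] in_arc_iff by (rule exI[of _ "- m"]) (use X in simp)
  then show "\<exists>X\<in>L. is_regular X \<and> circ t \<in> supp_J X" using X by blast
next
  assume "\<exists>X\<in>L. is_regular X \<and> circ t \<in> supp_J X"
  then obtain X where X: "X \<in> L" "is_regular X" "circ t \<in> supp_J X" by blast
  obtain m :: int where m: "lo X < t + of_int m * pi" "t + of_int m * pi < hi X"
    using X(3) unfolding regular_supp[OF X(2)] in_arc_iff by (elim exE conjE)
  have "iv (lo X + of_int (- m) * pi) (hi X + of_int (- m) * pi)" unfolding iv_def using X by blast
  moreover have "lo X + of_int (- m) * pi < t" "t < hi X + of_int (- m) * pi" using m by simp_all
  ultimately show "covered t" unfolding covered_def by blast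
qed

lemma R_union_iff: "circ t \<in> R_union L \<longleftrightarrow> covered t"
  unfolding covered_iff R_union_def by auto

lemma R_union_range: "R_union L \<subseteq> range circ"
proof
  fix z assume "z \<in> R_union L"
  then obtain X where X: "is_regular X" "z \<in> supp_J X" unfolding R_union_def by auto
  then show "z \<in> range circ" using arc_subset_range unfolding regular_supp[OF X(1)] by blast
qed

lemma covered_shift: "covered (t + of_int m * pi) \<longleftrightarrow> covered t"
  unfolding R_union_iff[symmetric] by simp

lemma open_covered: "open {t. covered t}"
proof -
  have "{t. covered t} = (\<Union>p\<in>{(a, c). iv a c}. {fst p<..<snd p})" by (force simp: covered_def)
  moreover have "open (\<Union>p\<in>{(a, c). iv a c}. {fst p<..<snd p})" by (rule open_UN) simp
  ultimately show ?thesis by simp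
qed

lemma singular_uncovered: "Zs e t \<in> L \<Longrightarrow> \<not> covered t"
proof
  assume Z: "Zs e t \<in> L" and "covered t"
  then obtain X where X: "X \<in> L" "is_regular X" "circ t \<in> supp_J X" unfolding covered_iff by blast
  have "X \<noteq> Zs e t" using X(2) by auto
  then have "\<not> cross X (Zs e t)" using L_noncrossing[OF X(1) Z] noncrossing_regular(1)[OF X(2)] by simp
  then show False using cross_Z_iff[OF X(2), of e t] X(3) by blast
qed

lemma singular_compatible: "Zs e x \<in> L \<Longrightarrow> Zs e' y \<in> L \<Longrightarrow> e = e' \<or> circ x = circ y"
  using L_noncrossing[of "Zs e x" "Zs e' y"] by (cases "Zs e x = Zs e' y") auto

lemma singular_unique: "Zs e x \<in> L \<Longrightarrow> Zs e y \<in> L \<Longrightarrow> circ x = circ y \<Longrightarrow> x = y"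
  using L_noncrossing[of "Zs e x" "Zs e y"] same_Z_iff[of e x e y] by auto

text \<open>Under these hypotheses \<open>Zs e t\<close> crosses nothing, so maximality supplies it
  up to the choice of a name.\<close>

lemma singular_exists:
  assumes "\<not> covered t" "\<And>e' y. Zs e' y \<in> L \<Longrightarrow> e = e' \<or> circ t = circ y"
  obtains y where "Zs e y \<in> L" "circ y = circ t"
proof -
  have "noncrossing (Zs e t) Y" if Y: "Y \<in> L" for Y
  proof (cases Y)
    case (Zs e' y)
    then show ?thesis using assms(2)[of e' y] Y by simp
  next
    case (SM a c)
    then have r: "is_regular Y" using names Y by auto
    have "\<not> cross Y (Zs e t)" using assms(1) cross_Z_iff[OF r, of e t] Y r covered_iff by blast
    then show ?thesis using noncrossing_regular(2)[OF r] cross_sym by simp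
  qed
  then have nc: "\<forall>Y\<in>L. noncrossing (Zs e t) Y" by blast
  have "Zs e t \<in> {X. is_regular X \<or> is_singular X}" by simp
  then obtain Y where Y: "Y \<in> L" "same (Zs e t) Y" using nc by (rule max_noncrossing_same[OF max])
  have "\<not> is_regular Y" using Y(2) by (simp add: same_def)
  then obtain e' y where Ye: "Y = Zs e' y" using names Y(1) by (cases Y) auto
  then show ?thesis using Y that[of y] same_Z_iff[of e t e' y] by auto
qed

text \<open>The point is the supremum of the right ends of intervals over t. An interval covering it
  either lies over t itself and reaches beyond the supremum, or starts to the right of t and crosses
  an interval over t whose end is close enough to the supremum.\<close>

lemma right_end:
  assumes "covered t"
  obtains \<beta> where "t < \<beta>" "\<not> covered \<beta>" "\<And>a c. iv a c \<Longrightarrow> a < t \<Longrightarrow> t < c \<Longrightarrow> c \<le> \<beta>"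
    "\<And>d. d < \<beta> \<Longrightarrow> \<exists>a c. iv a c \<and> a < t \<and> t < c \<and> d < c"
proof -
  define B where "B = {c. \<exists>a. iv a c \<and> a < t \<and> t < c}"
  have ne: "B \<noteq> {}" using assms unfolding covered_def B_def by blast
  have bdd: "bdd_above B"
  proof (rule bdd_aboveI[of _ "t + pi"])
    fix c assume "c \<in> B"
    then show "c \<le> t + pi" using iv_length unfolding B_def by fastforce
  qed
  define \<beta> where "\<beta> = Sup B"
  have up: "c \<le> \<beta>" if "iv a c" "a < t" "t < c" for a c
    unfolding \<beta>_def by (rule cSup_upper[OF _ bdd]) (use that in \<open>auto simp: B_def\<close>)
  have app: "\<exists>a c. iv a c \<and> a < t \<and> t < c \<and> d < c" if "d < \<beta>" for d
  proof -
    have "\<exists>c\<in>B. d < c" using that less_cSup_iff[OF ne bdd] unfolding \<beta>_def by blast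
    then show ?thesis unfolding B_def by blast
  qed
  obtain a0 c0 where i0: "iv a0 c0" "a0 < t" "t < c0" using assms unfolding covered_def by blast
  have "t < \<beta>" using up[OF i0] i0(3) by simp
  moreover have "\<not> covered \<beta>"
  proof
    assume "covered \<beta>"
    then obtain a' c' where i': "iv a' c'" "a' < \<beta>" "\<beta> < c'" unfolding covered_def by blast
    obtain a c where i: "iv a c" "a < t" "t < c" "a' < c" using app[OF i'(2)] by blast
    show False
    proof (cases "a' < t")
      case True
      then show ?thesis using up[OF i'(1) True] i'(3) \<open>t < \<beta>\<close> by simp
    next
      case False
      then show ?thesis using iv_noncrossing[OF i(1) i'(1)] i i'(3) up[OF i(1-3)] by simp
    qed
  qed
  ultimately show ?thesis using that up app by blast
qed

lemma left_end:
  assumes "covered t"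
  obtains \<alpha> where "\<alpha> < t" "\<not> covered \<alpha>" "\<And>a c. iv a c \<Longrightarrow> a < t \<Longrightarrow> t < c \<Longrightarrow> \<alpha> \<le> a"
    "\<And>d. \<alpha> < d \<Longrightarrow> \<exists>a c. iv a c \<and> a < t \<and> t < c \<and> a < d"
proof -
  define B where "B = {a. \<exists>c. iv a c \<and> a < t \<and> t < c}"
  have ne: "B \<noteq> {}" using assms unfolding covered_def B_def by blast
  have bdd: "bdd_below B"
  proof (rule bdd_belowI[of _ "t - pi"])
    fix a assume "a \<in> B"
    then show "t - pi \<le> a" using iv_length unfolding B_def by fastforce
  qed
  define \<alpha> where "\<alpha> = Inf B"
  have lo: "\<alpha> \<le> a" if "iv a c" "a < t" "t < c" for a c
    unfolding \<alpha>_def by (rule cInf_lower[OF _ bdd]) (use that in \<open>auto simp: B_def\<close>)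
  have app: "\<exists>a c. iv a c \<and> a < t \<and> t < c \<and> a < d" if "\<alpha> < d" for d
  proof -
    have "\<exists>a\<in>B. a < d" using that cInf_less_iff[OF ne bdd] unfolding \<alpha>_def by blast
    then show ?thesis unfolding B_def by blast
  qed
  obtain a0 c0 where i0: "iv a0 c0" "a0 < t" "t < c0" using assms unfolding covered_def by blast
  have "\<alpha> < t" using lo[OF i0] i0(2) by simp
  moreover have "\<not> covered \<alpha>"
  proof
    assume "covered \<alpha>"
    then obtain a' c' where i': "iv a' c'" "a' < \<alpha>" "\<alpha> < c'" unfolding covered_def by blast
    obtain a c where i: "iv a c" "a < t" "t < c" "a < c'" using app[OF i'(3)] by blast
    show False
    proof (cases "t < c'")
      case True
      then show ?thesis using lo[OF i'(1) _ True] i'(2) \<open>\<alpha> < t\<close> by simp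
    next
      case False
      then show ?thesis using iv_noncrossing[OF i'(1) i(1)] i i'(2) lo[OF i(1-3)] by simp
    qed
  qed
  ultimately show ?thesis using that lo app by blast
qed

lemma uncovered_exists: "\<exists>t. \<not> covered t"
proof (rule ccontr)
  assume "\<not> ?thesis"
  then show False using right_end[of 0] by metis
qed

text \<open>If everything strictly between x and x + pi were covered, the intervals over the
  midpoint would come arbitrarily close to both ends. They are nested, so a single one comes close
  to both, which contradicts the isolation of the singular object at x.\<close>

lemma uncovered_between_pair:
  assumes p: "Zs Pos x \<in> L" and n: "Zs Neg y \<in> L"
  shows "\<exists>t. x < t \<and> t < x + pi \<and> \<not> covered t"
proof (rule ccontr)
  assume "\<not> ?thesis"
  then have cov: "covered t" if "x < t" "t < x + pi" for t using that by blast
  have xu: "\<not> covered x" "\<not> covered (x + pi)"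
    using singular_uncovered[OF p] covered_shift[of x 1] by simp_all
  define t where "t = x + pi / 2"
  have t: "x < t" "t < x + pi" by (simp_all add: t_def)
  note ct = cov[OF t]
  have bounds: "x \<le> a \<and> c \<le> x + pi" if "iv a c" "a < t" "t < c" for a c
  proof
    show "x \<le> a"
    proof (rule ccontr)
      assume "\<not> x \<le> a"
      then have "a < x" "x < c" using that t by simp_all
      then show False using xu(1) that(1) unfolding covered_def by blast
    qed
    show "c \<le> x + pi"
    proof (rule ccontr)
      assume "\<not> c \<le> x + pi"
      then have "a < x + pi" "x + pi < c" using that t by simp_all
      then show False using xu(2) that(1) unfolding covered_def by blast
    qed
  qed
  obtain \<beta> where b: "t < \<beta>" "\<not> covered \<beta>" "\<And>d. d < \<beta> \<Longrightarrow> \<exists>a c. iv a c \<and> a < t \<and> t < c \<and> d < c"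
    using right_end[OF ct] by metis
  have b2: "x + pi \<le> \<beta>" using cov[of \<beta>] b(1,2) t by linarith
  obtain \<alpha> where a: "\<alpha> < t" "\<not> covered \<alpha>" "\<And>d. \<alpha> < d \<Longrightarrow> \<exists>a c. iv a c \<and> a < t \<and> t < c \<and> a < d"
    using left_end[OF ct] by metis
  have a2: "\<alpha> \<le> x" using cov[of \<alpha>] a(1,2) t by linarith
  obtain \<delta> where d: "0 < \<delta>"
    "\<And>Y m. Y \<in> L \<Longrightarrow> is_regular Y \<Longrightarrow> \<bar>lo Y + of_int m * pi - x\<bar> < \<delta> \<Longrightarrow>
      \<bar>hi Y + of_int m * pi - (x + pi)\<bar> < \<delta> \<Longrightarrow> False"
    using discrete_singularD[OF names disc p] by metis
  have far: False if i: "iv a c" "a < t" "t < c" "a < x + \<delta>" "x + pi - \<delta> < c" for a c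
  proof -
    obtain X m where X: "X \<in> L" "is_regular X" "a = lo X + of_int m * pi" "c = hi X + of_int m * pi"
      using i(1) unfolding iv_def by blast
    show False by (rule d(2)[OF X(1,2), of m]) (use bounds[OF i(1-3)] i X in auto)
  qed
  have 1: "x + pi - \<delta> < \<beta>" using b2 d(1) by simp
  have 2: "\<alpha> < x + \<delta>" using a2 d(1) by simp
  obtain a1 c1 where i1: "iv a1 c1" "a1 < t" "t < c1" "x + pi - \<delta> < c1" using b(3)[OF 1] by blast
  obtain a2 c2 where i2: "iv a2 c2" "a2 < t" "t < c2" "a2 < x + \<delta>" using a(3)[OF 2] by blast
  \<comment> \<open>One of these intervals reaches far to the right and the other far to the left.
    They do not cross, so the outer one does both.\<close>
  show False
  proof (cases "c1 \<le> c2")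
    case True
    then show ?thesis using far[OF i2] i1 by simp
  next
    case False
    then have "a1 \<le> a2" using iv_noncrossing[OF i2(1) i1(1)] i1 i2 by force
    then show ?thesis using far[OF i1(1-3)] i1 i2 by simp
  qed
qed

text \<open>For uncovered t < t' in this range, the interval from x to t' has uncovered ends, so it
  crosses no regular object, and all singular objects sit at its end x. By maximality it belongs to
  \<open>L\<close>, and then it covers t.\<close>

lemma uncovered_unique:
  assumes p: "Zs Pos x \<in> L" and n: "Zs Neg y \<in> L"
    and t: "x < t" "t < x + pi" "\<not> covered t" and t': "x < t'" "t' < x + pi" "\<not> covered t'"
  shows "t = t'"
proof -
  have xu: "\<not> covered x" using singular_uncovered[OF p] .
  have xy: "circ x = circ y" using singular_compatible[OF p n] by simp
  have no: False if t: "x < t" "t < t'" "\<not> covered t" and t': "t' < x + pi" "\<not> covered t'" for t t'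
  proof -
    have xt: "x < t'" "t' < x + pi" using t t' by simp_all
    note I = mkI_simps[OF xt]
    have "noncrossing (mkI x t') Y" if Y: "Y \<in> L" for Y
    proof (cases "is_regular Y")
      case True
      have "circ x \<notin> supp_J Y" "circ t' \<notin> supp_J Y"
        using xu t'(2) Y True unfolding covered_iff by blast+
      then show ?thesis
        using not_cross_mkI[OF xt True] noncrossing_regular(1)[OF I(1)] by simp
    next
      case False
      then obtain e z where Z: "Y = Zs e z" using names Y by (cases Y) auto
      \<comment> \<open>Both signs occur at x, and a singular object elsewhere would be incompatible
        with the one of opposite sign.\<close>
      have "circ z = circ x"
        using singular_compatible[of e z Pos x] singular_compatible[of e z Neg y] Y Z p n xy by (cases e) auto
      moreover have "circ x \<notin> circ_arc x t'" using not_in_own_arc xt by simp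
      ultimately show ?thesis
        unfolding noncrossing_regular(1)[OF I(1)] Z using cross_Z_iff[OF I(1), of e z] I(4) by simp
    qed
    then have nc: "\<forall>Y\<in>L. noncrossing (mkI x t') Y" by blast
    have "mkI x t' \<in> {X. is_regular X \<or> is_singular X}" using I(1) by simp
    then obtain Y where Y: "Y \<in> L" "same (mkI x t') Y" using nc by (rule max_noncrossing_same[OF max])
    note s = same_regularD[OF Y(2) I(1)]
    have "circ t \<in> supp_J Y" unfolding s(2)[symmetric] I(4) circ_arc_def using t by simp
    then show False using t(3) Y(1) s(1) unfolding covered_iff by blast
  qed
  show ?thesis
  proof (rule linorder_cases[of t t'])
    assume "t < t'"
    from no[OF t(1) this t(3) t'(2,3)] show ?thesis ..
  next
    assume "t' < t"
    from no[OF t'(1) this t'(3) t(2,3)] show ?thesis ..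
  qed
qed

text \<open>The singular objects determine the finite complement of \<open>R(\<L>)\<close>: by maximality every point of the
  complement supports a singular object unless \<open>\<L>\<close> contains singular objects of both signs.\<close>

lemma complement:
  obtains F a where "finite F" "F \<subseteq> {a..<a + pi}" "2 \<le> card F"
    "\<And>t. \<not> covered t \<longleftrightarrow> circ t \<in> circ ` F"
    "card {X \<in> L. is_singular X} = card F"
    "same_sign_at {X \<in> L. is_singular X} (circ ` F) \<or>
      card F = 2 \<and> (\<exists>p\<in>circ ` F. singular_pair_at {X \<in> L. is_singular X} p)"
proof -
  let ?T = "{X \<in> L. is_singular X}"
  have sing: "\<exists>e x. X = Zs e x" if "X \<in> ?T" for X using that by (cases X) auto
  show ?thesis
  proof (cases "\<exists>x y. Zs Pos x \<in> L \<and> Zs Neg y \<in> L")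
    case True
    then obtain x y where p: "Zs Pos x \<in> L" and n: "Zs Neg y \<in> L" by blast
    have xy: "circ x = circ y" using singular_compatible[OF p n] by simp
    obtain t where t: "x < t" "t < x + pi" "\<not> covered t" using uncovered_between_pair[OF p n] by blast
    have T: "?T = {Zs Pos x, Zs Neg y}"
    proof
      show "?T \<subseteq> {Zs Pos x, Zs Neg y}"
      proof
        fix X assume X: "X \<in> ?T"
        then obtain e z where Z: "X = Zs e z" using sing by blast
        have zL: "Zs e z \<in> L" using X Z by simp
        show "X \<in> {Zs Pos x, Zs Neg y}"
        proof (cases e)
          case Pos
          have "circ z = circ y" using singular_compatible[OF zL n] Pos by simp
          then have "circ z = circ x" using xy by (rule trans[OF _ sym])
          from singular_unique[OF zL[unfolded Pos] p this] show ?thesis using Z Pos by simp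
        next
          case Neg
          have "circ z = circ x" using singular_compatible[OF zL p] Neg by simp
          then have "circ z = circ y" using xy by (rule trans)
          from singular_unique[OF zL[unfolded Neg] n this] show ?thesis using Z Neg by simp
        qed
      qed
    qed (use p n in auto)
    show ?thesis
    proof (rule that[of "{x, t}" x])
      show "{x, t} \<subseteq> {x..<x + pi}" "2 \<le> card {x, t}" using t by auto
      show "card ?T = card {x, t}" unfolding T using t by simp
      have "singular_pair_at ?T (circ x)" unfolding singular_pair_at_def T using xy by blast
      then show "same_sign_at ?T (circ ` {x, t}) \<or>
        card {x, t} = 2 \<and> (\<exists>p\<in>circ ` {x, t}. singular_pair_at ?T p)" using t by auto
      fix s
      obtain m :: int where m: "x \<le> s + of_int m * pi" "s + of_int m * pi < x + pi"
        using circ_representative .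
      have c: "covered s \<longleftrightarrow> covered (s + of_int m * pi)" using covered_shift by simp
      show "\<not> covered s \<longleftrightarrow> circ s \<in> circ ` {x, t}"
      proof
        assume "\<not> covered s"
        then have u: "\<not> covered (s + of_int m * pi)" using c by simp
        have "s + of_int m * pi = x \<or> s + of_int m * pi = t"
        proof (cases "s + of_int m * pi = x")
          case False
          then have "x < s + of_int m * pi" using m(1) by simp
          from uncovered_unique[OF p n this m(2) u t] show ?thesis ..
        qed simp
        then have "circ (s + of_int m * pi) \<in> circ ` {x, t}" by auto
        then show "circ s \<in> circ ` {x, t}" by simp
      next
        assume "circ s \<in> circ ` {x, t}"
        then have "circ s = circ x \<or> circ s = circ t" by auto
        then show "\<not> covered s"
          using singular_uncovered[OF p] t(3) unfolding R_union_iff[symmetric] by auto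
      qed
    qed simp
  next
    case False
    \<comment> \<open>As long as no singular object has been found, any sign would serve as
      e.\<close>
    then obtain e where e: "\<And>e' y. Zs e' y \<in> L \<Longrightarrow> e' = e" by (metis sign.exhaust)
    have ex: "\<exists>y. Zs e y \<in> L \<and> circ y = circ t" if u: "\<not> covered t" for t
    proof -
      have "e = e' \<or> circ t = circ y" if "Zs e' y \<in> L" for e' y using e[OF that] by simp
      then obtain y where "Zs e y \<in> L" "circ y = circ t" by (rule singular_exists[OF u])
      then show ?thesis by blast
    qed
    have oppe: "opp e \<noteq> e" by (cases e) auto
    define F where "F = {t. 0 \<le> t \<and> t < pi \<and> \<not> covered t}"
    have unc: "\<not> covered t \<longleftrightarrow> circ t \<in> circ ` F" for t
    proof
      assume "\<not> covered t"
      obtain m :: int where m: "0 \<le> t + of_int m * pi" "t + of_int m * pi < 0 + pi"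
        using circ_representative .
      then have "t + of_int m * pi \<in> F" using \<open>\<not> covered t\<close> covered_shift by (simp add: F_def)
      then have "circ (t + of_int m * pi) \<in> circ ` F" by (rule imageI)
      then show "circ t \<in> circ ` F" by simp
    next
      assume "circ t \<in> circ ` F"
      then obtain s where "s \<in> F" "circ t = circ s" by auto
      then show "\<not> covered t" using R_union_iff[of t] R_union_iff[of s] by (simp add: F_def)
    qed
    \<comment> \<open>A limit point of uncovered points is uncovered, so it carries a singular
      object. The uncovered points near it carry further ones of the same sign, against
      discreteness.\<close>
    have fin: "finite F"
    proof (rule ccontr)
      assume inf: "infinite F"
      have "F \<subseteq> {0..pi}" by (auto simp: F_def)
      from Heine_Borel_imp_Bolzano_Weierstrass[OF compact_Icc inf this] obtain x where x: "x islimpt F" ..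
      have "closed {t. \<not> covered t}" using open_covered by (simp add: closed_def Compl_eq)
      moreover have "x islimpt {t. \<not> covered t}" by (rule islimpt_subset[OF x]) (auto simp: F_def)
      ultimately have "\<not> covered x" unfolding closed_limpt by blast
      then obtain y where y: "Zs e y \<in> L" "circ y = circ x" using ex by blast
      obtain k :: int where k: "x = y + of_int k * pi" using y(2) unfolding circ_eq_iff by blast
      obtain \<delta> where d: "0 < \<delta>" "\<And>z m. Zs e z \<in> L \<Longrightarrow> \<bar>z + of_int m * pi - y\<bar> < \<delta> \<Longrightarrow> circ z = circ y"
        by (rule discrete_singularD[OF names disc y(1)]) (rule that)
      have "0 < min \<delta> pi" using d(1) by simp
      then have "x \<in> {x - min \<delta> pi<..<x + min \<delta> pi}" by simp
      then obtain t where t: "t \<in> F" "t \<noteq> x" "t \<in> {x - min \<delta> pi<..<x + min \<delta> pi}"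
        using x open_greaterThanLessThan unfolding islimpt_def by blast
      then have close: "\<bar>t - x\<bar> < \<delta>" "\<bar>t - x\<bar> < pi" by auto
      obtain z where z: "Zs e z \<in> L" "circ z = circ t" using ex t(1) unfolding F_def by blast
      obtain m :: int where m: "t = z + of_int m * pi" using z(2) unfolding circ_eq_iff by blast
      have "z + of_int (m - k) * pi - y = t - x" unfolding m k by (simp add: algebra_simps)
      then have "circ z = circ y" using d(2)[OF z(1), of "m - k"] close(1) by simp
      then have "circ x = circ t" using y z by simp
      then obtain n :: int where n: "t = x + of_int n * pi" unfolding circ_eq_iff by blast
      have "\<bar>of_int n * pi\<bar> < 1 * pi" using close(2) n by simp
      then have "\<bar>real_of_int n\<bar> < 1" by (simp add: abs_mult)
      then have "n = 0" by linarith
      then show False using n t(2) by simp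
    qed
    have inj: "inj_on circ F"
      by (rule inj_on_subset[OF circ_inj_on[of 0]]) (auto simp: F_def)
    let ?P = "circ ` F"
    \<comment> \<open>The value at \<open>SM\<close> is a dummy, as only singular names are
      inserted.\<close>
    let ?s = "\<lambda>X. case X of Zs e x \<Rightarrow> circ x | SM x y \<Rightarrow> {}"
    have TZ: "\<exists>x. X = Zs e x" if "X \<in> ?T" for X using sing[OF that] e that by blast
    have bij: "bij_betw ?s ?T ?P"
      unfolding bij_betw_def
    proof
      show "inj_on ?s ?T"
      proof (rule inj_onI)
        fix X Y assume X: "X \<in> ?T" and Y: "Y \<in> ?T" and eq: "?s X = ?s Y"
        obtain x y where "X = Zs e x" "Y = Zs e y" using TZ[OF X] TZ[OF Y] by blast
        then show "X = Y" using singular_unique[of e x y] X Y eq by simp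
      qed
      show "?s ` ?T = ?P"
      proof
        show "?s ` ?T \<subseteq> ?P"
        proof
          fix z assume "z \<in> ?s ` ?T"
          then obtain X where X: "X \<in> ?T" "z = ?s X" by blast
          obtain x where x: "X = Zs e x" using TZ[OF X(1)] by blast
          have "\<not> covered x" using singular_uncovered[of e x] X(1) x by simp
          then show "z \<in> ?P" using unc X x by simp
        qed
        show "?P \<subseteq> ?s ` ?T"
        proof
          fix z assume "z \<in> ?P"
          then obtain t where t: "t \<in> F" "z = circ t" by blast
          obtain y where y: "Zs e y \<in> L" "circ y = circ t" using ex t(1) unfolding F_def by blast
          have "z = ?s (Zs e y)" using y t by simp
          then show "z \<in> ?s ` ?T" using y(1) by (intro image_eqI) auto
        qed
      qed
    qed
    have cT: "card ?T = card F" using bij_betw_same_card[OF bij] card_image[OF inj] by simp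
    have supp: "\<Union> (supp_J ` ?T) = ?P"
    proof -
      have "supp_J X = {?s X}" if "X \<in> ?T" for X using TZ[OF that] by auto
      then have "\<Union> (supp_J ` ?T) = ?s ` ?T" by auto
      then show ?thesis using bij by (simp add: bij_betw_def)
    qed
    \<comment> \<open>With only one uncovered point, the singular object of the opposite sign there
      would be compatible with everything, and maximality would force it into
      \<open>L\<close>.\<close>
    have two: "2 \<le> card F"
    proof (rule ccontr)
      assume "\<not> 2 \<le> card F"
      then have one: "s = t" if "s \<in> F" "t \<in> F" for s t
        using card_le_Suc0_iff_eq[OF fin] that by auto
      obtain t where t: "\<not> covered t" using uncovered_exists by blast
      have "\<exists>y. Zs (opp e) y \<in> L"
      proof -
        have "circ t = circ y" if "Zs e' y \<in> L" for e' y
        proof -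
          have "circ y \<in> ?P" "circ t \<in> ?P" using singular_uncovered[OF that] t unc by blast+
          then show ?thesis using one by auto
        qed
        then have "opp e = e' \<or> circ t = circ y" if "Zs e' y \<in> L" for e' y using that by blast
        then obtain y where "Zs (opp e) y \<in> L" "circ y = circ t" by (rule singular_exists[OF t])
        then show ?thesis by blast
      qed
      then show False using e oppe by blast
    qed
    show ?thesis
    proof (rule that[of F 0])
      show "F \<subseteq> {0..<0 + pi}" by (auto simp: F_def)
      have "card ?T = card ?P" using cT card_image[OF inj] by simp
      moreover have "\<exists>e. \<forall>X\<in>?T. \<exists>x. X = Zs e x" using TZ by (intro exI[of _ e] ballI)
      ultimately have "same_sign_at ?T ?P" unfolding same_sign_at_def using supp by (intro conjI)
      then show "same_sign_at ?T ?P \<or> card F = 2 \<and> (\<exists>p\<in>?P. singular_pair_at ?T p)" by (rule disjI1)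
    qed (rule fin two unc cT)+
  qed
qed

lemma R_union_complement:
  assumes "\<And>t. \<not> covered t \<longleftrightarrow> circ t \<in> circ ` F"
  shows "R_union L = topspace circle - circ ` F"
proof
  show "R_union L \<subseteq> topspace circle - circ ` F"
  proof
    fix z assume z: "z \<in> R_union L"
    then have "z \<in> range circ" using R_union_range by (rule rev_subsetD)
    then obtain t where t: "z = circ t" by (rule rangeE)
    have "covered t" using z[unfolded t] by (simp only: R_union_iff)
    then have "circ t \<notin> circ ` F" by (rule contrapos_pn) (rule iffD2[OF assms])
    then show "z \<in> topspace circle - circ ` F" unfolding t topspace_circle by (intro DiffI rangeI)
  qed
  show "topspace circle - circ ` F \<subseteq> R_union L"
  proof
    fix z assume z: "z \<in> topspace circle - circ ` F"
    then have "z \<in> range circ" unfolding topspace_circle by (rule DiffD1)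
    then obtain t where t: "z = circ t" by (rule rangeE)
    have "circ t \<notin> circ ` F" using z unfolding t by (rule DiffE)
    then have "covered t" by (rule contrapos_np) (rule iffD1[OF assms])
    then show "z \<in> R_union L" unfolding t by (simp only: R_union_iff)
  qed
qed

theorem structure_of_lamination:
  "\<exists>(k::nat) x :: nat \<Rightarrow> real.
     2 \<le> k \<and> strict_mono_on {1..k} x \<and> x k < x 1 + pi \<and>
     (let P = circ ` x ` {1..k}; T = {X \<in> L. is_singular X} in
        R_union L = topspace circle - P \<and>
        (\<exists>\<I>. card \<I> = k \<and> (\<forall>I\<in>\<I>. circle_interval I) \<and>
             pairwise disjnt \<I> \<and> \<Union>\<I> = R_union L) \<and>
        card T = k \<and>
        (same_sign_at T P \<or>
         k = 2 \<and> (singular_pair_at T (circ (x 1)) \<or> singular_pair_at T (circ (x 2)))))"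
proof -
  obtain F a where F: "finite F" "F \<subseteq> {a..<a + pi}" "2 \<le> card F"
    and unc: "\<And>t. \<not> covered t \<longleftrightarrow> circ t \<in> circ ` F"
    and T: "card {X \<in> L. is_singular X} = card F"
    "same_sign_at {X \<in> L. is_singular X} (circ ` F) \<or>
      card F = 2 \<and> (\<exists>p\<in>circ ` F. singular_pair_at {X \<in> L. is_singular X} p)"
    by (rule complement) (rule that)
  obtain x :: "nat \<Rightarrow> real" where x: "strict_mono_on {1..card F} x" "x (card F) < x 1 + pi" "x ` {1..card F} = F"
    and I: "\<exists>\<I>. card \<I> = card F \<and> (\<forall>I\<in>\<I>. circle_interval I) \<and> pairwise disjnt \<I> \<and>
       \<Union>\<I> = topspace circle - circ ` F"
    by (rule exE[OF circle_arcs[OF F(1,2) refl F(3)]]) (elim conjE, rule that)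
  have R: "R_union L = topspace circle - circ ` F" using R_union_complement[OF unc] .
  have pair: "singular_pair_at {X \<in> L. is_singular X} (circ (x 1)) \<or>
      singular_pair_at {X \<in> L. is_singular X} (circ (x 2))"
    if c: "card F = 2" and p: "\<exists>p\<in>circ ` F. singular_pair_at {X \<in> L. is_singular X} p"
  proof -
    have "{1..2::nat} = {1, 2}" by auto
    then have "F = {x 1, x 2}" using x(3) c by auto
    then show ?thesis using p by auto
  qed
  show ?thesis
    unfolding Let_def
    unfolding R
    by (rule exI[of _ "card F"], rule exI[of _ x], unfold x(3))
      (intro conjI F(3) x(1,2) refl I T(1); use T(2) pair in blast)
qed

end

section \<open>Assembling laminations from sublaminations\<close>

lemma separation:
  assumes "finite S" "S \<subseteq> range circ" "circ x \<notin> S"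
  shows "\<exists>\<delta>>0. \<forall>t. \<bar>t - x\<bar> < \<delta> \<longrightarrow> circ t \<notin> S"
  using assms
proof (induction S rule: finite_induct)
  case empty
  show ?case by (rule exI[of _ 1]) simp
next
  case (insert p S)
  have "S \<subseteq> range circ" "circ x \<notin> S" using insert.prems by simp_all
  then obtain \<delta> where d: "0 < \<delta>" "\<And>t. \<bar>t - x\<bar> < \<delta> \<Longrightarrow> circ t \<notin> S" using insert.IH by blast
  obtain r0 where r0: "p = circ r0" using insert.prems(1) by auto
  obtain m :: int where m: "x \<le> r0 + of_int m * pi" "r0 + of_int m * pi < x + pi"
    using circ_representative .
  define r where "r = r0 + of_int m * pi"
  have r: "p = circ r" "x \<le> r" "r < x + pi" using r0 m by (simp_all add: r_def)
  have "r \<noteq> x" using r(1) insert.prems(2) by auto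
  then have rx: "x < r" using r(2) by simp
  \<comment> \<open>As r lies between x and x + pi, the lifts of p nearest to x are r and r - pi;
    the radius stays below both distances.\<close>
  show ?case
  proof (intro exI[of _ "min \<delta> (min (r - x) (x + pi - r))"] conjI allI impI)
    show "0 < min \<delta> (min (r - x) (x + pi - r))" using d(1) rx r(3) by simp
    fix t assume "\<bar>t - x\<bar> < min \<delta> (min (r - x) (x + pi - r))"
    then have t: "\<bar>t - x\<bar> < \<delta>" "\<bar>t - x\<bar> < r - x" "\<bar>t - x\<bar> < x + pi - r" by simp_all
    have "circ t \<noteq> circ r"
    proof
      assume "circ t = circ r"
      then obtain n :: int where n: "r = t + of_int n * pi" unfolding circ_eq_iff by blast
      have "n = 0" by (rule shift_less_pi[of 0 0]) (use t n in linarith)+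
      then show False using n t by simp
    qed
    then show "circ t \<notin> insert p S" using d(2)[OF t(1)] r(1) by simp
  qed
qed

section \<open>Gaps of a finite set of points on the circle\<close>

locale finite_on_circle =
  fixes S :: "real set set"
  assumes finite_S: "finite S" and card_S: "2 \<le> card S" and S_circle: "S \<subseteq> topspace circle"
begin

lemma S_range: "S \<subseteq> range circ"
  using S_circle unfolding topspace_circle .

abbreviation "D \<equiv> topspace circle - S"
abbreviation "XD \<equiv> subtopology circle D"

text \<open>Lifts of two neighbouring points of \<open>S\<close>; the arc between them is a
  component of the complement.\<close>

definition gap :: "real \<Rightarrow> real \<Rightarrow> bool" where
  "gap s t \<longleftrightarrow> s < t \<and> t < s + pi \<and> circ s \<in> S \<and> circ t \<in> S \<and> circ_arc s t \<inter> S = {}"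

text \<open>Lift \<open>S\<close> to the window of length pi that starts at w. The least lift is the
  right end of the gap, and the greatest one, moved back by a turn, is the left end. Since
  \<open>S\<close> has two points these lifts differ, which keeps the gap shorter than pi.\<close>

lemma gap_exists:
  assumes w: "circ w \<notin> S"
  obtains s t where "gap s t" "s < w" "w < t"
proof -
  define F where "F = {r \<in> {w..<w + pi}. circ r \<in> S}"
  have inj: "inj_on circ F" by (rule inj_on_subset[OF circ_inj_on[of w]]) (auto simp: F_def)
  have im: "circ ` F = S"
  proof
    show "S \<subseteq> circ ` F"
    proof
      fix p assume p: "p \<in> S"
      then have "p \<in> range circ" using S_range by (rule rev_subsetD)
      then obtain r where r: "p = circ r" by (rule rangeE)
      obtain m :: int where m: "w \<le> r + of_int m * pi" "r + of_int m * pi < w + pi"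
        using circ_representative .
      have "circ (r + of_int m * pi) = p" using r by simp
      then have "r + of_int m * pi \<in> F" using m p by (simp add: F_def)
      then have "circ (r + of_int m * pi) \<in> circ ` F" by (rule imageI)
      then show "p \<in> circ ` F" using r by simp
    qed
  qed (auto simp: F_def)
  have fin: "finite F" by (rule finite_imageD[OF _ inj]) (use im finite_S in simp)
  have cF: "2 \<le> card F" using card_image[OF inj] im card_S by simp
  then have ne: "F \<noteq> {}" by auto
  define t where "t = Min F"
  define m where "m = Max F"
  have t: "t \<in> F" "\<And>r. r \<in> F \<Longrightarrow> t \<le> r" using Min_in[OF fin ne] Min_le[OF fin] by (simp_all add: t_def)
  have m: "m \<in> F" "\<And>r. r \<in> F \<Longrightarrow> r \<le> m" using Max_in[OF fin ne] Max_ge[OF fin] by (simp_all add: m_def)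
  have "t \<noteq> m"
  proof
    assume "t = m"
    then have "F \<subseteq> {t}" using t(2) m(2) by force
    then have "card F \<le> 1" using card_mono[of "{t}" F] by simp
    then show False using cF by simp
  qed
  then have tm: "t < m" using m(2)[OF t(1)] by simp
  have tw: "w < t" using t(1) w by (cases "t = w") (auto simp: F_def)
  define s where "s = m - pi"
  have sw: "s < w" using m(1) by (simp add: s_def F_def)
  have "circ s = circ m" unfolding s_def using circ_shift[of m "- 1"] by simp
  then have sS: "circ s \<in> S" using m(1) by (simp add: F_def)
  have "circ_arc s t \<inter> S = {}"
  proof (rule ccontr)
    assume "circ_arc s t \<inter> S \<noteq> {}"
    then obtain r where r: "s < r" "r < t" "circ r \<in> S" by (auto simp: circ_arc_def)
    show False
    proof (cases "w \<le> r")
      case True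
      then have "r \<in> F" using r t(1) by (simp add: F_def)
      then show False using t(2)[of r] r(2) by simp
    next
      case False
      have "circ (r + pi) \<in> S" using circ_shift[of r 1] r(3) by simp
      then have "r + pi \<in> F" using False r(1) m(1) by (simp add: F_def s_def)
      then show False using m(2)[of "r + pi"] r(1) by (simp add: s_def)
    qed
  qed
  moreover have "t < s + pi" using tm by (simp add: s_def)
  ultimately have "gap s t" using sw tw sS t(1) by (simp add: gap_def F_def)
  then show ?thesis using that sw tw by blast
qed

lemma gap_subset_D: "gap s t \<Longrightarrow> circ_arc s t \<subseteq> D"
  using arc_subset_range unfolding gap_def topspace_circle by blast

text \<open>The component is covered by two disjoint open arcs, the gap and the rest of the turn
  from t to s + pi; being connected, it stays in the one that contains the image of w.\<close>

lemma component_of_gap: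
  assumes g: "gap s t" and w: "s < w" "w < t"
  shows "connected_component_of_set XD (circ w) = circ_arc s t"
proof
  have st: "s < t" "t < s + pi" "circ s \<in> S" "circ t \<in> S" using g by (simp_all add: gap_def)
  have wA: "circ w \<in> circ_arc s t" unfolding circ_arc_def using w by simp
  have "connectedin XD (circ_arc s t)"
    unfolding connectedin_subtopology using connectedin_arc gap_subset_D[OF g] by blast
  then show "circ_arc s t \<subseteq> connected_component_of_set XD (circ w)"
    using wA by (rule connected_component_of_maximal)
  let ?C = "connected_component_of_set XD (circ w)"
  let ?B = "circ_arc t (s + pi)"
  have "connectedin XD ?C" by (rule connectedin_connected_component_of)
  then have C: "connectedin circle ?C" "?C \<subseteq> D" unfolding connectedin_subtopology by simp_all
  have cov: "?C \<subseteq> circ_arc s t \<union> ?B"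
  proof
    fix z assume "z \<in> ?C"
    then have z: "z \<in> D" using C(2) by (rule rev_subsetD)
    then obtain r0 where r0: "z = circ r0" unfolding topspace_circle by auto
    obtain m :: int where m: "s \<le> r0 + of_int m * pi" "r0 + of_int m * pi < s + pi"
      using circ_representative .
    define r where "r = r0 + of_int m * pi"
    have r: "z = circ r" "s \<le> r" "r < s + pi" using r0 m by (simp_all add: r_def)
    have "r \<noteq> s" "r \<noteq> t" using z st(3,4) unfolding r(1) by auto
    then have "r \<in> {s<..<t} \<or> r \<in> {t<..<s + pi}" using r by auto
    then show "z \<in> circ_arc s t \<union> ?B" unfolding r(1) circ_arc_def by blast
  qed
  have disj: "circ_arc s t \<inter> ?B = {}"
  proof (rule ccontr)
    assume "circ_arc s t \<inter> ?B \<noteq> {}"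
    then obtain r where r: "circ r \<in> circ_arc s t" "t < r" "r < s + pi"
      by (auto simp: circ_arc_def[of t])
    have "s < r \<and> r < t" by (rule in_arc_disjoint[OF _ r(1)]) (use st r in auto)
    then show False using r by simp
  qed
  have wC: "circ w \<in> ?C" using \<open>circ_arc s t \<subseteq> ?C\<close> wA by (rule subsetD)
  have "?C \<inter> ?B = {}"
  proof (rule ccontr)
    assume "?C \<inter> ?B \<noteq> {}"
    then have "?B \<inter> ?C \<noteq> {}" by blast
    moreover have "circ_arc s t \<inter> ?C \<noteq> {}" using wC wA by blast
    moreover have "circ_arc s t \<inter> ?B \<inter> ?C = {}" using disj by blast
    ultimately show False using connectedinD[OF C(1) openin_arc openin_arc cov] by blast
  qed
  then show "?C \<subseteq> circ_arc s t" using cov by blast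
qed

abbreviation "comps \<equiv> connected_components_of XD"

lemma gap_component: "gap s t \<Longrightarrow> circ_arc s t \<in> comps"
proof -
  assume g: "gap s t"
  define w where "w = (s + t) / 2"
  have w: "s < w" "w < t" using g by (simp_all add: w_def gap_def)
  have "circ w \<in> circ_arc s t" unfolding circ_arc_def using w by simp
  then have "circ w \<in> topspace XD" using gap_subset_D[OF g] by auto
  then have "connected_component_of_set XD (circ w) \<in> comps"
    unfolding connected_components_of_def by (rule imageI)
  then show ?thesis unfolding component_of_gap[OF g w] .
qed

lemma comps_subset: "I \<in> comps \<Longrightarrow> I \<subseteq> D"
  using connected_components_of_subset[of I XD] by auto

lemma comps_eq: "I \<in> comps \<Longrightarrow> J \<in> comps \<Longrightarrow> z \<in> I \<Longrightarrow> z \<in> J \<Longrightarrow> I = J"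
  using pairwise_disjoint_connected_components_of[of XD]
  by (auto simp: pairwise_def disjnt_def)

lemma two_points: obtains p q where "p \<in> S" "q \<in> S" "p \<noteq> q"
proof -
  have "\<not> card S \<le> Suc 0" using card_S by simp
  then show ?thesis using card_le_Suc0_iff_eq[OF finite_S] that by blast
qed

end

section \<open>The union of singular objects and sublaminations\<close>

locale assembled_lamination = finite_on_circle S for S :: "real set set" +
  fixes T :: "indec set" and N :: "real set set \<Rightarrow> indec set"
  assumes admissible: "admissible_singular T S"
    and N_max: "\<And>I. I \<in> comps \<Longrightarrow> max_noncrossing {X. is_regular X \<and> supp_J X \<subseteq> I} (N I)"
    and N_discrete: "\<And>I. I \<in> comps \<Longrightarrow> discrete_indecs (N I)"
begin

definition "L = T \<union> (\<Union>I\<in>comps. N I)"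

text \<open>The equality of cardinalities in \<open>same_sign_at\<close> makes the support map
  injective, which gives one name per point. In the other case q is the point of \<open>S\<close>
  without a singular object.\<close>

lemma T_cases:
  obtains (same) e where "\<And>X. X \<in> T \<Longrightarrow> \<exists>x. X = Zs e x \<and> circ x \<in> S"
      "\<And>x y. Zs e x \<in> T \<Longrightarrow> Zs e y \<in> T \<Longrightarrow> circ x = circ y \<Longrightarrow> x = y"
      "\<And>p. p \<in> S \<Longrightarrow> \<exists>x. Zs e x \<in> T \<and> circ x = p"
  | (pair) x y p q where "T = {Zs Pos x, Zs Neg y}" "circ x = p" "circ y = p" "S = {p, q}" "p \<noteq> q"
  using admissible unfolding admissible_singular_def
proof
  assume s: "same_sign_at T S"
  then obtain e where e: "\<And>X. X \<in> T \<Longrightarrow> \<exists>x. X = Zs e x" unfolding same_sign_at_def by blast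
  have c: "card T = card S" and U: "\<Union> (supp_J ` T) = S" using s by (simp_all add: same_sign_at_def)
  have fT: "finite T" by (rule card_ge_0_finite) (use c card_S in simp)
  let ?s = "\<lambda>X. case X of Zs e x \<Rightarrow> circ x | SM x y \<Rightarrow> {}"
  have "supp_J X = {?s X}" if "X \<in> T" for X using e[OF that] by auto
  then have im: "?s ` T = S" using U by auto
  have inj: "inj_on ?s T" by (rule eq_card_imp_inj_on[OF fT]) (simp only: im c)
  show ?thesis
  proof (rule same)
    fix X assume X: "X \<in> T"
    then obtain x where x: "X = Zs e x" using e by blast
    have "?s X \<in> S" using X im by blast
    then show "\<exists>x. X = Zs e x \<and> circ x \<in> S" using x by simp
  next
    fix x y assume "Zs e x \<in> T" "Zs e y \<in> T" "circ x = circ y"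
    then have "Zs e x = Zs e y" using inj_onD[OF inj, of "Zs e x" "Zs e y"] by simp
    then show "x = y" by simp
  next
    fix p assume "p \<in> S"
    then have "p \<in> ?s ` T" using im by simp
    then obtain X where X: "X \<in> T" "p = ?s X" by blast
    obtain x where "X = Zs e x" using e[OF X(1)] by blast
    then show "\<exists>x. Zs e x \<in> T \<and> circ x = p" using X by auto
  qed
next
  assume p: "card S = 2 \<and> (\<exists>p\<in>S. singular_pair_at T p)"
  then obtain p x y where p: "p \<in> S" "card S = 2" "circ x = p" "circ y = p" "T = {Zs Pos x, Zs Neg y}"
    unfolding singular_pair_at_def by blast
  obtain a b where ab: "S = {a, b}" "a \<noteq> b" using p(2) unfolding card_2_iff by blast
  show ?thesis
  proof (cases "p = a")
    case True
    from pair[OF p(5,3,4) ab(1)[folded True] ab(2)[folded True]] show ?thesis .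
  next
    case False
    then have "p = b" using p(1) ab(1) by simp
    then have "S = {p, a}" "p \<noteq> a" using ab by auto
    from pair[OF p(5,3,4) this] show ?thesis .
  qed
qed

lemma T_singular:
  assumes "X \<in> T"
  obtains e x where "X = Zs e x" "circ x \<in> S"
  by (rule T_cases) (use assms that in blast)+

lemma T_unique:
  assumes "Zs e x \<in> T" "Zs e y \<in> T" "circ x = circ y"
  shows "x = y"
proof (rule T_cases)
  fix e' assume a: "\<And>X. X \<in> T \<Longrightarrow> \<exists>x. X = Zs e' x \<and> circ x \<in> S"
    "\<And>x y. Zs e' x \<in> T \<Longrightarrow> Zs e' y \<in> T \<Longrightarrow> circ x = circ y \<Longrightarrow> x = y"
  have "e = e'" using a(1)[OF assms(1)] by simp
  then show ?thesis using a(2)[of x y] assms by simp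
next
  fix x' y' assume "T = {Zs Pos x', Zs Neg y'}"
  then show ?thesis using assms(1,2) by (cases e) auto
qed

lemma T_compatible:
  assumes "Zs e x \<in> T" "Zs e' y \<in> T"
  shows "e = e' \<or> circ x = circ y"
proof (rule T_cases)
  fix e0 assume a: "\<And>X. X \<in> T \<Longrightarrow> \<exists>x. X = Zs e0 x \<and> circ x \<in> S"
  show ?thesis using a[OF assms(1)] a[OF assms(2)] by simp
next
  fix x' y' p assume a: "T = {Zs Pos x', Zs Neg y'}" "circ x' = p" "circ y' = p"
  have "circ x = p" "circ y = p" using assms a by auto
  then show ?thesis by simp
qed

text \<open>In the case of a common sign, \<open>S\<close> has two points and the new object can
  share the support of only one of them, so it must share the sign. In the case of a pair, the
  member of opposite sign fixes the support.\<close>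

lemma T_maximal:
  assumes nc: "\<And>Y. Y \<in> T \<Longrightarrow> noncrossing (Zs e t) Y" and t: "circ t \<in> S"
  shows "\<exists>Y\<in>T. same (Zs e t) Y"
proof (rule T_cases)
  fix e0 assume a: "\<And>p. p \<in> S \<Longrightarrow> \<exists>x. Zs e0 x \<in> T \<and> circ x = p"
  obtain p q where pq: "p \<in> S" "q \<in> S" "p \<noteq> q" using two_points .
  obtain x where x: "Zs e0 x \<in> T" "circ x = p" using a[OF pq(1)] by blast
  obtain y where y: "Zs e0 y \<in> T" "circ y = q" using a[OF pq(2)] by blast
  have "e = e0" using nc[OF x(1)] nc[OF y(1)] x(2) y(2) pq(3) by auto
  moreover obtain z where "Zs e0 z \<in> T" "circ z = circ t" using a[OF t] by blast
  ultimately show ?thesis by (intro bexI[of _ "Zs e0 z"]) (simp_all add: same_Z_iff)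
next
  fix x y p assume a: "T = {Zs Pos x, Zs Neg y}" "circ x = p" "circ y = p"
  have P: "noncrossing (Zs e t) (Zs Pos x)" and Q: "noncrossing (Zs e t) (Zs Neg y)"
    using nc a(1) by blast+
  show ?thesis
  proof (cases e)
    case Pos
    then have "circ t = circ x" using Q a(2,3) by simp
    then show ?thesis using Pos a(1) by (intro bexI[of _ "Zs Pos x"]) (simp_all add: same_Z_iff)
  next
    case Neg
    then have "circ t = circ y" using P a(2,3) by simp
    then show ?thesis using Neg a(1) by (intro bexI[of _ "Zs Neg y"]) (simp_all add: same_Z_iff)
  qed
qed

lemma N_regular:
  assumes "I \<in> comps" "X \<in> N I"
  shows "is_regular X" "supp_J X \<subseteq> I" "supp_J X \<inter> S = {}"
proof -
  have "X \<in> {X. is_regular X \<and> supp_J X \<subseteq> I}"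
    using N_max[OF assms(1)] assms(2) unfolding max_noncrossing_def by blast
  then show "is_regular X" "supp_J X \<subseteq> I" by simp_all
  then show "supp_J X \<inter> S = {}" using comps_subset[OF assms(1)] by blast
qed

lemma L_cases:
  assumes "X \<in> L"
  obtains (singular) e x where "X = Zs e x" "X \<in> T" "circ x \<in> S"
  | (regular) I where "I \<in> comps" "X \<in> N I"
proof (cases "X \<in> T")
  case True
  then show ?thesis using T_singular[OF True] singular by metis
next
  case False
  then show ?thesis using assms regular unfolding L_def by blast
qed

lemma L_names: "\<forall>X\<in>L. is_regular X \<or> is_singular X"
proof
  fix X assume "X \<in> L"
  then show "is_regular X \<or> is_singular X" by (cases rule: L_cases) (use N_regular in auto)
qed

lemma gap_in_L:
  assumes g: "gap s t"
  shows "\<exists>Y\<in>L. same (mkI s t) Y"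
proof -
  have st: "s < t" "t < s + pi" using g by (simp_all add: gap_def)
  note I = mkI_simps[OF st]
  let ?I = "circ_arc s t"
  have c: "?I \<in> comps" using gap_component[OF g] .
  have nc: "\<forall>Y\<in>N ?I. noncrossing (mkI s t) Y"
  proof
    fix Y assume Y: "Y \<in> N ?I"
    note Yr = N_regular[OF c Y]
    have "circ s \<notin> supp_J Y" "circ t \<notin> supp_J Y" using g Yr(3) unfolding gap_def by blast+
    then show "noncrossing (mkI s t) Y"
      using not_cross_mkI[OF st Yr(1)] noncrossing_regular(1)[OF I(1)] by simp
  qed
  have "mkI s t \<in> {X. is_regular X \<and> supp_J X \<subseteq> ?I}" using I by simp
  then obtain Y where Y: "Y \<in> N ?I" "same (mkI s t) Y" using nc by (rule max_noncrossing_same[OF N_max[OF c]])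
  have "Y \<in> L" unfolding L_def using Y(1) c by blast
  then show ?thesis using Y(2) by (rule bexI[rotated])
qed

lemma gap_not_cross:
  assumes g: "gap s t" and nc: "\<And>Y. Y \<in> L \<Longrightarrow> noncrossing X Y"
  shows "\<not> cross X (mkI s t)"
proof
  assume x: "cross X (mkI s t)"
  obtain Y where Y: "Y \<in> L" "same (mkI s t) Y" using gap_in_L[OF g] by blast
  have st: "s < t" "t < s + pi" using g by (simp_all add: gap_def)
  have r: "is_regular Y" by (rule same_regularD(1)[OF Y(2) mkI_simps(1)[OF st]])
  show False using cross_same[OF Y(2) x] nc[OF Y(1)] noncrossing_regular(2)[OF r] by simp
qed

lemma L_maximal_singular:
  assumes nc: "\<And>Y. Y \<in> L \<Longrightarrow> noncrossing (Zs e t) Y"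
  shows "\<exists>Y\<in>L. same (Zs e t) Y"
proof (cases "circ t \<in> S")
  case True
  have "\<exists>Y\<in>T. same (Zs e t) Y" by (rule T_maximal[OF nc True]) (simp add: L_def)
  then show ?thesis unfolding L_def by blast
next
  case False
  obtain s r where g: "gap s r" "s < t" "t < r" using gap_exists[OF False] .
  have sr: "s < r" "r < s + pi" using g(1) by (simp_all add: gap_def)
  note I = mkI_simps[OF sr]
  have "circ t \<in> supp_J (mkI s r)" unfolding I(4) circ_arc_def using g by simp
  then have "cross (Zs e t) (mkI s r)" using cross_Z_iff[OF I(1), of e t] cross_sym by simp
  then show ?thesis using gap_not_cross[OF g(1) nc] by blast
qed

lemma T_avoid:
  assumes X: "is_regular X" and nc: "\<And>Y. Y \<in> L \<Longrightarrow> noncrossing X Y" and Z: "Zs e x \<in> T"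
  shows "circ x \<notin> supp_J X"
proof -
  have "Zs e x \<in> L" using Z by (simp add: L_def)
  then have "\<not> cross X (Zs e x)" using nc noncrossing_regular(1)[OF X] by blast
  then show ?thesis using cross_Z_iff[OF X, of e x] by simp
qed

text \<open>The points that carry singular objects are excluded at once. In the case of a pair it
  remains to exclude q. If X contained q, it would lie within one turn from v to v + pi. Not
  crossing the intervals of the two gaps on either side of q then forces X to be the whole turn,
  which is too long.\<close>

lemma supp_avoids:
  assumes X: "is_regular X" and nc: "\<And>Y. Y \<in> L \<Longrightarrow> noncrossing X Y"
  shows "supp_J X \<inter> S = {}"
proof (rule T_cases)
  fix e assume a: "\<And>p. p \<in> S \<Longrightarrow> \<exists>x. Zs e x \<in> T \<and> circ x = p"
  show ?thesis
  proof (rule ccontr)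
    assume "supp_J X \<inter> S \<noteq> {}"
    then obtain p where p: "p \<in> supp_J X" "p \<in> S" by blast
    obtain x where "Zs e x \<in> T" "circ x = p" using a[OF p(2)] by blast
    then show False using T_avoid[OF X nc, of e x] p(1) by simp
  qed
next
  fix v y p q assume a: "T = {Zs Pos v, Zs Neg y}" "circ v = p" "S = {p, q}" "p \<noteq> q"
  have p: "circ v \<notin> supp_J X" by (rule T_avoid[OF X nc, of Pos]) (simp_all add: a(1))
  show ?thesis
  proof (rule ccontr)
    assume "supp_J X \<inter> S \<noteq> {}"
    then have q: "q \<in> supp_J X" using p a by auto
    obtain w0 where w0: "q = circ w0" using S_range a(3) by auto
    obtain m :: int where m: "v \<le> w0 + of_int m * pi" "w0 + of_int m * pi < v + pi"
      using circ_representative .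
    define w where "w = w0 + of_int m * pi"
    have w: "q = circ w" "v \<le> w" "w < v + pi" using w0 m by (simp_all add: w_def)
    have "w \<noteq> v" using w(1) a(2,4) by auto
    then have vw: "v < w" using w(2) by simp
    have only: "circ r \<notin> S" if "v < r" "r < v + pi" "r \<noteq> w" for r
    proof
      assume "circ r \<in> S"
      then have "circ r = circ v \<or> circ r = circ w" using a(2,3) w(1) by auto
      then show False
      proof
        assume "circ r = circ v"
        from inj_onD[OF circ_inj_on[of v] this] show False using that by simp
      next
        assume "circ r = circ w"
        from inj_onD[OF circ_inj_on[of v] this] show False using that w(2,3) by simp
      qed
    qed
    have vpi: "circ (v + pi) = circ v" using circ_shift[of v 1] by simp
    have mem: "circ v \<in> S" "circ w \<in> S" "circ (v + pi) \<in> S" using a(2,3) w(1) vpi by simp_all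
    have "circ_arc v w \<inter> S = {}"
      using only w(3) unfolding circ_arc_def by fastforce
    then have g1: "gap v w" unfolding gap_def using vw w(3) mem by (intro conjI)
    have "circ_arc w (v + pi) \<inter> S = {}"
      using only vw unfolding circ_arc_def by fastforce
    then have g2: "gap w (v + pi)" unfolding gap_def
      using w(3) add_strict_right_mono[OF vw, of pi] mem by (intro conjI)
    obtain n :: int where n: "lo X < w + of_int n * pi" "w + of_int n * pi < hi X"
      using q unfolding w(1) regular_supp[OF X] in_arc_iff by (elim exE conjE)
    define A B where "A = lo X - of_int n * pi" and "B = hi X - of_int n * pi"
    have AB: "A < w" "w < B" "B < A + pi" using n regular_lo_hi[OF X] by (simp_all add: A_def B_def)
    have lX: "lo X = A + of_int n * pi" "hi X = B + of_int n * pi" by (simp_all add: A_def B_def)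
    have supp: "supp_J X = circ_arc A B"
      unfolding regular_supp[OF X] using arc_shift[of A n B] by (simp add: A_def B_def)
    have vA: "v \<le> A"
    proof (rule ccontr)
      assume "\<not> v \<le> A"
      then have "circ v \<in> circ_arc A B" unfolding circ_arc_def using AB vw by simp
      then show False using p supp by simp
    qed
    have Bv: "B \<le> v + pi"
    proof (rule ccontr)
      assume "\<not> B \<le> v + pi"
      then have "circ (v + pi) \<in> circ_arc A B" unfolding circ_arc_def using AB w(3) by simp
      then show False using p supp vpi by simp
    qed
    have 1: "\<not> v < A"
    proof
      assume "v < A"
      then have "cross X (mkI v w)"
        unfolding cross_def mkI_simps[OF vw w(3)]
        by (intro exI[of _ n] disjI2 conjI) (use \<open>v < A\<close> AB lX in linarith)+
      then show False using gap_not_cross[OF g1 nc] by blast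
    qed
    have 2: "\<not> B < v + pi"
    proof
      assume "B < v + pi"
      then have "cross X (mkI w (v + pi))"
        unfolding cross_def mkI_simps[OF w(3) add_strict_right_mono[OF vw]]
        by (intro exI[of _ n] disjI1 conjI) (use \<open>B < v + pi\<close> AB lX in linarith)+
      then show False using gap_not_cross[OF g2 nc] by blast
    qed
    show False using 1 2 vA Bv AB by simp
  qed
qed

text \<open>An arc that avoids \<open>S\<close> is connected, so it lies in one component, where the
  sublamination is already maximal.\<close>

lemma L_maximal_regular:
  assumes X: "is_regular X" and nc: "\<And>Y. Y \<in> L \<Longrightarrow> noncrossing X Y"
  shows "\<exists>Y\<in>L. same X Y"
proof -
  have S: "supp_J X \<inter> S = {}" using supp_avoids[OF X nc] .
  define w where "w = (lo X + hi X) / 2"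
  have w: "circ w \<in> supp_J X"
    unfolding regular_supp[OF X] circ_arc_def using regular_lo_hi[OF X] by (simp add: w_def)
  then have "circ w \<notin> S" using S by blast
  then obtain s t where g: "gap s t" "s < w" "w < t" by (rule gap_exists)
  let ?I = "circ_arc s t"
  have c: "?I \<in> comps" using gap_component[OF g(1)] .
  have "supp_J X \<subseteq> D" using S arc_subset_range unfolding regular_supp[OF X] topspace_circle by blast
  then have "connectedin XD (supp_J X)"
    unfolding connectedin_subtopology using connectedin_arc regular_supp[OF X] by simp
  then have "supp_J X \<subseteq> ?I"
    unfolding component_of_gap[OF g, symmetric] using w by (rule connected_component_of_maximal)
  then have U: "X \<in> {X. is_regular X \<and> supp_J X \<subseteq> ?I}" using X by simp
  have NL: "N ?I \<subseteq> L" unfolding L_def using c by blast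
  then have "\<forall>Y\<in>N ?I. noncrossing X Y" using nc by blast
  with U obtain Y where "Y \<in> N ?I" "same X Y" by (rule max_noncrossing_same[OF N_max[OF c]])
  then show ?thesis using NL by blast
qed

lemma L_noncrossing_TN:
  assumes "Zs e x \<in> T" "circ x \<in> S" "I \<in> comps" "Y \<in> N I"
  shows "noncrossing (Zs e x) Y \<and> \<not> same (Zs e x) Y"
proof
  note Y = N_regular[OF assms(3,4)]
  have "circ x \<notin> supp_J Y" using Y(3) assms(2) by blast
  then have "\<not> cross (Zs e x) Y" using cross_Z_iff[OF Y(1), of e x] cross_sym by simp
  then show "noncrossing (Zs e x) Y" using noncrossing_regular(2)[OF Y(1)] by simp
  show "\<not> same (Zs e x) Y" using Y(1) by (simp add: same_def)
qed

lemma L_pairwise: "pairwise (\<lambda>X Y. noncrossing X Y \<and> \<not> same X Y) L"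
proof (rule pairwiseI)
  fix X Y assume X: "X \<in> L" and Y: "Y \<in> L" and ne: "X \<noteq> Y"
  from X show "noncrossing X Y \<and> \<not> same X Y"
  proof (cases rule: L_cases)
    case sX: (singular e x)
    from Y show ?thesis
    proof (cases rule: L_cases)
      case sY: (singular e' y)
      have T: "Zs e x \<in> T" "Zs e' y \<in> T" using sX sY by simp_all
      have "\<not> same (Zs e x) (Zs e' y)"
      proof
        assume "same (Zs e x) (Zs e' y)"
        then have *: "e = e'" "circ x = circ y" by (simp_all add: same_Z_iff)
        then have "x = y" using T_unique[of e x y] T by simp
        then show False using * ne sX sY by simp
      qed
      then show ?thesis using T_compatible[OF T] sX(1) sY(1) by simp
    next
      case (regular I)
      show ?thesis using L_noncrossing_TN[of e x I Y] sX regular by simp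
    qed
  next
    case rX: (regular I)
    from Y show ?thesis
    proof (cases rule: L_cases)
      case (singular e y)
      have "noncrossing (Zs e y) X \<and> \<not> same (Zs e y) X"
        using L_noncrossing_TN[of e y I X] singular rX by simp
      then show ?thesis using noncrossing_sym same_sym singular(1) by blast
    next
      case rY: (regular J)
      show ?thesis
      proof (cases "I = J")
        case True
        have "pairwise (\<lambda>X Y. noncrossing X Y \<and> \<not> same X Y) (N I)"
          using N_max[OF rX(1)] unfolding max_noncrossing_def by (elim conjE)
        from pairwiseD[OF this rX(2) rY(2)[folded True] ne] show ?thesis .
      next
        case False
        note RX = N_regular[OF rX] and RY = N_regular[OF rY]
        have disj: "supp_J X \<inter> supp_J Y = {}"
        proof (rule ccontr)
          assume "supp_J X \<inter> supp_J Y \<noteq> {}"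
          then obtain z where "z \<in> supp_J X" "z \<in> supp_J Y" by blast
          then have "z \<in> I" "z \<in> J" using RX(2) RY(2) by blast+
          then show False using comps_eq[OF rX(1) rY(1)] False by blast
        qed
        have "\<not> cross X Y" using cross_supp_meet[OF RX(1) RY(1)] disj by blast
        moreover have "supp_J X \<noteq> {}"
          unfolding regular_supp[OF RX(1)] by (rule arc_nonempty) (use regular_lo_hi[OF RX(1)] in simp)
        then have "\<not> same X Y" using same_regularD(2)[OF _ RX(1), of Y] disj by auto
        ultimately show ?thesis using noncrossing_regular(1)[OF RX(1)] by simp
      qed
    qed
  qed
qed

theorem L_max_noncrossing: "max_noncrossing {X. is_regular X \<or> is_singular X} L"
  unfolding max_noncrossing_def
proof (intro conjI ballI impI)
  show "L \<subseteq> {X. is_regular X \<or> is_singular X}" using L_names by blast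
  show "pairwise (\<lambda>X Y. noncrossing X Y \<and> \<not> same X Y) L" by (rule L_pairwise)
  fix X assume X: "X \<in> {X. is_regular X \<or> is_singular X}" and "\<forall>Y\<in>L. noncrossing X Y \<and> \<not> same X Y"
  then have nc: "\<And>Y. Y \<in> L \<Longrightarrow> noncrossing X Y" and ns: "\<not> (\<exists>Y\<in>L. same X Y)" by blast+
  have "\<exists>Y\<in>L. same X Y"
  proof (cases "is_regular X")
    case True
    show ?thesis by (rule L_maximal_regular[OF True nc])
  next
    case False
    then obtain e t where Z: "X = Zs e t" using X by (cases X) auto
    show ?thesis unfolding Z by (rule L_maximal_singular) (rule nc[unfolded Z])
  qed
  then show "X \<in> L" using ns by blast
qed

text \<open>Choose the radius so that no other point of \<open>S\<close> is closer to x. A regular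
  interval that starts within half of it from a lift of x, and misses a full turn by less than half
  of it, would contain another point of \<open>S\<close>, which the sublaminations avoid.\<close>

lemma discrete_at_singular:
  assumes X: "Zs e x \<in> T" "circ x \<in> S"
  shows "\<exists>W. openin Hspace W \<and> W \<inter> h_map ` L = {h_map (Zs e x)}"
proof -
  have "finite (S - {circ x})" "S - {circ x} \<subseteq> range circ" "circ x \<notin> S - {circ x}"
    using finite_S S_range by auto
  from separation[OF this] obtain \<delta> where d: "0 < \<delta>" "\<And>t. \<bar>t - x\<bar> < \<delta> \<Longrightarrow> circ t \<notin> S - {circ x}"
    by blast
  have "\<exists>q0. circ q0 \<in> S \<and> circ q0 \<noteq> circ x"
  proof -
    obtain a b where "a \<in> S" "b \<in> S" "a \<noteq> b" using two_points .
    then have "\<exists>c\<in>S. c \<noteq> circ x" by blast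
    then show ?thesis using S_range by blast
  qed
  then obtain q0 where q0: "circ q0 \<in> S" "circ q0 \<noteq> circ x" by blast
  obtain m :: int where m: "x \<le> q0 + of_int m * pi" "q0 + of_int m * pi < x + pi"
    using circ_representative .
  define q where "q = q0 + of_int m * pi"
  have q: "circ q \<in> S - {circ x}" "x \<le> q" "q < x + pi" using q0 m by (simp_all add: q_def)
  have "circ (q - pi) = circ q" using circ_shift[of q "- 1"] by simp
  then have "\<not> \<bar>q - x\<bar> < \<delta>" "\<not> \<bar>q - pi - x\<bar> < \<delta>" using d(2)[of q] d(2)[of "q - pi"] q(1) by auto
  then have qd: "x + \<delta> \<le> q" "q \<le> x + pi - \<delta>" using q(2,3) by linarith+
  \<comment> \<open>On the sheet of the opposite sign the full turns are removed, which excludes the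
    other member of a singular pair. Shorter intervals belong to both sheets, so the set stays
    saturated.\<close>
  define G where "G e' = (\<Union>n::int. {p::real\<times>real. \<bar>fst p - x - of_int n * pi\<bar> < \<delta> / 2}) \<inter>
    {p. pi - \<delta> / 2 < snd p - fst p} \<inter> (if e' = e then UNIV else {p. snd p - fst p < pi})" for e'
  have G_iff: "(a, c) \<in> G e' \<longleftrightarrow> (\<exists>n::int. \<bar>a - x - of_int n * pi\<bar> < \<delta> / 2) \<and> pi - \<delta> / 2 < c - a \<and>
      (e' = e \<or> c - a < pi)" for a c e'
    by (auto simp: G_def)
  have Gopen: "open (G e')" for e'
    unfolding G_def by (intro open_Int open_UN ballI open_Collect_less continuous_intros) (auto intro!: open_Collect_less continuous_intros)
  obtain W where W: "openin Hspace W"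
    "\<And>a c e'. (a, c, e') \<in> Htilde \<Longrightarrow> Hclass (a, c, e') \<in> W \<longleftrightarrow> (a, c) \<in> G e'"
  proof (rule openin_HspaceI[of G])
    show "open (G e')" for e' by (rule Gopen)
    fix a c e1 a' c' e2
    assume H: "(a, c, e1) \<in> Htilde" and q: "Heq (a, c, e1) (a', c', e2)" and g: "(a, c) \<in> G e1"
    obtain k :: int where k: "a' = a + of_int k * pi" "c' = c + of_int k * pi"
      using q by (auto simp: Heq_def)
    have ee: "c = a + pi \<longrightarrow> e1 = e2" using q by (simp add: Heq_def)
    obtain n :: int where n: "\<bar>a - x - of_int n * pi\<bar> < \<delta> / 2" using g unfolding G_iff by blast
    have "a' - x - of_int (n + k) * pi = a - x - of_int n * pi" by (simp add: k algebra_simps)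
    then have "\<bar>a' - x - of_int (n + k) * pi\<bar> < \<delta> / 2" using n by (simp only:)
    then have "\<exists>n::int. \<bar>a' - x - of_int n * pi\<bar> < \<delta> / 2" by (rule exI)
    moreover have "c' - a' = c - a" by (simp add: k)
    moreover have "e2 = e \<or> c - a < pi"
    proof (cases "c - a < pi")
      case False
      then have "c = a + pi" using H by (simp add: Htilde_iff)
      then show ?thesis using ee g unfolding G_iff by simp
    qed simp
    ultimately show "(a', c') \<in> G e2" using g unfolding G_iff by simp
  qed (rule that)
  have "(x, x + pi) \<in> G e" unfolding G_iff using d(1) by (auto intro: exI[of _ 0])
  then have hX: "h_map (Zs e x) \<in> W" using W(2)[of x "x + pi" e] by (simp add: Htilde_iff)
  have "h_map Y = h_map (Zs e x)" if Y: "Y \<in> L" "h_map Y \<in> W" for Y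
  proof -
    have nm: "is_regular Y \<or> is_singular Y" using L_names Y(1) by blast
    have g: "(lo Y, hi Y) \<in> G (sg Y)"
      using Y(2) unfolding h_map_eq[OF nm] W(2)[OF h_point_Htilde[OF nm]] .
    then obtain n :: int where n: "\<bar>lo Y - x - of_int n * pi\<bar> < \<delta> / 2" unfolding G_iff by blast
    have long: "pi - \<delta> / 2 < hi Y - lo Y" using g unfolding G_iff by (elim conjE)
    from Y(1) show ?thesis
    proof (cases rule: L_cases)
      case (singular e' y)
      have e': "e' = e" using g unfolding G_iff singular(1) by simp
      have "\<bar>y - x - of_int n * pi\<bar> < \<delta> / 2" using n singular(1) by simp
      moreover have "real_of_int (- n) * pi = - (of_int n * pi)" by simp
      ultimately have "\<bar>y + of_int (- n) * pi - x\<bar> < \<delta>" using d(1) by linarith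
      from d(2)[OF this] have "circ y \<notin> S - {circ x}" unfolding circ_shift .
      then have eq: "circ y = circ x" by (rule contrapos_np) (intro DiffI singular(3), simp)
      have "Zs e y \<in> T" using singular(2) unfolding singular(1) e' .
      from T_unique[OF this X(1) eq] show ?thesis unfolding singular(1) e' by (rule arg_cong)
    next
      case (regular I)
      note r = N_regular[OF regular]
      have "lo Y < q + of_int n * pi" "q + of_int n * pi < hi Y" using n long qd d(1) by linarith+
      then have "circ q \<in> supp_J Y" unfolding regular_supp[OF r(1)] in_arc_iff by blast
      then show ?thesis using r(3) q(1) by blast
    qed
  qed
  moreover have "Zs e x \<in> L" using X(1) by (simp add: L_def)
  ultimately have "W \<inter> h_map ` L = {h_map (Zs e x)}" using hX by blast
  then show ?thesis using W(1) by blast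
qed

text \<open>Intersect an isolating set for the sublamination of \<open>I\<close> with the open set
  of intervals shorter than pi that contain a lift of the midpoint w of X. The length excludes
  singular objects, and w excludes the other components.\<close>

lemma discrete_at_regular:
  assumes I: "I \<in> comps" and X: "X \<in> N I"
  shows "\<exists>W. openin Hspace W \<and> W \<inter> h_map ` L = {h_map X}"
proof -
  note rX = N_regular[OF I X]
  have nm: "\<forall>X\<in>N I. is_regular X \<or> is_singular X" using N_regular(1)[OF I] by blast
  from bspec[OF N_discrete[OF I, unfolded discrete_indecs_iff[OF nm]] X]
  obtain W0 where W0: "openin Hspace W0" "W0 \<inter> h_map ` N I = {h_map X}" by (elim exE conjE)
  define w where "w = (lo X + hi X) / 2"
  have w: "lo X < w" "w < hi X" using regular_lo_hi[OF rX(1)] by (simp_all add: w_def)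
  define G where "G e' = (\<Union>n::int. {p::real\<times>real. fst p < w + of_int n * pi} \<inter> {p. w + of_int n * pi < snd p}) \<inter>
    {p. snd p - fst p < pi}" for e' :: sign
  have G_iff: "(a, c) \<in> G e' \<longleftrightarrow> (\<exists>n::int. a < w + of_int n * pi \<and> w + of_int n * pi < c) \<and> c - a < pi" for a c e'
    by (auto simp: G_def)
  have Gopen: "open (G e')" for e'
    unfolding G_def by (intro open_Int open_UN ballI open_Collect_less continuous_intros)
  obtain V where V: "openin Hspace V"
    "\<And>a c e'. (a, c, e') \<in> Htilde \<Longrightarrow> Hclass (a, c, e') \<in> V \<longleftrightarrow> (a, c) \<in> G e'"
  proof (rule openin_HspaceI[of G])
    show "open (G e')" for e' by (rule Gopen)
    fix a c e1 a' c' e2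
    assume q: "Heq (a, c, e1) (a', c', e2)" and g: "(a, c) \<in> G e1"
    obtain k :: int where k: "a' = a + of_int k * pi" "c' = c + of_int k * pi"
      using q by (auto simp: Heq_def)
    obtain n :: int where n: "a < w + of_int n * pi" "w + of_int n * pi < c" using g unfolding G_iff by blast
    have "\<exists>n::int. a' < w + of_int n * pi \<and> w + of_int n * pi < c'"
      by (rule exI[of _ "n + k"]) (use n in \<open>simp add: k algebra_simps\<close>)
    then show "(a', c') \<in> G e2" using g k unfolding G_iff by simp
  qed (rule that)
  have inV: "h_map Y \<in> V \<longleftrightarrow> (lo Y, hi Y) \<in> G (sg Y)" if "is_regular Y \<or> is_singular Y" for Y
    unfolding h_map_eq[OF that] by (rule V(2)[OF h_point_Htilde[OF that]])
  have "lo X < w + of_int 0 * pi \<and> w + of_int 0 * pi < hi X" using w by simp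
  moreover have "hi X - lo X < pi" using regular_lo_hi[OF rX(1)] by simp
  ultimately have "(lo X, hi X) \<in> G (sg X)" unfolding G_iff by (rule conjI[OF exI])
  then have "h_map X \<in> V" using inV[OF disjI1[OF rX(1)]] by (simp only:)
  then have hX: "h_map X \<in> W0 \<inter> V" using W0(2) by blast
  have "h_map Y = h_map X" if Y: "Y \<in> L" "h_map Y \<in> W0 \<inter> V" for Y
  proof -
    have "h_map Y \<in> V" using Y(2) by (rule IntD2)
    then have g: "(lo Y, hi Y) \<in> G (sg Y)" using inV[OF L_names[rule_format, OF Y(1)]] by (simp only:)
    from Y(1) show ?thesis
    proof (cases rule: L_cases)
      case (singular e y)
      then show ?thesis using g unfolding G_iff by simp
    next
      case (regular J)
      note r = N_regular[OF regular]
      have "circ w \<in> supp_J Y" using g unfolding G_iff regular_supp[OF r(1)] in_arc_iff by blast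
      then have 1: "circ w \<in> J" using r(2) by blast
      have "circ w \<in> supp_J X" unfolding regular_supp[OF rX(1)] circ_arc_def using w by simp
      then have 2: "circ w \<in> I" using rX(2) by blast
      have "Y \<in> N I" using comps_eq[OF I regular(1) 2 1] regular(2) by simp
      then have "h_map Y \<in> W0 \<inter> h_map ` N I" using Y(2) by blast
      then show ?thesis unfolding W0(2) by simp
    qed
  qed
  moreover have "X \<in> L" using I X by (auto simp: L_def)
  ultimately have "(W0 \<inter> V) \<inter> h_map ` L = {h_map X}" using hX by blast
  then show ?thesis using openin_Int[OF W0(1) V(1)] by blast
qed

theorem L_discrete: "discrete_indecs L"
  unfolding discrete_indecs_iff[OF L_names]
proof
  fix X assume "X \<in> L"
  then show "\<exists>W. openin Hspace W \<and> W \<inter> h_map ` L = {h_map X}"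
  proof (cases rule: L_cases)
    case (singular e x)
    then show ?thesis using discrete_at_singular[of e x] by simp
  next
    case (regular I)
    then show ?thesis by (rule discrete_at_regular)
  qed
qed

end

theorem theorem2p6p4:
  fixes u :: "'r::idom"
    and E :: "real \<Rightarrow> (point set list, 'r fmor) conflations"
  assumes "dvr_uniformizer u"
    and "\<not> u dvd 2"
    and "\<And>b. 0 < b \<Longrightarrow> b \<le> pi \<Longrightarrow> is_standard_exact_structure u b (E b)"
  shows "(\<forall>L. lamination u E L \<and> discrete_indecs L \<longrightarrow>
            (\<exists>(k::nat) x :: nat \<Rightarrow> real.
               2 \<le> k \<and> strict_mono_on {1..k} x \<and> x k < x 1 + pi \<and>
               (let P = circ ` x ` {1..k}; T = {X \<in> L. is_singular X} in
                  R_union L = topspace circle - P \<and>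
                  (\<exists>\<I>. card \<I> = k \<and> (\<forall>I\<in>\<I>. circle_interval I) \<and>
                       pairwise disjnt \<I> \<and> \<Union>\<I> = R_union L) \<and>
                  card T = k \<and>
                  (same_sign_at T P \<or>
                   k = 2 \<and> (singular_pair_at T (circ (x 1)) \<or> singular_pair_at T (circ (x 2)))))))
       \<and>
         (\<forall>S T N. finite S \<and> 2 \<le> card S \<and> S \<subseteq> topspace circle \<and> admissible_singular T S \<and>
            (\<forall>I\<in>connected_components_of (subtopology circle (topspace circle - S)).
               sublamination u E I (N I) \<and> discrete_indecs (N I)) \<longrightarrow>
            (let L = T \<union> (\<Union>I\<in>connected_components_of (subtopology circle (topspace circle - S)). N I)
             in lamination u E L \<and> discrete_indecs L))"
proof -
  interpret frobenius_family u E
    by (rule frobenius_family.intro) (use assms in auto)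
  show ?thesis
  proof (intro conjI allI impI)
    fix L assume "lamination u E L \<and> discrete_indecs L"
    then interpret discrete_lamination L
      unfolding lamination_iff by (intro discrete_lamination.intro) (elim conjE, assumption)+
    show "\<exists>(k::nat) x :: nat \<Rightarrow> real.
      2 \<le> k \<and> strict_mono_on {1..k} x \<and> x k < x 1 + pi \<and>
      (let P = circ ` x ` {1..k}; T = {X \<in> L. is_singular X} in
         R_union L = topspace circle - P \<and>
         (\<exists>\<I>. card \<I> = k \<and> (\<forall>I\<in>\<I>. circle_interval I) \<and>
              pairwise disjnt \<I> \<and> \<Union>\<I> = R_union L) \<and>
         card T = k \<and>
         (same_sign_at T P \<or>
          k = 2 \<and> (singular_pair_at T (circ (x 1)) \<or> singular_pair_at T (circ (x 2)))))"
      by (rule structure_of_lamination)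
  next
    fix S T N
    assume a: "finite S \<and> 2 \<le> card S \<and> S \<subseteq> topspace circle \<and> admissible_singular T S \<and>
      (\<forall>I\<in>connected_components_of (subtopology circle (topspace circle - S)).
         sublamination u E I (N I) \<and> discrete_indecs (N I))"
    interpret finite_on_circle S by (rule finite_on_circle.intro; insert a; elim conjE)
    have N: "max_noncrossing {X. is_regular X \<and> supp_J X \<subseteq> I} (N I)" "discrete_indecs (N I)"
      if "I \<in> comps" for I
      using a that unfolding sublamination_iff by blast+
    have adm: "admissible_singular T S" using a by (elim conjE)
    interpret asm: assembled_lamination S T N
      by (rule assembled_lamination.intro[OF finite_on_circle_axioms])
        (rule assembled_lamination_axioms.intro[OF adm N])
    show "let L = T \<union> (\<Union>I\<in>comps. N I) in lamination u E L \<and> discrete_indecs L"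
      unfolding Let_def lamination_iff asm.L_def[symmetric]
      using asm.L_max_noncrossing asm.L_discrete by (rule conjI)
  qed
qed

end
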